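(* Let $\alpha\in(0,2)$ and $u\in\mathcal S(\mathbb R^d)$. Then for every $x\in\mathbb R^d$, $$(-\Delta_k)^{\alpha/2}u(x)=\frac{1}{\pi_{k,d}(\alpha)}\int_0^\infty\frac{u(x)-\mathcal M_r^ku(x)}{r^{1+\alpha}}\,dr,\qquad \pi_{k,d}(\alpha):=\frac{\gamma_{k,d}(\alpha)}{2\sigma_k(d)} .$$
   Context: Let $d\ge 1$, let $\mathcal R\subset\mathbb R^d\setminus\{0\}$ be a reduced root system with reflections $\sigma_v(x)=x-2\frac{\langle x,v\rangle}{|v|^2}v$, $v\in\mathcal R$, let $G$ be the finite group generated by them, let $k:\mathcal R\to[0,\infty)$ be $G$-invariant, and let $\mathcal R_+$ be a positive subsystem; $\gamma_k=\sum_{v\in\mathcal R_+}k(v)$. Dunkl operators: $T_jf(x)=\partial_jf(x)+\sum_{v\in\mathcal R_+}k(v)\langle v,e_j\rangle\frac{f(x)-f(\sigma_v(x))}{\langle v,x\rangle}$. Weight: $w_k(x)=\prod_{v\in\mathcal R_+}|\langle x,v\rangle|^{2k(v)}$. For $z\in\mathbb C^d$ the Dunkl kernel $\mathcal E_k(z,\cdot)$ is the unique analytic solution on $\mathbb R^d$ of $T_jf=z_jf$ ($1\le j\le d$), $f(0)=1$. Put $c_k=\int_{\mathbb R^d}e^{-|x|^2/2}w_k(x)\,dx$. Dunkl transform: $\mathcal F_kf(\xi)=\frac1{c_k}\int_{\mathbb R^d}f(x)\mathcal E_k(-i\xi,x)w_k(x)\,dx$, an automorphism of $\mathcal S(\mathbb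 R^d)$ with inverse $\mathcal F_k^{-1}g(x)=\frac1{c_k}\int_{\mathbb R^d}g(\xi)\mathcal E_k(ix,\xi)w_k(\xi)\,d\xi$. Dunkl translation: $\tau^xf(y)=\mathcal F_k^{-1}(\mathcal E_k(ix,\cdot)\mathcal F_kf)(y)$. For $u\in\mathcal S(\mathbb R^d)$ the fractional Dunkl Laplacian is defined by the (convergent) integral $$(-\Delta_k)^{\alpha/2}u(x)=\frac1{\gamma_{k,d}(\alpha)}\int_{\mathbb R^d}\frac{2u(x)-\tau^xu(y)-\tau^xu(-y)}{|y|^{\alpha+2\gamma_k+d}}\,w_k(y)\,dy,$$ with the normalization constant $\gamma_{k,d}(\alpha)=\frac{c_k|\Gamma(-\alpha/2)|}{2^{\alpha+\gamma_k+d/2-1}\Gamma(\gamma_k+\frac{\alpha+d}2)}$. The spherical mean operator is $\mathcal M_r^ku(x)=\frac1{\sigma_k(d)}\int_{\mathbb S^{d-1}}\tau^xu(r\omega)\,w_k(\omega)\,d\sigma(\omega)$, $r\ge0$, where $d\sigma$ is surface measure on the unit sphere (counting measure on $\{\pm1\}$ if $d=1$) and $\sigma_k(d)=\int_{\mathbb S^{d-1}}w_k(\omega)\,d\sigma(\omega)=\frac{c_k}{2^{\gamma_k+d/2-1}\Gamma(\gamma_k+d/2)}$. *)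

theory Defs
  imports "HOL-Analysis.Analysis"
begin

definition reflection :: "real ^ 'n \<Rightarrow> real ^ 'n \<Rightarrow> real ^ 'n" where
  "reflection v x = x - (2 * (x \<bullet> v) / (norm v)\<^sup>2) *\<^sub>R v"

text \<open>No integrality (crystallographic) or spanning condition is required, the usual convention in Dunkl theory.\<close>

definition reduced_root_system :: "(real ^ 'n) set \<Rightarrow> bool" where
  "reduced_root_system R \<longleftrightarrow>
     finite R \<and> 0 \<notin> R \<and> (\<forall>v\<in>R. reflection v ` R = R) \<and>
     (\<forall>v\<in>R. R \<inter> range (\<lambda>t::real. t *\<^sub>R v) = {v, - v})"

text \<open>Reflections are involutions, so closure under products already gives a group.\<close>

inductive_set reflection_group :: "(real ^ 'n) set \<Rightarrow> (real ^ 'n \<Rightarrow> real ^ 'n) set"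
  for R :: "(real ^ 'n) set" where
  reflection_group_id: "id \<in> reflection_group R"
| reflection_group_step: "v \<in> R \<Longrightarrow> g \<in> reflection_group R \<Longrightarrow> reflection v \<circ> g \<in> reflection_group R"

definition positive_subsystem :: "(real ^ 'n) set \<Rightarrow> (real ^ 'n) set \<Rightarrow> bool" where
  "positive_subsystem R P \<longleftrightarrow>
     (\<exists>b. (\<forall>v\<in>R. v \<bullet> b \<noteq> 0) \<and> P = {v \<in> R. v \<bullet> b > 0})"

definition multiplicity_function :: "(real ^ 'n) set \<Rightarrow> (real ^ 'n \<Rightarrow> real) \<Rightarrow> bool" where
  "multiplicity_function R k \<longleftrightarrow>
     (\<forall>v\<in>R. k v \<ge> 0) \<and> (\<forall>g\<in>reflection_group R. \<forall>v\<in>R. k (g v) = k v)"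

definition real_analytic :: "(real ^ 'n \<Rightarrow> complex) \<Rightarrow> bool" where
  "real_analytic f \<longleftrightarrow>
     (\<forall>a. \<exists>e>0. \<exists>c :: ('n \<Rightarrow> nat) \<Rightarrow> complex. \<forall>x\<in>ball a e.
        ((\<lambda>m. c m * of_real (\<Prod>i\<in>UNIV. (x $ i - a $ i) ^ m i)) has_sum f x) UNIV)"

definition partial_deriv :: "'n \<Rightarrow> (real ^ 'n \<Rightarrow> complex) \<Rightarrow> real ^ 'n \<Rightarrow> complex" where
  "partial_deriv j f x = vector_derivative (\<lambda>t. f (x + t *\<^sub>R axis j 1)) (at 0)"

fun iterated_partial :: "'n list \<Rightarrow> (real ^ 'n \<Rightarrow> complex) \<Rightarrow> real ^ 'n \<Rightarrow> complex" where
  "iterated_partial [] f = f"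
| "iterated_partial (j # js) f = partial_deriv j (iterated_partial js f)"

text \<open>Differentiability of all iterated partial derivatives is smoothness.\<close>

definition schwartz_space :: "(real ^ 'n \<Rightarrow> complex) set" where
  "schwartz_space =
     {f. \<forall>js. (\<forall>x. iterated_partial js f differentiable at x) \<and>
              (\<forall>N::nat. bounded (range (\<lambda>x. (1 + norm x) ^ N *\<^sub>R iterated_partial js f x)))}"

text \<open>The arguments \<open>P\<close> and \<open>k\<close> stand for the positive subsystem and the multiplicity function.
  For smooth \<open>f\<close>, the difference quotient extends continuously across the hyperplane orthogonal
  to \<open>v\<close>, and this extension is meant there.\<close>

definition refl_quotient :: "real ^ 'n \<Rightarrow> (real ^ 'n \<Rightarrow> complex) \<Rightarrow> real ^ 'n \<Rightarrow> complex" where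
  "refl_quotient v f x =
     (if v \<bullet> x \<noteq> 0 then (f x - f (reflection v x)) / of_real (v \<bullet> x)
      else Lim (at x within {y. v \<bullet> y \<noteq> 0}) (\<lambda>y. (f y - f (reflection v y)) / of_real (v \<bullet> y)))"

definition dunkl_op ::
  "(real ^ 'n) set \<Rightarrow> (real ^ 'n \<Rightarrow> real) \<Rightarrow> 'n \<Rightarrow> (real ^ 'n \<Rightarrow> complex) \<Rightarrow> real ^ 'n \<Rightarrow> complex" where
  "dunkl_op P k j f x =
     partial_deriv j f x + (\<Sum>v\<in>P. of_real (k v * (v \<bullet> axis j 1)) * refl_quotient v f x)"

definition dunkl_kernel ::
  "(real ^ 'n) set \<Rightarrow> (real ^ 'n \<Rightarrow> real) \<Rightarrow> complex ^ 'n \<Rightarrow> real ^ 'n \<Rightarrow> complex" where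
  "dunkl_kernel P k z =
     (THE f. real_analytic f \<and> (\<forall>j x. dunkl_op P k j f x = z $ j * f x) \<and> f 0 = 1)"

definition gamma_index :: "(real ^ 'n) set \<Rightarrow> (real ^ 'n \<Rightarrow> real) \<Rightarrow> real" where
  "gamma_index P k = (\<Sum>v\<in>P. k v)"

text \<open>The case distinction gives \<open>0\<^sup>0 = 1\<close>, whereas \<^term>\<open>0 powr 0 :: real\<close> is \<open>0\<close>.\<close>

definition dunkl_weight :: "(real ^ 'n) set \<Rightarrow> (real ^ 'n \<Rightarrow> real) \<Rightarrow> real ^ 'n \<Rightarrow> real" where
  "dunkl_weight P k x = (\<Prod>v\<in>P. if k v = 0 then 1 else \<bar>x \<bullet> v\<bar> powr (2 * k v))"

definition dunkl_const :: "(real ^ 'n) set \<Rightarrow> (real ^ 'n \<Rightarrow> real) \<Rightarrow> real" where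
  "dunkl_const P k = (LINT x|lborel. exp (- (norm x)\<^sup>2 / 2) * dunkl_weight P k x)"

definition cvec :: "complex \<Rightarrow> real ^ 'n \<Rightarrow> complex ^ 'n" where
  "cvec c x = (\<chi> j. c * of_real (x $ j))"

definition dunkl_transform ::
  "(real ^ 'n) set \<Rightarrow> (real ^ 'n \<Rightarrow> real) \<Rightarrow> (real ^ 'n \<Rightarrow> complex) \<Rightarrow> real ^ 'n \<Rightarrow> complex" where
  "dunkl_transform P k f \<xi> =
     1 / of_real (dunkl_const P k) *
     (LINT x|lborel. f x * dunkl_kernel P k (cvec (- \<i>) \<xi>) x * of_real (dunkl_weight P k x))"

definition inv_dunkl_transform ::
  "(real ^ 'n) set \<Rightarrow> (real ^ 'n \<Rightarrow> real) \<Rightarrow> (real ^ 'n \<Rightarrow> complex) \<Rightarrow> real ^ 'n \<Rightarrow> complex" where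
  "inv_dunkl_transform P k g x =
     1 / of_real (dunkl_const P k) *
     (LINT \<xi>|lborel. g \<xi> * dunkl_kernel P k (cvec \<i> x) \<xi> * of_real (dunkl_weight P k \<xi>))"

definition dunkl_translation ::
  "(real ^ 'n) set \<Rightarrow> (real ^ 'n \<Rightarrow> real) \<Rightarrow> real ^ 'n \<Rightarrow> (real ^ 'n \<Rightarrow> complex) \<Rightarrow> real ^ 'n \<Rightarrow> complex"
where
  "dunkl_translation P k x f =
     inv_dunkl_transform P k (\<lambda>\<xi>. dunkl_kernel P k (cvec \<i> x) \<xi> * dunkl_transform P k f \<xi>)"

definition frac_const :: "(real ^ 'n) set \<Rightarrow> (real ^ 'n \<Rightarrow> real) \<Rightarrow> real \<Rightarrow> real" where
  "frac_const P k \<alpha> =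
     dunkl_const P k * \<bar>Gamma (- \<alpha> / 2)\<bar> /
     (2 powr (\<alpha> + gamma_index P k + real CARD('n) / 2 - 1) *
      Gamma (gamma_index P k + (\<alpha> + real CARD('n)) / 2))"

definition frac_dunkl_laplacian ::
  "(real ^ 'n) set \<Rightarrow> (real ^ 'n \<Rightarrow> real) \<Rightarrow> real \<Rightarrow> (real ^ 'n \<Rightarrow> complex) \<Rightarrow> real ^ 'n \<Rightarrow> complex" where
  "frac_dunkl_laplacian P k \<alpha> u x =
     1 / of_real (frac_const P k \<alpha>) *
     (LINT y|lborel.
        (2 * u x - dunkl_translation P k x u y - dunkl_translation P k x u (- y)) /
        of_real (norm y powr (\<alpha> + 2 * gamma_index P k + real CARD('n))) *
        of_real (dunkl_weight P k y))"

text \<open>Surface measure on the unit sphere as the cone measure: a Borel set \<open>A\<close> of the sphere gets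
  \<open>d\<close> times the volume of the truncated cone over \<open>A\<close>. For \<open>d = 1\<close> this is the counting measure
  on the two unit vectors.\<close>

definition sphere_measure :: "(real ^ 'n) measure" where
  "sphere_measure =
     scale_measure (of_nat CARD('n))
       (distr (restrict_space lborel (cball 0 1 - {0})) (restrict_space borel (sphere 0 1)) sgn)"

lemma space_sphere_measure: "space sphere_measure = sphere 0 1"
  by (simp add: sphere_measure_def space_restrict_space space_scale_measure)

lemma emeasure_sphere_measure:
  fixes A :: "(real ^ 'n) set"
  assumes "A \<in> sets borel" "A \<subseteq> sphere 0 1"
  shows "emeasure sphere_measure A =
    of_nat CARD('n) * emeasure lborel {t *\<^sub>R w | t w. 0 < t \<and> t \<le> 1 \<and> w \<in> A}"
proof -
  let ?M = "restrict_space lborel (cball 0 1 - {0}) :: (real ^ 'n) measure"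
  let ?N = "restrict_space borel (sphere 0 1) :: (real ^ 'n) measure"
  have "(sgn :: real ^ 'n \<Rightarrow> _) \<in> borel_measurable borel"
    unfolding sgn_div_norm by measurable
  then have m: "sgn \<in> measurable ?M ?N"
    by (intro measurable_restrict_space2 measurable_restrict_space1)
       (auto simp: space_restrict_space norm_sgn)
  have A: "A \<in> sets ?N"
    using assms by (auto simp: sets_restrict_space)
  have eq: "sgn -` A \<inter> (cball 0 1 - {0}) = {t *\<^sub>R w | t w. 0 < t \<and> t \<le> 1 \<and> w \<in> A}"
    (is "?L = ?R")
  proof (intro set_eqI iffI)
    fix x assume "x \<in> ?L"
    then have "x = norm x *\<^sub>R sgn x \<and> 0 < norm x \<and> norm x \<le> 1 \<and> sgn x \<in> A"
      by (auto simp: sgn_div_norm)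
    then show "x \<in> ?R" by blast
  next
    fix x assume "x \<in> ?R"
    then obtain t w where "x = t *\<^sub>R w" "0 < t" "t \<le> 1" "w \<in> A" by blast
    moreover from this assms have "norm w = 1" by auto
    ultimately show "x \<in> ?L"
      by (auto simp: sgn_div_norm)
  qed
  have "emeasure sphere_measure A =
      of_nat CARD('n) * emeasure ?M (sgn -` A \<inter> space ?M)"
    using m A by (simp add: sphere_measure_def emeasure_distr)
  also have "emeasure ?M (sgn -` A \<inter> space ?M) = emeasure lborel (sgn -` A \<inter> (cball 0 1 - {0}))"
    by (simp add: space_restrict_space emeasure_restrict_space)
  finally show ?thesis
    by (simp add: eq)
qed

definition sphere_const :: "(real ^ 'n) set \<Rightarrow> (real ^ 'n \<Rightarrow> real) \<Rightarrow> real" where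
  "sphere_const P k = (LINT w|sphere_measure. dunkl_weight P k w)"

definition spherical_mean ::
  "(real ^ 'n) set \<Rightarrow> (real ^ 'n \<Rightarrow> real) \<Rightarrow> real \<Rightarrow> (real ^ 'n \<Rightarrow> complex) \<Rightarrow> real ^ 'n \<Rightarrow> complex" where
  "spherical_mean P k r u x =
     1 / of_real (sphere_const P k) *
     (LINT w|sphere_measure. dunkl_translation P k x u (r *\<^sub>R w) * of_real (dunkl_weight P k w))"

definition pi_const :: "(real ^ 'n) set \<Rightarrow> (real ^ 'n \<Rightarrow> real) \<Rightarrow> real \<Rightarrow> real" where
  "pi_const P k \<alpha> = frac_const P k \<alpha> / (2 * sphere_const P k)"

end

theory Submission
  imports Defs
begin

text \<open>In polar coordinates \<open>y = r \<omega>\<close> the weight contributes the factor \<open>r\<close> to the power \<open>2 \<gamma>\<^sub>k\<close>, and by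
  the antipodal symmetry of \<open>w\<^sub>k d\<sigma>\<close> the two translates have the same spherical integral, so the
  formula is Fubini's theorem once the integrand is known to be absolutely integrable. That follows
  from \<open>|2 u(x) - \<tau>\<^sup>x u(y) - \<tau>\<^sup>x u(-y)| \<le> C min(1, |y|\<^sup>2)\<close>, hence from the inversion formula, the decay
  of the Dunkl transform and the boundedness of \<open>E\<^sub>k(ix, \<cdot>)\<close>.

  The kernel is built degree by degree, by inverting the operators \<open>n + \<gamma>\<^sub>k - (\<Sum>v. k v \<sigma>\<^sub>v)\<close>, which
  obey a maximum principle on group orbits; this needs neither the commutativity of the Dunkl
  operators nor the intertwining operator. Along rays the eigenvalue equations become an ordinary
  differential system for the values on a group orbit, whose energy estimates give uniqueness,
  boundedness for imaginary and positivity for real arguments. Inversion is obtained by Gaussian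
  regularisation: up to a constant, \<open>\<integral> E\<^sub>k(ix, z) E\<^sub>k(-iy, z) exp(-s |z|\<^sup>2 / 2) w\<^sub>k(z) dz\<close> is a
  probability density in \<open>y\<close> with respect to \<open>w\<^sub>k(y) dy\<close>, whose second moment about \<open>x\<close> is a multiple
  of \<open>s\<close>, so it concentrates at \<open>x\<close> as \<open>s \<rightarrow> 0\<close>.\<close>

section \<open>Reflections and the reflection group\<close>

text \<open>Contraction with \<open>x\<close> works because the coefficients
  \<open>x $ j * v $ j\<close> add up to \<open>v \<bullet> x\<close>, which cancels the denominator
  of the difference quotient: the contracted equation has no singularity on the hyperplanes and
  couples only values on one orbit. It is one equation in place of \<open>CARD('n)\<close>, so the
  full system must be recovered from it; this is done by letting the maximum principle act on pairs
  of a point and a direction moved by the same group element. Summing an energy over an orbit costs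
  a factor \<open>card G\<close>, whence the bound \<open>sqrt (card G)\<close> for imaginary
  arguments. Two obstacles shape the analysis. The weight may fail to be differentiable on the
  hyperplanes, so antisymmetry of the Dunkl operators is proved for a regularised weight, where the
  error terms are odd under a reflection. Decay of the transform rests on Dunkl operators preserving
  the Schwartz class, and there the quotient is an average over a segment that may pass near the
  origin: the averages give decay near the hyperplane only, and division by
  \<open>v \<bullet> x\<close> gives it elsewhere.\<close>

lemma reflection_linear: "linear (reflection v)"
  unfolding reflection_def
  by (rule linearI) (auto simp: algebra_simps inner_add_left add_divide_distrib)

text \<open>For \<open>v = 0\<close> the quotient in \<open>reflection\<close> is 0 by the
  convention on division and the map is the identity; the case split lets the rule hold for every
  \<open>v\<close>, so that it rewrites without side conditions.\<close>

lemma reflection_involution [simp]: "reflection v (reflection v x) = x"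
  by (cases "v = 0") (auto simp: reflection_def algebra_simps inner_diff_left power2_norm_eq_inner)

lemma reflection_inner [simp]: "reflection v x \<bullet> reflection v y = x \<bullet> y"
  by (cases "v = 0")
     (auto simp: reflection_def algebra_simps inner_diff_left inner_diff_right power2_norm_eq_inner inner_commute)

lemma reflection_norm [simp]: "norm (reflection v x) = norm x"
  by (simp add: norm_eq_sqrt_inner)

lemma reflection_inner_swap: "reflection v x \<bullet> y = x \<bullet> reflection v y"
  by (metis reflection_inner reflection_involution)

lemma reflection_minus [simp]: "reflection (- v) = reflection v"
  by (auto simp: reflection_def fun_eq_iff)

lemma reflection_self [simp]: "reflection v v = - v"
proof (cases "v = 0")
  case False
  then have "2 * (v \<bullet> v) / (norm v)\<^sup>2 = 2" by (simp add: power2_norm_eq_inner)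
  then show ?thesis by (simp add: reflection_def scaleR_2)
qed (simp add: reflection_def)

lemma inner_reflection_self [simp]: "v \<bullet> reflection v x = - (v \<bullet> x)"
  by (metis inner_minus_left reflection_inner_swap reflection_self)

lemma reflection_orth: "v \<bullet> x = 0 \<Longrightarrow> reflection v x = x"
  by (auto simp: reflection_def inner_commute)

text \<open>Linearity and isometry of the reflection in \<open>u\<close> carry the formula for
  \<open>v\<close> into the one for the image of \<open>v\<close>. As a rewrite rule this turns a
  composition with \<open>u\<close> into a reindexing of sums over roots.\<close>

lemma reflection_conj:
  "reflection u (reflection v x) = reflection (reflection u v) (reflection u x)"
proof -
  have 1: "reflection u (a - c *\<^sub>R b) = reflection u a - c *\<^sub>R reflection u b" for a b c
    using reflection_linear[of u] by (simp add: linear_diff linear_scale)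
  show ?thesis
    unfolding reflection_def[of v] reflection_def[of "reflection u v"] 1 by simp
qed

lemma reflection_orthogonal: "orthogonal_transformation (reflection v)"
  by (simp add: orthogonal_transformation_def reflection_linear)

lemma reflection_add [simp]: "reflection v (x + y) = reflection v x + reflection v y"
  and reflection_scaleR [simp]: "reflection v (c *\<^sub>R x) = c *\<^sub>R reflection v x"
  and reflection_neg [simp]: "reflection v (- x) = - reflection v x"
  and reflection_zero [simp]: "reflection v 0 = 0"
  using reflection_linear[of v]
  by (auto simp: linear_add linear_scale linear_neg linear_0)

lemma continuous_on_reflection [continuous_intros]:
  "continuous_on S f \<Longrightarrow> continuous_on S (\<lambda>x. reflection v (f x))"
  using bounded_linear.continuous_on linear_conv_bounded_linear reflection_linear by blast

lemma reflection_measurable [measurable]: "reflection v \<in> borel_measurable borel"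
  by (intro borel_measurable_continuous_onI continuous_intros)

section \<open>Sums over roots and the finite reflection group\<close>

locale dunkl_setting =
  fixes R P :: "(real ^ 'n) set" and k :: "real ^ 'n \<Rightarrow> real"
  assumes root: "reduced_root_system R"
    and pos: "positive_subsystem R P"
    and mult: "multiplicity_function R k"
begin

lemma finite_R: "finite R" and zero_notin_R: "0 \<notin> R"
  and reflection_R: "v \<in> R \<Longrightarrow> reflection v ` R = R"
  using root by (auto simp: reduced_root_system_def)

lemma neg_R: "v \<in> R \<Longrightarrow> - v \<in> R"
  using reflection_R[of v] reflection_self[of v] by force

lemma P_subset: "P \<subseteq> R"
  using pos by (auto simp: positive_subsystem_def)

lemma finite_P [simp]: "finite P"
  using finite_R P_subset finite_subset by blast

lemma P_nonzero: "v \<in> P \<Longrightarrow> v \<noteq> 0"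
  using zero_notin_R P_subset by auto

lemma k_nonneg: "v \<in> P \<Longrightarrow> 0 \<le> k v"
  using mult P_subset by (auto simp: multiplicity_function_def)

lemma k_reflection: "u \<in> R \<Longrightarrow> v \<in> R \<Longrightarrow> k (reflection u v) = k v"
  using mult reflection_group_step[OF _ reflection_group_id, of u R]
  by (auto simp: multiplicity_function_def)

lemma k_neg: "v \<in> R \<Longrightarrow> k (- v) = k v"
  using k_reflection[of v v] by simp

lemma R_split: "R = P \<union> uminus ` P" "P \<inter> uminus ` P = {}"
proof -
  obtain b where b: "\<forall>v\<in>R. v \<bullet> b \<noteq> 0" "P = {v \<in> R. v \<bullet> b > 0}"
    using pos by (auto simp: positive_subsystem_def)
  have "v \<in> P \<union> uminus ` P" if "v \<in> R" for v
  proof (cases "v \<bullet> b > 0")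
    case False
    then have "- v \<in> P" using b that neg_R[OF that] by force
    then show ?thesis by (metis UnI2 imageI minus_minus)
  qed (use b that in auto)
  moreover have "uminus ` P \<subseteq> R" using neg_R P_subset by auto
  ultimately show "R = P \<union> uminus ` P" using P_subset by auto
  show "P \<inter> uminus ` P = {}" using b by force
qed

lemma sum_R:
  fixes \<phi> :: "real ^ 'n \<Rightarrow> 'b::real_vector"
  assumes "\<And>v. v \<in> P \<Longrightarrow> \<phi> (- v) = \<phi> v"
  shows "(\<Sum>v\<in>R. \<phi> v) = 2 *\<^sub>R (\<Sum>v\<in>P. \<phi> v)"
proof -
  have "(\<Sum>v\<in>R. \<phi> v) = (\<Sum>v\<in>P. \<phi> v) + (\<Sum>v\<in>uminus ` P. \<phi> v)"
    by (subst R_split(1), rule sum.union_disjoint) (use R_split(2) in auto)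
  also have "(\<Sum>v\<in>uminus ` P. \<phi> v) = (\<Sum>v\<in>P. \<phi> v)"
    by (subst sum.reindex) (auto simp: inj_on_def assms)
  finally show ?thesis by (simp add: scaleR_2)
qed

text \<open>The reflection in \<open>u\<close> permutes \<open>R\<close> but does not preserve
  \<open>P\<close>. For an even summand the sum over \<open>P\<close> is half of the sum over
  \<open>R\<close>, and the latter is invariant because \<open>k\<close> is.\<close>

lemma sum_P_reflect:
  fixes \<phi> :: "real ^ 'n \<Rightarrow> 'b::real_vector"
  assumes u: "u \<in> P" and even: "\<And>v. \<phi> (- v) = \<phi> v"
  shows "(\<Sum>v\<in>P. k v *\<^sub>R \<phi> (reflection u v)) = (\<Sum>v\<in>P. k v *\<^sub>R \<phi> v)"
proof -
  have uR: "u \<in> R" using u P_subset by auto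
  have "2 *\<^sub>R (\<Sum>v\<in>P. k v *\<^sub>R \<phi> (reflection u v)) = (\<Sum>v\<in>R. k v *\<^sub>R \<phi> (reflection u v))"
    by (subst sum_R) (use even k_neg P_subset in auto)
  also have "\<dots> = (\<Sum>v\<in>R. k (reflection u v) *\<^sub>R \<phi> (reflection u v))"
    using k_reflection[OF uR] by simp
  also have "\<dots> = (\<Sum>v\<in>reflection u ` R. k v *\<^sub>R \<phi> v)"
    by (subst sum.reindex) (auto simp: inj_on_def, metis reflection_involution)
  also have "\<dots> = (\<Sum>v\<in>R. k v *\<^sub>R \<phi> v)"
    using reflection_R[OF uR] by simp
  also have "\<dots> = 2 *\<^sub>R (\<Sum>v\<in>P. k v *\<^sub>R \<phi> v)"
    by (subst sum_R) (use even k_neg P_subset in auto)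
  finally show ?thesis by simp
qed

abbreviation G where "G \<equiv> reflection_group R"
abbreviation \<Gamma> where "\<Gamma> \<equiv> gamma_index P k"

lemma Gamma_nonneg: "0 \<le> \<Gamma>"
  unfolding gamma_index_def by (rule sum_nonneg) (rule k_nonneg)

lemma G_orthogonal: "g \<in> G \<Longrightarrow> orthogonal_transformation g"
proof (induction rule: reflection_group.induct)
  case reflection_group_id
  then show ?case using orthogonal_transformation_id by (simp add: id_def)
next
  case (reflection_group_step v g)
  then show ?case using orthogonal_transformation_compose reflection_orthogonal by blast
qed

lemma G_linear: "g \<in> G \<Longrightarrow> linear g"
  using G_orthogonal orthogonal_transformation_def by blast

lemma G_norm [simp]: "g \<in> G \<Longrightarrow> norm (g x) = norm x"
  using G_orthogonal orthogonal_transformation_norm by blast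

lemma G_left: "v \<in> P \<Longrightarrow> g \<in> G \<Longrightarrow> reflection v \<circ> g \<in> G"
  using P_subset reflection_group_step by blast

lemma G_right: assumes "v \<in> P" "g \<in> G" shows "g \<circ> reflection v \<in> G"
  using assms(2)
proof (induction rule: reflection_group.induct)
  case reflection_group_id
  then show ?case using G_left[OF assms(1) reflection_group.reflection_group_id] by simp
next
  case (reflection_group_step u g)
  then show ?case by (metis comp_assoc reflection_group.reflection_group_step)
qed

lemma G_comp: "g \<in> G \<Longrightarrow> h \<in> G \<Longrightarrow> g \<circ> h \<in> G"
  by (induction rule: reflection_group.induct) (auto simp: comp_assoc intro: reflection_group_step)

lemma reflection_comp_invol: "reflection v \<circ> (reflection v \<circ> g) = g"
  "(g \<circ> reflection v) \<circ> reflection v = g"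
  by (auto simp: fun_eq_iff)

lemma bij_left: "v \<in> P \<Longrightarrow> bij_betw (\<lambda>g. reflection v \<circ> g) G G"
  by (rule bij_betw_byWitness[where f' = "\<lambda>g. reflection v \<circ> g"])
     (auto simp: reflection_comp_invol G_left)

lemma bij_right: "v \<in> P \<Longrightarrow> bij_betw (\<lambda>g. g \<circ> reflection v) G G"
  by (rule bij_betw_byWitness[where f' = "\<lambda>g. g \<circ> reflection v"])
     (auto simp: reflection_comp_invol G_right)

lemma G_maps_R: "g \<in> G \<Longrightarrow> v \<in> R \<Longrightarrow> g v \<in> R"
  by (induction rule: reflection_group.induct) (use reflection_R in auto)

lemma G_fixes_orth: "g \<in> G \<Longrightarrow> \<forall>v\<in>R. v \<bullet> x = 0 \<Longrightarrow> g x = x"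
  by (induction rule: reflection_group.induct) (auto simp: reflection_orth)

text \<open>An element of \<open>G\<close> is determined by its values on the finite set
  \<open>R\<close>: they fix it on the span of \<open>R\<close> by linearity, and every generator is
  the identity on the orthogonal complement, which may be nonzero.\<close>

lemma finite_G [simp]: "finite G"
proof -
  have "inj_on (\<lambda>g. restrict g R) G"
  proof (rule inj_onI)
    fix g h assume gh: "g \<in> G" "h \<in> G" "restrict g R = restrict h R"
    then have eqR: "g v = h v" if "v \<in> R" for v
      by (metis restrict_apply' that)
    show "g = h"
    proof
      fix x
      obtain y z where yz: "y \<in> span R" "\<And>w. w \<in> span R \<Longrightarrow> orthogonal z w" "x = y + z"
        using orthogonal_subspace_decomp_exists[of R x] by metis
      have "g y = h y"
        using linear_eq_on_span[OF G_linear[OF gh(1)] G_linear[OF gh(2)] eqR] yz(1) by blast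
      moreover have "\<forall>v\<in>R. v \<bullet> z = 0"
        using yz(2) span_base by (metis inner_commute orthogonal_def)
      ultimately show "g x = h x"
        using gh G_fixes_orth yz(3) G_linear by (metis linear_add)
    qed
  qed
  moreover have "(\<lambda>g. restrict g R) ` G \<subseteq> PiE R (\<lambda>_. R)"
    using G_maps_R by auto
  ultimately show ?thesis
    using finite_PiE[OF finite_R, of "\<lambda>_. R"] finite_R finite_imageD finite_subset by metis
qed

lemma id_in_G [simp]: "id \<in> G" by (rule reflection_group_id)

section \<open>Maximum principle on orbits and inversion in the group algebra\<close>

text \<open>At an element where \<open>\<psi>\<close> is largest, the sum on the right is at most
  \<open>\<Gamma>\<close> times the maximum, and the surplus \<open>c\<close> in the coefficient on
  the left remains. The uniqueness arguments for the recursions by degree all rest on this.\<close>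

lemma orbit_maximum_principle:
  fixes \<psi> :: "(real ^ 'n \<Rightarrow> real ^ 'n) \<Rightarrow> real"
  assumes "0 < c"
    and le: "\<And>g. g \<in> G \<Longrightarrow> (c + \<Gamma>) * \<psi> g \<le> B + (\<Sum>v\<in>P. k v * \<psi> (reflection v \<circ> g))"
    and "g \<in> G"
  shows "\<psi> g \<le> B / c"
proof -
  define M where "M = Max (\<psi> ` G)"
  have "M \<in> \<psi> ` G" unfolding M_def using assms(3) by (intro Max_in) auto
  then obtain h where h: "h \<in> G" "\<psi> h = M" by auto
  have leM: "\<psi> g \<le> M" if "g \<in> G" for g
    unfolding M_def using that by auto
  have "(c + \<Gamma>) * M \<le> B + (\<Sum>v\<in>P. k v * \<psi> (reflection v \<circ> h))"
    using le[OF h(1)] h by simp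
  also have "\<dots> \<le> B + (\<Sum>v\<in>P. k v * M)"
    by (intro add_left_mono sum_mono mult_left_mono leM G_left h k_nonneg)
  also have "\<dots> = B + \<Gamma> * M" by (simp add: gamma_index_def sum_distrib_right)
  finally have "M \<le> B / c" using \<open>0 < c\<close> by (simp add: field_simps)
  then show ?thesis using leM[OF \<open>g \<in> G\<close>] by simp
qed

text \<open>Neumann series: the operator with weights \<open>k v\<close> has total mass
  \<open>\<Gamma>\<close>, which is less than \<open>c + \<Gamma>\<close>, so the powers can be
  summed. All terms are nonnegative, hence so is the inverse.\<close>

lemma resolvent_exists:
  assumes "0 < c"
  shows "\<exists>a. (\<forall>g\<in>G. 0 \<le> a g) \<and>
    (\<forall>g\<in>G. (c + \<Gamma>) * a g = (if g = id then 1 else 0) + (\<Sum>v\<in>P. k v * a (g \<circ> reflection v)))"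
proof -
  \<comment> \<open>\<open>p j g\<close> is the total weight of the words of \<open>j\<close>
    reflections in positive roots whose product is \<open>g\<close>.\<close>
  define p where "p = rec_nat (\<lambda>g. if g = id then 1 else (0::real))
    (\<lambda>_ q g. \<Sum>v\<in>P. k v * q (g \<circ> reflection v))"
  have p0: "p 0 g = (if g = id then 1 else 0)" and
    pS: "p (Suc j) g = (\<Sum>v\<in>P. k v * p j (g \<circ> reflection v))" for j g
    by (auto simp: p_def)
  have pb: "0 \<le> p j g \<and> p j g \<le> \<Gamma> ^ j" if "g \<in> G" for j g
    using that
  proof (induction j arbitrary: g)
    case (Suc j)
    have "p (Suc j) g \<le> (\<Sum>v\<in>P. k v * \<Gamma> ^ j)"
      unfolding pS by (intro sum_mono mult_left_mono k_nonneg) (use Suc G_right in auto)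
    also have "\<dots> = \<Gamma> ^ Suc j" by (simp add: gamma_index_def sum_distrib_right)
    moreover have "0 \<le> p (Suc j) g"
      unfolding pS by (intro sum_nonneg mult_nonneg_nonneg k_nonneg) (use Suc G_right in auto)
    ultimately show ?case by simp
  qed (auto simp: p0)
  define q where "q = \<Gamma> / (c + \<Gamma>)"
  have q: "0 \<le> q" "q < 1" using assms Gamma_nonneg by (auto simp: q_def)
  have sm: "summable (\<lambda>j. p j g / (c + \<Gamma>) ^ j)" if "g \<in> G" for g
    by (rule summable_comparison_test'[OF summable_geometric[of q], of 0])
       (use q pb[OF that] assms Gamma_nonneg
         in \<open>auto simp: q_def power_divide abs_mult intro!: divide_right_mono\<close>)
  define a where "a g = (\<Sum>j. p j g / (c + \<Gamma>) ^ j) / (c + \<Gamma>)" for g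
  have "0 \<le> a g" if "g \<in> G" for g
    unfolding a_def using pb[OF that] assms Gamma_nonneg
    by (intro divide_nonneg_nonneg suminf_nonneg sm that) auto
  moreover have "(c + \<Gamma>) * a g = (if g = id then 1 else 0) + (\<Sum>v\<in>P. k v * a (g \<circ> reflection v))"
    if "g \<in> G" for g
  proof -
    have cG: "c + \<Gamma> > 0" using assms Gamma_nonneg by simp
    have "(c + \<Gamma>) * a g = (\<Sum>j. p j g / (c + \<Gamma>) ^ j)"
      using cG by (simp add: a_def)
    also have "\<dots> = p 0 g + (\<Sum>j. p (Suc j) g / (c + \<Gamma>) ^ Suc j)"
      using suminf_split_head[OF sm[OF that]] by simp
    also have "(\<Sum>j. p (Suc j) g / (c + \<Gamma>) ^ Suc j) =
        (\<Sum>j. \<Sum>v\<in>P. k v / (c + \<Gamma>) * (p j (g \<circ> reflection v) / (c + \<Gamma>) ^ j))"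
      by (simp add: pS sum_divide_distrib)
    also have "\<dots> = (\<Sum>v\<in>P. \<Sum>j. k v / (c + \<Gamma>) * (p j (g \<circ> reflection v) / (c + \<Gamma>) ^ j))"
      by (rule suminf_sum) (intro summable_mult sm G_right that)
    also have "\<dots> = (\<Sum>v\<in>P. k v * a (g \<circ> reflection v))"
      by (intro sum.cong refl)
         (subst suminf_mult[OF sm[OF G_right[OF _ that]]], auto simp: a_def)
    finally show ?thesis by (simp add: p0)
  qed
  ultimately show ?thesis by blast
qed

text \<open>The coefficients of the inverse of \<open>c + \<gamma>\<^sub>k - (\<Sum>v\<in>P. k v \<sigma>\<^sub>v)\<close> in the group algebra.\<close>

definition resolvent :: "real \<Rightarrow> (real ^ 'n \<Rightarrow> real ^ 'n) \<Rightarrow> real" where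
  "resolvent c = (SOME a. (\<forall>g\<in>G. 0 \<le> a g) \<and>
    (\<forall>g\<in>G. (c + \<Gamma>) * a g = (if g = id then 1 else 0) + (\<Sum>v\<in>P. k v * a (g \<circ> reflection v))))"

lemma resolvent_nonneg: "0 < c \<Longrightarrow> g \<in> G \<Longrightarrow> 0 \<le> resolvent c g"
  and resolvent_eq: "0 < c \<Longrightarrow> g \<in> G \<Longrightarrow> (c + \<Gamma>) * resolvent c g =
    (if g = id then 1 else 0) + (\<Sum>v\<in>P. k v * resolvent c (g \<circ> reflection v))"
  using someI_ex[OF resolvent_exists, of c] unfolding resolvent_def by auto

text \<open>Right multiplication by a reflection reindexes \<open>G\<close> and moves the reflection
  from the arguments to the coefficients, where \<open>resolvent_eq\<close> leaves only the term of
  the identity. Two arguments are carried so that the lemma covers functions of a point as well as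
  derivatives, whose direction is moved by the same group element.\<close>

lemma resolvent_apply:
  fixes h :: "real ^ 'n \<Rightarrow> real ^ 'n \<Rightarrow> real"
  assumes "0 < c"
  shows "(c + \<Gamma>) * (\<Sum>g\<in>G. resolvent c g * h (g x) (g y)) -
    (\<Sum>v\<in>P. k v * (\<Sum>g\<in>G. resolvent c g * h (g (reflection v x)) (g (reflection v y)))) = h x y"
proof -
  have 1: "(\<Sum>g\<in>G. resolvent c g * h (g (reflection v x)) (g (reflection v y))) =
      (\<Sum>g\<in>G. resolvent c (g \<circ> reflection v) * h (g x) (g y))" if "v \<in> P" for v
    by (subst sum.reindex_bij_betw[OF bij_right[OF that], symmetric]) simp
  have "(\<Sum>v\<in>P. k v * (\<Sum>g\<in>G. resolvent c g * h (g (reflection v x)) (g (reflection v y)))) =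
     (\<Sum>v\<in>P. \<Sum>g\<in>G. k v * resolvent c (g \<circ> reflection v) * h (g x) (g y))"
    by (intro sum.cong refl) (simp only: 1 sum_distrib_left mult.assoc)
  also have "\<dots> = (\<Sum>g\<in>G. (\<Sum>v\<in>P. k v * resolvent c (g \<circ> reflection v)) * h (g x) (g y))"
    by (subst sum.swap) (simp only: sum_distrib_right)
  finally have "(\<Sum>v\<in>P. k v * (\<Sum>g\<in>G. resolvent c g * h (g (reflection v x)) (g (reflection v y)))) =
     (\<Sum>g\<in>G. (\<Sum>v\<in>P. k v * resolvent c (g \<circ> reflection v)) * h (g x) (g y))" .
  then have "(c + \<Gamma>) * (\<Sum>g\<in>G. resolvent c g * h (g x) (g y)) -
    (\<Sum>v\<in>P. k v * (\<Sum>g\<in>G. resolvent c g * h (g (reflection v x)) (g (reflection v y)))) =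
    (\<Sum>g\<in>G. ((c + \<Gamma>) * resolvent c g - (\<Sum>v\<in>P. k v * resolvent c (g \<circ> reflection v))) * h (g x) (g y))"
    by (simp add: sum_distrib_left algebra_simps sum_subtractf)
  also have "\<dots> = (\<Sum>g\<in>G. if g = id then h (g x) (g y) else 0)"
    by (intro sum.cong refl) (use resolvent_eq[OF assms] in auto)
  also have "\<dots> = h x y" by simp
  finally show ?thesis .
qed

text \<open>The inverse is applied to the constant 1, on which the operator is multiplication by
  \<open>c\<close>. With nonnegativity this bounds the inverse by \<open>1 / c\<close> in the
  supremum norm; for \<open>c = n\<close> these factors build up the \<open>1 / fact n\<close> in
  the bounds below.\<close>

lemma resolvent_sum: assumes "0 < c" shows "(\<Sum>g\<in>G. resolvent c g) = 1 / c"
proof -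
  have "(c + \<Gamma>) * (\<Sum>g\<in>G. resolvent c g) - \<Gamma> * (\<Sum>g\<in>G. resolvent c g) = 1"
    using resolvent_apply[OF assms, of "\<lambda>_ _. 1" 0 0]
    by (simp add: gamma_index_def sum_distrib_right)
  then show ?thesis using assms by (simp add: field_simps)
qed

end

section \<open>Homogeneous components of the Dunkl kernel\<close>

context dunkl_setting
begin

text \<open>The part of degree \<open>n\<close> in \<open>x\<close> of the Dunkl kernel. Contracting the eigenvalue equations with \<open>x\<close>
  and applying Euler's identity gives the equation \<open>K_recursion\<close>, which determines each part from the preceding one.\<close>

primrec K :: "nat \<Rightarrow> real ^ 'n \<Rightarrow> real ^ 'n \<Rightarrow> real" where
  "K 0 \<xi> x = 1"
| "K (Suc n) \<xi> x = (\<Sum>g\<in>G. resolvent (real (Suc n)) g * ((\<xi> \<bullet> g x) * K n \<xi> (g x)))"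

text \<open>The derivative of \<open>K n \<xi>\<close> at \<open>x\<close> in the direction
  \<open>h\<close>, found by differentiating the recursion formally. The explicit formula gives
  \<open>DK\<close> a recursion with the same resolvent, to which \<open>resolvent_apply\<close>
  applies.\<close>

primrec DK :: "nat \<Rightarrow> real ^ 'n \<Rightarrow> real ^ 'n \<Rightarrow> real ^ 'n \<Rightarrow> real" where
  "DK 0 \<xi> x h = 0"
| "DK (Suc n) \<xi> x h = (\<Sum>g\<in>G. resolvent (real (Suc n)) g *
     ((\<xi> \<bullet> g h) * K n \<xi> (g x) + (\<xi> \<bullet> g x) * DK n \<xi> (g x) (g h)))"

lemma K_recursion:
  "(real (Suc n) + \<Gamma>) * K (Suc n) \<xi> x - (\<Sum>v\<in>P. k v * K (Suc n) \<xi> (reflection v x)) =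
    (\<xi> \<bullet> x) * K n \<xi> x"
  unfolding K.simps(2)
  using resolvent_apply[of "real (Suc n)" "\<lambda>x _. (\<xi> \<bullet> x) * K n \<xi> x" x x]
  by simp

lemma DK_recursion:
  "(real (Suc n) + \<Gamma>) * DK (Suc n) \<xi> x h
     - (\<Sum>v\<in>P. k v * DK (Suc n) \<xi> (reflection v x) (reflection v h)) =
    (\<xi> \<bullet> h) * K n \<xi> x + (\<xi> \<bullet> x) * DK n \<xi> x h"
  unfolding DK.simps(2)
  using resolvent_apply[of "real (Suc n)" "\<lambda>x h. (\<xi> \<bullet> h) * K n \<xi> x + (\<xi> \<bullet> x) * DK n \<xi> x h" x h]
  by simp

lemma G_bounded_linear: "g \<in> G \<Longrightarrow> bounded_linear g"
  using G_linear linear_conv_bounded_linear by blast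

lemma K_has_derivative: "(K n \<xi> has_derivative DK n \<xi> x) (at x)"
proof (induction n arbitrary: x)
  case (Suc n)
  have "((\<lambda>x. (\<xi> \<bullet> g x) * K n \<xi> (g x)) has_derivative
      (\<lambda>h. (\<xi> \<bullet> g h) * K n \<xi> (g x) + (\<xi> \<bullet> g x) * DK n \<xi> (g x) (g h))) (at x)" if "g \<in> G" for g
  proof -
    have g: "(g has_derivative g) (at x)"
      by (rule bounded_linear_imp_has_derivative[OF G_bounded_linear[OF that]])
    have "((\<lambda>x. K n \<xi> (g x)) has_derivative (\<lambda>h. DK n \<xi> (g x) (g h))) (at x)"
      by (rule has_derivative_compose[OF g Suc.IH])
    from has_derivative_mult[OF has_derivative_inner_right[OF g, of \<xi>] this]
    show ?thesis by (simp add: algebra_simps)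
  qed
  then show ?case
    unfolding K.simps(2) DK.simps(2) K.simps(2)[abs_def] DK.simps(2)[abs_def]
    by (intro has_derivative_sum has_derivative_mult_right)
qed (simp add: K.simps(1)[abs_def] DK.simps(1)[abs_def])

text \<open>Group elements are isometries and the resolvent weights of degree \<open>n\<close> have
  total mass \<open>1 / n\<close>, so the step to degree \<open>n\<close> costs at most a factor
  \<open>norm \<xi> * norm x / n\<close>.\<close>

lemma K_bound: "\<bar>K n \<xi> x\<bar> \<le> (norm \<xi> * norm x) ^ n / fact n"
proof (induction n arbitrary: x)
  case (Suc n)
  have "\<bar>K (Suc n) \<xi> x\<bar> \<le> (\<Sum>g\<in>G. resolvent (real (Suc n)) g *
      ((norm \<xi> * norm x) * ((norm \<xi> * norm x) ^ n / fact n)))"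
    unfolding K.simps
  proof (rule order_trans[OF sum_abs], rule sum_mono)
    fix g assume g: "g \<in> G"
    have "\<bar>\<xi> \<bullet> g x\<bar> \<le> norm \<xi> * norm x"
      using Cauchy_Schwarz_ineq2[of \<xi> "g x"] g by simp
    moreover have "\<bar>K n \<xi> (g x)\<bar> \<le> (norm \<xi> * norm x) ^ n / fact n"
      using Suc.IH[of "g x"] g by simp
    ultimately have "\<bar>(\<xi> \<bullet> g x) * K n \<xi> (g x)\<bar> \<le>
        (norm \<xi> * norm x) * ((norm \<xi> * norm x) ^ n / fact n)"
      unfolding abs_mult by (intro mult_mono) auto
    then show "\<bar>resolvent (real (Suc n)) g * ((\<xi> \<bullet> g x) * K n \<xi> (g x))\<bar> \<le>
       resolvent (real (Suc n)) g * ((norm \<xi> * norm x) * ((norm \<xi> * norm x) ^ n / fact n))"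
      using mult_left_mono[OF _ resolvent_nonneg[of "real (Suc n)" g]] g
        resolvent_nonneg[of "real (Suc n)" g]
      by (simp only: abs_mult[of "resolvent (real (Suc n)) g"] abs_of_nonneg of_nat_0_less_iff zero_less_Suc)
  qed
  also have "\<dots> = (norm \<xi> * norm x) ^ Suc n / fact (Suc n)"
    by (subst sum_distrib_right[symmetric]) (simp add: resolvent_sum)
  finally show ?case .
qed simp

text \<open>The majorant is \<open>norm h\<close> times the derivative of
  \<open>(norm \<xi> * r) ^ n / fact n\<close> at \<open>r = norm x\<close>. In the step to degree
  \<open>Suc n\<close> the two summands of the recursion contribute 1 and \<open>n\<close> parts of
  it.\<close>

lemma DK_bound: "\<bar>DK n \<xi> x h\<bar> \<le> real n * (norm \<xi> * norm h) * (norm \<xi> * norm x) ^ (n - 1) / fact n"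
proof (induction n arbitrary: x h)
  case (Suc n)
  define q where "q = norm \<xi> * norm x"
  define B where "B = real (Suc n) * (norm \<xi> * norm h * (q ^ n / fact n))"
  have "\<bar>DK (Suc n) \<xi> x h\<bar> \<le> (\<Sum>g\<in>G. resolvent (real (Suc n)) g * B)"
    unfolding DK.simps
  proof (rule order_trans[OF sum_abs], rule sum_mono)
    fix g assume g: "g \<in> G"
    have "\<bar>\<xi> \<bullet> g h\<bar> \<le> norm \<xi> * norm h" "\<bar>\<xi> \<bullet> g x\<bar> \<le> q"
      using Cauchy_Schwarz_ineq2[of \<xi> "g h"] Cauchy_Schwarz_ineq2[of \<xi> "g x"] g
      by (auto simp: q_def)
    moreover have "\<bar>K n \<xi> (g x)\<bar> \<le> q ^ n / fact n"
      using K_bound[of n \<xi> "g x"] g by (simp add: q_def)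
    moreover have "\<bar>DK n \<xi> (g x) (g h)\<bar> \<le> real n * (norm \<xi> * norm h) * q ^ (n - 1) / fact n"
      using Suc.IH[of "g x" "g h"] g by (simp add: q_def)
    moreover have "q \<ge> 0" by (simp add: q_def)
    ultimately have "\<bar>(\<xi> \<bullet> g h) * K n \<xi> (g x)\<bar> \<le> norm \<xi> * norm h * (q ^ n / fact n)"
      "\<bar>(\<xi> \<bullet> g x) * DK n \<xi> (g x) (g h)\<bar> \<le> q * (real n * (norm \<xi> * norm h) * q ^ (n - 1) / fact n)"
      by (auto simp only: abs_mult intro!: mult_mono)
    moreover have "q * (real n * (norm \<xi> * norm h) * q ^ (n - 1) / fact n) =
        real n * (norm \<xi> * norm h * (q ^ n / fact n))"
      by (cases n) auto
    ultimately have "\<bar>(\<xi> \<bullet> g h) * K n \<xi> (g x) + (\<xi> \<bullet> g x) * DK n \<xi> (g x) (g h)\<bar> \<le> B"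
      unfolding B_def by (simp only: of_nat_Suc distrib_right mult_1)
    then show "\<bar>resolvent (real (Suc n)) g * ((\<xi> \<bullet> g h) * K n \<xi> (g x) + (\<xi> \<bullet> g x) * DK n \<xi> (g x) (g h))\<bar>
        \<le> resolvent (real (Suc n)) g * B"
      using resolvent_nonneg[of "real (Suc n)" g] g by (simp add: abs_mult mult_left_mono)
  qed
  also have "\<dots> = B / real (Suc n)"
    by (simp add: resolvent_sum flip: sum_distrib_right)
  also have "\<dots> = real (Suc n) * (norm \<xi> * norm h) * (norm \<xi> * norm x) ^ (Suc n - 1) / fact (Suc n)"
    by (simp add: B_def q_def)
  finally show ?case .
qed simp

section \<open>Uniqueness for the recursion and symmetries of the components\<close>

text \<open>Along the orbit of a point, the modulus of the difference of two solutions satisfies the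
  hypothesis of the maximum principle with \<open>B = 0\<close>.\<close>

lemma reflection_equation_unique:
  assumes "0 < c"
    and "\<And>x. (c + \<Gamma>) * f x - (\<Sum>v\<in>P. k v * f (reflection v x)) = h x"
    and "\<And>x. (c + \<Gamma>) * f' x - (\<Sum>v\<in>P. k v * f' (reflection v x)) = h x"
  shows "f x = (f' x :: real)"
proof -
  let ?d = "\<lambda>x. f x - f' x"
  have eq: "(c + \<Gamma>) * ?d x = (\<Sum>v\<in>P. k v * ?d (reflection v x))" for x
    using assms(2)[of x] assms(3)[of x] by (simp add: algebra_simps sum_subtractf)
  have "(c + \<Gamma>) * \<bar>?d (g x)\<bar> \<le> 0 + (\<Sum>v\<in>P. k v * \<bar>?d ((reflection v \<circ> g) x)\<bar>)" for g
  proof -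
    have "(c + \<Gamma>) * \<bar>?d (g x)\<bar> = \<bar>\<Sum>v\<in>P. k v * ?d (reflection v (g x))\<bar>"
      using \<open>0 < c\<close> Gamma_nonneg by (subst eq[symmetric]) (simp add: abs_mult)
    also have "\<dots> \<le> (\<Sum>v\<in>P. k v * \<bar>?d (reflection v (g x))\<bar>)"
      by (rule order_trans[OF sum_abs]) (auto simp: abs_mult k_nonneg intro!: sum_mono)
    finally show ?thesis by simp
  qed
  from orbit_maximum_principle[OF \<open>0 < c\<close> this id_in_G] show ?thesis by simp
qed

text \<open>Conjugation by the reflection in \<open>u\<close> only permutes the reflections in the
  recursion, so both sides solve the same equation.\<close>

lemma K_reflection: "u \<in> P \<Longrightarrow> K n (reflection u \<xi>) (reflection u x) = K n \<xi> x"
proof (induction n arbitrary: x)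
  case (Suc n)
  have "(real (Suc n) + \<Gamma>) * K (Suc n) (reflection u \<xi>) (reflection u x) -
     (\<Sum>v\<in>P. k v * K (Suc n) (reflection u \<xi>) (reflection u (reflection v x))) = (\<xi> \<bullet> x) * K n \<xi> x" for x
  proof -
    have "(\<Sum>v\<in>P. k v *\<^sub>R K (Suc n) (reflection u \<xi>) (reflection (reflection u v) (reflection u x))) =
        (\<Sum>v\<in>P. k v *\<^sub>R K (Suc n) (reflection u \<xi>) (reflection v (reflection u x)))"
      by (rule sum_P_reflect[OF Suc.prems]) (metis reflection_minus)
    then show ?thesis
      using K_recursion[of n "reflection u \<xi>" "reflection u x"] Suc
      by (simp add: reflection_conj[of u] del: K.simps)
  qed
  from reflection_equation_unique[OF _ this K_recursion] show ?case by simp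
qed simp

lemma K_reflection': "u \<in> P \<Longrightarrow> K n (reflection u \<xi>) x = K n \<xi> (reflection u x)"
  by (metis K_reflection reflection_involution)

text \<open>By \<open>K_reflection'\<close> the reflections in the recursion move from one argument
  to the other. Both sides therefore solve the recursion in \<open>x\<close>, with equal right sides
  by induction. This symmetry later allows differentiation of the kernel in its spectral
  variable.\<close>

lemma K_commute: "K n \<xi> x = K n x \<xi>"
proof (induction n arbitrary: x)
  case (Suc n)
  have "(real (Suc n) + \<Gamma>) * K (Suc n) x \<xi> - (\<Sum>v\<in>P. k v * K (Suc n) (reflection v x) \<xi>) =
      (\<xi> \<bullet> x) * K n \<xi> x" for x
    using K_recursion[of n x \<xi>] K_reflection'[of _ "Suc n"] Suc
    by (simp add: inner_commute del: K.simps cong: sum.cong)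
  from reflection_equation_unique[OF _ K_recursion this] show ?case by simp
qed simp

text \<open>Euler's identity, \<open>K n \<xi>\<close> being homogeneous of degree
  \<open>n\<close>.\<close>

lemma DK_self: "DK n \<xi> x x = real n * K n \<xi> x"
  by (induction n arbitrary: x) (auto simp: sum_distrib_left algebra_simps intro!: sum.cong)

section \<open>Dunkl operators off the reflecting hyperplanes\<close>

text \<open>The complement of the reflecting hyperplanes: invariant under \<open>G\<close>, dense
  and of full measure. All denominators of the Dunkl operators are nonzero here.\<close>

definition Om where "Om = {x. \<forall>v\<in>P. v \<bullet> x \<noteq> 0}"

text \<open>The derivative \<open>f'\<close> of \<open>f\<close> is an argument, and in contrast to \<^const>\<open>dunkl_op\<close> the quotients
  are \<open>0\<close> on the hyperplanes.\<close>

definition dop :: "(real ^ 'n \<Rightarrow> 'b::real_normed_vector) \<Rightarrow> (real ^ 'n \<Rightarrow> real ^ 'n \<Rightarrow> 'b) \<Rightarrow>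
    real ^ 'n \<Rightarrow> real ^ 'n \<Rightarrow> 'b" where
  "dop f f' \<eta> x = f' x \<eta> + (\<Sum>v\<in>P. k v *\<^sub>R ((v \<bullet> \<eta> / (v \<bullet> x)) *\<^sub>R (f x - f (reflection v x))))"

lemma Om_reflection: "u \<in> P \<Longrightarrow> x \<in> Om \<Longrightarrow> reflection u x \<in> Om"
proof (unfold Om_def, safe)
  fix v assume u: "u \<in> P" and x: "\<forall>v\<in>P. v \<bullet> x \<noteq> 0" and v: "v \<in> P" "v \<bullet> reflection u x = 0"
  have "reflection u v \<in> R" using reflection_R u v P_subset by blast
  then have "reflection u v \<in> P \<or> - reflection u v \<in> P" using R_split(1) by force
  then show False using x v
    by (metis inner_minus_left neg_equal_0_iff_equal reflection_inner_swap)
qed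

lemma Om_G: "g \<in> G \<Longrightarrow> x \<in> Om \<Longrightarrow> g x \<in> Om"
proof (induction rule: reflection_group.induct)
  case (reflection_group_step v g)
  then have "v \<in> P \<or> - v \<in> P" using R_split(1) by force
  then show ?case
    using Om_reflection[of v "g x"] Om_reflection[of "- v" "g x"] reflection_group_step by auto
qed simp

text \<open>Equivariance of Dunkl operators: the direction is reflected together with the point, and
  the sum over roots is reindexed by \<open>sum_P_reflect\<close>. Its summand is even in
  \<open>v\<close> because numerator and denominator change sign together.\<close>

lemma dop_reflect:
  assumes u: "u \<in> P"
  shows "dop (\<lambda>x. f (reflection u x)) (\<lambda>x h. f' (reflection u x) (reflection u h)) \<eta> x =
    dop f f' (reflection u \<eta>) (reflection u x)"
proof -
  let ?\<phi> = "\<lambda>v. (v \<bullet> reflection u \<eta> / (v \<bullet> reflection u x)) *\<^sub>R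
    (f (reflection u x) - f (reflection v (reflection u x)))"
  have "(\<Sum>v\<in>P. k v *\<^sub>R ?\<phi> (reflection u v)) = (\<Sum>v\<in>P. k v *\<^sub>R ?\<phi> v)"
    by (rule sum_P_reflect[OF u]) (metis inner_minus_left minus_divide_divide reflection_minus)
  then show ?thesis
    by (simp add: dop_def reflection_conj[of u])
qed

text \<open>The combination is the left side of \<open>K_recursion\<close>, so that
  \<open>dop\<close> can be applied to that equation.\<close>

lemma dop_linear:
  fixes f :: "real ^ 'n \<Rightarrow> real"
  shows "dop (\<lambda>x. c * f x - (\<Sum>v\<in>P. k v * F v x)) (\<lambda>x h. c * f' x h - (\<Sum>v\<in>P. k v * F' v x h)) \<eta> x =
    c * dop f f' \<eta> x - (\<Sum>v\<in>P. k v * dop (F v) (F' v) \<eta> x)"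
proof -
  have "(\<Sum>v\<in>P. k v * (\<Sum>u\<in>P. k u * (u \<bullet> \<eta> / (u \<bullet> x) * (F v x - F v (reflection u x))))) =
      (\<Sum>u\<in>P. k u * (u \<bullet> \<eta> / (u \<bullet> x) * (\<Sum>v\<in>P. k v * (F v x - F v (reflection u x)))))"
    unfolding sum_distrib_left by (subst sum.swap) (simp only: mult.left_commute)
  moreover have "dop (\<lambda>x. c * f x - (\<Sum>v\<in>P. k v * F v x)) (\<lambda>x h. c * f' x h - (\<Sum>v\<in>P. k v * F' v x h)) \<eta> x =
      c * f' x \<eta> - (\<Sum>v\<in>P. k v * F' v x \<eta>) +
      (\<Sum>u\<in>P. k u * (u \<bullet> \<eta> / (u \<bullet> x) * (c * (f x - f (reflection u x)) -
        (\<Sum>v\<in>P. k v * (F v x - F v (reflection u x))))))"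
    unfolding dop_def by (simp add: right_diff_distrib sum_subtractf algebra_simps)
  moreover have "\<dots> = c * f' x \<eta> - (\<Sum>v\<in>P. k v * F' v x \<eta>) +
      (c * (\<Sum>u\<in>P. k u * (u \<bullet> \<eta> / (u \<bullet> x) * (f x - f (reflection u x)))) -
      (\<Sum>u\<in>P. k u * (u \<bullet> \<eta> / (u \<bullet> x) * (\<Sum>v\<in>P. k v * (F v x - F v (reflection u x))))))"
    by (simp only: right_diff_distrib sum_subtractf sum_distrib_left mult.left_commute[of c])
  ultimately show ?thesis
    unfolding dop_def real_scaleR_def by (simp only: distrib_left sum.distrib)
qed

text \<open>The difference quotient of a linear form is constant in \<open>x\<close>, so the
  commutator of a Dunkl operator with multiplication by a linear form has no singular part: it is a
  scalar plus a combination of reflections.\<close>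

lemma dop_mult_linear:
  fixes f :: "real ^ 'n \<Rightarrow> real"
  assumes "x \<in> Om"
  shows "dop (\<lambda>x. (\<xi> \<bullet> x) * f x) (\<lambda>x h. (\<xi> \<bullet> h) * f x + (\<xi> \<bullet> x) * f' x h) \<eta> x =
    (\<xi> \<bullet> \<eta>) * f x + (\<xi> \<bullet> x) * dop f f' \<eta> x +
    (\<Sum>v\<in>P. k v * ((\<xi> \<bullet> \<eta> - \<xi> \<bullet> reflection v \<eta>) * f (reflection v x)))"
proof -
  have "(v \<bullet> \<eta> / (v \<bullet> x)) * ((\<xi> \<bullet> x) * f x - (\<xi> \<bullet> reflection v x) * f (reflection v x)) =
      (\<xi> \<bullet> x) * ((v \<bullet> \<eta> / (v \<bullet> x)) * (f x - f (reflection v x))) +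
      (\<xi> \<bullet> \<eta> - \<xi> \<bullet> reflection v \<eta>) * f (reflection v x)" if "v \<in> P" for v
  proof -
    have vx: "v \<bullet> x \<noteq> 0" using assms that by (auto simp: Om_def)
    have "\<xi> \<bullet> \<eta> - \<xi> \<bullet> reflection v \<eta> = (v \<bullet> \<eta> / (v \<bullet> x)) * (\<xi> \<bullet> x - \<xi> \<bullet> reflection v x)"
      using vx by (simp add: reflection_def inner_diff_right inner_commute)
    moreover define q where "q = v \<bullet> \<eta> / (v \<bullet> x)"
    ultimately have 1: "\<xi> \<bullet> \<eta> - \<xi> \<bullet> reflection v \<eta> = q * (\<xi> \<bullet> x - \<xi> \<bullet> reflection v x)"
      by simp
    show ?thesis unfolding 1 q_def[symmetric] by (simp add: algebra_simps)
  qed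
  then have "(\<Sum>v\<in>P. k v * ((v \<bullet> \<eta> / (v \<bullet> x)) * ((\<xi> \<bullet> x) * f x - (\<xi> \<bullet> reflection v x) * f (reflection v x)))) =
     (\<Sum>v\<in>P. k v * ((\<xi> \<bullet> x) * ((v \<bullet> \<eta> / (v \<bullet> x)) * (f x - f (reflection v x))) +
      (\<xi> \<bullet> \<eta> - \<xi> \<bullet> reflection v \<eta>) * f (reflection v x)))"
    by (intro sum.cong refl) simp
  also have "\<dots> = (\<xi> \<bullet> x) * (\<Sum>v\<in>P. k v * ((v \<bullet> \<eta> / (v \<bullet> x)) * (f x - f (reflection v x)))) +
     (\<Sum>v\<in>P. k v * ((\<xi> \<bullet> \<eta> - \<xi> \<bullet> reflection v \<eta>) * f (reflection v x)))"
    by (simp only: distrib_left sum.distrib sum_distrib_left mult.left_commute)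
  finally show ?thesis
    unfolding dop_def real_scaleR_def by (simp only: distrib_left add.assoc)
qed

text \<open>Applied to the recursion of degree \<open>Suc n\<close>, \<open>dop\<close> and the
  product rule give an equation for \<open>dop (K (Suc n) \<xi>)\<close> in which point and
  direction are reflected together. The expected value solves it as well, and the maximum principle
  on the orbit of the pair \<open>(x, \<eta>)\<close> shows that the two agree. \<open>IH\<close> is
  the claim of the preceding degree multiplied by \<open>\<xi> \<bullet> x\<close> and rewritten by
  \<open>K_recursion\<close>; in this form it makes sense in degree 0, where both sides
  vanish.\<close>

lemma dop_K_step:
  assumes IH: "\<And>x \<eta>. x \<in> Om \<Longrightarrow> (\<xi> \<bullet> x) * dop (K n \<xi>) (DK n \<xi>) \<eta> x =
         (\<xi> \<bullet> \<eta>) * ((real n + \<Gamma>) * K n \<xi> x - (\<Sum>v\<in>P. k v * K n \<xi> (reflection v x)))"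
    and x: "x \<in> Om"
  shows "dop (K (Suc n) \<xi>) (DK (Suc n) \<xi>) \<eta> x = (\<xi> \<bullet> \<eta>) * K n \<xi> x"
proof -
  define L where "L x \<eta> = dop (K (Suc n) \<xi>) (DK (Suc n) \<xi>) \<eta> x" for x \<eta>
  define M where "M x \<eta> = (\<xi> \<bullet> \<eta>) * K n \<xi> x" for x \<eta>
  let ?c = "real (Suc n) + \<Gamma>"
  have L: "?c * L x \<eta> - (\<Sum>v\<in>P. k v * L (reflection v x) (reflection v \<eta>)) =
      (\<xi> \<bullet> \<eta>) * K n \<xi> x + (\<xi> \<bullet> \<eta>) * ((real n + \<Gamma>) * K n \<xi> x - (\<Sum>v\<in>P. k v * K n \<xi> (reflection v x)))
      + (\<Sum>v\<in>P. k v * ((\<xi> \<bullet> \<eta> - \<xi> \<bullet> reflection v \<eta>) * K n \<xi> (reflection v x)))"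
    if x: "x \<in> Om" for x \<eta>
  proof -
    have "?c * L x \<eta> - (\<Sum>v\<in>P. k v * L (reflection v x) (reflection v \<eta>)) =
       ?c * L x \<eta> - (\<Sum>v\<in>P. k v * dop (\<lambda>x. K (Suc n) \<xi> (reflection v x))
         (\<lambda>x h. DK (Suc n) \<xi> (reflection v x) (reflection v h)) \<eta> x)"
      unfolding L_def by (intro arg_cong2[where f = minus] sum.cong refl) (simp only: dop_reflect)
    also have "\<dots> = dop (\<lambda>x. (\<xi> \<bullet> x) * K n \<xi> x)
        (\<lambda>x h. (\<xi> \<bullet> h) * K n \<xi> x + (\<xi> \<bullet> x) * DK n \<xi> x h) \<eta> x"
      unfolding L_def by (subst dop_linear[symmetric]) (simp only: K_recursion DK_recursion)
    finally show ?thesis using dop_mult_linear[OF x, of \<xi> "K n \<xi>" "DK n \<xi>" \<eta>] IH[OF x] by simp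
  qed
  have M: "?c * M x \<eta> - (\<Sum>v\<in>P. k v * M (reflection v x) (reflection v \<eta>)) =
      (\<xi> \<bullet> \<eta>) * K n \<xi> x + (\<xi> \<bullet> \<eta>) * ((real n + \<Gamma>) * K n \<xi> x - (\<Sum>v\<in>P. k v * K n \<xi> (reflection v x)))
      + (\<Sum>v\<in>P. k v * ((\<xi> \<bullet> \<eta> - \<xi> \<bullet> reflection v \<eta>) * K n \<xi> (reflection v x)))" for x \<eta>
    unfolding M_def by (simp add: algebra_simps sum_subtractf sum_distrib_left)
  define d where "d x \<eta> = L x \<eta> - M x \<eta>" for x \<eta>
  have eq: "?c * d x \<eta> = (\<Sum>v\<in>P. k v * d (reflection v x) (reflection v \<eta>))" if "x \<in> Om" for x \<eta>
    using L[OF that, of \<eta>] M[of x \<eta>] unfolding d_def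
    by (simp only: right_diff_distrib sum_subtractf)
  have "?c * \<bar>d (g x) (g \<eta>)\<bar> \<le> 0 + (\<Sum>v\<in>P. k v * \<bar>d ((reflection v \<circ> g) x) ((reflection v \<circ> g) \<eta>)\<bar>)"
    if "g \<in> G" for g
  proof -
    have "?c * \<bar>d (g x) (g \<eta>)\<bar> = \<bar>?c * d (g x) (g \<eta>)\<bar>"
      using Gamma_nonneg by (simp only: abs_mult)
    also have "\<dots> = \<bar>\<Sum>v\<in>P. k v * d (reflection v (g x)) (reflection v (g \<eta>))\<bar>"
      by (simp only: eq[OF Om_G[OF that x]])
    also have "\<dots> \<le> (\<Sum>v\<in>P. k v * \<bar>d (reflection v (g x)) (reflection v (g \<eta>))\<bar>)"
      by (rule order_trans[OF sum_abs]) (auto simp: abs_mult k_nonneg intro!: sum_mono)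
    finally show ?thesis by simp
  qed
  from orbit_maximum_principle[OF _ this id_in_G] have "d x \<eta> = 0" by simp
  then show ?thesis by (simp add: d_def L_def M_def)
qed

lemma dop_K:
  assumes "x \<in> Om"
  shows "dop (K (Suc n) \<xi>) (DK (Suc n) \<xi>) \<eta> x = (\<xi> \<bullet> \<eta>) * K n \<xi> x"
  using assms
proof (induction n arbitrary: x \<eta>)
  case 0
  show ?case
    by (rule dop_K_step[OF _ 0]) (auto simp: dop_def gamma_index_def)
next
  case (Suc n)
  show ?case
    by (rule dop_K_step[OF _ Suc.prems]) (simp only: K_recursion Suc.IH mult.left_commute)
qed

end

section \<open>Power series in several variables\<close>

definition monom_at :: "real ^ 'n \<Rightarrow> ('n \<Rightarrow> nat) \<Rightarrow> real ^ 'n \<Rightarrow> real" where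
  "monom_at a m x = (\<Prod>i\<in>UNIV. (x $ i - a $ i) ^ m i)"

text \<open>A power series about \<open>a\<close> that converges absolutely on the closed cube of
  half side \<open>\<delta>\<close>, where \<open>B\<close> bounds the weighted sum of the moduli of
  the coefficients. Recording \<open>B\<close> is what permits infinite sums of such series.\<close>

definition pser :: "real ^ 'n \<Rightarrow> real \<Rightarrow> real \<Rightarrow> (real ^ 'n \<Rightarrow> complex) \<Rightarrow> bool" where
  "pser a \<delta> B f \<longleftrightarrow> (\<exists>c. (\<lambda>m. norm (c m) * \<delta> ^ sum m UNIV) summable_on UNIV \<and>
     infsum (\<lambda>m. norm (c m) * \<delta> ^ sum m UNIV) UNIV \<le> B \<and>
     (\<forall>x. (\<forall>i. \<bar>x $ i - a $ i\<bar> \<le> \<delta>) \<longrightarrow>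
       ((\<lambda>m. c m * of_real (monom_at a m x)) has_sum f x) UNIV))"

lemma monom_at_bound:
  assumes "\<forall>i. \<bar>x $ i - a $ i\<bar> \<le> \<delta>"
  shows "\<bar>monom_at a m x\<bar> \<le> \<delta> ^ sum m UNIV"
  unfolding monom_at_def abs_prod power_sum power_abs
  using assms by (intro prod_mono) (auto intro: power_mono)

lemma pser_const:
  assumes "0 \<le> \<delta>"
  shows "pser a \<delta> (norm z) (\<lambda>_. z)"
proof -
  define c where "c m = (if m = (\<lambda>_. 0) then z else 0)" for m :: "'a \<Rightarrow> nat"
  have 1: "((\<lambda>m. norm (c m) * \<delta> ^ sum m UNIV) has_sum norm z) UNIV"
    by (rule has_sum_finite_neutralI[where B = "{\<lambda>_. 0}"]) (auto simp: c_def)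
  have "((\<lambda>m. c m * of_real (monom_at a m x)) has_sum z) UNIV" for x
    by (rule has_sum_finite_neutralI[where B = "{\<lambda>_. 0}"]) (auto simp: c_def monom_at_def)
  then show ?thesis
    unfolding pser_def using 1 by (intro exI[of _ c]) (auto simp: infsumI has_sum_imp_summable)
qed

lemma pser_cmult:
  assumes "pser a \<delta> B f"
  shows "pser a \<delta> (norm z * B) (\<lambda>x. z * f x)"
proof -
  obtain c where c: "(\<lambda>m. norm (c m) * \<delta> ^ sum m UNIV) summable_on UNIV"
    "infsum (\<lambda>m. norm (c m) * \<delta> ^ sum m UNIV) UNIV \<le> B"
    "\<And>x. \<forall>i. \<bar>x $ i - a $ i\<bar> \<le> \<delta> \<Longrightarrow> ((\<lambda>m. c m * of_real (monom_at a m x)) has_sum f x) UNIV"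
    using assms unfolding pser_def by auto
  have "(\<lambda>m. norm (z * c m) * \<delta> ^ sum m UNIV) summable_on UNIV"
    using summable_on_cmult_right[OF c(1), of "norm z"] by (simp add: norm_mult mult.assoc)
  moreover have "infsum (\<lambda>m. norm (z * c m) * \<delta> ^ sum m UNIV) UNIV \<le> norm z * B"
    using c(1,2) by (simp add: norm_mult mult.assoc infsum_cmult_right mult_left_mono)
  moreover have "((\<lambda>m. z * c m * of_real (monom_at a m x)) has_sum z * f x) UNIV"
    if "\<forall>i. \<bar>x $ i - a $ i\<bar> \<le> \<delta>" for x
    using has_sum_cmult_right[OF c(3)[OF that], of z] by (simp add: mult.assoc)
  ultimately show ?thesis unfolding pser_def by (intro exI[of _ "\<lambda>m. z * c m"]) blast
qed

lemma pser_add: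
  assumes "pser a \<delta> B f" "pser a \<delta> B' g" "0 \<le> \<delta>"
  shows "pser a \<delta> (B + B') (\<lambda>x. f x + g x)"
proof -
  obtain c where c: "(\<lambda>m. norm (c m) * \<delta> ^ sum m UNIV) summable_on UNIV"
    "infsum (\<lambda>m. norm (c m) * \<delta> ^ sum m UNIV) UNIV \<le> B"
    "\<And>x. \<forall>i. \<bar>x $ i - a $ i\<bar> \<le> \<delta> \<Longrightarrow> ((\<lambda>m. c m * of_real (monom_at a m x)) has_sum f x) UNIV"
    using assms(1) unfolding pser_def by auto
  obtain d where d: "(\<lambda>m. norm (d m) * \<delta> ^ sum m UNIV) summable_on UNIV"
    "infsum (\<lambda>m. norm (d m) * \<delta> ^ sum m UNIV) UNIV \<le> B'"
    "\<And>x. \<forall>i. \<bar>x $ i - a $ i\<bar> \<le> \<delta> \<Longrightarrow> ((\<lambda>m. d m * of_real (monom_at a m x)) has_sum g x) UNIV"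
    using assms(2) unfolding pser_def by auto
  have le: "norm (c m + d m) * \<delta> ^ sum m UNIV \<le> norm (c m) * \<delta> ^ sum m UNIV + norm (d m) * \<delta> ^ sum m UNIV" for m
    using assms(3) by (simp flip: distrib_right add: mult_right_mono norm_triangle_ineq)
  have cd: "(\<lambda>m. norm (c m) * \<delta> ^ sum m UNIV + norm (d m) * \<delta> ^ sum m UNIV) summable_on UNIV"
    by (rule summable_on_add[OF c(1) d(1)])
  have s: "(\<lambda>m. norm (c m + d m) * \<delta> ^ sum m UNIV) summable_on UNIV"
    by (rule summable_on_comparison_test[OF cd]) (use le assms(3) in auto)
  moreover have "infsum (\<lambda>m. norm (c m + d m) * \<delta> ^ sum m UNIV) UNIV \<le> B + B'"
    using infsum_mono[OF s cd le] infsum_add[OF c(1) d(1)] c(2) d(2) by simp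
  moreover have "((\<lambda>m. (c m + d m) * of_real (monom_at a m x)) has_sum f x + g x) UNIV"
    if "\<forall>i. \<bar>x $ i - a $ i\<bar> \<le> \<delta>" for x
    using has_sum_add[OF c(3)[OF that] d(3)[OF that]] by (simp add: distrib_right)
  ultimately show ?thesis unfolding pser_def by (intro exI[of _ "\<lambda>m. c m + d m"]) blast
qed

lemma pser_sum:
  assumes "finite I" "\<And>i. i \<in> I \<Longrightarrow> pser a \<delta> (B i) (f i)" "0 \<le> \<delta>"
  shows "pser a \<delta> (\<Sum>i\<in>I. B i) (\<lambda>x. \<Sum>i\<in>I. f i x)"
  using assms(1,2)
proof (induction rule: finite_induct)
  case empty
  then show ?case using pser_const[OF assms(3), of a 0] by simp
qed (simp add: pser_add assms(3))

lemma pser_mono: "pser a \<delta> B f \<Longrightarrow> B \<le> B' \<Longrightarrow> pser a \<delta> B' f"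
  unfolding pser_def by (meson order_trans)

text \<open>Multiplication by a coordinate raises one exponent by 1. This shift of multi-indices is
  injective, the indices outside its range get the coefficient 0, and each term gains a factor
  \<open>\<delta>\<close>.\<close>

lemma pser_coord:
  assumes "pser a \<delta> B f" "0 \<le> \<delta>"
  shows "pser a \<delta> (\<delta> * B) (\<lambda>x. of_real (x $ i - a $ i) * f x)"
proof -
  obtain c where c: "(\<lambda>m. norm (c m) * \<delta> ^ sum m UNIV) summable_on UNIV"
    "infsum (\<lambda>m. norm (c m) * \<delta> ^ sum m UNIV) UNIV \<le> B"
    "\<And>x. \<forall>i. \<bar>x $ i - a $ i\<bar> \<le> \<delta> \<Longrightarrow> ((\<lambda>m. c m * of_real (monom_at a m x)) has_sum f x) UNIV"
    using assms unfolding pser_def by auto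
  define s where "s m = m(i := Suc (m i))" for m :: "'a \<Rightarrow> nat"
  define d where "d m = (if m i = 0 then 0 else c (m(i := m i - 1)))" for m
  have inj: "inj s" by (auto simp: inj_def s_def fun_eq_iff split: if_splits)
  have rng: "m \<in> range s" if "m i \<noteq> 0" for m
    using that by (intro range_eqI[of _ _ "m(i := m i - 1)"]) (auto simp: s_def)
  have ds: "d (s m) = c m" for m by (simp add: d_def s_def)
  have ss: "sum (s m) UNIV = Suc (sum m UNIV)" for m
    by (simp add: s_def sum.remove[of UNIV i])
  have ms: "monom_at a (s m) x = (x $ i - a $ i) * monom_at a m x" for m x
    by (simp add: monom_at_def s_def prod.remove[of UNIV i])
  have "((\<lambda>m. norm (d m) * \<delta> ^ sum m UNIV) has_sum
      (\<delta> * infsum (\<lambda>m. norm (c m) * \<delta> ^ sum m UNIV) UNIV)) (range s)"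
    using has_sum_cmult_right[OF has_sum_infsum[OF c(1)], of \<delta>]
    by (subst has_sum_reindex[OF inj]) (simp add: o_def ds ss mult_ac)
  then have 1: "((\<lambda>m. norm (d m) * \<delta> ^ sum m UNIV) has_sum
      (\<delta> * infsum (\<lambda>m. norm (c m) * \<delta> ^ sum m UNIV) UNIV)) UNIV"
    by (subst has_sum_cong_neutral[where T = "range s"]) (use rng in \<open>auto simp: d_def\<close>)
  have 2: "((\<lambda>m. d m * of_real (monom_at a m x)) has_sum of_real (x $ i - a $ i) * f x) UNIV"
    if "\<forall>i. \<bar>x $ i - a $ i\<bar> \<le> \<delta>" for x
  proof -
    have "((\<lambda>m. d m * of_real (monom_at a m x)) has_sum of_real (x $ i - a $ i) * f x) (range s)"
      using has_sum_cmult_right[OF c(3)[OF that], of "of_real (x $ i - a $ i)"]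
      by (subst has_sum_reindex[OF inj]) (simp add: o_def ds ms mult_ac)
    then show ?thesis
      by (subst has_sum_cong_neutral[where T = "range s"]) (use rng in \<open>auto simp: d_def\<close>)
  qed
  show ?thesis unfolding pser_def
    using 1 2 c(2) assms(2)
    by (intro exI[of _ d]) (auto simp: infsumI has_sum_imp_summable mult_left_mono)
qed

text \<open>The linear form is expanded about \<open>a\<close>: the constant collects its value at
  \<open>a\<close> and one factor \<open>\<delta>\<close> for each coordinate.\<close>

lemma pser_linear:
  assumes f: "pser a \<delta> B f" and \<delta>: "0 \<le> \<delta>" and B: "0 \<le> B"
  shows "pser a \<delta> (norm b * (norm a + real CARD('n) * \<delta>) * B)
    (\<lambda>x::real ^ 'n. of_real (b \<bullet> x) * f x)"
proof -
  have "pser a \<delta> (norm (of_real (b \<bullet> a) :: complex) * B + (\<Sum>i\<in>UNIV. norm (of_real (b $ i) :: complex) * (\<delta> * B)))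
     (\<lambda>x. of_real (b \<bullet> a) * f x + (\<Sum>i\<in>UNIV. of_real (b $ i) * (of_real (x $ i - a $ i) * f x)))"
    by (intro pser_add pser_sum pser_cmult pser_coord f \<delta>) auto
  also have "(\<lambda>x. of_real (b \<bullet> a) * f x + (\<Sum>i\<in>UNIV. of_real (b $ i) * (of_real (x $ i - a $ i) * f x))) =
     (\<lambda>x. of_real (b \<bullet> x) * f x)"
  proof
    fix x
    have "b \<bullet> x = b \<bullet> a + (\<Sum>i\<in>UNIV. b $ i * (x $ i - a $ i))"
      unfolding inner_vec_def by (simp add: right_diff_distrib sum_subtractf)
    then show "of_real (b \<bullet> a) * f x + (\<Sum>i\<in>UNIV. of_real (b $ i) * (of_real (x $ i - a $ i) * f x)) =
        of_real (b \<bullet> x) * f x"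
      by (simp add: distrib_right sum_distrib_right mult.assoc)
  qed
  finally show ?thesis
  proof (rule pser_mono)
    have "(\<Sum>i\<in>UNIV. norm (of_real (b $ i) :: complex) * (\<delta> * B)) \<le> (\<Sum>i\<in>(UNIV::'n set). norm b * (\<delta> * B))"
      using \<delta> B by (intro sum_mono mult_right_mono) (auto simp: component_le_norm_cart)
    moreover have "norm (of_real (b \<bullet> a) :: complex) * B \<le> norm b * norm a * B"
      using B Cauchy_Schwarz_ineq2[of b a] by (auto intro: mult_right_mono)
    ultimately show "norm (of_real (b \<bullet> a) :: complex) * B + (\<Sum>i\<in>UNIV. norm (of_real (b $ i) :: complex) * (\<delta> * B)) \<le>
        norm b * (norm a + real CARD('n) * \<delta>) * B"
      by (simp add: algebra_simps)
  qed
qed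

text \<open>The bounds \<open>B n\<close> make the family indexed by \<open>n\<close> and the
  multi-index absolutely summable, so it may be summed in either order: over \<open>n\<close> first
  for the coefficients, over multi-indices first for the values \<open>f n x\<close>.\<close>

lemma pser_suminf:
  assumes f: "\<And>n. pser a \<delta> (B n) (f n)" and \<delta>: "0 < \<delta>" and B: "summable B"
    and F: "\<And>x. (\<lambda>n::nat. f n x) sums F x"
  shows "\<exists>B. pser a \<delta> B F"
proof -
  define A where "A n c \<longleftrightarrow> (\<lambda>m. norm (c m) * \<delta> ^ sum m UNIV) summable_on UNIV \<and>
    infsum (\<lambda>m. norm (c m) * \<delta> ^ sum m UNIV) UNIV \<le> B n \<and>
    (\<forall>x. (\<forall>i. \<bar>x $ i - a $ i\<bar> \<le> \<delta>) \<longrightarrow> ((\<lambda>m. c m * of_real (monom_at a m x)) has_sum f n x) UNIV)"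
    for n c
  have "\<exists>c. A n c" for n
    using f[of n] unfolding pser_def A_def .
  then obtain c where "\<And>n. A n (c n)" by metis
  then have c: "\<And>n. (\<lambda>m. norm (c n m) * \<delta> ^ sum m UNIV) summable_on UNIV"
    "\<And>n. infsum (\<lambda>m. norm (c n m) * \<delta> ^ sum m UNIV) UNIV \<le> B n"
    "\<And>n x. \<forall>i. \<bar>x $ i - a $ i\<bar> \<le> \<delta> \<Longrightarrow> ((\<lambda>m. c n m * of_real (monom_at a m x)) has_sum f n x) UNIV"
    unfolding A_def by simp_all
  have nn: "0 \<le> infsum (\<lambda>m. norm (c n m) * \<delta> ^ sum m UNIV) UNIV" for n
    using \<delta> by (intro infsum_nonneg) auto
  have B0: "0 \<le> B n" for n using nn[of n] c(2)[of n] by linarith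
  have Bs: "B summable_on UNIV" using B B0 by (simp add: summable_nonneg_imp_summable_on)
  have tot: "(\<lambda>(n, m). norm (c n m) * \<delta> ^ sum m UNIV) summable_on UNIV \<times> UNIV"
  proof (rule summable_on_SigmaI)
    show "((\<lambda>m. case (n, m) of (n, m) \<Rightarrow> norm (c n m) * \<delta> ^ sum m UNIV) has_sum
        infsum (\<lambda>m. norm (c n m) * \<delta> ^ sum m UNIV) UNIV) UNIV" for n
      using c(1) by simp
    show "(\<lambda>n. infsum (\<lambda>m. norm (c n m) * \<delta> ^ sum m UNIV) UNIV) summable_on UNIV"
      by (rule summable_on_comparison_test[OF Bs]) (use c(2) nn in auto)
  qed (use \<delta> in auto)
  have tot': "(\<lambda>(m, n). norm (c n m) * \<delta> ^ sum m UNIV) summable_on UNIV \<times> UNIV"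
    using tot by (subst (asm) summable_on_swap) (simp only: case_prod_unfold fst_conv snd_conv)
  have row: "(\<lambda>n. norm (c n m) * \<delta> ^ sum m UNIV) summable_on UNIV" for m
    using summable_on_SigmaD1[of "\<lambda>m n. norm (c n m) * \<delta> ^ sum m UNIV" UNIV "\<lambda>_. UNIV" m] tot' by simp
  have crow: "(\<lambda>n. norm (c n m)) summable_on UNIV" for m
    using row[of m] \<delta> summable_on_cmult_left'[of "\<delta> ^ sum m UNIV" "\<lambda>n. norm (c n m)" UNIV] by simp
  define C where "C m = infsum (\<lambda>n. c n m) UNIV" for m
  have "(\<lambda>m. infsum (\<lambda>n. norm (c n m) * \<delta> ^ sum m UNIV) UNIV) summable_on UNIV"
    using summable_on_Sigma_banach[OF tot'] by simp
  moreover have "norm (C m) * \<delta> ^ sum m UNIV \<le> infsum (\<lambda>n. norm (c n m) * \<delta> ^ sum m UNIV) UNIV" for m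
  proof -
    have "norm (C m) \<le> infsum (\<lambda>n. norm (c n m)) UNIV"
      unfolding C_def by (rule norm_infsum_bound[OF crow])
    then show ?thesis using \<delta> by (simp add: infsum_cmult_left' mult_right_mono)
  qed
  moreover have "0 \<le> norm (C m) * \<delta> ^ sum m UNIV" for m
    using \<delta> by simp
  ultimately have Cs: "(\<lambda>m. norm (C m) * \<delta> ^ sum m UNIV) summable_on UNIV"
    by (rule summable_on_comparison_test)
  have "((\<lambda>m. C m * of_real (monom_at a m x)) has_sum F x) UNIV" if x: "\<forall>i. \<bar>x $ i - a $ i\<bar> \<le> \<delta>" for x
  proof -
    let ?t = "\<lambda>(n, m). c n m * of_real (monom_at a m x)"
    have "(\<lambda>p. norm (?t p)) summable_on UNIV \<times> UNIV"
      by (rule summable_on_comparison_test[OF tot])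
         (auto simp: norm_mult intro!: mult_left_mono monom_at_bound x)
    then have "?t summable_on UNIV \<times> UNIV" by (rule abs_summable_summable)
    then obtain S where S: "(?t has_sum S) (UNIV \<times> UNIV)" by (auto simp: summable_on_def)
    have "((\<lambda>n. f n x) has_sum S) UNIV"
      by (rule has_sum_SigmaD[OF S]) (use c(3)[OF x] in simp)
    then have FS: "S = F x" using has_sum_imp_sums F sums_unique2 by blast
    have S': "((\<lambda>(m, n). c n m * of_real (monom_at a m x)) has_sum S) (UNIV \<times> UNIV)"
      using S by (subst (asm) has_sum_swap) (simp only: case_prod_unfold fst_conv snd_conv)
    have "((\<lambda>n. c n m * of_real (monom_at a m x)) has_sum C m * of_real (monom_at a m x)) UNIV" for m
      unfolding C_def by (rule has_sum_cmult_left[OF has_sum_infsum[OF abs_summable_summable[OF crow]]])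
    then have "((\<lambda>m. C m * of_real (monom_at a m x)) has_sum S) UNIV"
      by (intro has_sum_SigmaD[OF S']) simp
    then show ?thesis by (simp only: FS)
  qed
  with Cs show ?thesis unfolding pser_def
    by (intro exI[of _ "infsum (\<lambda>m. norm (C m) * \<delta> ^ sum m UNIV) UNIV"] exI[of _ C] conjI allI impI order_refl)
qed

lemma real_analyticI:
  assumes "\<And>a. \<exists>\<delta>>0. \<exists>B. pser a \<delta> B f"
  shows "real_analytic f"
  unfolding real_analytic_def
proof
  fix a
  obtain \<delta> B where \<delta>: "\<delta> > 0" "pser a \<delta> B f" using assms by blast
  then obtain c where c: "\<And>x. \<forall>i. \<bar>x $ i - a $ i\<bar> \<le> \<delta> \<Longrightarrow> ((\<lambda>m. c m * of_real (monom_at a m x)) has_sum f x) UNIV"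
    unfolding pser_def by auto
  have "\<bar>x $ i - a $ i\<bar> \<le> \<delta>" if "x \<in> ball a \<delta>" for x i
    using component_le_norm_cart[of "x - a" i] that by (auto simp: dist_norm norm_minus_commute)
  then show "\<exists>e>0. \<exists>c. \<forall>x\<in>ball a e. ((\<lambda>m. c m * of_real (\<Prod>i\<in>UNIV. (x $ i - a $ i) ^ m i)) has_sum f x) UNIV"
    using \<delta>(1) c unfolding monom_at_def by (intro exI[of _ \<delta>] conjI exI[of _ c] ballI) blast+
qed

text \<open>Absolute convergence at one corner \<open>p\<close> of a small cube dominates the series
  near \<open>a\<close>. A monomial of degree at least 2 is at \<open>x\<close> at most
  \<open>(norm (x - a) / \<delta>)\<^sup>2\<close> times its value at \<open>p\<close>, so the
  remainder after the linear part is quadratic.\<close>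

lemma real_analytic_differentiable:
  assumes "real_analytic f"
  shows "f differentiable (at a)"
proof -
  obtain e c where e: "e > 0" and c: "\<And>x. x \<in> ball a e \<Longrightarrow>
      ((\<lambda>m. c m * of_real (monom_at a m x)) has_sum f x) UNIV"
  proof -
    from assms have "\<exists>e>0. \<exists>c. \<forall>x\<in>ball a e.
        ((\<lambda>m. c m * of_real (\<Prod>i\<in>UNIV. (x $ i - a $ i) ^ m i)) has_sum f x) UNIV"
      unfolding real_analytic_def by (rule spec)
    then show thesis using that unfolding monom_at_def by (elim exE conjE) blast
  qed
  \<comment> \<open>Division by the dimension keeps the corner \<open>p\<close> of the cube within
    distance \<open>e / 2\<close> of \<open>a\<close>, hence inside the ball.\<close>
  define \<delta> where "\<delta> = e / (2 * real CARD('a))"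
  have \<delta>: "\<delta> > 0" using e by (simp add: \<delta>_def)
  define u where "u i = (\<lambda>j. if j = i then 1 else (0::nat))" for i :: 'a
  have inj_u: "inj u"
  proof (rule injI)
    fix i j assume "u i = u j"
    then have "u i i = u j i" by simp
    then show "i = j" by (simp add: u_def split: if_splits)
  qed
  define D where "D h = (\<Sum>i\<in>UNIV. c (u i) * of_real (h $ i))" for h
  have D: "bounded_linear D"
    unfolding D_def
    by (intro bounded_linear_sum bounded_linear_mult_const bounded_linear_const_mult
        bounded_linear_compose[OF bounded_linear_of_real] bounded_linear_vec_nth)
  define p where "p = a + \<delta> *\<^sub>R (\<chi> i. 1)"
  have "norm (\<delta> *\<^sub>R (\<chi> i. 1) :: real ^ 'a) \<le> \<delta> * real CARD('a)"
    using norm_le_l1_cart[of "(\<chi> i. 1) :: real ^ 'a"] \<delta> by (simp add: mult_left_mono)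
  also have "\<dots> < e" using e by (simp add: \<delta>_def)
  finally have p: "p \<in> ball a e" by (simp add: p_def dist_norm del: norm_scaleR)
  have mp: "monom_at a m p = \<delta> ^ sum m UNIV" for m
    by (simp add: monom_at_def p_def power_sum)
  have abs: "(\<lambda>m. norm (c m * of_real (monom_at a m p))) summable_on UNIV"
    by (rule summable_on_iff_abs_summable_on_complex[THEN iffD1]) (rule has_sum_imp_summable[OF c[OF p]])
  define S where "S = infsum (\<lambda>m. norm (c m * of_real (monom_at a m p))) UNIV"
  \<comment> \<open>The multi-indices of degree at most 1.\<close>
  define T where "T = insert (\<lambda>_. 0) (range u)"
  have fT: "finite T" by (simp add: T_def)
  have not_T: "2 \<le> sum m UNIV" if "m \<notin> T" for m
  proof (rule ccontr)
    assume "\<not> 2 \<le> sum m UNIV"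
    then consider "sum m UNIV = 0" | "sum m UNIV = 1" by linarith
    then show False
    proof cases
      case 1
      then have "m = (\<lambda>_. 0)" by auto
      then show ?thesis using that by (simp add: T_def)
    next
      case 2
      then obtain i where i: "m i = 1" "\<forall>j\<in>UNIV. i \<noteq> j \<longrightarrow> m j = 0"
        using sum_eq_1_iff[of UNIV m] by auto
      then have "m = u i" by (auto simp: u_def)
      then show ?thesis using that by (simp add: T_def)
    qed
  qed
  have rem: "norm (f x - f a - D (x - a)) \<le> S / \<delta>\<^sup>2 * (norm (x - a))\<^sup>2"
    if x: "norm (x - a) < \<delta>" for x
  proof -
    have "1 \<le> 2 * real CARD('a)" using one_le_card_finite[where 'a = 'a] by linarith
    then have "e * 1 \<le> e * (2 * real CARD('a))" using e by (intro mult_left_mono) auto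
    then have "\<delta> \<le> e" by (simp add: \<delta>_def divide_le_eq)
    then have xb: "x \<in> ball a e" using x by (simp add: dist_norm norm_minus_commute)
    have hT: "(\<Sum>m\<in>T. c m * of_real (monom_at a m x)) = f a + D (x - a)"
    proof -
      have "((\<lambda>m. c m * of_real (monom_at a m a)) has_sum c (\<lambda>_. 0)) UNIV"
        by (rule has_sum_finite_neutralI[where B = "{\<lambda>_. 0}"])
           (auto simp: monom_at_def prod_zero_iff power_0_left)
      then have fa: "f a = c (\<lambda>_. 0)" using c[of a] e has_sum_unique by force
      have mu: "monom_at a (u i) x = x $ i - a $ i" for i
        unfolding monom_at_def u_def by (subst prod.remove[of _ i]) auto
      have "(\<lambda>_. 0) \<noteq> u i" for i using fun_cong[of "\<lambda>_. 0" "u i" i] by (auto simp: u_def)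
      then have "(\<lambda>_. 0) \<notin> range u" by auto
      then have "(\<Sum>m\<in>T. c m * of_real (monom_at a m x)) =
          c (\<lambda>_. 0) * of_real (monom_at a (\<lambda>_. 0) x) + (\<Sum>m\<in>range u. c m * of_real (monom_at a m x))"
        unfolding T_def by (subst sum.insert) auto
      also have "(\<Sum>m\<in>range u. c m * of_real (monom_at a m x)) = D (x - a)"
        unfolding D_def by (subst sum.reindex[OF inj_u]) (simp add: mu)
      finally show ?thesis using fa by (simp add: monom_at_def)
    qed
    have "((\<lambda>m. c m * of_real (monom_at a m x)) has_sum f x - (f a + D (x - a))) (UNIV - T)"
      unfolding hT[symmetric] by (intro has_sum_Diff c xb has_sum_finite fT) auto
    then have eq: "f x - (f a + D (x - a)) = infsum (\<lambda>m. c m * of_real (monom_at a m x)) (UNIV - T)"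
      by (simp add: infsumI)
    define q where "q = (norm (x - a) / \<delta>)\<^sup>2"
    have le: "norm (c m * of_real (monom_at a m x)) \<le> q * norm (c m * of_real (monom_at a m p))"
      if "m \<in> UNIV - T" for m
    proof -
      define r where "r = norm (x - a) / \<delta>"
      have r: "0 \<le> r" "r \<le> 1" "norm (x - a) = r * \<delta>" using x \<delta> by (auto simp: r_def)
      have "\<bar>monom_at a m x\<bar> \<le> norm (x - a) ^ sum m UNIV"
        by (rule monom_at_bound, rule allI) (use component_le_norm_cart[of "x - a"] in simp)
      also have "\<dots> = r ^ sum m UNIV * \<delta> ^ sum m UNIV" by (simp add: r power_mult_distrib)
      also have "r ^ sum m UNIV \<le> r\<^sup>2" using r not_T[of m] that by (intro power_decreasing) auto
      finally have "\<bar>monom_at a m x\<bar> \<le> q * \<bar>monom_at a m p\<bar>"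
        using \<delta> by (simp add: mp q_def r_def mult_right_mono)
      then have "norm (c m) * \<bar>monom_at a m x\<bar> \<le> norm (c m) * (q * \<bar>monom_at a m p\<bar>)"
        by (rule mult_left_mono) simp
      then show ?thesis by (simp add: norm_mult mult_ac)
    qed
    have abs': "(\<lambda>m. q * norm (c m * of_real (monom_at a m p))) summable_on (UNIV - T)"
      by (intro summable_on_cmult_right summable_on_subset_banach[OF abs]) auto
    then have abs'': "(\<lambda>m. norm (c m * of_real (monom_at a m x))) summable_on (UNIV - T)"
      by (rule summable_on_comparison_test) (use le in auto)
    have "norm (f x - (f a + D (x - a))) \<le> infsum (\<lambda>m. norm (c m * of_real (monom_at a m x))) (UNIV - T)"
      unfolding eq by (rule norm_infsum_bound[OF abs''])
    also have "\<dots> \<le> infsum (\<lambda>m. q * norm (c m * of_real (monom_at a m p))) (UNIV - T)"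
      by (rule infsum_mono[OF abs'' abs' le])
    also have "\<dots> \<le> infsum (\<lambda>m. q * norm (c m * of_real (monom_at a m p))) UNIV"
      by (rule infsum_mono2[OF abs' summable_on_cmult_right[OF abs]]) (auto simp: q_def)
    also have "\<dots> = q * S" using abs by (simp add: S_def infsum_cmult_right)
    finally show ?thesis by (simp add: q_def power_divide diff_diff_eq mult.commute)
  qed
  have "(f has_derivative D) (at a)"
  proof (rule has_derivativeI_sandwich[OF \<delta> D, where H = "\<lambda>x. S / \<delta>\<^sup>2 * norm (x - a)"])
    show "((\<lambda>x. S / \<delta>\<^sup>2 * norm (x - a)) \<longlongrightarrow> 0) (at a)"
      using \<delta> by (auto intro!: tendsto_eq_intros)
    fix y assume "y \<noteq> a" "dist y a < \<delta>"
    then show "norm (f y - f a - D (y - a)) / norm (y - a) \<le> S / \<delta>\<^sup>2 * norm (y - a)"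
      using rem[of y] by (simp add: dist_norm divide_le_eq power2_eq_square)
  qed
  then show ?thesis by (auto simp: differentiable_def)
qed

section \<open>The Dunkl kernel\<close>

lemma continuous_on_UNIV_ballI:
  fixes f :: "'b::real_normed_vector \<Rightarrow> 'c::topological_space"
  assumes "\<And>r. r > 0 \<Longrightarrow> continuous_on (ball 0 r) f"
  shows "continuous_on UNIV f"
  unfolding continuous_on_eq_continuous_at[OF open_UNIV]
proof
  fix x :: 'b
  have "x \<in> ball 0 (norm x + 1)" by simp
  then show "isCont f x"
    using assms[of "norm x + 1"] continuous_on_eq_continuous_at[OF open_ball]
    by (metis add_nonneg_pos norm_ge_zero zero_less_one)
qed

context dunkl_setting
begin

text \<open>The kernel at the complex vector \<open>cvec c \<xi>\<close>. Only complex multiples of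
  real vectors occur as arguments, so the scalar is kept apart and enters the part of degree
  \<open>n\<close> as \<open>c ^ n\<close>; the components \<open>K\<close> stay real.\<close>

definition E :: "complex \<Rightarrow> real ^ 'n \<Rightarrow> real ^ 'n \<Rightarrow> complex" where
  "E c \<xi> x = (\<Sum>n. c ^ n * of_real (K n \<xi> x))"

definition DE :: "complex \<Rightarrow> real ^ 'n \<Rightarrow> real ^ 'n \<Rightarrow> real ^ 'n \<Rightarrow> complex" where
  "DE c \<xi> x h = (\<Sum>n. c ^ n * of_real (DK n \<xi> x h))"

lemma E_term_bound: "norm ((c::complex) ^ n * of_real (K n \<xi> x)) \<le> (norm c * norm \<xi> * norm x) ^ n /\<^sub>R fact n"
  using mult_left_mono[OF K_bound[of n \<xi> x], of "norm c ^ n"]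
  by (simp add: norm_mult norm_power power_mult_distrib field_simps)

lemma E_summable_norm: "summable (\<lambda>n. norm ((c::complex) ^ n * of_real (K n \<xi> x)))"
  by (rule summable_comparison_test'[OF summable_exp_generic[of "norm c * norm \<xi> * norm x"], of 0])
     (use E_term_bound in simp)

lemma E_sums: "(\<lambda>n. c ^ n * of_real (K n \<xi> x)) sums E c \<xi> x"
  unfolding E_def by (rule summable_sums[OF summable_norm_cancel[OF E_summable_norm]])

lemma norm_E_le: "norm (E c \<xi> x) \<le> exp (norm c * norm \<xi> * norm x)"
proof -
  have "norm (E c \<xi> x) \<le> (\<Sum>n. norm (c ^ n * of_real (K n \<xi> x)))"
    unfolding E_def by (rule summable_norm[OF E_summable_norm])
  also have "\<dots> \<le> exp (norm c * norm \<xi> * norm x)"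
    unfolding exp_def by (rule suminf_le[OF E_term_bound E_summable_norm summable_exp_generic])
  finally show ?thesis .
qed

lemma DE_term_bound:
  "norm ((c::complex) ^ n * of_real (DK n \<xi> x h)) \<le>
    norm h * (norm c ^ n * (real n * norm \<xi> * (norm \<xi> * norm x) ^ (n - 1) / fact n))"
  using mult_left_mono[OF DK_bound[of n \<xi> x h], of "norm c ^ n"]
  by (simp add: norm_mult norm_power mult_ac)

text \<open>The series of \<open>exp (a * b * r)\<close> differentiated termwise in
  \<open>r\<close>; the term \<open>n = 0\<close> vanishes.\<close>

lemma DE_majorant_sums:
  fixes a b r :: real
  shows "(\<lambda>n. a ^ n * (real n * b * (b * r) ^ (n - 1) / fact n)) sums (a * b * exp (a * b * r))"
proof -
  have "(\<lambda>n. (a * b) * ((a * b * r) ^ n /\<^sub>R fact n)) sums (a * b * exp (a * b * r))"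
    by (intro sums_mult exp_converges)
  moreover have "a ^ Suc n * (real (Suc n) * b * (b * r) ^ (Suc n - 1) / fact (Suc n)) =
      (a * b) * ((a * b * r) ^ n /\<^sub>R fact n)" for n
    by (simp add: power_mult_distrib divide_simps)
  ultimately have "(\<lambda>n. a ^ Suc n * (real (Suc n) * b * (b * r) ^ (Suc n - 1) / fact (Suc n))) sums
      (a * b * exp (a * b * r))" by (simp only:)
  from sums_Suc[OF this] show ?thesis by simp
qed

lemma DE_summable_norm: "summable (\<lambda>n. norm ((c::complex) ^ n * of_real (DK n \<xi> x h)))"
  by (rule summable_comparison_test'[OF summable_mult[OF sums_summable[OF DE_majorant_sums]], of 0])
     (use DE_term_bound[of c _ \<xi> x h] in simp)

lemma DE_sums: "(\<lambda>n. c ^ n * of_real (DK n \<xi> x h)) sums DE c \<xi> x h"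
  unfolding DE_def by (rule summable_sums[OF summable_norm_cancel[OF DE_summable_norm]])

lemma norm_DE_le: "norm (DE c \<xi> x h) \<le> norm c * norm \<xi> * exp (norm c * norm \<xi> * norm x) * norm h"
proof -
  have "norm (DE c \<xi> x h) \<le> (\<Sum>n. norm (c ^ n * of_real (DK n \<xi> x h)))"
    unfolding DE_def by (rule summable_norm[OF DE_summable_norm])
  also have "\<dots> \<le> norm h * (norm c * norm \<xi> * exp (norm c * norm \<xi> * norm x))"
    unfolding sums_unique[OF sums_mult[OF DE_majorant_sums]]
    by (rule suminf_le[OF DE_term_bound DE_summable_norm sums_summable[OF sums_mult[OF DE_majorant_sums]]])
  finally show ?thesis by (simp add: mult_ac)
qed

lemma E_has_derivative: "(E c \<xi> has_derivative DE c \<xi> x) (at x)"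
proof -
  define r where "r = norm x + 1"
  let ?S = "ball (0 :: real ^ 'n) r"
  define b where "b n = norm c ^ n * (real n * norm \<xi> * (norm \<xi> * r) ^ (n - 1) / fact n)" for n
  have b: "summable b" unfolding b_def by (rule sums_summable[OF DE_majorant_sums])
  have b0: "0 \<le> b n" for n by (simp add: b_def r_def)
  have tb: "norm (c ^ n * of_real (DK n \<xi> y h)) \<le> norm h * b n" if "y \<in> ?S" for n y h
    using that unfolding b_def
    by (intro order_trans[OF DE_term_bound] mult_left_mono divide_right_mono power_mono) auto
  have "\<exists>g. \<forall>x\<in>?S. (\<lambda>n. c ^ n * of_real (K n \<xi> x)) sums g x \<and> (g has_derivative DE c \<xi> x) (at x within ?S)"
  proof (rule has_derivative_series)
    show "convex ?S" by simp
    show "((\<lambda>x. c ^ n * of_real (K n \<xi> x)) has_derivative (\<lambda>h. c ^ n * of_real (DK n \<xi> x h))) (at x within ?S)" for n x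
      by (intro has_derivative_mult_right has_derivative_of_real has_derivative_at_withinI[OF K_has_derivative])
    show "x \<in> ?S" by (simp add: r_def)
    show "(\<lambda>n. c ^ n * of_real (K n \<xi> x)) sums E c \<xi> x" by (rule E_sums)
    fix e :: real assume "e > 0"
    \<comment> \<open>The tail of the majorant \<open>b\<close> bounds the error of the partial sums
      of derivatives uniformly on the ball and linearly in \<open>h\<close>.\<close>
    from suminf_exist_split[OF this b] obtain N where N: "\<And>n. n \<ge> N \<Longrightarrow> norm (\<Sum>i. b (i + n)) < e" by auto
    have "norm ((\<Sum>i<n. c ^ i * of_real (DK i \<xi> y h)) - DE c \<xi> y h) \<le> e * norm h"
      if n: "n \<ge> N" and y: "y \<in> ?S" for n y h
    proof -
      have "DE c \<xi> y h = (\<Sum>i. c ^ (i + n) * of_real (DK (i + n) \<xi> y h)) + (\<Sum>i<n. c ^ i * of_real (DK i \<xi> y h))"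
        unfolding DE_def by (rule suminf_split_initial_segment[OF sums_summable[OF DE_sums]])
      then have "norm ((\<Sum>i<n. c ^ i * of_real (DK i \<xi> y h)) - DE c \<xi> y h) =
          norm (\<Sum>i. c ^ (i + n) * of_real (DK (i + n) \<xi> y h))"
        by (simp add: norm_minus_commute)
      also have "\<dots> \<le> (\<Sum>i. norm (c ^ (i + n) * of_real (DK (i + n) \<xi> y h)))"
        by (rule summable_norm) (rule summable_ignore_initial_segment[OF DE_summable_norm])
      also have "\<dots> \<le> (\<Sum>i. norm h * b (i + n))"
        by (rule suminf_le[OF tb[OF y] summable_ignore_initial_segment[OF DE_summable_norm]])
           (intro summable_mult summable_ignore_initial_segment b)
      also have "\<dots> = norm h * (\<Sum>i. b (i + n))"
        by (intro suminf_mult summable_ignore_initial_segment b)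
      also have "\<dots> \<le> norm h * e"
        using N[OF n] by (intro mult_left_mono) auto
      finally show ?thesis by (simp add: mult.commute)
    qed
    then show "\<forall>\<^sub>F n in sequentially. \<forall>x\<in>?S. \<forall>h. norm ((\<Sum>i<n. c ^ i * of_real (DK i \<xi> x h)) - DE c \<xi> x h) \<le> e * norm h"
      unfolding eventually_sequentially by blast
  qed
  then obtain g where g: "\<And>y. y \<in> ?S \<Longrightarrow> (\<lambda>n. c ^ n * of_real (K n \<xi> y)) sums g y"
    "\<And>y. y \<in> ?S \<Longrightarrow> (g has_derivative DE c \<xi> y) (at y within ?S)" by blast
  have x: "x \<in> ?S" by (simp add: r_def)
  have "(g has_derivative DE c \<xi> x) (at x)"
    using g(2)[OF x] at_within_open[OF x open_ball] by simp
  moreover have "g y = E c \<xi> y" if "y \<in> ?S" for y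
    using g(1)[OF that] E_sums sums_unique2 by blast
  ultimately show ?thesis
    using has_derivative_transform_within_open[OF _ open_ball x] by blast
qed

lemma K_zero: "K (Suc n) \<xi> 0 = 0"
  using K_bound[of "Suc n" \<xi> 0] by simp

lemma E_zero [simp]: "E c \<xi> 0 = 1"
proof -
  have "E c \<xi> 0 = (\<Sum>n\<in>{0}. c ^ n * of_real (K n \<xi> 0))"
    unfolding E_def by (rule suminf_finite) (auto simp: gr0_conv_Suc K_zero simp del: K.simps(2))
  then show ?thesis by simp
qed

lemma E_commute: "E c \<xi> x = E c x \<xi>"
  unfolding E_def by (simp only: K_commute[of _ \<xi> x])

lemma E_zero_left [simp]: "E c 0 x = 1"
  by (simp add: E_commute[of c 0])

lemma E_cnj: "cnj (E c \<xi> x) = E (cnj c) \<xi> x"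
proof -
  have "(\<lambda>n. cnj (c ^ n * of_real (K n \<xi> x))) sums cnj (E c \<xi> x)"
    by (rule sums_cnj[THEN iffD2, OF E_sums])
  then have "(\<lambda>n. cnj c ^ n * of_real (K n \<xi> x)) sums cnj (E c \<xi> x)" by simp
  then show ?thesis using E_sums sums_unique2 by blast
qed

text \<open>Summation of \<open>K_recursion\<close> over all degrees, with Euler's identity for the
  derivative. No division by \<open>v \<bullet> x\<close> occurs, so in contrast to
  \<open>dop_E\<close> the identity holds on the hyperplanes too.\<close>

lemma E_radial:
  "DE c \<xi> x x + (\<Sum>v\<in>P. of_real (k v) * (E c \<xi> x - E c \<xi> (reflection v x))) =
    c * of_real (\<xi> \<bullet> x) * E c \<xi> x"
proof -
  have "(\<lambda>n. c ^ n * of_real (DK n \<xi> x x) +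
     (\<Sum>v\<in>P. of_real (k v) * (c ^ n * of_real (K n \<xi> x) - c ^ n * of_real (K n \<xi> (reflection v x))))) sums
     (DE c \<xi> x x + (\<Sum>v\<in>P. of_real (k v) * (E c \<xi> x - E c \<xi> (reflection v x))))"
    by (intro sums_add sums_sum sums_mult sums_diff DE_sums E_sums)
  moreover have "c ^ n * of_real (DK n \<xi> x x) +
     (\<Sum>v\<in>P. of_real (k v) * (c ^ n * of_real (K n \<xi> x) - c ^ n * of_real (K n \<xi> (reflection v x)))) =
     c ^ n * of_real ((real n + \<Gamma>) * K n \<xi> x - (\<Sum>v\<in>P. k v * K n \<xi> (reflection v x)))" for n
    by (simp add: DK_self gamma_index_def algebra_simps sum_subtractf sum_distrib_left sum_distrib_right)
  ultimately have "(\<lambda>n. c ^ n * of_real ((real n + \<Gamma>) * K n \<xi> x - (\<Sum>v\<in>P. k v * K n \<xi> (reflection v x)))) sums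
     (DE c \<xi> x x + (\<Sum>v\<in>P. of_real (k v) * (E c \<xi> x - E c \<xi> (reflection v x))))" by (simp only:)
  moreover have "(\<lambda>n. c ^ n * of_real ((real n + \<Gamma>) * K n \<xi> x - (\<Sum>v\<in>P. k v * K n \<xi> (reflection v x)))) sums
     (c * of_real (\<xi> \<bullet> x) * E c \<xi> x)"
  proof -
    have "(\<lambda>n. c * of_real (\<xi> \<bullet> x) * (c ^ n * of_real (K n \<xi> x))) sums (c * of_real (\<xi> \<bullet> x) * E c \<xi> x)"
      by (intro sums_mult E_sums)
    then have "(\<lambda>n. c ^ Suc n * of_real ((real (Suc n) + \<Gamma>) * K (Suc n) \<xi> x - (\<Sum>v\<in>P. k v * K (Suc n) \<xi> (reflection v x)))) sums
     (c * of_real (\<xi> \<bullet> x) * E c \<xi> x)"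
      unfolding K_recursion by (simp add: mult_ac)
    \<comment> \<open>The term of degree 0 that the shift adds is 0: there \<open>K\<close> is 1,
      and \<open>\<Gamma>\<close> is the sum of the \<open>k v\<close>.\<close>
    from sums_Suc[OF this] show ?thesis by (simp add: gamma_index_def)
  qed
  ultimately show ?thesis by (rule sums_unique2)
qed

lemma dop_E:
  assumes "x \<in> Om"
  shows "dop (E c \<xi>) (DE c \<xi>) \<eta> x = c * of_real (\<xi> \<bullet> \<eta>) * E c \<xi> x"
proof -
  have "(\<lambda>n. c ^ n * of_real (DK n \<xi> x \<eta>) + (\<Sum>v\<in>P. k v *\<^sub>R ((v \<bullet> \<eta> / (v \<bullet> x)) *\<^sub>R
     (c ^ n * of_real (K n \<xi> x) - c ^ n * of_real (K n \<xi> (reflection v x)))))) sums dop (E c \<xi>) (DE c \<xi>) \<eta> x"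
    unfolding dop_def by (intro sums_add sums_sum sums_scaleR_right sums_diff DE_sums E_sums)
  moreover have "c ^ n * of_real (DK n \<xi> x \<eta>) + (\<Sum>v\<in>P. k v *\<^sub>R ((v \<bullet> \<eta> / (v \<bullet> x)) *\<^sub>R
     (c ^ n * of_real (K n \<xi> x) - c ^ n * of_real (K n \<xi> (reflection v x))))) =
     c ^ n * of_real (dop (K n \<xi>) (DK n \<xi>) \<eta> x)" for n
    unfolding dop_def
    by (simp add: distrib_left sum_distrib_left scaleR_conv_of_real right_diff_distrib mult.left_commute[of "c ^ n"])
  ultimately have 1: "(\<lambda>n. c ^ n * of_real (dop (K n \<xi>) (DK n \<xi>) \<eta> x)) sums dop (E c \<xi>) (DE c \<xi>) \<eta> x"
    by (simp only:)
  have "(\<lambda>n. c * of_real (\<xi> \<bullet> \<eta>) * (c ^ n * of_real (K n \<xi> x))) sums (c * of_real (\<xi> \<bullet> \<eta>) * E c \<xi> x)"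
    by (intro sums_mult E_sums)
  then have "(\<lambda>n. c ^ Suc n * of_real (dop (K (Suc n) \<xi>) (DK (Suc n) \<xi>) \<eta> x)) sums (c * of_real (\<xi> \<bullet> \<eta>) * E c \<xi> x)"
    unfolding dop_K[OF assms] by (simp add: mult_ac)
  from sums_Suc[OF this] have "(\<lambda>n. c ^ n * of_real (dop (K n \<xi>) (DK n \<xi>) \<eta> x)) sums (c * of_real (\<xi> \<bullet> \<eta>) * E c \<xi> x)"
    by (simp add: dop_def)
  with 1 show ?thesis by (rule sums_unique2)
qed

lemma continuous_on_G: "g \<in> G \<Longrightarrow> continuous_on S f \<Longrightarrow> continuous_on S (\<lambda>x. g (f x))"
  by (rule bounded_linear.continuous_on[OF G_bounded_linear])

lemma continuous_on_K:
  "continuous_on S f \<Longrightarrow> continuous_on S h \<Longrightarrow> continuous_on S (\<lambda>p. K n (f p) (h p))"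
proof (induction n arbitrary: h)
  case (Suc n)
  show ?case unfolding K.simps
    by (intro continuous_on_sum continuous_on_mult continuous_on_inner continuous_on_const
        Suc.IH Suc.prems continuous_on_G[OF _ Suc.prems(2)])
qed simp

lemma continuous_on_DK:
  "continuous_on S h \<Longrightarrow> continuous_on S (\<lambda>p. DK n \<xi> (h p) \<eta>)"
proof (induction n arbitrary: h \<eta>)
  case (Suc n)
  show ?case unfolding DK.simps
    by (intro continuous_on_sum continuous_on_add continuous_on_mult continuous_on_inner continuous_on_const
        continuous_on_K Suc.IH continuous_on_G[OF _ Suc.prems])
qed simp

lemma continuous_on_E_pair: "continuous_on UNIV (\<lambda>p. E c (fst p) (snd p))"
proof (rule continuous_on_UNIV_ballI)
  fix r :: real assume r: "r > 0"
  let ?S = "ball (0 :: (real ^ 'n) \<times> (real ^ 'n)) r"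
  have ul: "uniform_limit ?S (\<lambda>N p. \<Sum>n<N. c ^ n * of_real (K n (fst p) (snd p)))
      (\<lambda>p. E c (fst p) (snd p)) sequentially"
    unfolding E_def
  proof (rule Weierstrass_m_test)
    show "summable (\<lambda>n. (norm c * r * r) ^ n /\<^sub>R fact n)" by (rule summable_exp_generic)
    fix n and p :: "(real ^ 'n) \<times> (real ^ 'n)" assume "p \<in> ?S"
    then have "norm (fst p) \<le> r" "norm (snd p) \<le> r"
      using norm_fst_le[of "fst p" "snd p"] norm_snd_le[of "snd p" "fst p"] by auto
    then show "norm (c ^ n * of_real (K n (fst p) (snd p))) \<le> (norm c * r * r) ^ n /\<^sub>R fact n"
      using r by (intro order_trans[OF E_term_bound] scaleR_left_mono power_mono mult_mono) auto
  qed
  have "continuous_on ?S (\<lambda>p. K n (fst p) (snd p))" for n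
    by (rule continuous_on_K[OF continuous_on_fst[OF continuous_on_id] continuous_on_snd[OF continuous_on_id]])
  then have "\<forall>\<^sub>F N in sequentially. continuous_on ?S (\<lambda>p. \<Sum>n<N. c ^ n * of_real (K n (fst p) (snd p)))"
    by (simp add: continuous_on_sum continuous_on_mult continuous_on_const continuous_on_of_real)
  from uniform_limit_theorem[OF this _ trivial_limit_sequentially] ul show "continuous_on ?S (\<lambda>p. E c (fst p) (snd p))"
    by simp
qed

lemma continuous_on_E [continuous_intros]:
  "continuous_on S f \<Longrightarrow> continuous_on S h \<Longrightarrow> continuous_on S (\<lambda>p. E c (f p) (h p))"
  using continuous_on_compose2[OF continuous_on_E_pair, of S "\<lambda>p. (f p, h p)"]
  by (auto intro: continuous_intros)

lemma continuous_on_DE: "continuous_on UNIV (\<lambda>x. DE c \<xi> x h)"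
proof (rule continuous_on_UNIV_ballI)
  fix r :: real assume r: "r > 0"
  let ?S = "ball (0 :: real ^ 'n) r"
  have ul: "uniform_limit ?S (\<lambda>N x. \<Sum>n<N. c ^ n * of_real (DK n \<xi> x h)) (\<lambda>x. DE c \<xi> x h) sequentially"
    unfolding DE_def
  proof (rule Weierstrass_m_test)
    show "summable (\<lambda>n. norm h * (norm c ^ n * (real n * norm \<xi> * (norm \<xi> * r) ^ (n - 1) / fact n)))"
      by (rule sums_summable[OF sums_mult[OF DE_majorant_sums]])
    fix n and x :: "real ^ 'n" assume "x \<in> ?S"
    then show "norm (c ^ n * of_real (DK n \<xi> x h)) \<le>
       norm h * (norm c ^ n * (real n * norm \<xi> * (norm \<xi> * r) ^ (n - 1) / fact n))"
      by (intro order_trans[OF DE_term_bound] mult_left_mono divide_right_mono power_mono) auto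
  qed
  have "continuous_on ?S (\<lambda>x. DK n \<xi> x h)" for n
    by (rule continuous_on_DK[OF continuous_on_id])
  then have "\<forall>\<^sub>F N in sequentially. continuous_on ?S (\<lambda>x. \<Sum>n<N. c ^ n * of_real (DK n \<xi> x h))"
    by (simp add: continuous_on_sum continuous_on_mult continuous_on_const continuous_on_of_real)
  from uniform_limit_theorem[OF this _ trivial_limit_sequentially] ul show "continuous_on ?S (\<lambda>x. DE c \<xi> x h)"
    by simp
qed

end

section \<open>Difference quotients across a hyperplane\<close>

text \<open>The fundamental theorem of calculus on the segment from \<open>x\<close> to its mirror
  image writes the difference quotient as an integral of the derivative, which stays meaningful on
  the hyperplane.\<close>

definition rquot :: "real ^ 'n \<Rightarrow> (real ^ 'n \<Rightarrow> real ^ 'n \<Rightarrow> complex) \<Rightarrow> real ^ 'n \<Rightarrow> complex" where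
  "rquot v f' x = (2 / (norm v)\<^sup>2) *\<^sub>R
    integral {0..1} (\<lambda>s. f' (x - (s * (2 * (x \<bullet> v) / (norm v)\<^sup>2)) *\<^sub>R v) v)"

lemma rquot_eq:
  assumes f: "\<And>x. (f has_derivative f' x) (at x)" and v: "v \<noteq> 0"
  shows "(v \<bullet> x) *\<^sub>R rquot v f' x = f x - f (reflection v x)"
proof -
  define c where "c = 2 * (x \<bullet> v) / (norm v)\<^sup>2"
  have "((\<lambda>s. f (x - (s * c) *\<^sub>R v)) has_vector_derivative (- c) *\<^sub>R f' (x - (s * c) *\<^sub>R v) v) (at s within {0..1})" for s
  proof -
    have "((\<lambda>s. x - (s * c) *\<^sub>R v) has_derivative (\<lambda>h. - (h * c) *\<^sub>R v)) (at s within {0..1})"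
      by (auto intro!: derivative_eq_intros)
    from has_derivative_compose[OF this f]
    have "((\<lambda>s. f (x - (s * c) *\<^sub>R v)) has_derivative (\<lambda>h. f' (x - (s * c) *\<^sub>R v) (- (h * c) *\<^sub>R v))) (at s within {0..1})" .
    moreover have "f' (x - (s * c) *\<^sub>R v) (- (h * c) *\<^sub>R v) = h *\<^sub>R ((- c) *\<^sub>R f' (x - (s * c) *\<^sub>R v) v)" for h
      using has_derivative_linear[OF f, of "x - (s * c) *\<^sub>R v"] linear_scale[of _ "- (h * c)" v] by simp
    ultimately show ?thesis unfolding has_vector_derivative_def by simp
  qed
  then have "((\<lambda>s. (- c) *\<^sub>R f' (x - (s * c) *\<^sub>R v) v) has_integral f (x - (1 * c) *\<^sub>R v) - f (x - (0 * c) *\<^sub>R v)) {0..1}"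
    by (intro fundamental_theorem_of_calculus) auto
  from integral_unique[OF this] have "integral {0..1} (\<lambda>s. (- c) *\<^sub>R f' (x - (s * c) *\<^sub>R v) v) = f (reflection v x) - f x"
    by (simp add: reflection_def flip: c_def)
  then have "- (c *\<^sub>R integral {0..1} (\<lambda>s. f' (x - (s * c) *\<^sub>R v) v)) = - (f x - f (reflection v x))"
    by simp
  then have "c *\<^sub>R integral {0..1} (\<lambda>s. f' (x - (s * c) *\<^sub>R v) v) = f x - f (reflection v x)"
    by (simp only: neg_equal_iff_equal)
  moreover have "(v \<bullet> x) * (2 / (norm v)\<^sup>2) = c" by (simp add: c_def inner_commute)
  ultimately show ?thesis unfolding rquot_def c_def[symmetric] by (simp only: scaleR_scaleR)
qed

lemma continuous_rquot:
  assumes "continuous_on UNIV (\<lambda>x. f' x v)"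
  shows "continuous_on UNIV (rquot v f')"
proof -
  have "continuous_on (UNIV \<times> cbox 0 (1::real))
     (\<lambda>(x, s). f' (x - (s * (2 * (x \<bullet> v) / (norm v)\<^sup>2)) *\<^sub>R v) v)"
    unfolding case_prod_unfold
    by (rule continuous_on_compose2[OF assms]) (auto intro!: continuous_intros simp: divide_inverse)
  from integral_continuous_on_param[OF this] show ?thesis
    unfolding rquot_def[abs_def] by (intro continuous_intros) (simp add: box_real)
qed

text \<open>Off the hyperplane this is \<open>rquot_eq\<close>. On it, the limit in
  \<open>refl_quotient\<close> runs through the complement, of which every point is a limit point,
  and continuity of \<open>rquot\<close> supplies the value.\<close>

lemma refl_quotient_rquot:
  assumes f: "\<And>x. (f has_derivative f' x) (at x)" and v: "v \<noteq> 0"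
    and c: "continuous_on UNIV (\<lambda>x. f' x v)"
  shows "refl_quotient v f x = rquot v f' x"
proof -
  have eq: "(f y - f (reflection v y)) / of_real (v \<bullet> y) = rquot v f' y" if "v \<bullet> y \<noteq> 0" for y
    using rquot_eq[OF f v, of y] that by (simp add: field_simps scaleR_conv_of_real)
  show ?thesis
  proof (cases "v \<bullet> x = 0")
    case True
    have "x islimpt {y. v \<bullet> y \<noteq> 0}"
      unfolding islimpt_approachable
    proof safe
      fix e :: real assume "e > 0"
      define t where "t = e / (2 * norm v)"
      have "t > 0" using \<open>e > 0\<close> v by (simp add: t_def)
      then show "\<exists>x'\<in>{y. v \<bullet> y \<noteq> 0}. x' \<noteq> x \<and> dist x' x < e"
        using v True \<open>e > 0\<close>
        by (intro bexI[of _ "x + t *\<^sub>R v"]) (auto simp: inner_add_right dist_norm t_def)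
    qed
    then have nt: "at x within {y. v \<bullet> y \<noteq> 0} \<noteq> bot"
      by (simp add: trivial_limit_within)
    have "(rquot v f' \<longlongrightarrow> rquot v f' x) (at x within {y. v \<bullet> y \<noteq> 0})"
    proof (rule Lim_at_imp_Lim_at_within)
      have "isCont (rquot v f') x"
        using continuous_rquot[of f' v, OF c] continuous_on_eq_continuous_at[OF open_UNIV] by blast
      then show "(rquot v f' \<longlongrightarrow> rquot v f' x) (at x)" by (simp add: isCont_def)
    qed
    then have "((\<lambda>y. (f y - f (reflection v y)) / of_real (v \<bullet> y)) \<longlongrightarrow> rquot v f' x) (at x within {y. v \<bullet> y \<noteq> 0})"
      by (rule Lim_transform_eventually) (auto simp: eventually_at_filter eq)
    then show ?thesis
      using True tendsto_Lim[OF nt] by (simp add: refl_quotient_def)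
  qed (simp add: refl_quotient_def eq)
qed

lemma partial_deriv_eq:
  assumes "(f has_derivative f') (at x)"
  shows "partial_deriv j f x = f' (axis j 1)"
proof -
  have "((\<lambda>t. x + t *\<^sub>R axis j 1) has_derivative (\<lambda>h. h *\<^sub>R axis j 1)) (at 0)"
    by (auto intro!: derivative_eq_intros)
  moreover have "(f has_derivative f') (at (x + 0 *\<^sub>R axis j 1))" using assms by simp
  ultimately have "((\<lambda>t. f (x + t *\<^sub>R axis j 1)) has_derivative (\<lambda>h. f' (h *\<^sub>R axis j 1))) (at 0)"
    by (rule has_derivative_compose)
  then have "((\<lambda>t. f (x + t *\<^sub>R axis j 1)) has_vector_derivative f' (axis j 1)) (at 0)"
    using has_derivative_linear[OF assms] by (simp add: has_vector_derivative_def linear_scale)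
  then show ?thesis unfolding partial_deriv_def by (rule vector_derivative_at)
qed

lemma derivative_axis_sum:
  fixes f' :: "real ^ 'n \<Rightarrow> 'b::real_vector"
  assumes "linear f'"
  shows "f' h = (\<Sum>j\<in>UNIV. (h $ j) *\<^sub>R f' (axis j 1))"
proof -
  have "f' h = f' (\<Sum>j\<in>UNIV. (h $ j) *\<^sub>R axis j 1)"
    using basis_expansion[of h] by (simp add: scalar_mult_eq_scaleR)
  also have "\<dots> = (\<Sum>j\<in>UNIV. (h $ j) *\<^sub>R f' (axis j 1))"
    using assms by (simp add: linear_sum linear_scale)
  finally show ?thesis .
qed

text \<open>A differentiable convex penalty for negative values, used as the energy in
  \<open>E_real_nonneg\<close>.\<close>

lemma has_real_derivative_min_square: "((\<lambda>s::real. (min s 0)\<^sup>2) has_real_derivative 2 * min s 0) (at s)"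
proof -
  consider "s < 0" | "s > 0" | "s = 0" by linarith
  then show ?thesis
  proof cases
    case 1
    have "((\<lambda>s::real. s\<^sup>2) has_real_derivative 2 * s) (at s)" by (auto intro!: derivative_eq_intros)
    then have "((\<lambda>s::real. (min s 0)\<^sup>2) has_real_derivative 2 * s) (at s)"
      by (rule has_field_derivative_transform_within[of _ _ _ _ "- s"]) (use 1 in \<open>auto simp: dist_real_def\<close>)
    then show ?thesis using 1 by simp
  next
    case 2
    have "((\<lambda>s::real. 0) has_real_derivative 0) (at s)" by simp
    then have "((\<lambda>s::real. (min s 0)\<^sup>2) has_real_derivative 0) (at s)"
      by (rule has_field_derivative_transform_within[of _ _ _ _ s]) (use 2 in \<open>auto simp: dist_real_def\<close>)
    then show ?thesis using 2 by simp
  next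
    case 3
    have "((\<lambda>s::real. (min s 0)\<^sup>2) has_derivative (\<lambda>h. 0)) (at 0)"
    proof (rule has_derivativeI_sandwich[where e = 1 and H = "\<lambda>y. \<bar>y\<bar>"])
      show "((\<lambda>y::real. \<bar>y\<bar>) \<longlongrightarrow> 0) (at 0)" by (auto intro!: tendsto_eq_intros)
      fix y :: real assume "y \<noteq> 0"
      then show "norm ((min y 0)\<^sup>2 - (min 0 0)\<^sup>2 - 0) / norm (y - 0) \<le> \<bar>y\<bar>"
        by (auto simp: min_def power2_eq_square divide_simps)
    qed auto
    moreover have "(*) (0::real) = (\<lambda>h. 0)" by auto
    ultimately show ?thesis using 3 by (simp add: has_field_derivative_def)
  qed
qed

context dunkl_setting
begin

section \<open>Analyticity and the eigenvalue equations of the kernel\<close>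

text \<open>The recursion evaluates \<open>K n\<close> at the images \<open>g (h x)\<close>, so the
  induction has to cover all \<open>h\<close> in \<open>G\<close> at once. Each factor is a linear
  form \<open>b \<bullet> x\<close> with \<open>norm b \<le> norm \<xi>\<close>, and the resolvent
  weights supply the factorial as in \<open>K_bound\<close>.\<close>

lemma pser_K:
  assumes \<delta>: "0 \<le> \<delta>"
  shows "h \<in> G \<Longrightarrow> pser a \<delta> ((norm \<xi> * (norm a + real CARD('n) * \<delta>)) ^ n / fact n)
     (\<lambda>x. of_real (K n \<xi> (h x)))"
proof (induction n arbitrary: h)
  case 0
  show ?case using pser_const[OF \<delta>, of a 1] by simp
next
  case (Suc n)
  define q where "q = norm \<xi> * (norm a + real CARD('n) * \<delta>)"
  have q0: "0 \<le> q" using \<delta> by (simp add: q_def)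
  have 1: "pser a \<delta> (q * (q ^ n / fact n)) (\<lambda>x. of_real (\<xi> \<bullet> g (h x)) * of_real (K n \<xi> (g (h x))))" if "g \<in> G" for g
  proof -
    have gh: "g \<circ> h \<in> G" using that Suc.prems by (rule G_comp)
    define b where "b = adjoint (g \<circ> h) \<xi>"
    have b: "\<xi> \<bullet> g (h x) = b \<bullet> x" for x
      using adjoint_works[OF G_linear[OF gh], of x \<xi>] by (simp add: b_def inner_commute)
    \<comment> \<open>The form is evaluated at \<open>b\<close> itself, and
      \<open>g \<circ> h\<close> is an isometry.\<close>
    have "norm b * norm b \<le> norm \<xi> * norm b"
      using Cauchy_Schwarz_ineq2[of \<xi> "(g \<circ> h) b"] b[of b] G_norm[OF gh, of b]
      by (simp add: power2_norm_eq_inner[symmetric] power2_eq_square)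
    then have "norm b \<le> norm \<xi>" using mult_le_cancel_right norm_ge_zero by (metis norm_le_zero_iff not_le order_trans)
    then have "norm b * (norm a + real CARD('n) * \<delta>) * (q ^ n / fact n) \<le> q * (q ^ n / fact n)"
      using \<delta> q0 unfolding q_def by (intro mult_right_mono) auto
    moreover have "pser a \<delta> (norm b * (norm a + real CARD('n) * \<delta>) * (q ^ n / fact n))
        (\<lambda>x. of_real (b \<bullet> x) * of_real (K n \<xi> ((g \<circ> h) x)))"
      using Suc.IH[OF gh] q0 unfolding q_def by (intro pser_linear \<delta>) auto
    ultimately show ?thesis using pser_mono by (auto simp: b)
  qed
  have "pser a \<delta> (\<Sum>g\<in>G. norm (of_real (resolvent (real (Suc n)) g) :: complex) * (q * (q ^ n / fact n)))
     (\<lambda>x. \<Sum>g\<in>G. of_real (resolvent (real (Suc n)) g) * (of_real (\<xi> \<bullet> g (h x)) * of_real (K n \<xi> (g (h x)))))"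
    by (intro pser_sum pser_cmult 1 \<delta>) auto
  moreover have "(\<Sum>g\<in>G. norm (of_real (resolvent (real (Suc n)) g) :: complex) * (q * (q ^ n / fact n))) =
      (\<Sum>g\<in>G. resolvent (real (Suc n)) g) * (q * (q ^ n / fact n))"
    unfolding sum_distrib_right by (intro sum.cong refl) (use resolvent_nonneg[of "real (Suc n)"] in auto)
  moreover have "\<dots> = q ^ Suc n / fact (Suc n)"
    by (subst resolvent_sum) auto
  ultimately show ?case by (simp only: K.simps of_real_sum of_real_mult q_def)
qed

lemma real_analytic_E: "real_analytic (E c \<xi>)"
proof (rule real_analyticI)
  fix a :: "real ^ 'n"
  define q where "q = norm \<xi> * (norm a + real CARD('n) * 1)"
  have "pser a 1 (norm (c ^ n) * (q ^ n / fact n)) (\<lambda>x. c ^ n * of_real (K n \<xi> x))" for n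
    using pser_cmult[OF pser_K[OF _ id_in_G, of 1 a \<xi> n], of "c ^ n"] by (simp add: q_def)
  moreover have "summable (\<lambda>n. norm (c ^ n) * (q ^ n / fact n))"
    using summable_exp_generic[of "norm c * q"] by (simp add: norm_power power_mult_distrib field_simps)
  ultimately have "\<exists>B. pser a 1 B (E c \<xi>)"
    by (intro pser_suminf[OF _ zero_less_one _ E_sums])
  then show "\<exists>\<delta>>0. \<exists>B. pser a \<delta> B (E c \<xi>)" using zero_less_one by blast
qed

text \<open>The set where two continuous functions differ is open; contained in the null union of
  the hyperplanes, it is empty.\<close>

lemma Om_eqI:
  fixes f h :: "real ^ 'n \<Rightarrow> complex"
  assumes "continuous_on UNIV f" "continuous_on UNIV h" "\<And>x. x \<in> Om \<Longrightarrow> f x = h x"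
  shows "f x = h x"
proof -
  have "open {x. f x \<noteq> h x}"
    by (rule open_Collect_neq[OF assms(1,2)])
  moreover have "{x. f x \<noteq> h x} \<subseteq> (\<Union>v\<in>P. {x. v \<bullet> x = 0})"
    using assms(3) by (auto simp: Om_def)
  moreover have "negligible (\<Union>v\<in>P. {x. v \<bullet> x = 0})"
    by (intro negligible_Union) (auto intro!: negligible_hyperplane P_nonzero)
  ultimately have "{x. f x \<noteq> h x} = {}"
    using negligible_subset open_not_negligible by blast
  then show ?thesis by auto
qed

lemma dunkl_op_C1:
  assumes f: "\<And>x. (f has_derivative f' x) (at x)" and c: "\<And>h. continuous_on UNIV (\<lambda>x. f' x h)"
  shows "dunkl_op P k j f x = f' x (axis j 1) + (\<Sum>v\<in>P. of_real (k v * (v \<bullet> axis j 1)) * rquot v f' x)"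
  unfolding dunkl_op_def partial_deriv_eq[OF f]
  using refl_quotient_rquot[OF f P_nonzero c] by simp

lemma dunkl_op_Om:
  assumes f: "\<And>x. (f has_derivative f' x) (at x)" and x: "x \<in> Om"
  shows "dunkl_op P k j f x = dop f f' (axis j 1) x"
  unfolding dunkl_op_def dop_def partial_deriv_eq[OF f] refl_quotient_def
  using x by (auto simp: Om_def scaleR_conv_of_real intro!: sum.cong)

lemma dunkl_op_E: "dunkl_op P k j (E c \<xi>) x = c * of_real (\<xi> $ j) * E c \<xi> x"
proof (rule Om_eqI)
  show "continuous_on UNIV (dunkl_op P k j (E c \<xi>))"
    unfolding dunkl_op_C1[OF E_has_derivative continuous_on_DE, abs_def]
    by (intro continuous_on_add continuous_on_sum continuous_on_mult continuous_on_const
        continuous_on_DE continuous_rquot)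
  show "continuous_on UNIV (\<lambda>x. c * of_real (\<xi> $ j) * E c \<xi> x)"
    by (intro continuous_on_mult continuous_on_const continuous_on_E continuous_on_id)
  show "dunkl_op P k j (E c \<xi>) x = c * of_real (\<xi> $ j) * E c \<xi> x" if "x \<in> Om" for x
    using dunkl_op_Om[OF E_has_derivative that] dop_E[OF that] by (simp add: inner_axis)
qed

section \<open>Energy estimates along rays\<close>

text \<open>The energy is the sum of \<open>\<psi>\<close> over the orbit of
  \<open>t *\<^sub>R x\<close>. By convexity each coupling term is bounded by a difference of values
  of \<open>\<psi>\<close> at two orbit points, and these differences cancel in the sum because
  composition with a reflection permutes \<open>G\<close>. The singular coefficient
  \<open>inverse t\<close> thus multiplies either 0 or the bound \<open>growth\<close>, which
  contains a factor \<open>t\<close>.\<close>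

lemma radial_energy:
  fixes f :: "real ^ 'n \<Rightarrow> complex" and \<psi> :: "complex \<Rightarrow> real"
  assumes deriv: "\<And>x t. 0 < t \<Longrightarrow> ((\<lambda>t. f (t *\<^sub>R x)) has_vector_derivative inverse t *\<^sub>R
      (lam (t *\<^sub>R x) * f (t *\<^sub>R x) - (\<Sum>v\<in>P. k v *\<^sub>R (f (t *\<^sub>R x) - f (t *\<^sub>R reflection v x))))) (at t)"
    and cont: "\<And>x. continuous_on {0..1} (\<lambda>t. f (t *\<^sub>R x))"
    and d\<psi>: "\<And>a. (\<psi> has_derivative d\<psi> a) (at a)"
    and convex: "\<And>a b. d\<psi> a (b - a) \<le> \<psi> b - \<psi> a"
    and nonneg: "\<And>a. 0 \<le> \<psi> a"
    and growth: "\<And>y. d\<psi> (f y) (lam y * f y) \<le> A * norm y * \<psi> (f y)"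
  shows "\<psi> (f x) \<le> real (card G) * \<psi> (f 0) * exp (A * norm x)"
proof -
  define \<Phi> where "\<Phi> t = (\<Sum>g\<in>G. \<psi> (f (t *\<^sub>R g x)))" for t
  \<comment> \<open>Integrating factor for the inequality bounding the derivative of
    \<open>\<Phi>\<close> by \<open>A * norm x * \<Phi>\<close>.\<close>
  define \<Theta> where "\<Theta> t = exp (- (A * norm x) * t) * \<Phi> t" for t
  have lin: "linear (d\<psi> a)" for a using d\<psi> has_derivative_linear by blast
  have D: "\<exists>y. DERIV \<Theta> t :> y \<and> y \<le> 0" if t: "0 < t" for t
  proof -
    define R' where "R' g = inverse t *\<^sub>R (lam (t *\<^sub>R g x) * f (t *\<^sub>R g x) -
        (\<Sum>v\<in>P. k v *\<^sub>R (f (t *\<^sub>R g x) - f (t *\<^sub>R reflection v (g x)))))" for g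
    have 1: "((\<lambda>t. \<psi> (f (t *\<^sub>R g x))) has_real_derivative d\<psi> (f (t *\<^sub>R g x)) (R' g)) (at t)" for g
    proof -
      have "((\<lambda>t. f (t *\<^sub>R g x)) has_derivative (\<lambda>h. h *\<^sub>R R' g)) (at t)"
        using deriv[OF t, of "g x"] by (simp add: has_vector_derivative_def R'_def)
      from has_derivative_compose[OF this d\<psi>] show ?thesis
        by (simp add: has_field_derivative_def linear_scale[OF lin] mult_commute_abs)
    qed
    have D\<Phi>: "(\<Phi> has_real_derivative (\<Sum>g\<in>G. d\<psi> (f (t *\<^sub>R g x)) (R' g))) (at t)"
      unfolding \<Phi>_def by (rule DERIV_sum) (rule 1)
    have 2: "d\<psi> (f (t *\<^sub>R g x)) (R' g) \<le> A * norm x * \<psi> (f (t *\<^sub>R g x)) +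
        inverse t * (\<Sum>v\<in>P. k v * (\<psi> (f (t *\<^sub>R reflection v (g x))) - \<psi> (f (t *\<^sub>R g x))))"
      if "g \<in> G" for g
    proof -
      let ?y = "t *\<^sub>R g x"
      have "R' g = inverse t *\<^sub>R (lam ?y * f ?y) + inverse t *\<^sub>R (\<Sum>v\<in>P. k v *\<^sub>R (f (t *\<^sub>R reflection v (g x)) - f ?y))"
        by (simp add: R'_def scaleR_diff_right sum_subtractf)
      then have "d\<psi> (f ?y) (R' g) = inverse t * d\<psi> (f ?y) (lam ?y * f ?y) +
          inverse t * (\<Sum>v\<in>P. k v * d\<psi> (f ?y) (f (t *\<^sub>R reflection v (g x)) - f ?y))"
        by (simp only: linear_add[OF lin] linear_scale[OF lin] linear_sum[OF lin] real_scaleR_def)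
      also have "\<dots> \<le> inverse t * (A * norm ?y * \<psi> (f ?y)) +
          inverse t * (\<Sum>v\<in>P. k v * (\<psi> (f (t *\<^sub>R reflection v (g x))) - \<psi> (f ?y)))"
        using t by (intro add_mono mult_left_mono growth sum_mono convex k_nonneg) auto
      also have "inverse t * (A * norm ?y * \<psi> (f ?y)) = A * norm x * \<psi> (f ?y)"
        using t that by (simp add: field_simps)
      finally show ?thesis .
    qed
    have zero: "(\<Sum>g\<in>G. \<Sum>v\<in>P. k v * (\<psi> (f (t *\<^sub>R reflection v (g x))) - \<psi> (f (t *\<^sub>R g x)))) = 0"
    proof (subst sum.swap, rule sum.neutral, rule ballI)
      fix v assume v: "v \<in> P"
      have "(\<Sum>g\<in>G. \<psi> (f (t *\<^sub>R reflection v (g x)))) = (\<Sum>g\<in>G. \<psi> (f (t *\<^sub>R g x)))"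
        using sum.reindex_bij_betw[OF bij_left[OF v], of "\<lambda>g. \<psi> (f (t *\<^sub>R g x))"] by simp
      then show "(\<Sum>g\<in>G. k v * (\<psi> (f (t *\<^sub>R reflection v (g x))) - \<psi> (f (t *\<^sub>R g x)))) = 0"
        by (simp add: sum_subtractf flip: sum_distrib_left)
    qed
    have "(\<Sum>g\<in>G. d\<psi> (f (t *\<^sub>R g x)) (R' g)) \<le> (\<Sum>g\<in>G. A * norm x * \<psi> (f (t *\<^sub>R g x)) +
        inverse t * (\<Sum>v\<in>P. k v * (\<psi> (f (t *\<^sub>R reflection v (g x))) - \<psi> (f (t *\<^sub>R g x)))))"
      by (rule sum_mono) (rule 2)
    also have "\<dots> = A * norm x * \<Phi> t"
      unfolding sum.distrib sum_distrib_left[symmetric] zero by (simp add: \<Phi>_def)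
    finally have le: "(\<Sum>g\<in>G. d\<psi> (f (t *\<^sub>R g x)) (R' g)) \<le> A * norm x * \<Phi> t" .
    have "(\<Theta> has_real_derivative exp (- (A * norm x) * t) * ((\<Sum>g\<in>G. d\<psi> (f (t *\<^sub>R g x)) (R' g)) - A * norm x * \<Phi> t)) (at t)"
      unfolding \<Theta>_def by (rule derivative_eq_intros D\<Phi> refl)+ (simp add: algebra_simps)
    moreover have "exp (- (A * norm x) * t) * ((\<Sum>g\<in>G. d\<psi> (f (t *\<^sub>R g x)) (R' g)) - A * norm x * \<Phi> t) \<le> 0"
      using le by (simp add: mult_nonneg_nonpos)
    ultimately show ?thesis by blast
  qed
  have "continuous_on UNIV \<psi>"
    using d\<psi> by (intro has_derivative_continuous_on) (auto intro: has_derivative_at_withinI)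
  then have "continuous_on {0..1} (\<lambda>t. \<psi> (f (t *\<^sub>R g x)))" for g
    by (rule continuous_on_compose2[OF _ cont]) auto
  then have "continuous_on {0..1} \<Theta>"
    unfolding \<Theta>_def \<Phi>_def by (intro continuous_intros) auto
  \<comment> \<open>The derivative is available for \<open>t > 0\<close> only; continuity takes care
    of the endpoint 0.\<close>
  then have "\<Theta> 1 \<le> \<Theta> 0"
    by (intro DERIV_nonpos_imp_decreasing_open[of 0 1 \<Theta>] D) auto
  then have "exp (- (A * norm x)) * \<Phi> 1 \<le> \<Phi> 0" by (simp add: \<Theta>_def)
  then have "exp (A * norm x) * (exp (- (A * norm x)) * \<Phi> 1) \<le> exp (A * norm x) * \<Phi> 0"
    by (rule mult_left_mono) simp
  then have "\<Phi> 1 \<le> exp (A * norm x) * \<Phi> 0"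
    by (simp add: mult.assoc[symmetric] flip: exp_add)
  moreover have "\<psi> (f x) \<le> \<Phi> 1"
    unfolding \<Phi>_def using member_le_sum[of id G "\<lambda>g. \<psi> (f (1 *\<^sub>R g x))"] nonneg by simp
  moreover have "\<Phi> 0 = real (card G) * \<psi> (f 0)"
    by (simp add: \<Phi>_def)
  ultimately show ?thesis by (simp add: mult_ac)
qed

text \<open>With the squared modulus as \<open>\<psi>\<close>, the convexity inequality is the
  nonnegativity of the square of \<open>b - a\<close>, and of \<open>lam\<close> only the real part
  enters the growth.\<close>

lemma radial_norm_bound:
  assumes deriv: "\<And>x t. 0 < t \<Longrightarrow> ((\<lambda>t. f (t *\<^sub>R x)) has_vector_derivative inverse t *\<^sub>R
      (lam (t *\<^sub>R x) * f (t *\<^sub>R x) - (\<Sum>v\<in>P. k v *\<^sub>R (f (t *\<^sub>R x) - f (t *\<^sub>R reflection v x))))) (at t)"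
    and cont: "\<And>x. continuous_on {0..1} (\<lambda>t. f (t *\<^sub>R x))"
    and growth: "\<And>y. 2 * Re (lam y) \<le> A * norm y"
  shows "(norm (f x))\<^sup>2 \<le> real (card G) * (norm (f 0))\<^sup>2 * exp (A * norm x)"
proof (rule radial_energy[OF deriv cont, where \<psi> = "\<lambda>a. (norm a)\<^sup>2" and d\<psi> = "\<lambda>a h. 2 * (a \<bullet> h)"])
  show "((\<lambda>a. (norm a)\<^sup>2) has_derivative (\<lambda>h. 2 * (a \<bullet> h))) (at a)" for a :: complex
    unfolding power2_norm_eq_inner by (auto intro!: derivative_eq_intros simp: inner_commute)
  show "2 * (a \<bullet> (b - a)) \<le> (norm b)\<^sup>2 - (norm a)\<^sup>2" for a b :: complex
    using inner_ge_zero[of "b - a"]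
    by (simp add: power2_norm_eq_inner inner_diff_left inner_diff_right inner_commute)
  show "2 * (f y \<bullet> (lam y * f y)) \<le> A * norm y * (norm (f y))\<^sup>2" for y
  proof -
    have "2 * (f y \<bullet> (lam y * f y)) = 2 * Re (lam y) * (norm (f y))\<^sup>2"
      unfolding inner_complex_def cmod_power2 by (simp add: algebra_simps power2_eq_square)
    also have "\<dots> \<le> A * norm y * (norm (f y))\<^sup>2"
      by (rule mult_right_mono[OF growth]) simp
    finally show ?thesis .
  qed
qed auto

text \<open>The chain rule along the ray; dividing the contracted equation by \<open>t\<close> gives
  the form in which the energy estimates are stated.\<close>

lemma radial_derivI:
  assumes f: "\<And>x. (f has_derivative f' x) (at x)"
    and rad: "\<And>x. f' x x + (\<Sum>v\<in>P. k v *\<^sub>R (f x - f (reflection v x))) = lam x * f x"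
    and t: "0 < t"
  shows "((\<lambda>t. f (t *\<^sub>R x)) has_vector_derivative inverse t *\<^sub>R
      (lam (t *\<^sub>R x) * f (t *\<^sub>R x) - (\<Sum>v\<in>P. k v *\<^sub>R (f (t *\<^sub>R x) - f (t *\<^sub>R reflection v x))))) (at t)"
proof -
  have "((\<lambda>t. t *\<^sub>R x) has_derivative (\<lambda>h. h *\<^sub>R x)) (at t)"
    by (auto intro!: derivative_eq_intros)
  from has_derivative_compose[OF this f]
  have D: "((\<lambda>t. f (t *\<^sub>R x)) has_derivative (\<lambda>h. f' (t *\<^sub>R x) (h *\<^sub>R x))) (at t)" .
  have "f' (t *\<^sub>R x) (h *\<^sub>R x) = h *\<^sub>R (inverse t *\<^sub>R f' (t *\<^sub>R x) (t *\<^sub>R x))" for h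
    using t has_derivative_linear[OF f, of "t *\<^sub>R x"] by (simp add: linear_scale)
  then have "((\<lambda>t. f (t *\<^sub>R x)) has_vector_derivative inverse t *\<^sub>R f' (t *\<^sub>R x) (t *\<^sub>R x)) (at t)"
    unfolding has_vector_derivative_def by (intro has_derivative_eq_rhs[OF D] ext)
  moreover have "f' (t *\<^sub>R x) (t *\<^sub>R x) = lam (t *\<^sub>R x) * f (t *\<^sub>R x) -
      (\<Sum>v\<in>P. k v *\<^sub>R (f (t *\<^sub>R x) - f (t *\<^sub>R reflection v x)))"
    unfolding rad[of "t *\<^sub>R x", symmetric] reflection_scaleR by (rule add_diff_cancel_right'[symmetric])
  ultimately show ?thesis by (simp only:)
qed

text \<open>The difference of \<open>f\<close> and \<open>f 0 * E c \<xi>\<close> solves the same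
  linear equation and vanishes at the origin, so its energy is 0.\<close>

lemma radial_unique:
  assumes deriv: "\<And>x t. 0 < t \<Longrightarrow> ((\<lambda>t. f (t *\<^sub>R x)) has_vector_derivative inverse t *\<^sub>R
      (c * of_real (\<xi> \<bullet> (t *\<^sub>R x)) * f (t *\<^sub>R x) - (\<Sum>v\<in>P. k v *\<^sub>R (f (t *\<^sub>R x) - f (t *\<^sub>R reflection v x))))) (at t)"
    and cont: "\<And>x. continuous_on {0..1} (\<lambda>t. f (t *\<^sub>R x))"
  shows "f x = f 0 * E c \<xi> x"
proof -
  define d where "d x = f x - f 0 * E c \<xi> x" for x
  have Ed: "((\<lambda>t. E c \<xi> (t *\<^sub>R x)) has_vector_derivative inverse t *\<^sub>R
      (c * of_real (\<xi> \<bullet> (t *\<^sub>R x)) * E c \<xi> (t *\<^sub>R x) -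
      (\<Sum>v\<in>P. k v *\<^sub>R (E c \<xi> (t *\<^sub>R x) - E c \<xi> (t *\<^sub>R reflection v x))))) (at t)" if "0 < t" for x t
    by (rule radial_derivI[OF E_has_derivative _ that]) (use E_radial in \<open>simp add: scaleR_conv_of_real\<close>)
  have "(norm (d x))\<^sup>2 \<le> real (card G) * (norm (d 0))\<^sup>2 * exp ((2 * norm c * norm \<xi>) * norm x)"
  proof (rule radial_norm_bound[where lam = "\<lambda>x. c * of_real (\<xi> \<bullet> x)"])
    fix x and t :: real assume t: "0 < t"
    show "((\<lambda>t. d (t *\<^sub>R x)) has_vector_derivative inverse t *\<^sub>R
      (c * of_real (\<xi> \<bullet> (t *\<^sub>R x)) * d (t *\<^sub>R x) - (\<Sum>v\<in>P. k v *\<^sub>R (d (t *\<^sub>R x) - d (t *\<^sub>R reflection v x))))) (at t)"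
      unfolding d_def
      by (rule has_vector_derivative_eq_rhs[OF has_vector_derivative_diff[OF deriv[OF t]
            has_vector_derivative_mult_right[OF Ed[OF t]]]])
         (simp add: algebra_simps sum_subtractf sum_distrib_left sum.distrib)
  next
    show "continuous_on {0..1} (\<lambda>t. d (t *\<^sub>R x))" for x
      unfolding d_def by (intro continuous_intros cont)
    show "2 * Re (c * of_real (\<xi> \<bullet> y)) \<le> 2 * norm c * norm \<xi> * norm y" for y
    proof -
      have "Re (c * of_real (\<xi> \<bullet> y)) \<le> norm c * \<bar>\<xi> \<bullet> y\<bar>"
        using complex_Re_le_cmod[of "c * of_real (\<xi> \<bullet> y)"] by (simp add: norm_mult)
      also have "\<dots> \<le> norm c * (norm \<xi> * norm y)"
        by (intro mult_left_mono Cauchy_Schwarz_ineq2) auto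
      finally show ?thesis by simp
    qed
  qed
  then show ?thesis by (simp add: d_def)
qed

text \<open>For imaginary \<open>c\<close> the multiplier has real part 0 and the energy does not
  grow. It equals \<open>card G\<close> at the origin and dominates the squared modulus at each
  single point, which explains the constant.\<close>

lemma norm_E_imaginary: assumes "Re c = 0" shows "norm (E c \<xi> x) \<le> sqrt (real (card G))"
proof -
  have "(norm (E c \<xi> x))\<^sup>2 \<le> real (card G) * (norm (E c \<xi> 0))\<^sup>2 * exp (0 * norm x)"
  proof (rule radial_norm_bound[where lam = "\<lambda>x. c * of_real (\<xi> \<bullet> x)"])
    show "((\<lambda>t. E c \<xi> (t *\<^sub>R x)) has_vector_derivative inverse t *\<^sub>R
      (c * of_real (\<xi> \<bullet> (t *\<^sub>R x)) * E c \<xi> (t *\<^sub>R x) -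
      (\<Sum>v\<in>P. k v *\<^sub>R (E c \<xi> (t *\<^sub>R x) - E c \<xi> (t *\<^sub>R reflection v x))))) (at t)" if "0 < t" for x t
      by (rule radial_derivI[OF E_has_derivative _ that]) (use E_radial in \<open>simp add: scaleR_conv_of_real\<close>)
  qed (auto intro!: continuous_intros simp: assms)
  then show ?thesis by (simp add: real_le_rsqrt)
qed

lemma E_real: "E (of_real c) \<xi> x = of_real (Re (E (of_real c) \<xi> x))"
  using E_cnj[of "of_real c" \<xi> x] by (simp add: complex_eq_iff)

text \<open>The energy is the orbit sum of the squared negative parts. It is 0 at the origin, where
  the kernel is 1, and so it stays 0.\<close>

lemma E_real_nonneg: "0 \<le> Re (E (of_real c) \<xi> x)"
proof -
  have "(min (Re (E (of_real c) \<xi> x)) 0)\<^sup>2 \<le>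
     real (card G) * (min (Re (E (of_real c) \<xi> 0)) 0)\<^sup>2 * exp ((2 * \<bar>c\<bar> * norm \<xi>) * norm x)"
  proof (rule radial_energy[where lam = "\<lambda>x. of_real c * of_real (\<xi> \<bullet> x)" and
        \<psi> = "\<lambda>a. (min (Re a) 0)\<^sup>2" and d\<psi> = "\<lambda>a h. Re h * (2 * min (Re a) 0)"])
    show "((\<lambda>t. E (of_real c) \<xi> (t *\<^sub>R x)) has_vector_derivative inverse t *\<^sub>R
      (of_real c * of_real (\<xi> \<bullet> (t *\<^sub>R x)) * E (of_real c) \<xi> (t *\<^sub>R x) -
      (\<Sum>v\<in>P. k v *\<^sub>R (E (of_real c) \<xi> (t *\<^sub>R x) - E (of_real c) \<xi> (t *\<^sub>R reflection v x))))) (at t)" if "0 < t" for x t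
      by (rule radial_derivI[OF E_has_derivative _ that]) (use E_radial in \<open>simp add: scaleR_conv_of_real\<close>)
    show "((\<lambda>a. (min (Re a) 0)\<^sup>2) has_derivative (\<lambda>h. Re h * (2 * min (Re a) 0))) (at a)" for a
      using has_derivative_compose[OF bounded_linear_imp_has_derivative[OF bounded_linear_Re]
          has_real_derivative_min_square[of "Re a", unfolded has_field_derivative_def]]
      by (simp add: mult.commute)
    show "Re (b - a) * (2 * min (Re a) 0) \<le> (min (Re b) 0)\<^sup>2 - (min (Re a) 0)\<^sup>2" for a b
    proof -
      define p q where "p = min (Re a) 0" "q = min (Re b) 0"
      have "Re b * p \<le> q * p" unfolding p_q_def by (intro mult_right_mono_neg) auto
      moreover have "Re a * p = p * p" unfolding p_q_def by (auto simp: min_def)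
      moreover have "0 \<le> q * q - 2 * (q * p) + p * p"
        using zero_le_square[of "q - p"] by (simp add: algebra_simps)
      moreover have "(Re b - Re a) * (2 * p) = 2 * (Re b * p) - 2 * (Re a * p)"
        by (simp add: algebra_simps)
      ultimately have "(Re b - Re a) * (2 * p) \<le> q\<^sup>2 - p\<^sup>2"
        unfolding power2_eq_square by linarith
      then show ?thesis by (simp add: p_q_def)
    qed
    show "Re (of_real c * of_real (\<xi> \<bullet> y) * E (of_real c) \<xi> y) * (2 * min (Re (E (of_real c) \<xi> y)) 0)
       \<le> 2 * \<bar>c\<bar> * norm \<xi> * norm y * (min (Re (E (of_real c) \<xi> y)) 0)\<^sup>2" for y
    proof -
      define e where "e = Re (E (of_real c) \<xi> y)"
      have "c * (\<xi> \<bullet> y) \<le> \<bar>c\<bar> * (norm \<xi> * norm y)"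
        using mult_mono[of "\<bar>c\<bar>" "\<bar>c\<bar>" "\<bar>\<xi> \<bullet> y\<bar>" "norm \<xi> * norm y"] Cauchy_Schwarz_ineq2[of \<xi> y]
          abs_le_D1[of "c * (\<xi> \<bullet> y)"] by (auto simp: abs_mult)
      then have "2 * (c * (\<xi> \<bullet> y)) * (min e 0)\<^sup>2 \<le> 2 * (\<bar>c\<bar> * (norm \<xi> * norm y)) * (min e 0)\<^sup>2"
        by (intro mult_right_mono) auto
      moreover have "e * min e 0 = (min e 0)\<^sup>2" by (auto simp: min_def power2_eq_square)
      then have "(c * (\<xi> \<bullet> y)) * e * (2 * min e 0) = 2 * (c * (\<xi> \<bullet> y)) * (min e 0)\<^sup>2" by (simp add: mult_ac)
      moreover have "Re (of_real c * of_real (\<xi> \<bullet> y) * E (of_real c) \<xi> y) = c * (\<xi> \<bullet> y) * e"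
        by (simp add: e_def)
      ultimately show ?thesis unfolding e_def[symmetric] by (simp only: mult.assoc)
    qed
  qed (auto intro!: continuous_intros)
  then show ?thesis by (auto simp: min_def split: if_splits)
qed

text \<open>A competing solution is differentiable by analyticity, and contracting its equations
  with \<open>x\<close> cancels the denominators, so it satisfies the hypotheses of
  \<open>radial_unique\<close> with value 1 at the origin.\<close>

theorem dunkl_kernel_eq: "dunkl_kernel P k (cvec c \<xi>) = E c \<xi>"
  unfolding dunkl_kernel_def
proof (rule the_equality)
  show "real_analytic (E c \<xi>) \<and> (\<forall>j x. dunkl_op P k j (E c \<xi>) x = cvec c \<xi> $ j * E c \<xi> x) \<and> E c \<xi> 0 = 1"
    by (simp add: real_analytic_E dunkl_op_E cvec_def)
next
  fix f assume f: "real_analytic f \<and> (\<forall>j x. dunkl_op P k j f x = cvec c \<xi> $ j * f x) \<and> f 0 = 1"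
  then have "\<forall>x. \<exists>f'. (f has_derivative f') (at x)"
    using real_analytic_differentiable unfolding differentiable_def by blast
  then obtain f' where f': "\<And>x. (f has_derivative f' x) (at x)" by metis
  have "f x = f 0 * E c \<xi> x" for x
  proof (rule radial_unique)
    show "((\<lambda>t. f (t *\<^sub>R x)) has_vector_derivative inverse t *\<^sub>R
      (c * of_real (\<xi> \<bullet> (t *\<^sub>R x)) * f (t *\<^sub>R x) - (\<Sum>v\<in>P. k v *\<^sub>R (f (t *\<^sub>R x) - f (t *\<^sub>R reflection v x))))) (at t)"
      if "0 < t" for x t
    proof (rule radial_derivI[OF f' _ that])
      fix x
      \<comment> \<open>On the hyperplane both sides are 0, whatever the value of the limit in
        \<open>refl_quotient\<close>.\<close>
      have q: "of_real (v \<bullet> x) * refl_quotient v f x = f x - f (reflection v x)" for v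
        by (auto simp: refl_quotient_def reflection_orth)
      have "c * of_real (\<xi> \<bullet> x) * f x = (\<Sum>j\<in>UNIV. of_real (x $ j) * dunkl_op P k j f x)"
        using f by (simp add: cvec_def inner_vec_def sum_distrib_left sum_distrib_right mult_ac)
      also have "\<dots> = (\<Sum>j\<in>UNIV. of_real (x $ j) * f' x (axis j 1)) +
         (\<Sum>j\<in>UNIV. \<Sum>v\<in>P. of_real (x $ j) * (of_real (k v * (v \<bullet> axis j 1)) * refl_quotient v f x))"
        unfolding dunkl_op_def partial_deriv_eq[OF f'] by (simp add: distrib_left sum.distrib sum_distrib_left)
      also have "(\<Sum>j\<in>UNIV. of_real (x $ j) * f' x (axis j 1)) = f' x x"
        using derivative_axis_sum[OF has_derivative_linear[OF f'[of x]], of x] by (simp add: scaleR_conv_of_real)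
      also have "(\<Sum>j\<in>UNIV. \<Sum>v\<in>P. of_real (x $ j) * (of_real (k v * (v \<bullet> axis j 1)) * refl_quotient v f x)) =
          (\<Sum>v\<in>P. of_real (k v) * (of_real (\<Sum>j\<in>UNIV. v $ j * x $ j) * refl_quotient v f x))"
        by (subst sum.swap) (simp add: inner_axis sum_distrib_left sum_distrib_right mult_ac)
      also have "\<dots> = (\<Sum>v\<in>P. k v *\<^sub>R (f x - f (reflection v x)))"
        using q by (simp add: inner_vec_def scaleR_conv_of_real)
      finally show "f' x x + (\<Sum>v\<in>P. k v *\<^sub>R (f x - f (reflection v x))) = c * of_real (\<xi> \<bullet> x) * f x" ..
    qed
    have "continuous_on UNIV f"
      using f' by (intro has_derivative_continuous_on) (auto intro: has_derivative_at_withinI)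
    then show "continuous_on {0..1} (\<lambda>t. f (t *\<^sub>R x))" for x
      by (rule continuous_on_compose2) (auto intro!: continuous_intros)
  qed
  then show "f = E c \<xi>" using f by auto
qed

end

section \<open>Gaussian integrals\<close>

text \<open>\<open>s\<close> is an inverse variance: letting \<open>s\<close> tend to 0 removes the
  Gaussian from an integral.\<close>

definition gauss :: "real \<Rightarrow> real ^ 'n \<Rightarrow> real" where
  "gauss s x = exp (- s * (norm x)\<^sup>2 / 2)"

text \<open>Growth class for the factors integrated against Gaussians. It is closed under sums and
  products and contains the kernel, its derivative and the weight, so integrability follows from
  structural rules.\<close>

definition exp_type :: "('b::real_normed_vector \<Rightarrow> 'c::real_normed_vector) \<Rightarrow> bool" where
  "exp_type f \<longleftrightarrow> (\<exists>C A. 0 \<le> C \<and> 0 \<le> A \<and> (\<forall>x. norm (f x) \<le> C * exp (A * norm x)))"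

lemma exp_typeI:
  assumes "\<And>x. norm (f x) \<le> C * exp (A * norm x)"
  shows "exp_type f"
  unfolding exp_type_def
proof (intro exI conjI allI)
  fix x
  have "norm (f x) \<le> \<bar>C\<bar> * exp (A * norm x)"
    using assms[of x] by (smt (verit) exp_gt_zero mult_right_mono)
  also have "\<dots> \<le> \<bar>C\<bar> * exp (\<bar>A\<bar> * norm x)"
    by (intro mult_left_mono) (auto intro!: mult_right_mono)
  finally show "norm (f x) \<le> \<bar>C\<bar> * exp (\<bar>A\<bar> * norm x)" .
qed auto

lemma exp_type_const [intro]: "exp_type (\<lambda>_. c)"
  by (rule exp_typeI[of _ "norm c" 0]) simp

lemma exp_type_mono: "exp_type f \<Longrightarrow> (\<And>x. norm (g x) \<le> norm (f x)) \<Longrightarrow> exp_type g"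
  unfolding exp_type_def by (meson order_trans)

lemma exp_type_norm: "exp_type (\<lambda>x. norm x)"
  by (rule exp_typeI[of _ 1 1]) (use exp_ge_add_one_self in \<open>smt (verit) norm_ge_zero real_norm_def\<close>)

lemma exp_type_add:
  assumes "exp_type f" "exp_type g"
  shows "exp_type (\<lambda>x. f x + g x)"
proof -
  obtain C A where f: "0 \<le> C" "0 \<le> A" "\<And>x. norm (f x) \<le> C * exp (A * norm x)"
    using assms(1) unfolding exp_type_def by auto
  obtain D B where g: "0 \<le> D" "0 \<le> B" "\<And>x. norm (g x) \<le> D * exp (B * norm x)"
    using assms(2) unfolding exp_type_def by auto
  show ?thesis
  proof (rule exp_typeI[of _ "C + D" "A + B"])
    fix x
    have "norm (f x + g x) \<le> C * exp (A * norm x) + D * exp (B * norm x)"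
      using norm_triangle_ineq[of "f x" "g x"] f(3)[of x] g(3)[of x] by linarith
    also have "\<dots> \<le> C * exp ((A + B) * norm x) + D * exp ((A + B) * norm x)"
      using f g by (intro add_mono mult_left_mono) (auto intro!: mult_right_mono)
    finally show "norm (f x + g x) \<le> (C + D) * exp ((A + B) * norm x)" by (simp add: distrib_right)
  qed
qed

lemma exp_type_bilinear:
  assumes "exp_type f" "exp_type g" "\<And>x. norm (h x) \<le> norm (f x) * norm (g x)"
  shows "exp_type h"
proof -
  obtain C A where f: "0 \<le> C" "0 \<le> A" "\<And>x. norm (f x) \<le> C * exp (A * norm x)"
    using assms(1) unfolding exp_type_def by auto
  obtain D B where g: "0 \<le> D" "0 \<le> B" "\<And>x. norm (g x) \<le> D * exp (B * norm x)"
    using assms(2) unfolding exp_type_def by auto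
  show ?thesis
  proof (rule exp_typeI[of _ "C * D" "A + B"])
    fix x
    have "norm (f x) * norm (g x) \<le> (C * exp (A * norm x)) * (D * exp (B * norm x))"
      using f g by (intro mult_mono) auto
    moreover have "exp ((A + B) * norm x) = exp (A * norm x) * exp (B * norm x)"
      by (simp add: distrib_right exp_add)
    ultimately show "norm (h x) \<le> C * D * exp ((A + B) * norm x)"
      using assms(3)[of x] by (simp add: mult_ac)
  qed
qed

lemma exp_type_scaleR: "exp_type f \<Longrightarrow> exp_type g \<Longrightarrow> exp_type (\<lambda>x. f x *\<^sub>R g x)"
  by (rule exp_type_bilinear[of f g]) auto

lemma exp_type_mult:
  fixes f g :: "'b::real_normed_vector \<Rightarrow> 'c::real_normed_algebra"
  shows "exp_type f \<Longrightarrow> exp_type g \<Longrightarrow> exp_type (\<lambda>x. f x * g x)"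
  by (rule exp_type_bilinear[of f g]) (auto intro: norm_mult_ineq)

lemma exp_type_minus: "exp_type f \<Longrightarrow> exp_type (\<lambda>x. - f x)"
  by (erule exp_type_mono) simp

lemma exp_type_diff: "exp_type f \<Longrightarrow> exp_type g \<Longrightarrow> exp_type (\<lambda>x. f x - g x)"
  using exp_type_add[OF _ exp_type_minus, of f g] by simp

lemma exp_type_sum: "finite I \<Longrightarrow> (\<And>i. i \<in> I \<Longrightarrow> exp_type (f i)) \<Longrightarrow> exp_type (\<lambda>x. \<Sum>i\<in>I. f i x)"
  by (induction rule: finite_induct) (auto intro: exp_type_add)

lemma exp_type_inner: "exp_type f \<Longrightarrow> exp_type g \<Longrightarrow> exp_type (\<lambda>x. f x \<bullet> g x)"
  by (rule exp_type_bilinear[of f g]) (auto intro: Cauchy_Schwarz_ineq2)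

lemma exp_type_id: "exp_type (\<lambda>x. x)"
  by (rule exp_type_mono[OF exp_type_norm]) simp

lemma exp_type_comp:
  assumes "exp_type f" "\<And>x. norm (g x) \<le> norm x"
  shows "exp_type (\<lambda>x. f (g x))"
proof -
  obtain C A where f: "0 \<le> C" "0 \<le> A" "\<And>x. norm (f x) \<le> C * exp (A * norm x)"
    using assms(1) unfolding exp_type_def by auto
  have "norm (f (g x)) \<le> C * exp (A * norm x)" for x
  proof (rule order_trans[OF f(3)])
    show "C * exp (A * norm (g x)) \<le> C * exp (A * norm x)"
      using f assms(2) by (intro mult_left_mono) (auto intro!: mult_left_mono)
  qed
  then show ?thesis by (rule exp_typeI)
qed

section \<open>Integrability against Gaussians\<close>

lemma nn_integral_inv_square: "(\<integral>\<^sup>+t. ennreal (1 / (1 + t\<^sup>2)) \<partial>lborel) < \<infinity>"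
proof -
  have m: "(\<lambda>t::real. 1 / (1 + t\<^sup>2)) \<in> borel_measurable borel" by measurable
  have D: "DERIV arctan t :> 1 / (1 + t\<^sup>2)" for t
    using DERIV_arctan[of t] by (simp add: inverse_eq_divide)
  have h: "(\<integral>\<^sup>+t. ennreal (1 / (1 + t\<^sup>2)) * indicator {0..} t \<partial>lborel) = ennreal (pi / 2 - arctan 0)"
    by (rule nn_integral_FTC_atLeast[OF m D _ tendsto_arctan_at_top]) (auto simp: add_nonneg_nonneg)
  have "(\<integral>\<^sup>+t. ennreal (1 / (1 + t\<^sup>2)) * indicator {..0} t \<partial>lborel) =
      (\<integral>\<^sup>+t. ennreal (1 / (1 + t\<^sup>2)) * indicator {0..} t \<partial>lborel)"
    by (subst lborel_distr_uminus[symmetric], subst nn_integral_distr)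
       (auto intro!: nn_integral_cong simp: indicator_def)
  moreover have "(\<integral>\<^sup>+t. ennreal (1 / (1 + t\<^sup>2)) \<partial>lborel) \<le>
     (\<integral>\<^sup>+t. ennreal (1 / (1 + t\<^sup>2)) * indicator {0..} t + ennreal (1 / (1 + t\<^sup>2)) * indicator {..0} t \<partial>lborel)"
    by (intro nn_integral_mono) (auto simp: indicator_def)
  moreover have "(\<integral>\<^sup>+t. ennreal (1 / (1 + t\<^sup>2)) * indicator {0..} t + ennreal (1 / (1 + t\<^sup>2)) * indicator {..0} t \<partial>lborel) =
     (\<integral>\<^sup>+t. ennreal (1 / (1 + t\<^sup>2)) * indicator {0..} t \<partial>lborel) + (\<integral>\<^sup>+t. ennreal (1 / (1 + t\<^sup>2)) * indicator {..0} t \<partial>lborel)"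
    by (rule nn_integral_add) (use m in auto)
  ultimately have "(\<integral>\<^sup>+t. ennreal (1 / (1 + t\<^sup>2)) \<partial>lborel) \<le>
      ennreal (pi / 2 - arctan 0) + ennreal (pi / 2 - arctan 0)"
    unfolding h by (simp only:)
  also have "\<dots> < \<infinity>"
    by (simp add: ennreal_plus[symmetric] del: ennreal_plus)
  finally show ?thesis .
qed

text \<open>Each factor \<open>1 + (x \<bullet> b)\<^sup>2\<close> is at most
  \<open>(1 + norm x)\<^sup>2\<close>, so a product of the one-dimensional functions
  \<open>1 / (1 + t\<^sup>2)\<close> dominates; this is the origin of the exponent
  \<open>2 * CARD('n)\<close>.\<close>

lemma integrable_poly_decay:
  "integrable lborel (\<lambda>x :: real ^ 'n. 1 / (1 + norm x) ^ (2 * CARD('n)))"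
proof (rule integrableI_bounded)
  have le: "(\<Prod>b\<in>(Basis :: (real ^ 'n) set). 1 + (x \<bullet> b)\<^sup>2) \<le> (1 + norm x) ^ (2 * CARD('n))" for x :: "real ^ 'n"
  proof -
    have "(\<Prod>b\<in>(Basis :: (real ^ 'n) set). 1 + (x \<bullet> b)\<^sup>2) \<le> (\<Prod>b\<in>(Basis :: (real ^ 'n) set). (1 + norm x)\<^sup>2)"
    proof (rule prod_mono, safe)
      fix b :: "real ^ 'n" assume b: "b \<in> Basis"
      have "(x \<bullet> b)\<^sup>2 \<le> (norm x)\<^sup>2"
        using Basis_le_norm[OF b, of x] by (simp add: abs_le_square_iff[symmetric])
      then show "1 + (x \<bullet> b)\<^sup>2 \<le> (1 + norm x)\<^sup>2" by (simp add: power2_sum add_increasing2)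
    qed auto
    then show ?thesis by (simp add: power_mult)
  qed
  have pos: "0 < (\<Prod>b\<in>(Basis :: (real ^ 'n) set). 1 + (x \<bullet> b)\<^sup>2)" for x :: "real ^ 'n"
    by (intro prod_pos) (auto intro: add_pos_nonneg)
  have "(\<integral>\<^sup>+x. ennreal (norm (1 / (1 + norm (x :: real ^ 'n)) ^ (2 * CARD('n)))) \<partial>lborel) \<le>
      (\<integral>\<^sup>+x. (\<Prod>b\<in>(Basis :: (real ^ 'n) set). ennreal (1 / (1 + (x \<bullet> b)\<^sup>2))) \<partial>lborel)"
  proof (intro nn_integral_mono)
    fix x :: "real ^ 'n"
    have "1 / (1 + norm x) ^ (2 * CARD('n)) \<le> 1 / (\<Prod>b\<in>(Basis :: (real ^ 'n) set). 1 + (x \<bullet> b)\<^sup>2)"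
      using pos[of x] le[of x] by (intro divide_left_mono) (auto intro!: mult_pos_pos zero_less_power add_pos_nonneg)
    then show "ennreal (norm (1 / (1 + norm x) ^ (2 * CARD('n)))) \<le> (\<Prod>b\<in>Basis. ennreal (1 / (1 + (x \<bullet> b)\<^sup>2)))"
      by (simp add: prod_ennreal prod_dividef ennreal_leI)
  qed
  also have "\<dots> = (\<Prod>b\<in>(Basis :: (real ^ 'n) set). \<integral>\<^sup>+t. ennreal (1 / (1 + t\<^sup>2)) \<partial>lborel)"
    by (rule nn_integral_lborel_prod) auto
  also have "\<dots> < \<infinity>"
    using nn_integral_inv_square by (simp add: power_less_top_ennreal)
  finally show "(\<integral>\<^sup>+x. ennreal (norm (1 / (1 + norm (x :: real ^ 'n)) ^ (2 * CARD('n)))) \<partial>lborel) < \<infinity>" .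
qed measurable

lemma gauss_exp_poly_bound:
  assumes "0 < s"
  shows "\<exists>C. \<forall>x :: real ^ 'n. gauss s x * exp (A * norm x) \<le> C / (1 + norm x) ^ m"
proof -
  \<comment> \<open>The power is absorbed by \<open>(1 + r) ^ m \<le> fact m * exp (1 + r)\<close>;
    completing the square then bounds \<open>(A + 1) * r - s * r\<^sup>2 / 2\<close> by
    \<open>(A + 1)\<^sup>2 / (2 * s)\<close>.\<close>
  define C where "C = fact m * exp (1 + (A + 1)\<^sup>2 / (2 * s))"
  have "gauss s x * exp (A * norm x) \<le> C / (1 + norm x) ^ m" for x :: "real ^ 'n"
  proof -
    define r where "r = norm x"
    have r: "0 \<le> r" by (simp add: r_def)
    have sm: "summable (\<lambda>n. (1 + r) ^ n /\<^sub>R fact n)" by (rule summable_exp_generic)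
    have "(1 + r) ^ m / fact m \<le> exp (1 + r)"
      unfolding exp_def using sum_le_suminf[OF sm, of "{m}"] r by (simp add: divide_inverse mult.commute)
    then have p: "(1 + r) ^ m \<le> fact m * exp (1 + r)" by (simp add: field_simps)
    have q: "0 \<le> (s * r - (A + 1))\<^sup>2 / (2 * s)" using assms by simp
    have "(s * r - (A + 1))\<^sup>2 / (2 * s) = s * r\<^sup>2 / 2 - r * (A + 1) + (A + 1)\<^sup>2 / (2 * s)"
      using assms by (simp add: power2_eq_square field_simps)
    with q have "(- s * r\<^sup>2 / 2) + A * r + (1 + r) \<le> 1 + (A + 1)\<^sup>2 / (2 * s)"
      by (simp add: algebra_simps)
    then have "exp ((- s * r\<^sup>2 / 2) + A * r + (1 + r)) \<le> exp (1 + (A + 1)\<^sup>2 / (2 * s))" by simp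
    then have "exp (- s * r\<^sup>2 / 2) * exp (A * r) * exp (1 + r) \<le> exp (1 + (A + 1)\<^sup>2 / (2 * s))"
      by (simp only: exp_add)
    moreover define q where "q = exp (- s * r\<^sup>2 / 2) * exp (A * r)"
    ultimately have "fact m * (q * exp (1 + r)) \<le> C"
      unfolding C_def by (intro mult_left_mono) auto
    moreover have "q * (1 + r) ^ m \<le> q * (fact m * exp (1 + r))"
      by (rule mult_left_mono[OF p]) (simp add: q_def)
    ultimately have "q * (1 + r) ^ m \<le> C"
      by (simp add: mult.left_commute)
    then have "exp (- s * r\<^sup>2 / 2) * exp (A * r) * (1 + r) ^ m \<le> C"
      by (simp add: q_def)
    then show ?thesis
      using r by (simp add: gauss_def r_def[symmetric] pos_le_divide_eq)
  qed
  then show ?thesis by blast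
qed

lemma gauss_measurable [measurable]: "gauss s \<in> borel_measurable borel"
  unfolding gauss_def[abs_def] by measurable

lemma gauss_pos: "0 < gauss s x" by (simp add: gauss_def)

lemma integrable_gauss_exp:
  assumes "0 < s"
  shows "integrable lborel (\<lambda>x :: real ^ 'n. gauss s x * exp (A * norm x))"
proof -
  obtain C where C: "\<And>x :: real ^ 'n. gauss s x * exp (A * norm x) \<le> C / (1 + norm x) ^ (2 * CARD('n))"
    using gauss_exp_poly_bound[OF assms] by blast
  show ?thesis
  proof (rule Bochner_Integration.integrable_bound)
    show "integrable lborel (\<lambda>x :: real ^ 'n. C * (1 / (1 + norm x) ^ (2 * CARD('n))))"
      by (intro integrable_mult_right integrable_poly_decay)
    show "AE x :: real ^ 'n in lborel. norm (gauss s x * exp (A * norm x)) \<le> norm (C * (1 / (1 + norm x) ^ (2 * CARD('n))))"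
    proof (intro AE_I2)
      fix x :: "real ^ 'n"
      have "norm (gauss s x * exp (A * norm x)) = gauss s x * exp (A * norm x)"
        using gauss_pos[of s x] by simp
      also have "\<dots> \<le> C / (1 + norm x) ^ (2 * CARD('n))" by (rule C)
      also have "\<dots> \<le> norm (C * (1 / (1 + norm x) ^ (2 * CARD('n))))" by (simp add: divide_right_mono)
      finally show "norm (gauss s x * exp (A * norm x)) \<le> norm (C * (1 / (1 + norm x) ^ (2 * CARD('n))))" .
    qed
  qed measurable
qed

lemma integrable_gauss_exp_type:
  fixes f :: "real ^ 'n \<Rightarrow> 'b::{banach, second_countable_topology}"
  assumes "0 < s" "exp_type f" "f \<in> borel_measurable borel"
  shows "integrable lborel (\<lambda>x. gauss s x *\<^sub>R f x)"
proof -
  obtain C A where f: "0 \<le> C" "\<And>x. norm (f x) \<le> C * exp (A * norm x)"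
    using assms(2) unfolding exp_type_def by auto
  show ?thesis
  proof (rule Bochner_Integration.integrable_bound)
    show "integrable lborel (\<lambda>x. C * (gauss s x * exp (A * norm x)) :: real)"
      by (intro integrable_mult_right integrable_gauss_exp assms)
    show "AE x in lborel. norm (gauss s x *\<^sub>R f x) \<le> norm (C * (gauss s x * exp (A * norm x)))"
    proof (intro AE_I2)
      fix x
      have "gauss s x * norm (f x) \<le> gauss s x * (C * exp (A * norm x))"
        using f gauss_pos[of s x] by (intro mult_left_mono) auto
      then show "norm (gauss s x *\<^sub>R f x) \<le> norm (C * (gauss s x * exp (A * norm x)))"
        using f(1) gauss_pos[of s x] by (simp add: abs_mult mult_ac)
    qed
  qed (use assms(3) in measurable)
qed

lemma difference_quotient_tendsto:
  fixes F :: "real ^ 'n \<Rightarrow> 'b::real_normed_vector"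
  assumes "(F has_derivative F') (at x)"
  shows "(\<lambda>i. real (Suc i) *\<^sub>R (F (x + (1 / real (Suc i)) *\<^sub>R \<eta>) - F x)) \<longlonglongrightarrow> F' \<eta>"
proof -
  have "((\<lambda>t. x + t *\<^sub>R \<eta>) has_derivative (\<lambda>h. h *\<^sub>R \<eta>)) (at 0)"
    by (auto intro!: derivative_eq_intros)
  moreover have "(F has_derivative F') (at (x + 0 *\<^sub>R \<eta>))" using assms by simp
  ultimately have "((\<lambda>t. F (x + t *\<^sub>R \<eta>)) has_derivative (\<lambda>h. F' (h *\<^sub>R \<eta>))) (at 0)"
    by (rule has_derivative_compose)
  then have "((\<lambda>t. F (x + t *\<^sub>R \<eta>)) has_vector_derivative F' \<eta>) (at 0)"
    using has_derivative_linear[OF assms] by (simp add: has_vector_derivative_def linear_scale)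
  then have "(\<lambda>h. norm (F (x + h *\<^sub>R \<eta>) - F x - h *\<^sub>R F' \<eta>) / norm h) \<midarrow>0\<rightarrow> 0"
    by (simp add: has_vector_derivative_def has_derivative_at)
  then have "(\<lambda>h. norm ((F (x + h *\<^sub>R \<eta>) - F x) /\<^sub>R h - F' \<eta>)) \<midarrow>0\<rightarrow> 0"
  proof (rule Lim_transform_eventually)
    have "norm (F (x + h *\<^sub>R \<eta>) - F x - h *\<^sub>R F' \<eta>) / norm h = norm ((F (x + h *\<^sub>R \<eta>) - F x) /\<^sub>R h - F' \<eta>)"
      if "h \<noteq> 0" for h
    proof -
      have "(F (x + h *\<^sub>R \<eta>) - F x) /\<^sub>R h - F' \<eta> = inverse h *\<^sub>R (F (x + h *\<^sub>R \<eta>) - F x - h *\<^sub>R F' \<eta>)"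
        using that by (simp add: scaleR_diff_right)
      then show ?thesis by (simp add: divide_inverse mult.commute)
    qed
    then show "\<forall>\<^sub>F h in at 0. norm (F (x + h *\<^sub>R \<eta>) - F x - h *\<^sub>R F' \<eta>) / norm h = norm ((F (x + h *\<^sub>R \<eta>) - F x) /\<^sub>R h - F' \<eta>)"
      by (simp add: eventually_at_filter)
  qed
  then have 1: "((\<lambda>t. (F (x + t *\<^sub>R \<eta>) - F x) /\<^sub>R t) \<longlongrightarrow> F' \<eta>) (at 0)"
    by (rule LIM_zero_cancel[OF tendsto_norm_zero_cancel])
  have "filterlim (\<lambda>i. 1 / real (Suc i)) (at 0) sequentially"
    using LIMSEQ_inverse_real_of_nat unfolding filterlim_at inverse_eq_divide by simp
  from filterlim_compose[OF 1 this]
  have "(\<lambda>i. (F (x + (1 / real (Suc i)) *\<^sub>R \<eta>) - F x) /\<^sub>R (1 / real (Suc i))) \<longlonglongrightarrow> F' \<eta>" .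
  then show ?thesis by (simp only: inverse_divide div_by_1)
qed

lemma borel_measurable_derivative:
  fixes F :: "real ^ 'n \<Rightarrow> complex"
  assumes F: "\<And>x. (F has_derivative F' x) (at x)"
  shows "(\<lambda>x. F' x \<eta>) \<in> borel_measurable borel"
proof (rule borel_measurable_LIMSEQ_metric[OF _ difference_quotient_tendsto[OF F]])
  have "continuous_on UNIV F"
    using F by (intro has_derivative_continuous_on) (auto intro: has_derivative_at_withinI)
  then have [measurable]: "F \<in> borel_measurable borel" by (rule borel_measurable_continuous_onI)
  show "(\<lambda>x. real (Suc i) *\<^sub>R (F (x + (1 / real (Suc i)) *\<^sub>R \<eta>) - F x)) \<in> borel_measurable borel" for i
    by measurable
qed

section \<open>Translation invariance and integration by parts\<close>

lemma integral_lborel_translate: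
  fixes F :: "real ^ 'n \<Rightarrow> 'b::{banach, second_countable_topology}"
  assumes "F \<in> borel_measurable borel"
  shows "(LINT x|lborel. F (x + a)) = (LINT x|lborel. F x)"
  using integral_distr[of "(+) a" lborel borel F] assms
  by (simp add: lborel_distr_plus add.commute)

lemma integrable_lborel_translate:
  fixes F :: "real ^ 'n \<Rightarrow> 'b::{banach, second_countable_topology}"
  assumes "integrable lborel F"
  shows "integrable lborel (\<lambda>x. F (x + a))"
  using integrable_distr_eq[of "(+) a" lborel borel F] assms borel_measurable_integrable[OF assms]
  by (simp add: lborel_distr_plus add.commute)

text \<open>Translation invariance makes the integral of every difference quotient 0, and the
  quotients converge to the derivative. \<open>B\<close> bounds the derivative on a whole segment so
  that the mean value inequality gives a majorant independent of the step.\<close>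

lemma integral_derivative_zero:
  fixes F :: "real ^ 'n \<Rightarrow> complex"
  assumes F: "\<And>x. (F has_derivative F' x) (at x)" and int: "integrable lborel F"
    and B: "integrable lborel B" "\<And>x t. 0 \<le> t \<Longrightarrow> t \<le> 1 \<Longrightarrow> norm (F' (x + t *\<^sub>R \<eta>) \<eta>) \<le> B x"
  shows "(LINT x|lborel. F' x \<eta>) = 0"
proof -
  let ?D = "\<lambda>i x. real (Suc i) *\<^sub>R (F (x + (1 / real (Suc i)) *\<^sub>R \<eta>) - F x)"
  have [measurable]: "F \<in> borel_measurable borel" using int by auto
  have "norm (?D i x) \<le> B x" for i x
  proof -
    define r where "r = 1 / real (Suc i)"
    have r: "0 < r" "r \<le> 1" by (auto simp: r_def)
    have "norm (F (x + r *\<^sub>R \<eta>) - F (x + 0 *\<^sub>R \<eta>)) \<le> B x * norm (r - 0)"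
    proof (rule differentiable_bound[of "{0..r}" "\<lambda>t. F (x + t *\<^sub>R \<eta>)" "\<lambda>t h. F' (x + t *\<^sub>R \<eta>) (h *\<^sub>R \<eta>)"])
      fix t assume t: "t \<in> {0..r}"
      have "((\<lambda>t. x + t *\<^sub>R \<eta>) has_derivative (\<lambda>h. h *\<^sub>R \<eta>)) (at t within {0..r})"
        by (auto intro!: derivative_eq_intros)
      from has_derivative_compose[OF this F]
      show "((\<lambda>t. F (x + t *\<^sub>R \<eta>)) has_derivative (\<lambda>h. F' (x + t *\<^sub>R \<eta>) (h *\<^sub>R \<eta>))) (at t within {0..r})" .
      show "onorm (\<lambda>h. F' (x + t *\<^sub>R \<eta>) (h *\<^sub>R \<eta>)) \<le> B x"
      proof (rule onorm_le)
        fix h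
        have "F' (x + t *\<^sub>R \<eta>) (h *\<^sub>R \<eta>) = h *\<^sub>R F' (x + t *\<^sub>R \<eta>) \<eta>"
          using has_derivative_linear[OF F] by (rule linear_scale)
        then show "norm (F' (x + t *\<^sub>R \<eta>) (h *\<^sub>R \<eta>)) \<le> B x * norm h"
          using mult_left_mono[OF B(2)[of t x], of "\<bar>h\<bar>"] t r by (simp add: mult.commute)
      qed
    qed (use r in auto)
    then have "norm (F (x + r *\<^sub>R \<eta>) - F x) / r \<le> B x" using r by (simp add: divide_le_eq)
    moreover have "norm (?D i x) = norm (F (x + r *\<^sub>R \<eta>) - F x) / r" by (simp add: r_def del: of_nat_Suc)
    ultimately show ?thesis by simp
  qed
  then have "(\<lambda>i. LINT x|lborel. ?D i x) \<longlonglongrightarrow> (LINT x|lborel. F' x \<eta>)"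
    by (intro integral_dominated_convergence[OF borel_measurable_derivative[OF F, unfolded measurable_lborel2[symmetric]] _ B(1)]
        AE_I2 difference_quotient_tendsto F) simp_all
  moreover have "(LINT x|lborel. ?D i x) = 0" for i
    using integrable_lborel_translate[OF int] int by (simp add: integral_lborel_translate)
  ultimately show ?thesis by (simp add: LIMSEQ_const_iff)
qed

lemma integration_by_parts_gauss:
  fixes W :: "real ^ 'n \<Rightarrow> complex"
  assumes s: "0 < s" and W: "\<And>x. (W has_derivative W' x) (at x)"
    and ex: "exp_type W" "exp_type (\<lambda>x. W' x \<eta>)"
  shows "(LINT x|lborel. gauss s x *\<^sub>R (W' x \<eta> - (s * (x \<bullet> \<eta>)) *\<^sub>R W x)) = 0"
proof -
  define F' where "F' x h = gauss s x *\<^sub>R (W' x h - (s * (x \<bullet> h)) *\<^sub>R W x)" for x h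
  have F: "((\<lambda>x. gauss s x *\<^sub>R W x) has_derivative F' x) (at x)" for x
    unfolding gauss_def[abs_def] F'_def[abs_def] power2_norm_eq_inner
    by (rule derivative_eq_intros W refl)+ (auto simp: fun_eq_iff inner_commute algebra_simps intro: W)
  have "continuous_on UNIV W"
    using W by (intro has_derivative_continuous_on) (auto intro: has_derivative_at_withinI)
  then have Wm[measurable]: "W \<in> borel_measurable borel" by (rule borel_measurable_continuous_onI)
  have "exp_type (\<lambda>x. W' x \<eta> - (s * (x \<bullet> \<eta>)) *\<^sub>R W x)"
    by (intro exp_type_diff exp_type_scaleR exp_type_mult exp_type_inner exp_type_id exp_type_const ex)
  then obtain C A where CA: "0 \<le> C" "0 \<le> A" "\<And>x. norm (W' x \<eta> - (s * (x \<bullet> \<eta>)) *\<^sub>R W x) \<le> C * exp (A * norm x)"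
    unfolding exp_type_def by auto
  \<comment> \<open>\<open>exp (A * norm \<eta>)\<close> comes from
    \<open>norm (x + t *\<^sub>R \<eta>) \<le> norm x + norm \<eta>\<close>, and moving the Gaussian
    by \<open>t *\<^sub>R \<eta>\<close> costs at most
    \<open>exp (s * norm \<eta> * norm x)\<close>.\<close>
  define B where "B x = C * exp (A * norm \<eta>) * (gauss s x * exp ((A + s * norm \<eta>) * norm x))" for x :: "real ^ 'n"
  have "integrable lborel B"
    unfolding B_def by (intro integrable_mult_right integrable_gauss_exp s)
  moreover have "norm (F' (x + t *\<^sub>R \<eta>) \<eta>) \<le> B x" if t: "0 \<le> t" "t \<le> 1" for x t
  proof -
    let ?y = "x + t *\<^sub>R \<eta>"
    have tn: "t * norm \<eta> \<le> norm \<eta>" using t by (simp add: mult_left_le_one_le)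
    have ny: "norm ?y \<le> norm x + norm \<eta>"
      using norm_triangle_ineq[of x "t *\<^sub>R \<eta>"] t tn by simp
    have "(norm ?y)\<^sup>2 = (norm x)\<^sup>2 + 2 * (t * (x \<bullet> \<eta>)) + (t * norm \<eta>)\<^sup>2"
      unfolding power2_norm_eq_inner
      by (simp add: inner_add_left inner_add_right inner_commute power2_norm_eq_inner power_mult_distrib) (simp add: power2_eq_square)
    moreover have "- (norm x * norm \<eta>) \<le> t * (x \<bullet> \<eta>)"
    proof -
      have "\<bar>t * (x \<bullet> \<eta>)\<bar> \<le> 1 * (norm x * norm \<eta>)"
        unfolding abs_mult using t Cauchy_Schwarz_ineq2[of x \<eta>] by (intro mult_mono) auto
      then show ?thesis by linarith
    qed
    ultimately have "(norm x)\<^sup>2 - 2 * (norm x * norm \<eta>) \<le> (norm ?y)\<^sup>2" 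
      using zero_le_power2[of "t * norm \<eta>"] by linarith
    then have "s * ((norm x)\<^sup>2 - 2 * (norm x * norm \<eta>)) \<le> s * (norm ?y)\<^sup>2"
      using s by (intro mult_left_mono) auto
    then have g: "gauss s ?y \<le> gauss s x * exp (s * norm \<eta> * norm x)"
      unfolding gauss_def exp_add[symmetric] by (simp add: algebra_simps)
    have "norm (F' ?y \<eta>) \<le> gauss s ?y * (C * exp (A * norm ?y))"
      unfolding F'_def using CA(3)[of ?y] gauss_pos[of s ?y] by simp
    also have "\<dots> \<le> (gauss s x * exp (s * norm \<eta> * norm x)) * (C * exp (A * (norm x + norm \<eta>)))"
      using g CA ny gauss_pos[of s x] by (intro mult_mono) (auto intro!: mult_left_mono simp: less_imp_le)
    also have "\<dots> = B x" by (simp add: B_def algebra_simps exp_add)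
    finally show ?thesis .
  qed
  ultimately show ?thesis
    using integral_derivative_zero[OF F integrable_gauss_exp_type[OF s ex(1) Wm]] unfolding F'_def by blast
qed

text \<open>Comparing \<open>\<integral> f (T x)\<close> and \<open>\<integral> f\<close> through a convolution with the indicator of a ball only
  uses translation invariance.\<close>

lemma nn_integral_lborel_isometric_involution:
  fixes T :: "real ^ 'n \<Rightarrow> real ^ 'n" and f :: "real ^ 'n \<Rightarrow> ennreal"
  assumes T: "linear T" "\<And>x. T (T x) = x" "\<And>x. norm (T x) = norm x"
    and f[measurable]: "f \<in> borel_measurable borel"
  shows "(\<integral>\<^sup>+x. f (T x) \<partial>lborel) = (\<integral>\<^sup>+x. f x \<partial>lborel)"
proof -
  have Tadd: "T (x + y) = T x + T y" "T (x - y) = T x - T y" for x y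
    using T(1) by (auto simp: linear_add linear_diff)
  have "continuous_on UNIV T"
    using T(1) linear_continuous_on linear_conv_bounded_linear by blast
  then have [measurable]: "T \<in> borel_measurable borel" by (rule borel_measurable_continuous_onI)
  have trans: "(\<integral>\<^sup>+x. h (x + a) \<partial>lborel) = (\<integral>\<^sup>+x. h x \<partial>lborel)"
    if [measurable]: "h \<in> borel_measurable borel" for h :: "real ^ 'n \<Rightarrow> ennreal" and a
    using nn_integral_distr[of "(+) a" lborel borel h] by (simp add: lborel_distr_plus add.commute)
  define g where "g x = (indicator (ball 0 1) x :: ennreal)" for x :: "real ^ 'n"
  have [measurable]: "g \<in> borel_measurable borel" unfolding g_def[abs_def] by (rule borel_measurable_indicator) simp
  have gT: "g (T x) = g x" "g (- x) = g x" for x by (simp_all add: g_def indicator_def T)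
  define A where "A = (\<integral>\<^sup>+x. g x \<partial>lborel)"
  have A: "A = emeasure lborel (ball (0 :: real ^ 'n) 1)" by (simp add: A_def g_def[abs_def])
  have "A \<noteq> 0" unfolding A
    using open_not_negligible[of "ball (0 :: real ^ 'n) 1"] by (auto simp: negligible_iff_emeasure0)
  moreover have "A \<noteq> \<infinity>" unfolding A using emeasure_bounded_finite[of "ball (0 :: real ^ 'n) 1"] by auto
  moreover have "A * (\<integral>\<^sup>+x. f (T x) \<partial>lborel) = A * (\<integral>\<^sup>+x. f x \<partial>lborel)"
  proof -
    have "A * (\<integral>\<^sup>+x. f (T x) \<partial>lborel) = (\<integral>\<^sup>+y. g y * (\<integral>\<^sup>+x. f (T x) \<partial>lborel) \<partial>lborel)"
      unfolding A_def by (rule nn_integral_multc[symmetric]) simp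
    also have "\<dots> = (\<integral>\<^sup>+y. g y * (\<integral>\<^sup>+x. f (T x + y) \<partial>lborel) \<partial>lborel)"
    proof (rule nn_integral_cong, rule arg_cong2[where f = "(*)"], rule refl)
      fix y
      show "(\<integral>\<^sup>+x. f (T x) \<partial>lborel) = (\<integral>\<^sup>+x. f (T x + y) \<partial>lborel)"
        using trans[of "\<lambda>x. f (T x)" "T y"] by (simp add: Tadd T)
    qed
    also have "\<dots> = (\<integral>\<^sup>+y. \<integral>\<^sup>+x. g y * f (T x + y) \<partial>lborel \<partial>lborel)"
      by (rule nn_integral_cong, rule nn_integral_cmult[symmetric]) measurable
    also have "\<dots> = (\<integral>\<^sup>+x. \<integral>\<^sup>+y. g y * f (T x + y) \<partial>lborel \<partial>lborel)"
      by (rule lborel_pair.Fubini') measurable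
    also have "\<dots> = (\<integral>\<^sup>+x. \<integral>\<^sup>+y. g (y - T x) * f y \<partial>lborel \<partial>lborel)"
    proof (rule nn_integral_cong)
      fix x
      show "(\<integral>\<^sup>+y. g y * f (T x + y) \<partial>lborel) = (\<integral>\<^sup>+y. g (y - T x) * f y \<partial>lborel)"
        using trans[of "\<lambda>y. g (y - T x) * f y" "T x"] by (simp add: add.commute)
    qed
    also have "\<dots> = (\<integral>\<^sup>+y. \<integral>\<^sup>+x. g (y - T x) * f y \<partial>lborel \<partial>lborel)"
      by (rule lborel_pair.Fubini') measurable
    also have "\<dots> = (\<integral>\<^sup>+y. A * f y \<partial>lborel)"
    proof (rule nn_integral_cong)
      fix y
      have "(\<integral>\<^sup>+x. g (y - T x) * f y \<partial>lborel) = (\<integral>\<^sup>+x. g (y - T x) \<partial>lborel) * f y"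
        by (rule nn_integral_multc) measurable
      also have "(\<integral>\<^sup>+x. g (y - T x) \<partial>lborel) = (\<integral>\<^sup>+x. g (x + (- T y)) \<partial>lborel)"
      proof (rule nn_integral_cong)
        fix x
        have "g (y - T x) = g (T (y - T x))" by (simp only: gT)
        also have "\<dots> = g (- (x + (- T y)))" by (simp add: Tadd T)
        finally show "g (y - T x) = g (x + (- T y))" by (simp only: gT)
      qed
      also have "\<dots> = A" unfolding A_def by (rule trans) measurable
      finally show "(\<integral>\<^sup>+x. g (y - T x) * f y \<partial>lborel) = A * f y" .
    qed
    also have "\<dots> = A * (\<integral>\<^sup>+y. f y \<partial>lborel)" by (rule nn_integral_cmult) measurable
    finally show ?thesis .
  qed
  ultimately show ?thesis by (simp add: ennreal_mult_cancel_left)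
qed

lemma distr_lborel_isometric_involution:
  fixes T :: "real ^ 'n \<Rightarrow> real ^ 'n"
  assumes T: "linear T" "\<And>x. T (T x) = x" "\<And>x. norm (T x) = norm x"
  shows "distr lborel borel T = lborel"
proof (rule measure_eqI)
  have "continuous_on UNIV T"
    using T(1) linear_continuous_on linear_conv_bounded_linear by blast
  then have [measurable]: "T \<in> borel_measurable borel" by (rule borel_measurable_continuous_onI)
  fix X :: "(real ^ 'n) set" assume "X \<in> sets (distr lborel borel T)"
  then have [measurable]: "X \<in> sets borel" by simp
  have "emeasure (distr lborel borel T) X = (\<integral>\<^sup>+x. indicator X (T x) \<partial>lborel)"
    using nn_integral_distr[of T lborel borel "indicator X"] by simp
  also have "\<dots> = emeasure lborel X"
    by (subst nn_integral_lborel_isometric_involution[OF T]) auto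
  finally show "emeasure (distr lborel borel T) X = emeasure lborel X" .
qed simp

lemma integral_lborel_reflection:
  fixes F :: "real ^ 'n \<Rightarrow> 'b::{banach, second_countable_topology}"
  assumes "F \<in> borel_measurable borel"
  shows "(LINT x|lborel. F (reflection v x)) = (LINT x|lborel. F x)"
  using integral_distr[of "reflection v" lborel borel F] assms
  by (simp add: distr_lborel_isometric_involution[OF reflection_linear])

section \<open>The weight and the antisymmetry of Dunkl operators\<close>

definition c1exp :: "(real ^ 'n \<Rightarrow> complex) \<Rightarrow> (real ^ 'n \<Rightarrow> real ^ 'n \<Rightarrow> complex) \<Rightarrow> bool" where
  "c1exp f f' \<longleftrightarrow> (\<forall>x. (f has_derivative f' x) (at x)) \<and>
    (\<exists>C A. 0 \<le> C \<and> 0 \<le> A \<and> (\<forall>x. norm (f x) \<le> C * exp (A * norm x)) \<and>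
      (\<forall>x h. norm (f' x h) \<le> C * exp (A * norm x) * norm h))"

lemma c1expI:
  fixes f :: "real ^ 'n \<Rightarrow> complex"
  assumes "\<And>x. (f has_derivative f' x) (at x)" "\<And>x. norm (f x) \<le> C * exp (A * norm x)"
    "\<And>x h. norm (f' x h) \<le> D * exp (B * norm x) * norm h" "0 \<le> C" "0 \<le> D" "0 \<le> A" "0 \<le> B"
  shows "c1exp f f'"
proof -
  have e: "exp (A * norm x) \<le> exp ((A + B) * norm x)" "exp (B * norm x) \<le> exp ((A + B) * norm x)"
    for x :: "real ^ 'n"
    using assms by (auto intro!: mult_right_mono)
  have "norm (f x) \<le> (C + D) * exp ((A + B) * norm x)" for x
  proof -
    have "C * exp (A * norm x) \<le> (C + D) * exp ((A + B) * norm x)"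
      using assms e by (intro mult_mono) auto
    then show ?thesis using assms(2)[of x] by linarith
  qed
  moreover have "norm (f' x h) \<le> (C + D) * exp ((A + B) * norm x) * norm h" for x h
  proof -
    have "D * exp (B * norm x) * norm h \<le> (C + D) * exp ((A + B) * norm x) * norm h"
      using assms e by (intro mult_right_mono mult_mono) auto
    then show ?thesis using assms(3)[of x h] by linarith
  qed
  ultimately show ?thesis unfolding c1exp_def
    using assms by (intro conjI exI[of _ "C + D"] exI[of _ "A + B"]) auto
qed

lemma c1exp_deriv: "c1exp f f' \<Longrightarrow> (f has_derivative f' x) (at x)"
  by (simp add: c1exp_def)

lemma c1exp_exp_type: "c1exp f f' \<Longrightarrow> exp_type f"
  unfolding c1exp_def by (auto intro: exp_typeI)

lemma c1exp_exp_type_deriv: assumes "c1exp f f'" shows "exp_type (\<lambda>x. f' x h)"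
proof -
  obtain C A where "\<And>x h. norm (f' x h) \<le> C * exp (A * norm x) * norm h"
    using assms unfolding c1exp_def by blast
  then have "norm (f' x h) \<le> (C * norm h) * exp (A * norm x)" for x by (simp add: mult_ac)
  then show ?thesis by (rule exp_typeI)
qed

lemma c1exp_continuous: "c1exp f f' \<Longrightarrow> continuous_on UNIV f"
  unfolding c1exp_def
  by (intro has_derivative_continuous_on) (auto intro: has_derivative_at_withinI)

lemma c1exp_measurable: "c1exp f f' \<Longrightarrow> f \<in> borel_measurable borel"
  "c1exp f f' \<Longrightarrow> (\<lambda>x. f' x h) \<in> borel_measurable borel"
  using c1exp_continuous borel_measurable_continuous_onI borel_measurable_derivative c1exp_deriv
  by blast+

lemma c1exp_mult:
  assumes f: "c1exp f f'" and g: "c1exp g g'"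
  shows "c1exp (\<lambda>x. f x * g x) (\<lambda>x h. f' x h * g x + f x * g' x h)"
proof -
  obtain C A where C: "0 \<le> C" "0 \<le> A" "\<And>x. norm (f x) \<le> C * exp (A * norm x)"
      "\<And>x h. norm (f' x h) \<le> C * exp (A * norm x) * norm h"
    using f unfolding c1exp_def by blast
  obtain D B where D: "0 \<le> D" "0 \<le> B" "\<And>x. norm (g x) \<le> D * exp (B * norm x)"
      "\<And>x h. norm (g' x h) \<le> D * exp (B * norm x) * norm h"
    using g unfolding c1exp_def by blast
  have e: "exp ((A + B) * norm x) = exp (A * norm x) * exp (B * norm x)" for x :: "real ^ 'a"
    by (simp add: distrib_right exp_add)
  show ?thesis
  proof (rule c1expI[of _ _ "C * D" "A + B" "2 * (C * D)" "A + B"])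
    show "((\<lambda>x. f x * g x) has_derivative (\<lambda>h. f' x h * g x + f x * g' x h)) (at x)" for x
      using has_derivative_mult[OF c1exp_deriv[OF f] c1exp_deriv[OF g]] by (simp add: add.commute)
    show "norm (f x * g x) \<le> C * D * exp ((A + B) * norm x)" for x
      unfolding e norm_mult using mult_mono[OF C(3)[of x] D(3)[of x]] C(1) by (simp add: mult_ac)
    show "norm (f' x h * g x + f x * g' x h) \<le> 2 * (C * D) * exp ((A + B) * norm x) * norm h" for x h
    proof -
      have "norm (f' x h * g x) \<le> (C * exp (A * norm x) * norm h) * (D * exp (B * norm x))"
        unfolding norm_mult using C D by (intro mult_mono) auto
      moreover have "norm (f x * g' x h) \<le> (C * exp (A * norm x)) * (D * exp (B * norm x) * norm h)"
        unfolding norm_mult using C D by (intro mult_mono) auto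
      ultimately show ?thesis
        unfolding e using norm_triangle_ineq[of "f' x h * g x" "f x * g' x h"] by (simp add: mult_ac)
    qed
  qed (use C D in auto)
qed

text \<open>Mean value inequality on the ball of radius \<open>norm x\<close>, which is convex and
  contains \<open>x\<close> and its mirror image. The factor
  \<open>\<bar>v \<bullet> x\<bar>\<close> later compensates the singular quotient.\<close>

lemma c1exp_reflection_diff:
  assumes f: "c1exp f f'" and v: "v \<noteq> 0"
  shows "\<exists>C A. 0 \<le> C \<and> 0 \<le> A \<and> (\<forall>x. norm (f x - f (reflection v x)) \<le> \<bar>v \<bullet> x\<bar> * (C * exp (A * norm x)))"
proof -
  obtain C A where C: "0 \<le> C" "0 \<le> A" "\<And>x h. norm (f' x h) \<le> C * exp (A * norm x) * norm h"
    using f unfolding c1exp_def by blast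
  have "norm (f x - f (reflection v x)) \<le> \<bar>v \<bullet> x\<bar> * ((2 / norm v * C) * exp (A * norm x))" for x
  proof -
    have "norm (f x - f (reflection v x)) \<le> (C * exp (A * norm x)) * norm (x - reflection v x)"
    proof (rule differentiable_bound[of "cball 0 (norm x)" f f'])
      show "(f has_derivative f' y) (at y within cball 0 (norm x))" for y
        by (rule has_derivative_at_withinI[OF c1exp_deriv[OF f]])
      fix y :: "real ^ 'a" assume y: "y \<in> cball 0 (norm x)"
      show "onorm (f' y) \<le> C * exp (A * norm x)"
      proof (rule onorm_le)
        fix h
        have "norm (f' y h) \<le> C * exp (A * norm y) * norm h" by (rule C)
        also have "\<dots> \<le> C * exp (A * norm x) * norm h"
          using C y by (intro mult_right_mono mult_left_mono) (auto intro!: mult_left_mono)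
        finally show "norm (f' y h) \<le> C * exp (A * norm x) * norm h" .
      qed
    qed auto
    moreover have "norm (x - reflection v x) = 2 * \<bar>v \<bullet> x\<bar> / norm v"
      using v by (simp add: reflection_def abs_mult inner_commute power2_eq_square)
    ultimately show ?thesis by (simp add: mult_ac)
  qed
  then show ?thesis using C by (intro exI[of _ "2 / norm v * C"] exI[of _ A]) auto
qed

text \<open>Dominated convergence along sequences of steps; the mean value inequality turns the
  bound \<open>B\<close> on the derivatives into a majorant of the difference quotients.\<close>

lemma has_vector_derivative_integral:
  fixes \<phi> :: "real \<Rightarrow> 'a \<Rightarrow> 'b::{banach, second_countable_topology}"
  assumes \<delta>: "0 < \<delta>"
    and int: "\<And>t. \<bar>t - t0\<bar> < \<delta> \<Longrightarrow> integrable M (\<phi> t)"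
    and deriv: "\<And>t x. \<bar>t - t0\<bar> < \<delta> \<Longrightarrow> ((\<lambda>t. \<phi> t x) has_vector_derivative \<phi>' t x) (at t)"
    and meas: "\<phi>' t0 \<in> borel_measurable M"
    and B: "\<And>t x. \<bar>t - t0\<bar> < \<delta> \<Longrightarrow> norm (\<phi>' t x) \<le> B x" "integrable M B"
  shows "((\<lambda>t. integral\<^sup>L M (\<phi> t)) has_vector_derivative integral\<^sup>L M (\<phi>' t0)) (at t0)"
proof -
  let ?q = "\<lambda>\<phi> h. (\<phi> (t0 + h) - \<phi> t0) /\<^sub>R h"
  have quot: "(g has_vector_derivative g') (at t0) \<longleftrightarrow> (?q g \<longlongrightarrow> g') (at 0)" for g :: "real \<Rightarrow> 'b" and g'
  proof -
    have eq: "norm (g (t0 + h) - g t0 - h *\<^sub>R g') / norm h = norm (?q g h - g')" if "h \<noteq> 0" for h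
    proof -
      have "?q g h - g' = inverse h *\<^sub>R (g (t0 + h) - g t0 - h *\<^sub>R g')"
        using that by (simp add: scaleR_diff_right)
      then show ?thesis by (simp add: divide_inverse mult.commute)
    qed
    have "(g has_vector_derivative g') (at t0) \<longleftrightarrow> (\<lambda>h. norm (g (t0 + h) - g t0 - h *\<^sub>R g') / norm h) \<midarrow>0\<rightarrow> 0"
      by (simp add: has_vector_derivative_def has_derivative_at bounded_linear_scaleR_left)
    also have "\<dots> \<longleftrightarrow> (\<lambda>h. norm (?q g h - g')) \<midarrow>0\<rightarrow> 0"
      by (rule LIM_equal) (use eq in auto)
    also have "\<dots> \<longleftrightarrow> (?q g \<longlongrightarrow> g') (at 0)"
      by (simp add: tendsto_norm_zero_iff LIM_zero_iff)
    finally show ?thesis .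
  qed
  have "(?q (\<lambda>t. integral\<^sup>L M (\<phi> t)) \<longlongrightarrow> integral\<^sup>L M (\<phi>' t0)) (at 0)"
    unfolding tendsto_at_iff_sequentially o_def
  proof (intro allI impI)
    fix X :: "nat \<Rightarrow> real" assume X0: "\<forall>i. X i \<in> UNIV - {0}" and X: "X \<longlonglongrightarrow> 0"
    from X \<delta> obtain N where N: "\<And>n. n \<ge> N \<Longrightarrow> \<bar>X n\<bar> < \<delta>"
      unfolding LIMSEQ_def by (auto simp: dist_real_def)
    let ?s = "\<lambda>n x. (\<phi> (t0 + X (n + N)) x - \<phi> t0 x) /\<^sub>R X (n + N)"
    have "(\<lambda>n. integral\<^sup>L M (?s n)) \<longlonglongrightarrow> integral\<^sup>L M (\<phi>' t0)"
    proof (rule integral_dominated_convergence[OF meas _ B(2)])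
      show "?s n \<in> borel_measurable M" for n
        using int[of t0] int[of "t0 + X (n + N)"] N \<delta>
        by (intro borel_measurable_scaleR borel_measurable_diff borel_measurable_integrable) auto
      show "AE x in M. (\<lambda>n. ?s n x) \<longlonglongrightarrow> \<phi>' t0 x"
      proof (intro AE_I2)
        fix x
        have "(?q (\<lambda>t. \<phi> t x) \<longlongrightarrow> \<phi>' t0 x) (at 0)"
          using deriv[of t0 x] \<delta> quot by simp
        then have "(\<lambda>n. ?q (\<lambda>t. \<phi> t x) (X n)) \<longlonglongrightarrow> \<phi>' t0 x"
          using X X0 unfolding tendsto_at_iff_sequentially o_def by blast
        from LIMSEQ_ignore_initial_segment[OF this, of N] show "(\<lambda>n. ?s n x) \<longlonglongrightarrow> \<phi>' t0 x" .
      qed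
      show "AE x in M. norm (?s n x) \<le> B x" for n
      proof (intro AE_I2)
        fix x
        define h where "h = X (n + N)"
        have h: "\<bar>h\<bar> < \<delta>" "h \<noteq> 0" using N X0 by (auto simp: h_def)
        have "norm (\<phi> (t0 + h) x - \<phi> t0 x) \<le> B x * norm (t0 + h - t0)"
        proof (rule differentiable_bound[of "ball t0 \<delta>" "\<lambda>t. \<phi> t x" "\<lambda>t k. k *\<^sub>R \<phi>' t x"])
          fix t assume "t \<in> ball t0 \<delta>"
          then have t: "\<bar>t - t0\<bar> < \<delta>" by (simp add: dist_real_def abs_minus_commute)
          show "((\<lambda>t. \<phi> t x) has_derivative (\<lambda>k. k *\<^sub>R \<phi>' t x)) (at t within ball t0 \<delta>)"
            using deriv[OF t, of x] has_derivative_at_withinI unfolding has_vector_derivative_def by blast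
          show "onorm (\<lambda>k. k *\<^sub>R \<phi>' t x) \<le> B x"
            by (rule onorm_le) (use mult_left_mono[OF B(1)[OF t, of x]] in \<open>simp add: mult.commute[of "B x"]\<close>)
        qed (use h \<delta> in \<open>auto simp: dist_real_def\<close>)
        then have "norm (\<phi> (t0 + h) x - \<phi> t0 x) / \<bar>h\<bar> \<le> B x" using h by (simp add: divide_le_eq)
        then show "norm (?s n x) \<le> B x" by (simp add: h_def divide_inverse mult.commute)
      qed
    qed
    moreover have 2: "integral\<^sup>L M (?s n) = ?q (\<lambda>t. integral\<^sup>L M (\<phi> t)) (X (n + N))" for n
      using int[of t0] int[of "t0 + X (n + N)"] N \<delta> by simp
    ultimately have "(\<lambda>n. ?q (\<lambda>t. integral\<^sup>L M (\<phi> t)) (X (n + N))) \<longlonglongrightarrow> integral\<^sup>L M (\<phi>' t0)"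
      by (simp only: 2)
    then show "(\<lambda>n. ?q (\<lambda>t. integral\<^sup>L M (\<phi> t)) (X n)) \<longlonglongrightarrow> integral\<^sup>L M (\<phi>' t0)"
      by (rule LIMSEQ_offset)
  qed
  then show ?thesis by (simp add: quot)
qed

context dunkl_setting
begin

abbreviation w where "w \<equiv> dunkl_weight P k"

section \<open>The regularised weight\<close>

text \<open>The product of \<open>(v \<bullet> x)\<^sup>2 + \<epsilon>\<close> to the powers
  \<open>k v\<close>, written as an exponential. For small \<open>k v\<close> the weight is not
  differentiable on the hyperplanes, whereas \<open>wreg\<close> is smooth for positive
  \<open>\<epsilon>\<close>, has the same reflection symmetry and tends to the weight as
  \<open>\<epsilon>\<close> tends to 0.\<close>

definition wreg :: "real \<Rightarrow> real ^ 'n \<Rightarrow> real" where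
  "wreg \<epsilon> x = exp (\<Sum>v\<in>P. k v * ln ((v \<bullet> x)\<^sup>2 + \<epsilon>))"

definition growth_const where "growth_const = 2 * (\<Sum>v\<in>P. k v * norm v)"

lemma wreg_pos: "0 < wreg \<epsilon> x" by (simp add: wreg_def)

lemma wreg_has_derivative:
  assumes "0 < \<epsilon>"
  shows "(wreg \<epsilon> has_derivative (\<lambda>h. wreg \<epsilon> x * (\<Sum>v\<in>P. k v * (2 * (v \<bullet> x) * (v \<bullet> h) / ((v \<bullet> x)\<^sup>2 + \<epsilon>))))) (at x)"
proof -
  have "((\<lambda>x. k v * ln ((v \<bullet> x)\<^sup>2 + \<epsilon>)) has_derivative
      (\<lambda>h. k v * (2 * (v \<bullet> x) * (v \<bullet> h) / ((v \<bullet> x)\<^sup>2 + \<epsilon>)))) (at x)" for v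
  proof -
    have pos: "0 < (v \<bullet> x)\<^sup>2 + \<epsilon>" using assms by (intro add_nonneg_pos) auto
    have "((\<lambda>x. (v \<bullet> x)\<^sup>2 + \<epsilon>) has_derivative (\<lambda>h. 2 * (v \<bullet> x) * (v \<bullet> h))) (at x)"
      by (auto intro!: derivative_eq_intros)
    from has_derivative_mult_right[OF has_derivative_ln[OF pos this], of "k v"]
    show ?thesis by (simp add: divide_inverse mult_ac)
  qed
  then have "((\<lambda>x. \<Sum>v\<in>P. k v * ln ((v \<bullet> x)\<^sup>2 + \<epsilon>)) has_derivative
      (\<lambda>h. \<Sum>v\<in>P. k v * (2 * (v \<bullet> x) * (v \<bullet> h) / ((v \<bullet> x)\<^sup>2 + \<epsilon>)))) (at x)"
    by (intro has_derivative_sum)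
  from has_derivative_exp[OF this] show ?thesis
    unfolding wreg_def[abs_def] by (rule has_derivative_eq_rhs) (rule ext, rule mult.commute)
qed

text \<open>With \<open>a = \<bar>v \<bullet> x\<bar>\<close> and \<open>\<epsilon> \<le> 1\<close>
  each base is at most \<open>(1 + a)\<^sup>2 \<le> exp (2 * a)\<close>, which is where
  \<open>growth_const\<close> comes from. The bound does not depend on \<open>\<epsilon>\<close>, as
  dominated convergence requires.\<close>

lemma wreg_bound:
  assumes "0 < \<epsilon>" "\<epsilon> \<le> 1"
  shows "wreg \<epsilon> x \<le> exp (growth_const * norm x)"
proof -
  have "k v * ln ((v \<bullet> x)\<^sup>2 + \<epsilon>) \<le> k v * (2 * (norm v * norm x))" if "v \<in> P" for v
  proof (rule mult_left_mono[OF _ k_nonneg[OF that]])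
    define a where "a = \<bar>v \<bullet> x\<bar>"
    have "(v \<bullet> x)\<^sup>2 + \<epsilon> \<le> (1 + a)\<^sup>2"
      using assms by (simp add: a_def power2_sum)
    also have "\<dots> \<le> (exp a)\<^sup>2"
      using exp_ge_add_one_self[of a] by (intro power_mono) (auto simp: a_def)
    also have "\<dots> = exp (2 * a)" by (simp add: exp_double)
    finally have "ln ((v \<bullet> x)\<^sup>2 + \<epsilon>) \<le> ln (exp (2 * a))"
      using assms by (subst ln_le_cancel_iff) (auto simp: add_nonneg_pos)
    then show "ln ((v \<bullet> x)\<^sup>2 + \<epsilon>) \<le> 2 * (norm v * norm x)"
      using Cauchy_Schwarz_ineq2[of v x] by (simp add: a_def)
  qed
  then have "(\<Sum>v\<in>P. k v * ln ((v \<bullet> x)\<^sup>2 + \<epsilon>)) \<le> (\<Sum>v\<in>P. k v * (2 * (norm v * norm x)))"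
    by (rule sum_mono)
  also have "\<dots> = growth_const * norm x"
    by (simp add: growth_const_def sum_distrib_left sum_distrib_right mult_ac)
  finally show ?thesis by (simp add: wreg_def)
qed

lemma wreg_reflect: "u \<in> P \<Longrightarrow> wreg \<epsilon> (reflection u x) = wreg \<epsilon> x"
  using sum_P_reflect[of u "\<lambda>v. ln ((v \<bullet> x)\<^sup>2 + \<epsilon>)"]
  by (simp add: wreg_def reflection_inner_swap[of u, symmetric])

lemma wreg_tendsto: "(\<lambda>i. wreg (1 / real (Suc i)) x) \<longlonglongrightarrow> w x"
proof -
  have eps: "(\<lambda>i. 1 / real (Suc i)) \<longlonglongrightarrow> 0"
    using LIMSEQ_inverse_real_of_nat by (simp only: inverse_eq_divide)
  have "(\<lambda>i. exp (k v * ln ((v \<bullet> x)\<^sup>2 + 1 / real (Suc i)))) \<longlonglongrightarrow>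
     (if k v = 0 then 1 else \<bar>x \<bullet> v\<bar> powr (2 * k v))" if v: "v \<in> P" for v
  proof (cases "k v = 0")
    case False
    then have kv: "k v > 0" using k_nonneg[OF v] by simp
    have "(\<lambda>i. ((v \<bullet> x)\<^sup>2 + 1 / real (Suc i)) powr k v) \<longlonglongrightarrow> ((v \<bullet> x)\<^sup>2 + 0) powr k v"
      by (rule tendsto_powr2[OF tendsto_add[OF tendsto_const eps] tendsto_const])
         (use kv in \<open>auto simp: add_nonneg_nonneg\<close>)
    moreover have "((v \<bullet> x)\<^sup>2 + 1 / real (Suc i)) powr k v = exp (k v * ln ((v \<bullet> x)\<^sup>2 + 1 / real (Suc i)))" for i
    proof -
      have "0 < (v \<bullet> x)\<^sup>2 + 1 / real (Suc i)" by (intro add_nonneg_pos) auto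
      then show ?thesis by (simp add: powr_def)
    qed
    moreover have "((v \<bullet> x)\<^sup>2 + 0) powr k v = \<bar>x \<bullet> v\<bar> powr (2 * k v)"
    proof (cases "x \<bullet> v = 0")
      case False
      have "\<bar>x \<bullet> v\<bar> powr (2 * k v) = (\<bar>x \<bullet> v\<bar> powr 2) powr k v" by (simp only: powr_powr)
      also have "\<bar>x \<bullet> v\<bar> powr 2 = (v \<bullet> x)\<^sup>2"
        using False powr_realpow[of "\<bar>x \<bullet> v\<bar>" 2] by (simp add: inner_commute)
      finally show ?thesis by (simp only: add_0_right)
    qed (simp add: inner_commute)
    ultimately show ?thesis using False by simp
  qed simp
  then have "(\<lambda>i. \<Prod>v\<in>P. exp (k v * ln ((v \<bullet> x)\<^sup>2 + 1 / real (Suc i)))) \<longlonglongrightarrow> w x"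
    unfolding dunkl_weight_def by (rule tendsto_prod)
  then show ?thesis by (simp add: wreg_def exp_sum)
qed

lemma eps_bounds: "0 < 1 / real (Suc i)" "1 / real (Suc i) \<le> 1" by auto

lemma w_nonneg [simp]: "0 \<le> w x"
  unfolding dunkl_weight_def by (intro prod_nonneg) auto

lemma w_bound: "w x \<le> exp (growth_const * norm x)"
  by (rule LIMSEQ_le_const2[OF wreg_tendsto]) (use wreg_bound eps_bounds in blast)

lemma wreg_continuous: "0 < \<epsilon> \<Longrightarrow> continuous_on UNIV (wreg \<epsilon>)"
  using wreg_has_derivative by (intro has_derivative_continuous_on) (blast intro: has_derivative_at_withinI)

lemma wreg_measurable: "0 < \<epsilon> \<Longrightarrow> wreg \<epsilon> \<in> borel_measurable borel"
  by (rule borel_measurable_continuous_onI[OF wreg_continuous])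

lemma w_measurable [measurable]: "w \<in> borel_measurable borel"
  by (rule borel_measurable_LIMSEQ_real[OF wreg_tendsto wreg_measurable[OF eps_bounds(1)]])

lemma exp_type_wreg: "0 < \<epsilon> \<Longrightarrow> \<epsilon> \<le> 1 \<Longrightarrow> exp_type (wreg \<epsilon>)"
  using wreg_bound wreg_pos by (intro exp_typeI[of _ 1 growth_const]) (simp add: less_imp_le)

lemma exp_type_w: "exp_type w"
  using w_bound by (intro exp_typeI[of _ 1 growth_const]) simp

text \<open>A regularisation of \<open>1 / (v \<bullet> x)\<close>: the logarithmic derivative of
  \<open>wreg \<epsilon>\<close> in the direction \<open>h\<close> is the sum of
  \<open>2 * k v * (v \<bullet> h) * rho \<epsilon> v x\<close>.\<close>

definition rho :: "real \<Rightarrow> real ^ 'n \<Rightarrow> real ^ 'n \<Rightarrow> real" where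
  "rho \<epsilon> v x = (v \<bullet> x) / ((v \<bullet> x)\<^sup>2 + \<epsilon>)"

lemma rho_reflect: "rho \<epsilon> v (reflection v x) = - rho \<epsilon> v x"
  by (simp add: rho_def)

lemma rho_measurable [measurable]: "rho \<epsilon> v \<in> borel_measurable borel"
  unfolding rho_def[abs_def] by measurable

lemma exp_type_rho: "0 < \<epsilon> \<Longrightarrow> exp_type (rho \<epsilon> v)"
proof -
  assume e: "0 < \<epsilon>"
  have "\<bar>rho \<epsilon> v x\<bar> \<le> \<bar>(1 / \<epsilon>) * (v \<bullet> x)\<bar>" for x
  proof -
    have "\<bar>v \<bullet> x\<bar> / ((v \<bullet> x)\<^sup>2 + \<epsilon>) \<le> \<bar>v \<bullet> x\<bar> / \<epsilon>"
      using e by (intro divide_left_mono) (auto simp: add_nonneg_pos)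
    then show ?thesis using e by (simp add: rho_def abs_mult add_nonneg_pos abs_of_pos)
  qed
  moreover have "exp_type (\<lambda>x. (1 / \<epsilon>) * (v \<bullet> x))"
    by (intro exp_type_mult exp_type_const exp_type_inner exp_type_id)
  ultimately show ?thesis using exp_type_mono[of "\<lambda>x. (1 / \<epsilon>) * (v \<bullet> x)" "rho \<epsilon> v"] by simp
qed

lemma rho_le: "0 < \<epsilon> \<Longrightarrow> \<bar>rho \<epsilon> v x\<bar> * \<bar>v \<bullet> x\<bar> \<le> 1"
proof -
  assume e: "0 < \<epsilon>"
  have "\<bar>rho \<epsilon> v x\<bar> * \<bar>v \<bullet> x\<bar> = (v \<bullet> x)\<^sup>2 / ((v \<bullet> x)\<^sup>2 + \<epsilon>)"
  proof -
    have "\<bar>rho \<epsilon> v x\<bar> = \<bar>v \<bullet> x\<bar> / ((v \<bullet> x)\<^sup>2 + \<epsilon>)"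
      using e by (simp add: rho_def abs_of_pos add_nonneg_pos)
    moreover have "\<bar>v \<bullet> x\<bar> * \<bar>v \<bullet> x\<bar> = (v \<bullet> x)\<^sup>2" by (simp add: power2_eq_square)
    ultimately show ?thesis by (metis times_divide_eq_left)
  qed
  also have "\<dots> \<le> 1" using e by (simp add: divide_le_eq add_nonneg_pos)
  finally show ?thesis .
qed

text \<open>On the hyperplane both sides are 0, the right one because \<open>1 / 0 = 0\<close>; this
  agrees with the convention in \<open>dop\<close>.\<close>

lemma rho_tendsto: "(\<lambda>i. rho (1 / real (Suc i)) v x) \<longlonglongrightarrow> 1 / (v \<bullet> x)"
proof (cases "v \<bullet> x = 0")
  case False
  have eps: "(\<lambda>i. 1 / real (Suc i)) \<longlonglongrightarrow> 0"
    using LIMSEQ_inverse_real_of_nat by (simp only: inverse_eq_divide)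
  have "(\<lambda>i. rho (1 / real (Suc i)) v x) \<longlonglongrightarrow> (v \<bullet> x) / ((v \<bullet> x)\<^sup>2 + 0)"
    unfolding rho_def by (intro tendsto_divide tendsto_add tendsto_const eps) (use False in auto)
  then show ?thesis using False by (simp add: power2_eq_square)
qed (simp add: rho_def)

end

context dunkl_setting
begin

lemma AE_Om: "AE x in lborel. x \<in> Om"
proof -
  have "negligible (\<Union>v\<in>P. {x. v \<bullet> x = 0})"
    by (intro negligible_Union) (auto intro!: negligible_hyperplane P_nonzero)
  moreover have "(\<Union>v\<in>P. {x. v \<bullet> x = 0}) \<in> sets borel"
    by (intro sets.finite_UN) auto
  ultimately have "(\<Union>v\<in>P. {x. v \<bullet> x = 0}) \<in> null_sets lborel"
    by (simp add: negligible_iff_null_sets null_sets_completion_iff)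
  from AE_not_in[OF this] show ?thesis by eventually_elim (auto simp: Om_def)
qed

text \<open>Integration by parts against the regularised weight produces
  \<open>2 * rho * f * e\<close> for each root, while the Dunkl operators call for
  \<open>rho * S\<close>. The discrepancy is odd under the reflection in \<open>v\<close> and
  integrates to 0. Since \<open>S\<close> vanishes on the hyperplane, \<open>rho * S\<close> has a
  bound of exponential type uniform in \<open>\<epsilon>\<close>, and \<open>\<epsilon>\<close> may
  tend to 0. The term with \<open>s\<close> is the derivative of the Gaussian.\<close>

lemma dop_antisymmetric:
  assumes s: "0 < s" and f: "c1exp f f'" and e: "c1exp e e'"
  shows "(LINT x|lborel. (gauss s x * w x) *\<^sub>R
    (dop f f' \<eta> x * e x + f x * dop e e' \<eta> x - (s * (x \<bullet> \<eta>)) *\<^sub>R (f x * e x))) = 0"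
proof -
  define S where "S v x = (f x - f (reflection v x)) * e x + f x * (e x - e (reflection v x))" for v x
  define D where "D x = f' x \<eta> * e x + f x * e' x \<eta> - (s * (x \<bullet> \<eta>)) *\<^sub>R (f x * e x)" for x
  note [measurable] = c1exp_measurable[OF f] c1exp_measurable[OF e]
  have [measurable]: "S v \<in> borel_measurable borel" "D \<in> borel_measurable borel" for v
    unfolding S_def[abs_def] D_def[abs_def] by measurable
  have exf: "exp_type f" "exp_type e" "exp_type (\<lambda>x. f (reflection v x))" "exp_type (\<lambda>x. e (reflection v x))" for v
    using c1exp_exp_type[OF f] c1exp_exp_type[OF e] exp_type_comp[of _ "reflection v"] by auto
  have exS: "exp_type (S v)" for v
    unfolding S_def[abs_def] by (intro exp_type_add exp_type_mult exp_type_diff exf)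
  have exD: "exp_type D"
    unfolding D_def[abs_def]
    by (intro exp_type_add exp_type_mult exp_type_diff exp_type_scaleR exf c1exp_exp_type_deriv[OF f]
        c1exp_exp_type_deriv[OF e] exp_type_inner exp_type_id exp_type_const)
  define \<Psi> where "\<Psi> \<epsilon> x = D x + (\<Sum>v\<in>P. (k v * (v \<bullet> \<eta>) * rho \<epsilon> v x) *\<^sub>R S v x)" for \<epsilon> x
  have zero: "(LINT x|lborel. gauss s x *\<^sub>R (wreg \<epsilon> x *\<^sub>R \<Psi> \<epsilon> x)) = 0" if eps: "0 < \<epsilon>" "\<epsilon> \<le> 1" for \<epsilon>
  proof -
    note [measurable] = wreg_measurable[OF eps(1)]
    define W where "W x = wreg \<epsilon> x *\<^sub>R (f x * e x)" for x
    define W' where "W' x h = wreg \<epsilon> x *\<^sub>R (f' x h * e x + f x * e' x h) +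
      (wreg \<epsilon> x * (\<Sum>v\<in>P. k v * (2 * (v \<bullet> x) * (v \<bullet> h) / ((v \<bullet> x)\<^sup>2 + \<epsilon>)))) *\<^sub>R (f x * e x)" for x h
    have W'2: "W' x h = wreg \<epsilon> x *\<^sub>R (f' x h * e x + f x * e' x h) +
      wreg \<epsilon> x *\<^sub>R (\<Sum>v\<in>P. (k v * (v \<bullet> h) * rho \<epsilon> v x) *\<^sub>R (2 * (f x * e x)))" for x h
    proof -
      have "(\<Sum>v\<in>P. (k v * (v \<bullet> h) * rho \<epsilon> v x) *\<^sub>R (2 * (f x * e x))) =
         (\<Sum>v\<in>P. k v * (2 * (v \<bullet> x) * (v \<bullet> h) / ((v \<bullet> x)\<^sup>2 + \<epsilon>))) *\<^sub>R (f x * e x)"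
        unfolding scaleR_sum_left
        by (intro sum.cong refl) (simp add: rho_def scaleR_conv_of_real mult_ac)
      then show ?thesis unfolding W'_def by (simp only: scaleR_scaleR[symmetric])
    qed
    have "(W has_derivative W' x) (at x)" for x
      unfolding W_def[abs_def] W'_def
      using has_derivative_scaleR[OF wreg_has_derivative[OF eps(1), of x] c1exp_deriv[OF c1exp_mult[OF f e], of x]]
      by simp
    moreover have "exp_type W"
      unfolding W_def[abs_def] by (intro exp_type_scaleR exp_type_mult exf exp_type_wreg eps)
    moreover have "exp_type (\<lambda>x. W' x \<eta>)"
      unfolding W'2
      by (intro exp_type_scaleR exp_type_mult exp_type_add exp_type_sum exp_type_const exf exp_type_wreg
        eps exp_type_rho c1exp_exp_type_deriv[OF f] c1exp_exp_type_deriv[OF e] finite_P)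
    ultimately have A: "(LINT x|lborel. gauss s x *\<^sub>R (W' x \<eta> - (s * (x \<bullet> \<eta>)) *\<^sub>R W x)) = 0"
      by (intro integration_by_parts_gauss s)
    have eq: "gauss s x *\<^sub>R (W' x \<eta> - (s * (x \<bullet> \<eta>)) *\<^sub>R W x) =
       gauss s x *\<^sub>R (wreg \<epsilon> x *\<^sub>R \<Psi> \<epsilon> x) +
       (\<Sum>v\<in>P. (k v * (v \<bullet> \<eta>)) *\<^sub>R (gauss s x *\<^sub>R ((wreg \<epsilon> x * rho \<epsilon> v x) *\<^sub>R (2 * (f x * e x) - S v x))))" for x
    proof -
      have "(\<Sum>v\<in>P. (k v * (v \<bullet> \<eta>)) *\<^sub>R (gauss s x *\<^sub>R ((wreg \<epsilon> x * rho \<epsilon> v x) *\<^sub>R (2 * (f x * e x) - S v x)))) =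
        gauss s x *\<^sub>R (wreg \<epsilon> x *\<^sub>R (\<Sum>v\<in>P. (k v * (v \<bullet> \<eta>) * rho \<epsilon> v x) *\<^sub>R (2 * (f x * e x) - S v x)))"
        unfolding scaleR_sum_right by (intro sum.cong refl) (simp add: mult_ac)
      also have "(\<Sum>v\<in>P. (k v * (v \<bullet> \<eta>) * rho \<epsilon> v x) *\<^sub>R (2 * (f x * e x) - S v x)) =
         (\<Sum>v\<in>P. (k v * (v \<bullet> \<eta>) * rho \<epsilon> v x) *\<^sub>R (2 * (f x * e x))) - (\<Sum>v\<in>P. (k v * (v \<bullet> \<eta>) * rho \<epsilon> v x) *\<^sub>R S v x)"
        by (simp only: scaleR_diff_right sum_subtractf)
      finally show ?thesis
        unfolding W'2 W_def \<Psi>_def D_def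
        by (simp add: scaleR_add_right scaleR_diff_right)
    qed
    have int1: "integrable lborel (\<lambda>x. gauss s x *\<^sub>R (wreg \<epsilon> x *\<^sub>R \<Psi> \<epsilon> x))"
      unfolding \<Psi>_def
      by (intro integrable_gauss_exp_type s exp_type_scaleR exp_type_add exp_type_sum exp_type_mult exp_type_const
          exp_type_wreg eps exp_type_rho exS exD finite_P) measurable
    have int2: "integrable lborel (\<lambda>x. gauss s x *\<^sub>R ((wreg \<epsilon> x * rho \<epsilon> v x) *\<^sub>R (2 * (f x * e x) - S v x)))" for v
      by (intro integrable_gauss_exp_type s exp_type_scaleR exp_type_add exp_type_sum exp_type_mult exp_type_const
          exp_type_diff exp_type_wreg eps exp_type_rho exS exf) measurable
    \<comment> \<open>\<open>2 * (f x * e x) - S v x\<close> equals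
      \<open>f (reflection v x) * e x + f x * e (reflection v x)\<close>, which is symmetric under
      the reflection, as are \<open>gauss\<close> and \<open>wreg\<close>; only \<open>rho\<close>
      changes sign.\<close>
    have H: "(LINT x|lborel. gauss s x *\<^sub>R ((wreg \<epsilon> x * rho \<epsilon> v x) *\<^sub>R (2 * (f x * e x) - S v x))) = 0"
      if v: "v \<in> P" for v
    proof -
      let ?H = "\<lambda>x. gauss s x *\<^sub>R ((wreg \<epsilon> x * rho \<epsilon> v x) *\<^sub>R (2 * (f x * e x) - S v x))"
      have "?H (reflection v x) = - ?H x" for x
        by (simp add: gauss_def wreg_reflect[OF v] rho_reflect S_def algebra_simps)
      moreover have "?H \<in> borel_measurable borel" by measurable
      from integral_lborel_reflection[OF this, of v]
      have "(LINT x|lborel. ?H (reflection v x)) = (LINT x|lborel. ?H x)" .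
      ultimately have "- (LINT x|lborel. ?H x) = (LINT x|lborel. ?H x)" by simp
      then show ?thesis by (simp add: neg_eq_iff_add_eq_0 flip: mult_2)
    qed
    have "(LINT x|lborel. (\<Sum>v\<in>P. (k v * (v \<bullet> \<eta>)) *\<^sub>R
        (gauss s x *\<^sub>R ((wreg \<epsilon> x * rho \<epsilon> v x) *\<^sub>R (2 * (f x * e x) - S v x))))) = 0"
      by (subst Bochner_Integration.integral_sum, intro integrable_scaleR_right int2)
         (simp only: integral_scaleR_right H scaleR_zero_right sum.neutral_const cong: sum.cong)
    moreover note A[unfolded eq]
    moreover have "integrable lborel (\<lambda>x. \<Sum>v\<in>P. (k v * (v \<bullet> \<eta>)) *\<^sub>R
        (gauss s x *\<^sub>R ((wreg \<epsilon> x * rho \<epsilon> v x) *\<^sub>R (2 * (f x * e x) - S v x))))"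
      by (intro Bochner_Integration.integrable_sum integrable_scaleR_right int2)
    ultimately show ?thesis by (simp only: Bochner_Integration.integral_add[OF int1] add_0_right)
  qed
  \<comment> \<open>Both differences in \<open>S\<close> vanish to first order on the hyperplane,
    which compensates the growth of \<open>rho\<close> there through \<open>rho_le\<close>.\<close>
  have bS: "\<exists>C A. 0 \<le> C \<and> 0 \<le> A \<and> (\<forall>x. norm (S v x) \<le> \<bar>v \<bullet> x\<bar> * (C * exp (A * norm x)))" if v: "v \<in> P" for v
  proof -
    obtain C A where C: "0 \<le> C" "0 \<le> A" "\<And>x. norm (f x - f (reflection v x)) \<le> \<bar>v \<bullet> x\<bar> * (C * exp (A * norm x))"
      using c1exp_reflection_diff[OF f P_nonzero[OF v]] by blast
    obtain D B where D: "0 \<le> D" "0 \<le> B" "\<And>x. norm (e x - e (reflection v x)) \<le> \<bar>v \<bullet> x\<bar> * (D * exp (B * norm x))"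
      using c1exp_reflection_diff[OF e P_nonzero[OF v]] by blast
    have "exp_type (\<lambda>x. C * exp (A * norm x) * norm (e x) + norm (f x) * (D * exp (B * norm x)))"
      by (intro exp_type_add exp_type_mult exp_type_const exp_type_mono[OF exf(1)] exp_type_mono[OF exf(2)]
          exp_typeI[of "\<lambda>x. exp (A * norm x)" 1 A] exp_typeI[of "\<lambda>x. exp (B * norm x)" 1 B]) auto
    then obtain C' A' where C': "0 \<le> C'" "0 \<le> A'"
      "\<And>x. norm (C * exp (A * norm x) * norm (e x) + norm (f x) * (D * exp (B * norm x))) \<le> C' * exp (A' * norm x)"
      unfolding exp_type_def by blast
    have "norm (S v x) \<le> \<bar>v \<bullet> x\<bar> * (C' * exp (A' * norm x))" for x
    proof -
      have "norm (S v x) \<le> norm (f x - f (reflection v x)) * norm (e x) + norm (f x) * norm (e x - e (reflection v x))"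
        unfolding S_def by (rule order_trans[OF norm_triangle_ineq]) (simp add: norm_mult)
      also have "\<dots> \<le> (\<bar>v \<bullet> x\<bar> * (C * exp (A * norm x))) * norm (e x) + norm (f x) * (\<bar>v \<bullet> x\<bar> * (D * exp (B * norm x)))"
        by (intro add_mono mult_right_mono mult_left_mono C D) auto
      also have "\<dots> = \<bar>v \<bullet> x\<bar> * (C * exp (A * norm x) * norm (e x) + norm (f x) * (D * exp (B * norm x)))"
        by (simp add: algebra_simps)
      also have "\<dots> \<le> \<bar>v \<bullet> x\<bar> * (C' * exp (A' * norm x))"
        using C'(3)[of x] by (intro mult_left_mono) auto
      finally show ?thesis .
    qed
    then show ?thesis using C' by blast
  qed
  have "\<forall>v\<in>P. \<exists>B. exp_type B \<and> B \<in> borel_measurable borel \<and> (\<forall>x \<epsilon>. 0 < \<epsilon> \<longrightarrow> norm (rho \<epsilon> v x *\<^sub>R S v x) \<le> (B x :: real))"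
  proof
    fix v assume v: "v \<in> P"
    obtain C A where C: "0 \<le> C" "0 \<le> A" "\<And>x. norm (S v x) \<le> \<bar>v \<bullet> x\<bar> * (C * exp (A * norm x))"
      using bS[OF v] by blast
    have "norm (rho \<epsilon> v x *\<^sub>R S v x) \<le> C * exp (A * norm x)" if "0 < \<epsilon>" for x \<epsilon>
    proof -
      have "norm (rho \<epsilon> v x *\<^sub>R S v x) \<le> \<bar>rho \<epsilon> v x\<bar> * (\<bar>v \<bullet> x\<bar> * (C * exp (A * norm x)))"
        using C(3)[of x] by (simp add: mult_left_mono)
      also have "\<dots> = (\<bar>rho \<epsilon> v x\<bar> * \<bar>v \<bullet> x\<bar>) * (C * exp (A * norm x))" by simp
      also have "\<dots> \<le> 1 * (C * exp (A * norm x))"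
        using rho_le[OF that] C by (intro mult_right_mono) auto
      finally show ?thesis by simp
    qed
    then show "\<exists>B. exp_type B \<and> B \<in> borel_measurable borel \<and> (\<forall>x \<epsilon>. 0 < \<epsilon> \<longrightarrow> norm (rho \<epsilon> v x *\<^sub>R S v x) \<le> (B x :: real))"
      using C by (intro exI[of _ "\<lambda>x. C * exp (A * norm x)"])
        (auto intro!: exp_typeI[of _ C A] borel_measurable_continuous_onI continuous_intros)
  qed
  then obtain B where B: "\<And>v. v \<in> P \<Longrightarrow> exp_type (B v)" "\<And>v. v \<in> P \<Longrightarrow> B v \<in> borel_measurable borel"
    "\<And>v x \<epsilon>. v \<in> P \<Longrightarrow> 0 < \<epsilon> \<Longrightarrow> norm (rho \<epsilon> v x *\<^sub>R S v x) \<le> (B v x :: real)"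
    by metis
  define Bt where "Bt x = norm (D x) + (\<Sum>v\<in>P. \<bar>k v * (v \<bullet> \<eta>)\<bar> * B v x)" for x
  have Bt: "norm (\<Psi> \<epsilon> x) \<le> Bt x" if "0 < \<epsilon>" for \<epsilon> x
  proof -
    have "norm (\<Psi> \<epsilon> x) \<le> norm (D x) + (\<Sum>v\<in>P. norm ((k v * (v \<bullet> \<eta>) * rho \<epsilon> v x) *\<^sub>R S v x))"
      unfolding \<Psi>_def by (rule order_trans[OF norm_triangle_ineq]) (intro add_left_mono norm_sum)
    also have "(\<Sum>v\<in>P. norm ((k v * (v \<bullet> \<eta>) * rho \<epsilon> v x) *\<^sub>R S v x)) \<le> (\<Sum>v\<in>P. \<bar>k v * (v \<bullet> \<eta>)\<bar> * B v x)"
    proof (rule sum_mono)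
      fix v assume v: "v \<in> P"
      show "norm ((k v * (v \<bullet> \<eta>) * rho \<epsilon> v x) *\<^sub>R S v x) \<le> \<bar>k v * (v \<bullet> \<eta>)\<bar> * B v x"
        using mult_left_mono[OF B(3)[OF v that, of x], of "\<bar>k v * (v \<bullet> \<eta>)\<bar>"] by (simp add: abs_mult mult_ac)
    qed
    finally show ?thesis by (simp add: Bt_def)
  qed
  have intB: "integrable lborel (\<lambda>x. gauss s x *\<^sub>R (exp (growth_const * norm x) * Bt x))"
    unfolding Bt_def using B(2)
    by (intro integrable_gauss_exp_type s exp_type_mult exp_type_add exp_type_sum exp_type_const
        exp_type_mono[OF exD] B(1) exp_typeI[of "\<lambda>x. exp (growth_const * norm x)" 1 growth_const])
       (auto intro!: borel_measurable_times borel_measurable_add borel_measurable_sum)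
  define Lim' where "Lim' x = D x + (\<Sum>v\<in>P. (k v * (v \<bullet> \<eta>) * (1 / (v \<bullet> x))) *\<^sub>R S v x)" for x
  have Lim': "Lim' x = dop f f' \<eta> x * e x + f x * dop e e' \<eta> x - (s * (x \<bullet> \<eta>)) *\<^sub>R (f x * e x)" for x
    unfolding Lim'_def D_def S_def dop_def
    by (simp add: distrib_left distrib_right sum_distrib_left sum_distrib_right scaleR_add_right sum.distrib
        mult_scaleR_left mult_scaleR_right mult.assoc)
  have "(\<lambda>i. LINT x|lborel. gauss s x *\<^sub>R (wreg (1 / real (Suc i)) x *\<^sub>R \<Psi> (1 / real (Suc i)) x)) \<longlonglongrightarrow>
     (LINT x|lborel. gauss s x *\<^sub>R (w x *\<^sub>R Lim' x))"
  proof (rule integral_dominated_convergence[OF _ _ intB])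
    show "(\<lambda>x. gauss s x *\<^sub>R (w x *\<^sub>R Lim' x)) \<in> borel_measurable lborel"
      unfolding Lim'_def by measurable
    show "(\<lambda>x. gauss s x *\<^sub>R (wreg (1 / real (Suc i)) x *\<^sub>R \<Psi> (1 / real (Suc i)) x)) \<in> borel_measurable lborel" for i
      unfolding \<Psi>_def using wreg_measurable[OF eps_bounds(1)] by measurable
    show "AE x in lborel. (\<lambda>i. gauss s x *\<^sub>R (wreg (1 / real (Suc i)) x *\<^sub>R \<Psi> (1 / real (Suc i)) x))
        \<longlonglongrightarrow> gauss s x *\<^sub>R (w x *\<^sub>R Lim' x)"
      unfolding \<Psi>_def Lim'_def
      by (intro AE_I2 tendsto_scaleR tendsto_add tendsto_sum tendsto_mult tendsto_const wreg_tendsto rho_tendsto)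
    show "AE x in lborel. norm (gauss s x *\<^sub>R (wreg (1 / real (Suc i)) x *\<^sub>R \<Psi> (1 / real (Suc i)) x)) \<le>
        gauss s x *\<^sub>R (exp (growth_const * norm x) * Bt x)" for i
    proof (intro AE_I2)
      fix x
      have "wreg (1 / real (Suc i)) x * norm (\<Psi> (1 / real (Suc i)) x) \<le> exp (growth_const * norm x) * Bt x"
        by (rule mult_mono[OF wreg_bound[OF eps_bounds] Bt[OF eps_bounds(1)]]) auto
      then show "norm (gauss s x *\<^sub>R (wreg (1 / real (Suc i)) x *\<^sub>R \<Psi> (1 / real (Suc i)) x)) \<le>
        gauss s x *\<^sub>R (exp (growth_const * norm x) * Bt x)"
        using gauss_pos[of s x] wreg_pos by (simp add: abs_of_pos)
    qed
  qed
  moreover have "(LINT x|lborel. gauss s x *\<^sub>R (wreg (1 / real (Suc i)) x *\<^sub>R \<Psi> (1 / real (Suc i)) x)) = 0" for i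
    by (rule zero[OF eps_bounds])
  ultimately have "(LINT x|lborel. gauss s x *\<^sub>R (w x *\<^sub>R Lim' x)) = 0"
    by (simp add: LIMSEQ_const_iff)
  then show ?thesis by (simp add: Lim')
qed

lemma c1exp_E: "c1exp (E c \<xi>) (DE c \<xi>)"
  by (intro c1expI[where C = 1 and A = "norm c * norm \<xi>" and D = "norm c * norm \<xi>" and B = "norm c * norm \<xi>"] E_has_derivative)
     (simp_all add: norm_E_le norm_DE_le)

lemma E_measurable [measurable]: "E c \<xi> \<in> borel_measurable borel"
  by (rule c1exp_measurable[OF c1exp_E])

lemma integrable_gauss_w:
  fixes f :: "real ^ 'n \<Rightarrow> 'b::{banach, second_countable_topology}"
  assumes "0 < s" "exp_type f" "f \<in> borel_measurable borel"
  shows "integrable lborel (\<lambda>x. (gauss s x * w x) *\<^sub>R f x)"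
  using integrable_gauss_exp_type[OF assms(1) exp_type_scaleR[OF exp_type_w assms(2)]] assms(3) by simp

lemma exp_type_E: "exp_type (E c \<xi>)" by (rule c1exp_exp_type[OF c1exp_E])

section \<open>Gaussian integrals of products of two kernels\<close>

text \<open>In \<open>dop_antisymmetric\<close> with two kernels, the eigenvalue equations turn both
  Dunkl operators into scalars, and what remains is \<open>s\<close> times the first moment.\<close>

lemma gauss_EE_moment:
  assumes s: "0 < s"
  shows "(LINT z|lborel. (gauss s z * w z) *\<^sub>R (of_real (z \<bullet> \<eta>) * (E c x z * E c' y z))) =
    (c * of_real (x \<bullet> \<eta>) + c' * of_real (y \<bullet> \<eta>)) / of_real s *
    (LINT z|lborel. (gauss s z * w z) *\<^sub>R (E c x z * E c' y z))"
proof -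
  let ?I = "LINT z|lborel. (gauss s z * w z) *\<^sub>R (E c x z * E c' y z)"
  let ?J = "LINT z|lborel. (gauss s z * w z) *\<^sub>R (of_real (z \<bullet> \<eta>) * (E c x z * E c' y z))"
  have int1: "integrable lborel (\<lambda>z. (gauss s z * w z) *\<^sub>R (E c x z * E c' y z))"
    by (intro integrable_gauss_w s exp_type_mult exp_type_E) measurable
  have "exp_type (\<lambda>z::real ^ 'n. of_real (z \<bullet> \<eta>) :: complex)"
    by (rule exp_type_mono[OF exp_type_inner[OF exp_type_id exp_type_const[of \<eta>]]]) simp
  then have int2: "integrable lborel (\<lambda>z. (gauss s z * w z) *\<^sub>R (of_real (z \<bullet> \<eta>) * (E c x z * E c' y z)))"
    by (intro integrable_gauss_w s exp_type_mult exp_type_E) measurable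
  have "0 = (LINT z|lborel. (gauss s z * w z) *\<^sub>R
    (dop (E c x) (DE c x) \<eta> z * E c' y z + E c x z * dop (E c' y) (DE c' y) \<eta> z - (s * (z \<bullet> \<eta>)) *\<^sub>R (E c x z * E c' y z)))"
    by (rule dop_antisymmetric[OF s c1exp_E c1exp_E, symmetric])
  also have "\<dots> = (LINT z|lborel. (c * of_real (x \<bullet> \<eta>) + c' * of_real (y \<bullet> \<eta>)) * ((gauss s z * w z) *\<^sub>R (E c x z * E c' y z))
     - of_real s * ((gauss s z * w z) *\<^sub>R (of_real (z \<bullet> \<eta>) * (E c x z * E c' y z))))"
  proof (rule integral_cong_AE)
    show "(\<lambda>z. (gauss s z * w z) *\<^sub>R (dop (E c x) (DE c x) \<eta> z * E c' y z + E c x z * dop (E c' y) (DE c' y) \<eta> z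
       - (s * (z \<bullet> \<eta>)) *\<^sub>R (E c x z * E c' y z))) \<in> borel_measurable lborel"
      unfolding dop_def using c1exp_measurable(2)[OF c1exp_E] by measurable
    show "AE z in lborel. (gauss s z * w z) *\<^sub>R (dop (E c x) (DE c x) \<eta> z * E c' y z + E c x z * dop (E c' y) (DE c' y) \<eta> z
       - (s * (z \<bullet> \<eta>)) *\<^sub>R (E c x z * E c' y z)) =
       (c * of_real (x \<bullet> \<eta>) + c' * of_real (y \<bullet> \<eta>)) * ((gauss s z * w z) *\<^sub>R (E c x z * E c' y z))
     - of_real s * ((gauss s z * w z) *\<^sub>R (of_real (z \<bullet> \<eta>) * (E c x z * E c' y z)))"
      using AE_Om
    proof eventually_elim
      fix z assume z: "z \<in> Om"
      show "(gauss s z * w z) *\<^sub>R (dop (E c x) (DE c x) \<eta> z * E c' y z + E c x z * dop (E c' y) (DE c' y) \<eta> z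
       - (s * (z \<bullet> \<eta>)) *\<^sub>R (E c x z * E c' y z)) =
       (c * of_real (x \<bullet> \<eta>) + c' * of_real (y \<bullet> \<eta>)) * ((gauss s z * w z) *\<^sub>R (E c x z * E c' y z))
     - of_real s * ((gauss s z * w z) *\<^sub>R (of_real (z \<bullet> \<eta>) * (E c x z * E c' y z)))"
        unfolding dop_E[OF z] by (simp add: scaleR_conv_of_real algebra_simps)
    qed
  qed measurable
  also have "\<dots> = (c * of_real (x \<bullet> \<eta>) + c' * of_real (y \<bullet> \<eta>)) * ?I - of_real s * ?J"
    by (simp only: Bochner_Integration.integral_diff[OF integrable_mult_right[OF int1] integrable_mult_right[OF int2]]
        integral_mult_right_zero)
  finally show ?thesis using s by (simp add: field_simps)
qed

text \<open>By \<open>E_commute\<close> the spectral variable may play the role of the space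
  variable, so the derivative along the ray is \<open>DE\<close> with the integration variable as
  its parameter.\<close>

lemma gauss_EE_ray_derivative:
  assumes s: "0 < s"
  shows "((\<lambda>t. LINT z|lborel. (gauss s z * w z) *\<^sub>R (E c (t *\<^sub>R x) z * E c' y z)) has_vector_derivative
    (LINT z|lborel. (gauss s z * w z) *\<^sub>R (DE c z (t0 *\<^sub>R x) x * E c' y z))) (at t0)"
proof -
  define A where "A = (\<bar>t0\<bar> + 1) * norm x"
  let ?B = "\<lambda>z. (gauss s z * w z) *\<^sub>R ((norm c * norm z * exp (norm c * A * norm z) * norm x) * norm (E c' y z))"
  show ?thesis
  proof (rule has_vector_derivative_integral[where \<delta> = 1 and B = ?B and
        \<phi> = "\<lambda>t z. (gauss s z * w z) *\<^sub>R (E c (t *\<^sub>R x) z * E c' y z)" and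
        \<phi>' = "\<lambda>t z. (gauss s z * w z) *\<^sub>R (DE c z (t *\<^sub>R x) x * E c' y z)"])
    show "integrable lborel (\<lambda>z. (gauss s z * w z) *\<^sub>R (E c (t *\<^sub>R x) z * E c' y z))" for t
      by (intro integrable_gauss_w s exp_type_mult exp_type_E) measurable
    have D: "((\<lambda>t. E c (t *\<^sub>R x) z) has_vector_derivative DE c z (t *\<^sub>R x) x) (at t)" for t z
    proof -
      have "((\<lambda>t. t *\<^sub>R x) has_derivative (\<lambda>h. h *\<^sub>R x)) (at t)"
        by (auto intro!: derivative_eq_intros)
      from has_derivative_compose[OF this E_has_derivative]
      have "((\<lambda>t. E c z (t *\<^sub>R x)) has_derivative (\<lambda>h. DE c z (t *\<^sub>R x) (h *\<^sub>R x))) (at t)" .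
      then show ?thesis
        using has_derivative_linear[OF E_has_derivative] unfolding has_vector_derivative_def
        by (simp add: E_commute[of c "_ *\<^sub>R x"] linear_scale)
    qed
    show "((\<lambda>t. (gauss s z * w z) *\<^sub>R (E c (t *\<^sub>R x) z * E c' y z)) has_vector_derivative
       (gauss s z * w z) *\<^sub>R (DE c z (t *\<^sub>R x) x * E c' y z)) (at t)" for t z
      by (intro bounded_linear.has_vector_derivative[OF bounded_linear_scaleR_right] has_vector_derivative_mult_left D)
    have "(\<lambda>z. DE c z (t0 *\<^sub>R x) x) \<in> borel_measurable borel"
    proof (rule borel_measurable_LIMSEQ_metric)
      show "(\<lambda>i. real (Suc i) *\<^sub>R (E c (t0 *\<^sub>R x + (1 / real (Suc i)) *\<^sub>R x) z - E c (t0 *\<^sub>R x) z)) \<longlonglongrightarrow> DE c z (t0 *\<^sub>R x) x" for z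
        using difference_quotient_tendsto[OF E_has_derivative, of c z "t0 *\<^sub>R x" x] by (simp only: E_commute[of c z])
    qed measurable
    then show "(\<lambda>z. (gauss s z * w z) *\<^sub>R (DE c z (t0 *\<^sub>R x) x * E c' y z)) \<in> borel_measurable lborel"
      by measurable
    show "norm ((gauss s z * w z) *\<^sub>R (DE c z (t *\<^sub>R x) x * E c' y z)) \<le> ?B z" if "\<bar>t - t0\<bar> < 1" for t z
    proof -
      have "norm (t *\<^sub>R x) \<le> A" unfolding A_def norm_scaleR using that by (intro mult_right_mono) auto
      then have "norm c * norm z * norm (t *\<^sub>R x) \<le> norm c * A * norm z"
        using mult_left_mono[of "norm (t *\<^sub>R x)" A "norm c * norm z"] by (simp add: mult_ac)
      then have "norm c * norm z * exp (norm c * norm z * norm (t *\<^sub>R x)) * norm x \<le>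
          norm c * norm z * exp (norm c * A * norm z) * norm x"
        by (intro mult_right_mono mult_left_mono) auto
      with norm_DE_le[of c z "t *\<^sub>R x" x] have "norm (DE c z (t *\<^sub>R x) x) \<le> norm c * norm z * exp (norm c * A * norm z) * norm x"
        by linarith
      then show ?thesis
        using gauss_pos[of s z] by (simp add: norm_mult mult_left_mono mult_right_mono)
    qed
    show "integrable lborel ?B"
    proof (intro integrable_gauss_w s exp_type_mult exp_type_const)
      show "exp_type (\<lambda>z::real ^ 'n. norm z)" by (rule exp_type_norm)
      show "exp_type (\<lambda>z. exp (norm c * A * norm z))" by (rule exp_typeI[of _ 1 "norm c * A"]) simp
      show "exp_type (\<lambda>z. norm (E c' y z))" by (rule exp_type_mono[OF exp_type_E[of c' y]]) simp
    qed measurable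
  qed auto
qed

definition gmass :: "real \<Rightarrow> real" where
  "gmass s = (LINT z|lborel. gauss s z * w z)"

text \<open>After multiplication by a Gaussian factor the integral, as a function of
  \<open>x\<close>, satisfies the ray equation of \<open>E (c * c' / of_real s) y\<close>, and
  \<open>radial_unique\<close> identifies it from its value at 0. The equation comes from
  \<open>E_radial\<close> in the spectral variable, whose factor \<open>z \<bullet> x\<close> is
  evaluated by \<open>gauss_EE_moment\<close>.\<close>

lemma gauss_EE_aux:
  assumes s: "0 < s"
  shows "(LINT z|lborel. (gauss s z * w z) *\<^sub>R (E c x z * E c' y z)) =
    (LINT z|lborel. (gauss s z * w z) *\<^sub>R E c' y z) *
      exp (c\<^sup>2 * of_real ((norm x)\<^sup>2) / (2 * of_real s)) * E (c * c' / of_real s) y x"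
proof -
  define M where "M x = (LINT z|lborel. (gauss s z * w z) *\<^sub>R (E c x z * E c' y z))" for x
  \<comment> \<open>The first moment contributes the multiplier \<open>c\<^sup>2 / s\<close> times
    \<open>(norm x)\<^sup>2\<close>, which is the radial derivative of \<open>b\<close> times
    \<open>(norm x)\<^sup>2\<close>; the factor \<open>exp\<close> in \<open>h\<close> removes
    it.\<close>
  define b where "b = c\<^sup>2 / (2 * of_real s)"
  define h where "h x = M x * exp (- (b * of_real ((norm x)\<^sup>2)))" for x
  define M' where "M' t x = (LINT z|lborel. (gauss s z * w z) *\<^sub>R (DE c z (t *\<^sub>R x) x * E c' y z))" for t x
  have M': "((\<lambda>t. M (t *\<^sub>R x)) has_vector_derivative M' t x) (at t)" for t x
    unfolding M_def M'_def by (rule gauss_EE_ray_derivative[OF s])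
  have int: "integrable lborel (\<lambda>z. (gauss s z * w z) *\<^sub>R (E c x z * E c' y z))" for x
    by (intro integrable_gauss_w s exp_type_mult exp_type_E) measurable
  have "exp_type (\<lambda>z::real ^ 'n. of_real (z \<bullet> \<eta>) :: complex)" for \<eta>
    by (rule exp_type_mono[OF exp_type_inner[OF exp_type_id exp_type_const[of \<eta>]]]) simp
  then have int2: "integrable lborel (\<lambda>z. (gauss s z * w z) *\<^sub>R (of_real (z \<bullet> \<eta>) * (E c x z * E c' y z)))" for x \<eta>
    by (intro integrable_gauss_w s exp_type_mult exp_type_E) measurable
  have rad: "of_real t * M' t x = (c * (c * of_real ((norm (t *\<^sub>R x))\<^sup>2) + c' * of_real (y \<bullet> (t *\<^sub>R x))) / of_real s) * M (t *\<^sub>R x) -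
      (\<Sum>v\<in>P. of_real (k v) * (M (t *\<^sub>R x) - M (t *\<^sub>R reflection v x)))" for t x
  proof -
    have "of_real t * M' t x = (LINT z|lborel. of_real t * ((gauss s z * w z) *\<^sub>R (DE c z (t *\<^sub>R x) x * E c' y z)))"
      by (simp only: M'_def integral_mult_right_zero)
    also have "\<dots> = (LINT z|lborel. c * ((gauss s z * w z) *\<^sub>R (of_real (z \<bullet> (t *\<^sub>R x)) * (E c (t *\<^sub>R x) z * E c' y z))) -
       (\<Sum>v\<in>P. of_real (k v) * ((gauss s z * w z) *\<^sub>R (E c (t *\<^sub>R x) z * E c' y z) -
          (gauss s z * w z) *\<^sub>R (E c (t *\<^sub>R reflection v x) z * E c' y z))))"
    proof (rule Bochner_Integration.integral_cong[OF refl])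
      fix z
      have "of_real t * DE c z (t *\<^sub>R x) x = DE c z (t *\<^sub>R x) (t *\<^sub>R x)"
        using has_derivative_linear[OF E_has_derivative, of c z "t *\<^sub>R x"]
        by (simp add: linear_scale scaleR_conv_of_real[of t "DE c z _ _", symmetric])
      also have "\<dots> = c * of_real (z \<bullet> (t *\<^sub>R x)) * E c (t *\<^sub>R x) z -
         (\<Sum>v\<in>P. of_real (k v) * (E c (t *\<^sub>R x) z - E c (t *\<^sub>R reflection v x) z))"
        using E_radial[of c z "t *\<^sub>R x"] by (simp add: eq_diff_eq E_commute[of c "_ *\<^sub>R _"])
      finally have *: "of_real t * DE c z (t *\<^sub>R x) x = \<dots>" .
      have "of_real t * ((gauss s z * w z) *\<^sub>R (DE c z (t *\<^sub>R x) x * E c' y z)) =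
         (gauss s z * w z) *\<^sub>R ((of_real t * DE c z (t *\<^sub>R x) x) * E c' y z)"
        by (simp add: mult.assoc)
      also have "\<dots> = c * ((gauss s z * w z) *\<^sub>R (of_real (z \<bullet> (t *\<^sub>R x)) * (E c (t *\<^sub>R x) z * E c' y z))) -
       (\<Sum>v\<in>P. of_real (k v) * ((gauss s z * w z) *\<^sub>R (E c (t *\<^sub>R x) z * E c' y z) -
          (gauss s z * w z) *\<^sub>R (E c (t *\<^sub>R reflection v x) z * E c' y z)))"
        unfolding * left_diff_distrib scaleR_diff_right sum_distrib_right scaleR_sum_right
        by (intro arg_cong2[where f = minus] sum.cong refl) (simp_all add: mult.assoc right_diff_distrib scaleR_diff_right left_diff_distrib)
      finally show "of_real t * ((gauss s z * w z) *\<^sub>R (DE c z (t *\<^sub>R x) x * E c' y z)) = \<dots>" .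
    qed
    also have "\<dots> = c * (LINT z|lborel. (gauss s z * w z) *\<^sub>R (of_real (z \<bullet> (t *\<^sub>R x)) * (E c (t *\<^sub>R x) z * E c' y z))) -
       (\<Sum>v\<in>P. of_real (k v) * (M (t *\<^sub>R x) - M (t *\<^sub>R reflection v x)))"
      unfolding M_def
      by (subst Bochner_Integration.integral_diff, intro integrable_mult_right int2,
          intro Bochner_Integration.integrable_sum integrable_mult_right Bochner_Integration.integrable_diff int,
          subst Bochner_Integration.integral_sum, intro integrable_mult_right Bochner_Integration.integrable_diff int)
         (simp only: integral_mult_right_zero Bochner_Integration.integral_diff[OF int int])
    also have "(LINT z|lborel. (gauss s z * w z) *\<^sub>R (of_real (z \<bullet> (t *\<^sub>R x)) * (E c (t *\<^sub>R x) z * E c' y z))) =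
       (c * of_real ((norm (t *\<^sub>R x))\<^sup>2) + c' * of_real (y \<bullet> (t *\<^sub>R x))) / of_real s * M (t *\<^sub>R x)"
      unfolding M_def gauss_EE_moment[OF s] power2_norm_eq_inner ..
    finally show ?thesis by (simp only: mult.assoc times_divide_eq_right times_divide_eq_left)
  qed
  have cM: "continuous_on {0..1} (\<lambda>t. M (t *\<^sub>R x))" for x
    using M' has_vector_derivative_continuous
    by (intro continuous_at_imp_continuous_on) blast
  have "h x = h 0 * E (c * c' / of_real s) y x"
  proof (rule radial_unique)
    show "continuous_on {0..1} (\<lambda>t. h (t *\<^sub>R x))" for x
      unfolding h_def norm_scaleR by (intro continuous_intros cM)
    fix t :: real and x :: "real ^ 'n" assume t: "0 < t"
    define e where "e t = exp (- (b * of_real ((norm (t *\<^sub>R x))\<^sup>2)))" for t :: real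
    have "((\<lambda>z. exp (- (b * (z\<^sup>2 * of_real ((norm x)\<^sup>2))))) has_field_derivative
       - (2 * b * of_real t * of_real ((norm x)\<^sup>2)) * e t) (at (of_real t))"
      unfolding e_def by (auto intro!: derivative_eq_intros simp: power_mult_distrib algebra_simps)
    from has_vector_derivative_real_field[OF this]
    have e': "(e has_vector_derivative - (2 * b * of_real t * of_real ((norm x)\<^sup>2)) * e t) (at t)"
      unfolding e_def by (simp add: power_mult_distrib)
    have er: "exp (- (b * of_real ((norm (t *\<^sub>R reflection v x))\<^sup>2))) = e t" for v
      by (simp add: e_def)
    have "((\<lambda>t. h (t *\<^sub>R x)) has_vector_derivative
       M (t *\<^sub>R x) * (- (2 * b * of_real t * of_real ((norm x)\<^sup>2)) * e t) + M' t x * e t) (at t)"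
      unfolding h_def using has_vector_derivative_mult[OF M' e'] unfolding e_def .
    moreover have "M (t *\<^sub>R x) * (- (2 * b * of_real t * of_real ((norm x)\<^sup>2)) * e t) + M' t x * e t =
       inverse t *\<^sub>R (c * c' / of_real s * of_real (y \<bullet> (t *\<^sub>R x)) * h (t *\<^sub>R x) -
          (\<Sum>v\<in>P. k v *\<^sub>R (h (t *\<^sub>R x) - h (t *\<^sub>R reflection v x))))"
    proof -
      define S where "S = (\<Sum>v\<in>P. of_real (k v) * (M (t *\<^sub>R x) - M (t *\<^sub>R reflection v x)))"
      have S: "(\<Sum>v\<in>P. k v *\<^sub>R (h (t *\<^sub>R x) - h (t *\<^sub>R reflection v x))) = S * e t"
        unfolding S_def h_def er sum_distrib_right by (simp add: e_def scaleR_conv_of_real left_diff_distrib mult.assoc)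
      have hM: "h (t *\<^sub>R x) = M (t *\<^sub>R x) * e t" by (simp add: h_def e_def)
      have M'eq: "M' t x = inverse (of_real t) * ((c * (c * of_real ((norm (t *\<^sub>R x))\<^sup>2) + c' * of_real (y \<bullet> (t *\<^sub>R x))) / of_real s) * M (t *\<^sub>R x) - S)"
        using rad[of t x] t unfolding S_def by (simp add: field_simps)
      have n2: "(norm (t *\<^sub>R x))\<^sup>2 = t * t * (norm x)\<^sup>2" by (simp add: power_mult_distrib power2_eq_square)
      show ?thesis unfolding S unfolding hM M'eq n2 b_def
        using t s by (simp add: scaleR_conv_of_real field_simps power2_eq_square)
    qed
    ultimately show "((\<lambda>t. h (t *\<^sub>R x)) has_vector_derivative
       inverse t *\<^sub>R (c * c' / of_real s * of_real (y \<bullet> (t *\<^sub>R x)) * h (t *\<^sub>R x) -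
          (\<Sum>v\<in>P. k v *\<^sub>R (h (t *\<^sub>R x) - h (t *\<^sub>R reflection v x))))) (at t)" by simp
  qed
  moreover have "h 0 = (LINT z|lborel. (gauss s z * w z) *\<^sub>R E c' y z)" by (simp add: h_def M_def)
  moreover have "M x = h x * exp (b * of_real ((norm x)\<^sup>2))"
    by (simp add: h_def mult.assoc flip: exp_add)
  ultimately show ?thesis by (simp add: M_def b_def mult_ac)
qed

text \<open>The constant left open in \<open>gauss_EE_aux\<close>, the integral of a single kernel,
  is another instance of that lemma with \<open>E 0 0 z = 1\<close> as second factor.\<close>

lemma gauss_EE:
  assumes s: "0 < s"
  shows "(LINT z|lborel. (gauss s z * w z) *\<^sub>R (E c x z * E c' y z)) =
    of_real (gmass s) * exp ((c\<^sup>2 * of_real ((norm x)\<^sup>2) + c'\<^sup>2 * of_real ((norm y)\<^sup>2)) / (2 * of_real s)) *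
      E (c * c' / of_real s) y x"
proof -
  have "(LINT z|lborel. (gauss s z * w z) *\<^sub>R E c' y z) =
     (LINT z|lborel. (gauss s z * w z) *\<^sub>R (E c' y z * E 0 0 z))" by simp
  also have "\<dots> = (LINT z|lborel. (gauss s z * w z) *\<^sub>R (1::complex)) * exp (c'\<^sup>2 * of_real ((norm y)\<^sup>2) / (2 * of_real s))"
    by (subst gauss_EE_aux[OF s]) simp
  also have "(LINT z|lborel. (gauss s z * w z) *\<^sub>R (1::complex)) = of_real (gmass s)"
    unfolding gmass_def integral_complex_of_real[symmetric] by (simp only: scaleR_conv_of_real mult_1_right)
  finally show ?thesis
    unfolding gauss_EE_aux[OF s, of c x c' y]
    by (simp add: add_divide_distrib exp_add mult_ac)
qed

end

section \<open>Difference quotients of Schwartz functions\<close>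

definition decays_on :: "(real ^ 'n) set \<Rightarrow> (real ^ 'n \<Rightarrow> complex) \<Rightarrow> bool" where
  "decays_on D f \<longleftrightarrow> (\<forall>N::nat. \<exists>C. \<forall>x\<in>D. norm (f x) * (1 + norm x) ^ N \<le> C)"

text \<open>Differentiability is asked everywhere but decay only on \<open>D\<close>: for the
  difference quotient of a root, decay near the hyperplane and decay away from it have different
  reasons, and \<open>D\<close> keeps the two regimes apart.\<close>

primrec schwartz_upto :: "(real ^ 'n) set \<Rightarrow> nat \<Rightarrow> (real ^ 'n \<Rightarrow> complex) \<Rightarrow> bool" where
  "schwartz_upto D 0 f \<longleftrightarrow> decays_on D f \<and> (\<forall>x. f differentiable (at x))"
| "schwartz_upto D (Suc n) f \<longleftrightarrow> decays_on D f \<and> (\<forall>x. f differentiable (at x)) \<and>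
    (\<forall>j. schwartz_upto D n (partial_deriv j f))"

lemma decays_onD: "decays_on D f \<Longrightarrow> \<exists>C\<ge>0. \<forall>x\<in>D. norm (f x) * (1 + norm x) ^ N \<le> C"
proof -
  assume "decays_on D f"
  then obtain C where "\<forall>x\<in>D. norm (f x) * (1 + norm x) ^ N \<le> C" unfolding decays_on_def by blast
  then have "\<forall>x\<in>D. norm (f x) * (1 + norm x) ^ N \<le> \<bar>C\<bar>" by (meson abs_ge_self order_trans)
  then show ?thesis by (intro exI[of _ "\<bar>C\<bar>"]) auto
qed

lemma decays_on_add:
  assumes "decays_on D f" "decays_on D g"
  shows "decays_on D (\<lambda>x. f x + g x)"
  unfolding decays_on_def
proof
  fix N
  obtain A B where A: "\<forall>x\<in>D. norm (f x) * (1 + norm x) ^ N \<le> A" and B: "\<forall>x\<in>D. norm (g x) * (1 + norm x) ^ N \<le> B"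
    using assms unfolding decays_on_def by meson
  have "norm (f x + g x) * (1 + norm x) ^ N \<le> A + B" if "x \<in> D" for x
  proof -
    have "norm (f x + g x) * (1 + norm x) ^ N \<le> (norm (f x) + norm (g x)) * (1 + norm x) ^ N"
      by (intro mult_right_mono norm_triangle_ineq) auto
    then show ?thesis using A[rule_format, OF that] B[rule_format, OF that] by (simp add: distrib_right)
  qed
  then show "\<exists>C. \<forall>x\<in>D. norm (f x + g x) * (1 + norm x) ^ N \<le> C" by blast
qed

lemma decays_on_cmult: "decays_on D f \<Longrightarrow> decays_on D (\<lambda>x. c * f x)"
  unfolding decays_on_def
proof
  fix N
  assume "\<forall>N. \<exists>C. \<forall>x\<in>D. norm (f x) * (1 + norm x) ^ N \<le> C"
  then obtain C where "\<forall>x\<in>D. norm (f x) * (1 + norm x) ^ N \<le> C" by blast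
  then have "\<forall>x\<in>D. norm (c * f x) * (1 + norm x) ^ N \<le> norm c * C"
    by (auto simp: norm_mult mult.assoc intro: mult_left_mono)
  then show "\<exists>C. \<forall>x\<in>D. norm (c * f x) * (1 + norm x) ^ N \<le> C" by blast
qed

lemma differentiable_partial_deriv:
  assumes "f differentiable (at x)"
  shows "(f has_derivative (\<lambda>h. \<Sum>j\<in>UNIV. (h $ j) *\<^sub>R partial_deriv j f x)) (at x)"
proof -
  obtain f' where f': "(f has_derivative f') (at x)" using assms by (auto simp: differentiable_def)
  have "f' = (\<lambda>h. \<Sum>j\<in>UNIV. (h $ j) *\<^sub>R partial_deriv j f x)"
    unfolding partial_deriv_eq[OF f'] by (rule ext) (rule derivative_axis_sum[OF has_derivative_linear[OF f']])
  then show ?thesis using f' by simp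
qed

lemma continuous_on_differentiable:
  "(\<And>x. f differentiable (at x)) \<Longrightarrow> continuous_on UNIV f"
  by (intro differentiable_imp_continuous_on) (simp add: differentiable_on_def)

lemma partial_deriv_add:
  assumes "\<And>x. f differentiable (at x)" "\<And>x. g differentiable (at x)"
  shows "partial_deriv j (\<lambda>x. f x + g x) = (\<lambda>x. partial_deriv j f x + partial_deriv j g x)"
proof
  fix x
  obtain f' where d1: "(f has_derivative f') (at x)" using assms(1)[of x] unfolding differentiable_def by blast
  obtain g' where d2: "(g has_derivative g') (at x)" using assms(2)[of x] unfolding differentiable_def by blast
  show "partial_deriv j (\<lambda>x. f x + g x) x = partial_deriv j f x + partial_deriv j g x"
    using partial_deriv_eq[OF has_derivative_add[OF d1 d2]] partial_deriv_eq[OF d1] partial_deriv_eq[OF d2] by simp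
qed

lemma partial_deriv_cmult:
  assumes "\<And>x. f differentiable (at x)"
  shows "partial_deriv j (\<lambda>x. c * f x) = (\<lambda>x. c * partial_deriv j f x)"
proof
  fix x
  obtain f' where d: "(f has_derivative f') (at x)" using assms unfolding differentiable_def by blast
  show "partial_deriv j (\<lambda>x. c * f x) x = c * partial_deriv j f x"
    using partial_deriv_eq[OF has_derivative_mult_right[OF d]] partial_deriv_eq[OF d] by simp
qed

lemma schwartz_upto_differentiable: "schwartz_upto D n f \<Longrightarrow> f differentiable (at x)"
  by (cases n) auto

lemma schwartz_upto_decays: "schwartz_upto D n f \<Longrightarrow> decays_on D f"
  by (cases n) auto

lemma schwartz_upto_add:
  "schwartz_upto D n f \<Longrightarrow> schwartz_upto D n g \<Longrightarrow> schwartz_upto D n (\<lambda>x. f x + g x)"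
proof (induction n arbitrary: f g)
  case (Suc n)
  then show ?case by (simp add: decays_on_add partial_deriv_add)
qed (simp add: decays_on_add)

lemma schwartz_upto_cmult: "schwartz_upto D n f \<Longrightarrow> schwartz_upto D n (\<lambda>x. c * f x)"
proof (induction n arbitrary: f)
  case (Suc n)
  then show ?case by (simp add: decays_on_cmult partial_deriv_cmult)
qed (simp add: decays_on_cmult)

lemma schwartz_upto_zero: "schwartz_upto D n (\<lambda>x. 0)"
proof (induction n)
  case (Suc n)
  have "partial_deriv j (\<lambda>x. 0) = (\<lambda>x. 0)" for j :: 'a
    using partial_deriv_eq[OF has_derivative_const[of 0]] by auto
  then show ?case using Suc by (auto simp: decays_on_def intro!: exI[of _ 0])
qed (auto simp: decays_on_def intro!: exI[of _ 0])

lemma schwartz_upto_sum: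
  "finite I \<Longrightarrow> (\<And>i. i \<in> I \<Longrightarrow> schwartz_upto D n (f i)) \<Longrightarrow> schwartz_upto D n (\<lambda>x. \<Sum>i\<in>I. f i x)"
  by (induction rule: finite_induct) (auto simp: schwartz_upto_zero intro: schwartz_upto_add)

lemma schwartz_upto_Suc: "schwartz_upto D (Suc n) f \<Longrightarrow> schwartz_upto D n f"
  by (induction n arbitrary: f) auto

lemma iterated_partial_snoc: "iterated_partial (js @ [j]) f = iterated_partial js (partial_deriv j f)"
  by (induction js) auto

lemma schwartz_partial_deriv: assumes "f \<in> schwartz_space" shows "partial_deriv j f \<in> schwartz_space"
  unfolding schwartz_space_def mem_Collect_eq
proof
  fix js
  show "(\<forall>x. iterated_partial js (partial_deriv j f) differentiable (at x)) \<and>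
      (\<forall>N. bounded (range (\<lambda>x. (1 + norm x) ^ N *\<^sub>R iterated_partial js (partial_deriv j f) x)))"
    using assms unfolding schwartz_space_def mem_Collect_eq iterated_partial_snoc[symmetric] by blast
qed

lemma schwartz_imp_schwartz_upto: "f \<in> schwartz_space \<Longrightarrow> schwartz_upto UNIV n f"
proof (induction n arbitrary: f)
  have 1: "decays_on UNIV f \<and> (\<forall>x. f differentiable (at x))" if f: "f \<in> schwartz_space" for f :: "real ^ 'a \<Rightarrow> complex"
  proof -
    have "bounded (range (\<lambda>x. (1 + norm x) ^ N *\<^sub>R iterated_partial [] f x))"
      "iterated_partial [] f differentiable (at x)" for N :: nat and x
      using f unfolding schwartz_space_def by blast+
    then have 2: "bounded (range (\<lambda>x. (1 + norm x) ^ N *\<^sub>R f x))" "f differentiable (at x)" for N :: nat and x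
      by simp_all
    have "\<exists>C. \<forall>x. norm (f x) * (1 + norm x) ^ N \<le> C" for N :: nat
    proof -
      obtain C where "\<And>x. norm ((1 + norm x) ^ N *\<^sub>R f x) \<le> C"
        using 2(1)[of N] unfolding bounded_iff by blast
      then have "\<forall>x. norm (f x) * (1 + norm x) ^ N \<le> C" by (simp add: mult.commute)
      then show ?thesis by blast
    qed
    then show ?thesis using 2(2) by (auto simp: decays_on_def)
  qed
  {
    case 0
    then show ?case using 1 by simp
  next
    case (Suc n)
    then show ?case using 1[of f] Suc.IH[OF schwartz_partial_deriv[OF Suc.prems]] by simp
  }
qed

lemma has_derivative_of_differentiable_compose_linear:
  fixes f :: "real ^ 'n \<Rightarrow> complex" and L :: "real ^ 'n \<Rightarrow> real ^ 'n"
  assumes f: "f differentiable (at (L x))" and L: "bounded_linear L"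
  shows "((\<lambda>x. f (L x)) has_derivative (\<lambda>h. \<Sum>i\<in>UNIV. (L h $ i) *\<^sub>R partial_deriv i f (L x))) (at x)"
  by (rule has_derivative_compose[OF bounded_linear_imp_has_derivative[OF L] differentiable_partial_deriv[OF f]])

lemma decays_on_reflect:
  assumes "decays_on UNIV f" shows "decays_on UNIV (\<lambda>x. f (reflection v x))"
  unfolding decays_on_def
proof
  fix N
  obtain C where C: "\<forall>x. norm (f x) * (1 + norm x) ^ N \<le> C" using assms unfolding decays_on_def by blast
  have "norm (f (reflection v x)) * (1 + norm x) ^ N \<le> C" for x
    using C[rule_format, of "reflection v x"] by simp
  then show "\<exists>C. \<forall>x\<in>UNIV. norm (f (reflection v x)) * (1 + norm x) ^ N \<le> C" by blast
qed

lemma schwartz_upto_reflect: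
  "schwartz_upto UNIV n f \<Longrightarrow> schwartz_upto UNIV n (\<lambda>x. f (reflection v x))"
proof (induction n arbitrary: f)
  have bl: "bounded_linear (reflection v)" for v :: "real ^ 'a"
    using reflection_linear linear_conv_bounded_linear by blast
  have D: "(\<lambda>x. f (reflection v x)) differentiable (at x)" if "\<And>x. f differentiable (at x)"
    for f :: "real ^ 'a \<Rightarrow> complex" and x
    using has_derivative_of_differentiable_compose_linear[OF that bl] by (auto simp: differentiable_def)
  {
    case 0
    then show ?case using D by (simp add: decays_on_reflect)
  next
    case (Suc n)
    have df: "f differentiable (at x)" for x using Suc.prems by simp
    have "partial_deriv j (\<lambda>x. f (reflection v x)) =
       (\<lambda>x. \<Sum>i\<in>UNIV. of_real (reflection v (axis j 1) $ i) * partial_deriv i f (reflection v x))" for j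
      using partial_deriv_eq[OF has_derivative_of_differentiable_compose_linear[OF df bl]]
      by (auto simp: scaleR_conv_of_real)
    moreover have "schwartz_upto UNIV n (\<lambda>x. \<Sum>i\<in>UNIV. of_real (reflection v (axis j 1) $ i) * partial_deriv i f (reflection v x))" for j
      using Suc by (intro schwartz_upto_sum schwartz_upto_cmult) auto
    ultimately show ?case using Suc.prems D[OF df] by (simp add: decays_on_reflect)
  }
qed

section \<open>Averages over the segment to the mirror image\<close>

definition seg :: "real ^ 'n \<Rightarrow> real \<Rightarrow> real ^ 'n \<Rightarrow> real ^ 'n" where
  "seg v s x = x - (s * (2 * (x \<bullet> v) / (norm v)\<^sup>2)) *\<^sub>R v"

text \<open>\<open>rquot\<close> averages a derivative over the segment from \<open>x\<close> to its
  mirror image. The weight \<open>c\<close> is there because differentiation under the integral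
  produces coefficients depending on \<open>s\<close>; with weights, sums of such averages are
  closed under partial derivatives.\<close>

definition seg_average :: "real ^ 'n \<Rightarrow> (real \<Rightarrow> real) \<Rightarrow> (real ^ 'n \<Rightarrow> complex) \<Rightarrow> real ^ 'n \<Rightarrow> complex" where
  "seg_average v c f x = integral {0..1} (\<lambda>s. c s *\<^sub>R f (seg v s x))"

lemma bounded_linear_seg: "bounded_linear (seg v s)"
proof -
  have "linear (seg v s)"
    unfolding seg_def by (rule linearI) (auto simp: algebra_simps inner_add_left add_divide_distrib)
  then show ?thesis by (simp add: linear_conv_bounded_linear)
qed

lemma continuous_on_seg [continuous_intros]:
  "continuous_on S c \<Longrightarrow> continuous_on S f \<Longrightarrow> continuous_on S (\<lambda>p. seg v (c p) (f p))"
  unfolding seg_def divide_inverse by (intro continuous_intros)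

text \<open>The Leibniz rule for Frechet derivatives asks for a continuous family of bounded linear
  maps; this is the reason for \<open>Blinfun\<close>, which is then evaluated at
  \<open>h\<close>.\<close>

lemma seg_average_has_derivative:
  assumes f: "\<And>x. f differentiable (at x)" "\<And>i x. partial_deriv i f differentiable (at x)"
    and c: "continuous_on {0..1} c"
  shows "(seg_average v c f has_derivative
    (\<lambda>h. \<Sum>i\<in>UNIV. seg_average v (\<lambda>s. c s * (seg v s h $ i)) (partial_deriv i f) x)) (at x)"
proof -
  define D where "D x s h = c s *\<^sub>R (\<Sum>i\<in>UNIV. (seg v s h $ i) *\<^sub>R partial_deriv i f (seg v s x))" for x s h
  have blD: "bounded_linear (D x s)" for x s
    unfolding D_def
    by (intro bounded_linear_const_scaleR bounded_linear_sum bounded_linear_scaleR_const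
        bounded_linear_compose[OF bounded_linear_vec_nth bounded_linear_seg])
  have contf: "continuous_on UNIV f" "continuous_on UNIV (partial_deriv i f)" for i
    using f by (auto intro: continuous_on_differentiable)
  have contD: "continuous_on (UNIV \<times> cbox 0 1) (\<lambda>p. D (fst p) (snd p) h)" for h
  proof -
    let ?S = "UNIV \<times> cbox 0 (1::real)"
    have "continuous_on ?S (\<lambda>p. c (snd p))"
      by (rule continuous_on_compose2[OF c continuous_on_snd[OF continuous_on_id]]) auto
    moreover have "continuous_on ?S (\<lambda>p. partial_deriv i f (seg v (snd p) (fst p)))" for i
      by (rule continuous_on_compose2[OF contf(2)])
         (intro continuous_on_seg continuous_on_fst continuous_on_snd continuous_on_id subset_UNIV)+
    moreover have "continuous_on ?S (\<lambda>p. seg v (snd p) h $ i)" for i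
      by (intro bounded_linear.continuous_on[OF bounded_linear_vec_nth] continuous_on_seg
          continuous_on_snd continuous_on_id continuous_on_const)
    ultimately show ?thesis
      unfolding D_def by (intro continuous_on_scaleR continuous_on_sum)
  qed
  have "(seg_average v c f has_derivative integral (cbox 0 1) (\<lambda>s. Blinfun (D x s))) (at x within UNIV)"
    unfolding seg_average_def[abs_def] box_real[symmetric]
  proof (rule leibniz_rule)
    show "((\<lambda>x. c s *\<^sub>R f (seg v s x)) has_derivative blinfun_apply (Blinfun (D x s))) (at x within UNIV)" for x s
      unfolding bounded_linear_Blinfun_apply[OF blD] D_def
      using has_derivative_scaleR_right[OF has_derivative_of_differentiable_compose_linear[OF f(1) bounded_linear_seg]]
      by simp
    show "(\<lambda>s. c s *\<^sub>R f (seg v s x)) integrable_on cbox 0 1" for x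
      by (intro integrable_continuous continuous_intros continuous_on_compose2[OF contf(1)])
         (use c in \<open>auto simp: box_real\<close>)
    show "continuous_on (UNIV \<times> cbox 0 1) (\<lambda>(x, s). Blinfun (D x s))"
      unfolding case_prod_unfold
      by (rule continuous_on_blinfun_componentwise) (use contD in \<open>simp add: bounded_linear_Blinfun_apply[OF blD]\<close>)
  qed auto
  moreover have eq: "blinfun_apply (integral (cbox 0 1) (\<lambda>s. Blinfun (D x s))) h =
     (\<Sum>i\<in>UNIV. seg_average v (\<lambda>s. c s * (seg v s h $ i)) (partial_deriv i f) x)" for h
  proof -
    have c1: "continuous_on (cbox 0 1) (\<lambda>s. Blinfun (D x s))"
    proof (rule continuous_on_blinfun_componentwise)
      fix i :: "real ^ 'a"
      have "continuous_on (cbox 0 1) (\<lambda>s. D x s i)"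
        using continuous_on_compose2[OF contD[of i] continuous_on_Pair[OF continuous_on_const[of _ x] continuous_on_id], of "cbox 0 1"]
        by (simp add: image_subset_iff)
      then show "continuous_on (cbox 0 1) (\<lambda>s. blinfun_apply (Blinfun (D x s)) i)"
        by (simp add: bounded_linear_Blinfun_apply[OF blD])
    qed
    have "blinfun_apply (integral (cbox 0 1) (\<lambda>s. Blinfun (D x s))) h = integral (cbox 0 1) (\<lambda>s. D x s h)"
      using blinfun_apply_integral[OF integrable_continuous[OF c1], of h]
      by (simp add: bounded_linear_Blinfun_apply[OF blD])
    also have "\<dots> = integral {0..1} (\<lambda>s. \<Sum>i\<in>UNIV. (c s * (seg v s h $ i)) *\<^sub>R partial_deriv i f (seg v s x))"
      unfolding D_def box_real by (simp add: scaleR_sum_right)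
    also have "\<dots> = (\<Sum>i\<in>UNIV. integral {0..1} (\<lambda>s. (c s * (seg v s h $ i)) *\<^sub>R partial_deriv i f (seg v s x)))"
    proof (rule integral_sum)
      fix i
      show "(\<lambda>s. (c s * (seg v s h $ i)) *\<^sub>R partial_deriv i f (seg v s x)) integrable_on {0..1}"
        by (intro integrable_continuous_interval continuous_on_scaleR continuous_on_mult c
            bounded_linear.continuous_on[OF bounded_linear_vec_nth] continuous_on_compose2[OF contf(2)]
            continuous_on_seg continuous_on_id continuous_on_const subset_UNIV)
    qed auto
    finally show ?thesis by (simp add: seg_average_def)
  qed
  ultimately show ?thesis by (simp only: ext[OF eq])
qed

definition slab :: "real ^ 'n \<Rightarrow> (real ^ 'n) set" where
  "slab v = {x. \<bar>v \<bullet> x\<bar> \<le> 1}"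

text \<open>In the slab the segment has length at most \<open>2 / norm v\<close>, so
  \<open>1 + norm x\<close> is comparable to its values along the segment. Outside the slab the
  segment may reach the origin from far away and the comparison fails.\<close>

lemma seg_average_decays:
  assumes f: "decays_on UNIV f" "\<And>x. f differentiable (at x)" and c: "continuous_on {0..1} c" and v: "v \<noteq> 0"
  shows "decays_on (slab v) (seg_average v c f)"
  unfolding decays_on_def
proof
  fix N
  obtain C where C: "C \<ge> 0" "\<And>x. norm (f x) * (1 + norm x) ^ N \<le> C"
    using decays_onD[OF f(1), of N] by blast
  have "compact (c ` {0..1})" by (rule compact_continuous_image[OF c]) simp
  then have "bounded (c ` {0..1})" by (rule compact_imp_bounded)
  then obtain B where "\<forall>y\<in>c ` {0..1}. norm y \<le> B" unfolding bounded_iff by blast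
  then have B: "\<bar>c s\<bar> \<le> B" if "s \<in> {0..1}" for s using that by auto
  define M where "M = 1 + 2 / norm v"
  have M: "M \<ge> 1" by (simp add: M_def)
  have contf: "continuous_on UNIV f"
    using f(2) by (rule continuous_on_differentiable)
  have "norm (seg_average v c f x) * (1 + norm x) ^ N \<le> B * (C * M ^ N)" if x: "x \<in> slab v" for x
  proof -
    define K where "K = B * (C * M ^ N) / (1 + norm x) ^ N"
    have pos: "0 < (1 + norm x) ^ N" by (simp add: add_pos_nonneg)
    have "norm (c s *\<^sub>R f (seg v s x)) \<le> K" if s: "s \<in> {0..1}" for s
    proof -
      have "norm (x - seg v s x) = s * (2 * \<bar>v \<bullet> x\<bar> / norm v)"
        using v s by (simp add: seg_def abs_mult inner_commute power2_eq_square)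
      also have "\<dots> \<le> 1 * (2 * 1 / norm v)"
        using s x by (intro mult_mono divide_right_mono) (auto simp: slab_def)
      finally have "norm x \<le> norm (seg v s x) + 2 / norm v"
        using norm_triangle_sub[of x "seg v s x"] by simp
      moreover have "2 / norm v * 1 \<le> 2 / norm v * (1 + norm (seg v s x))"
        by (intro mult_left_mono) auto
      ultimately have "1 + norm x \<le> M * (1 + norm (seg v s x))"
        unfolding M_def by (simp only: distrib_right mult_1_right mult_1_left)
      then have "(1 + norm x) ^ N \<le> (M * (1 + norm (seg v s x))) ^ N"
        by (intro power_mono) auto
      then have "norm (f (seg v s x)) * (1 + norm x) ^ N \<le> norm (f (seg v s x)) * (M * (1 + norm (seg v s x))) ^ N"
        by (intro mult_left_mono) auto
      also have "\<dots> = M ^ N * (norm (f (seg v s x)) * (1 + norm (seg v s x)) ^ N)"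
        by (simp add: power_mult_distrib)
      also have "\<dots> \<le> M ^ N * C" using C M by (intro mult_left_mono) auto
      finally have "\<bar>c s\<bar> * (norm (f (seg v s x)) * (1 + norm x) ^ N) \<le> B * (M ^ N * C)"
        using B[OF s] by (intro mult_mono[OF B[OF s]]) auto
      then show ?thesis using pos by (simp add: K_def pos_le_divide_eq mult_ac)
    qed
    then have "norm (seg_average v c f x) \<le> K * (1 - 0)"
      unfolding seg_average_def
      by (intro integral_bound continuous_intros c continuous_on_compose2[OF contf]) auto
    then show ?thesis using pos by (simp add: K_def pos_le_divide_eq)
  qed
  then show "\<exists>C. \<forall>x\<in>slab v. norm (seg_average v c f x) * (1 + norm x) ^ N \<le> C" by blast
qed

lemma seg_average_schwartz_upto_slab:
  assumes v: "v \<noteq> 0"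
  shows "(\<And>m. schwartz_upto UNIV m f) \<Longrightarrow> continuous_on {0..1} c \<Longrightarrow>
    schwartz_upto (slab v) n (seg_average v c f)"
proof (induction n arbitrary: f c)
  have D: "(seg_average v c f has_derivative
      (\<lambda>h. \<Sum>i\<in>UNIV. seg_average v (\<lambda>s. c s * (seg v s h $ i)) (partial_deriv i f) x)) (at x)"
    if "\<And>m. schwartz_upto UNIV m f" "continuous_on {0..1} c" for f c x
    using that(1)[of 0] that(1)[of "Suc 0"] that(2) by (intro seg_average_has_derivative) auto
  {
    case 0
    then show ?case using D[OF 0] seg_average_decays[OF _ _ 0(2) v] schwartz_upto_decays[OF 0(1)]
      schwartz_upto_differentiable[OF 0(1)] by (auto simp: differentiable_def)
  next
    case (Suc n)
    have "schwartz_upto UNIV m (partial_deriv i f)" for m i using Suc.prems(1)[of "Suc m"] by simp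
    moreover have "continuous_on {0..1} (\<lambda>s. c s * (seg v s (axis j 1) $ i))" for i j
      by (intro continuous_on_mult Suc.prems(2) continuous_on_seg continuous_on_id continuous_on_const
          bounded_linear.continuous_on[OF bounded_linear_vec_nth])
    ultimately have "schwartz_upto (slab v) n (\<lambda>x. \<Sum>i\<in>UNIV. seg_average v (\<lambda>s. c s * (seg v s (axis j 1) $ i)) (partial_deriv i f) x)" for j
      by (intro schwartz_upto_sum Suc.IH) auto
    moreover have "partial_deriv j (seg_average v c f) =
       (\<lambda>x. \<Sum>i\<in>UNIV. seg_average v (\<lambda>s. c s * (seg v s (axis j 1) $ i)) (partial_deriv i f) x)" for j
      using partial_deriv_eq[OF D[OF Suc.prems]] by auto
    ultimately show ?case
      using D[OF Suc.prems] seg_average_decays[OF _ _ Suc.prems(2) v] schwartz_upto_decays[OF Suc.prems(1)]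
      schwartz_upto_differentiable[OF Suc.prems(1)] by (auto simp: differentiable_def)
  }
qed

lemma decays_on_divide_linear:
  assumes Q: "decays_on (slab v) Q" and h: "decays_on UNIV (\<lambda>x. of_real (v \<bullet> x) * Q x)"
  shows "decays_on UNIV Q"
  unfolding decays_on_def
proof
  fix N
  obtain A where A: "\<And>x. x \<in> slab v \<Longrightarrow> norm (Q x) * (1 + norm x) ^ N \<le> A"
    using Q unfolding decays_on_def by blast
  obtain B where B: "\<And>x. norm (of_real (v \<bullet> x) * Q x) * (1 + norm x) ^ N \<le> B"
    using h unfolding decays_on_def by blast
  have "norm (Q x) * (1 + norm x) ^ N \<le> max A B" for x
  proof (cases "x \<in> slab v")
    case False
    then have "1 * norm (Q x) \<le> \<bar>v \<bullet> x\<bar> * norm (Q x)" by (intro mult_right_mono) (auto simp: slab_def)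
    then have "norm (Q x) * (1 + norm x) ^ N \<le> (\<bar>v \<bullet> x\<bar> * norm (Q x)) * (1 + norm x) ^ N"
      by (intro mult_right_mono) auto
    then show ?thesis using B[of x] by (simp add: norm_mult)
  qed (use A in fastforce)
  then show "\<exists>C. \<forall>x\<in>UNIV. norm (Q x) * (1 + norm x) ^ N \<le> C" by blast
qed

text \<open>Outside the slab \<open>\<bar>v \<bullet> x\<bar>\<close> exceeds 1, so \<open>Q\<close>
  is bounded by its product with \<open>v \<bullet> x\<close>. For derivatives,
  \<open>v \<bullet> x\<close> times a partial derivative of \<open>Q\<close> is the derivative of
  the product minus a multiple of \<open>Q\<close>, which the induction already controls.\<close>

lemma schwartz_upto_divide_linear:
  "(\<And>m. schwartz_upto (slab v) m Q) \<Longrightarrow> schwartz_upto UNIV n (\<lambda>x. of_real (v \<bullet> x) * Q x) \<Longrightarrow>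
    schwartz_upto UNIV n Q"
proof (induction n arbitrary: Q)
  case 0
  then show ?case using decays_on_divide_linear[of v Q] schwartz_upto_decays[OF 0(1)]
    schwartz_upto_differentiable[OF 0(1)] by auto
next
  case (Suc n)
  let ?h = "\<lambda>x. of_real (v \<bullet> x) * Q x"
  have Q: "schwartz_upto UNIV n Q" using Suc.IH[OF Suc.prems(1) schwartz_upto_Suc[OF Suc.prems(2)]] .
  have dQ: "Q differentiable (at x)" for x by (rule schwartz_upto_differentiable[OF Suc.prems(1)])
  have "schwartz_upto UNIV n (partial_deriv j Q)" for j
  proof (rule Suc.IH)
    show "schwartz_upto (slab v) m (partial_deriv j Q)" for m
      using Suc.prems(1)[of "Suc m"] by simp
    have "(\<lambda>x. of_real (v \<bullet> x) * partial_deriv j Q x) = (\<lambda>x. partial_deriv j ?h x + (- of_real (v $ j)) * Q x)"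
    proof
      fix x
      have "((\<lambda>x. of_real (v \<bullet> x) :: complex) has_derivative (\<lambda>h. of_real (v \<bullet> h))) (at x)"
        by (auto intro!: derivative_eq_intros)
      from has_derivative_mult[OF this differentiable_partial_deriv[OF dQ]]
      have "partial_deriv j ?h x = of_real (v \<bullet> x) * (\<Sum>i\<in>UNIV. (axis j 1 $ i) *\<^sub>R partial_deriv i Q x) + of_real (v \<bullet> axis j 1) * Q x"
        by (rule partial_deriv_eq)
      moreover have "(\<Sum>i\<in>UNIV. (axis j 1 $ i :: real) *\<^sub>R partial_deriv i Q x) = partial_deriv j Q x"
        using derivative_axis_sum[OF has_derivative_linear[OF differentiable_partial_deriv[OF dQ]], of "axis j 1" x]
          partial_deriv_eq[OF differentiable_partial_deriv[OF dQ], of j x] by metis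
      ultimately show "of_real (v \<bullet> x) * partial_deriv j Q x = partial_deriv j ?h x + (- of_real (v $ j)) * Q x"
        by (simp add: inner_axis)
    qed
    moreover have "schwartz_upto UNIV n (\<lambda>x. partial_deriv j ?h x + (- of_real (v $ j)) * Q x)"
      using Suc.prems(2) by (intro schwartz_upto_add schwartz_upto_cmult Q) auto
    ultimately show "schwartz_upto UNIV n (\<lambda>x. of_real (v \<bullet> x) * partial_deriv j Q x)" by simp
  qed
  then show ?case using schwartz_upto_decays[OF Q] dQ by simp
qed

text \<open>In the slab decay comes from the averages; elsewhere it comes from
  \<open>rquot_eq\<close>, by which the product with \<open>v \<bullet> x\<close> is a difference of
  functions with decay.\<close>

lemma rquot_schwartz_upto:
  assumes f: "\<And>m. schwartz_upto UNIV m f" and f': "\<And>x. (f has_derivative f' x) (at x)" and v: "v \<noteq> 0"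
  shows "schwartz_upto UNIV n (rquot v f')"
proof (rule schwartz_upto_divide_linear)
  have df: "f differentiable (at x)" for x by (rule schwartz_upto_differentiable[OF f])
  have pf: "schwartz_upto UNIV m (partial_deriv i f)" for m i using f[of "Suc m"] by simp
  have contf: "continuous_on UNIV (partial_deriv i f)" for i
    by (rule continuous_on_differentiable[OF schwartz_upto_differentiable[OF pf]])
  have "rquot v f' x = (\<Sum>i\<in>UNIV. of_real (2 / (norm v)\<^sup>2 * v $ i) * seg_average v (\<lambda>_. 1) (partial_deriv i f) x)" for x
  proof -
    have "f' y v = (\<Sum>i\<in>UNIV. (v $ i) *\<^sub>R partial_deriv i f y)" for y
      unfolding partial_deriv_eq[OF f'] by (rule derivative_axis_sum[OF has_derivative_linear[OF f']])
    then have "rquot v f' x = (2 / (norm v)\<^sup>2) *\<^sub>R integral {0..1} (\<lambda>s. \<Sum>i\<in>UNIV. (v $ i) *\<^sub>R partial_deriv i f (seg v s x))"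
      by (simp add: rquot_def seg_def)
    also have "integral {0..1} (\<lambda>s. \<Sum>i\<in>UNIV. (v $ i) *\<^sub>R partial_deriv i f (seg v s x)) =
       (\<Sum>i\<in>UNIV. integral {0..1} (\<lambda>s. (v $ i) *\<^sub>R partial_deriv i f (seg v s x)))"
      by (rule integral_sum)
         (auto intro!: integrable_continuous_interval continuous_intros continuous_on_compose2[OF contf])
    finally show ?thesis
      by (simp add: seg_average_def scaleR_conv_of_real sum_divide_distrib sum_distrib_left mult.assoc)
  qed
  then have "rquot v f' = (\<lambda>x. \<Sum>i\<in>UNIV. of_real (2 / (norm v)\<^sup>2 * v $ i) * seg_average v (\<lambda>_. 1) (partial_deriv i f) x)"
    by blast
  moreover have "schwartz_upto (slab v) m (\<lambda>x. \<Sum>i\<in>UNIV. of_real (2 / (norm v)\<^sup>2 * v $ i) * seg_average v (\<lambda>_. 1) (partial_deriv i f) x)" for m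
    by (intro schwartz_upto_sum schwartz_upto_cmult seg_average_schwartz_upto_slab v pf) auto
  ultimately show "schwartz_upto (slab v) m (rquot v f')" for m by simp
  have "(\<lambda>x. of_real (v \<bullet> x) * rquot v f' x) = (\<lambda>x. f x + (- 1) * f (reflection v x))"
    using rquot_eq[OF f' v] by (auto simp: scaleR_conv_of_real)
  then show "schwartz_upto UNIV n (\<lambda>x. of_real (v \<bullet> x) * rquot v f' x)"
    by (simp only:) (intro schwartz_upto_add schwartz_upto_cmult schwartz_upto_reflect f)
qed

section \<open>The Dunkl transform\<close>

context dunkl_setting
begin

definition schwartz where "schwartz f \<longleftrightarrow> (\<forall>n. schwartz_upto UNIV n f)"

definition grad :: "(real ^ 'n \<Rightarrow> complex) \<Rightarrow> real ^ 'n \<Rightarrow> real ^ 'n \<Rightarrow> complex" where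
  "grad f x h = (\<Sum>j\<in>UNIV. (h $ j) *\<^sub>R partial_deriv j f x)"

lemma schwartz_partial: "schwartz f \<Longrightarrow> schwartz (partial_deriv j f)"
  unfolding schwartz_def by (metis schwartz_upto.simps(2))

lemma schwartz_differentiable: "schwartz f \<Longrightarrow> f differentiable (at x)"
  unfolding schwartz_def using schwartz_upto_differentiable by blast

lemma schwartz_decays: "schwartz f \<Longrightarrow> decays_on UNIV f"
  unfolding schwartz_def using schwartz_upto_decays by blast

lemma schwartz_continuous: "schwartz f \<Longrightarrow> continuous_on UNIV f"
  by (rule continuous_on_differentiable[OF schwartz_differentiable])

lemma schwartz_has_derivative: "schwartz f \<Longrightarrow> (f has_derivative grad f x) (at x)"
  unfolding grad_def[abs_def] by (rule differentiable_partial_deriv[OF schwartz_differentiable])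

lemma schwartz_bounded: "schwartz f \<Longrightarrow> \<exists>C\<ge>0. \<forall>x. norm (f x) \<le> C"
  using decays_onD[OF schwartz_decays, of f 0] by simp

lemma schwartz_grad_bounded: assumes "schwartz f" shows "\<exists>C\<ge>0. \<forall>x h. norm (grad f x h) \<le> C * norm h"
proof -
  have "\<forall>j. \<exists>C\<ge>0. \<forall>x. norm (partial_deriv j f x) \<le> C"
    using schwartz_bounded[OF schwartz_partial[OF assms]] by blast
  then obtain C where C: "\<And>j. C j \<ge> 0" "\<And>j x. norm (partial_deriv j f x) \<le> C j" by metis
  have "norm (grad f x h) \<le> (\<Sum>j\<in>UNIV. C j) * norm h" for x h
  proof -
    have "norm (grad f x h) \<le> (\<Sum>j\<in>UNIV. norm ((h $ j) *\<^sub>R partial_deriv j f x))"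
      unfolding grad_def by (rule norm_sum)
    also have "\<dots> \<le> (\<Sum>j\<in>UNIV. norm h * C j)"
      unfolding norm_scaleR real_norm_def
      by (intro sum_mono mult_mono component_le_norm_cart C) auto
    finally show ?thesis by (simp add: sum_distrib_left sum_distrib_right mult.commute)
  qed
  then show ?thesis using C(1) by (intro exI[of _ "\<Sum>j\<in>UNIV. C j"]) (auto intro: sum_nonneg)
qed

lemma schwartz_c1exp: assumes "schwartz f" shows "c1exp f (grad f)"
proof -
  obtain C where "C \<ge> 0" "\<And>x. norm (f x) \<le> C" using schwartz_bounded[OF assms] by blast
  moreover obtain D where "D \<ge> 0" "\<And>x h. norm (grad f x h) \<le> D * norm h" using schwartz_grad_bounded[OF assms] by blast
  ultimately show ?thesis
    by (intro c1expI[where C = C and A = 0 and D = D and B = 0] schwartz_has_derivative assms) auto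
qed

lemma schwartz_lipschitz:
  fixes f :: "real ^ 'n \<Rightarrow> complex"
  assumes "schwartz f"
  shows "\<exists>L\<ge>0. \<forall>x y. norm (f x - f y) \<le> L * norm (x - y)"
proof -
  obtain D where D: "D \<ge> 0" "\<And>x h. norm (grad f x h) \<le> D * norm h" using schwartz_grad_bounded[OF assms] by blast
  have "norm (f x - f y) \<le> D * norm (x - y)" for x y
    by (rule differentiable_bound[of UNIV f "grad f"])
       (use schwartz_has_derivative[OF assms] D(2) in \<open>auto intro!: onorm_le\<close>)
  then show ?thesis using D(1) by blast
qed

lemma continuous_grad: "schwartz f \<Longrightarrow> continuous_on UNIV (\<lambda>x. grad f x h)"
  unfolding grad_def
  by (intro continuous_on_sum continuous_on_scaleR continuous_on_const schwartz_continuous schwartz_partial)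

lemma schwartz_dunkl_op: assumes f: "schwartz f" shows "schwartz (dunkl_op P k j f)"
  unfolding schwartz_def
proof
  fix n
  have "dunkl_op P k j f = (\<lambda>x. grad f x (axis j 1) + (\<Sum>v\<in>P. of_real (k v * (v \<bullet> axis j 1)) * rquot v (grad f) x))"
    using dunkl_op_C1[OF schwartz_has_derivative[OF f] continuous_grad[OF f]] by blast
  moreover have "schwartz_upto UNIV n (\<lambda>x. grad f x (axis j 1))"
    using schwartz_partial[OF f] unfolding grad_def scaleR_conv_of_real schwartz_def
    by (intro schwartz_upto_sum schwartz_upto_cmult) auto
  moreover have "schwartz_upto UNIV n (\<lambda>x. \<Sum>v\<in>P. of_real (k v * (v \<bullet> axis j 1)) * rquot v (grad f) x)"
    using f unfolding schwartz_def
    by (intro schwartz_upto_sum schwartz_upto_cmult rquot_schwartz_upto[OF _ schwartz_has_derivative[OF f]]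
        finite_P P_nonzero) auto
  ultimately show "schwartz_upto UNIV n (dunkl_op P k j f)"
    by (simp only: schwartz_upto_add)
qed

text \<open>Against functions that merely decay faster than every power, the exponential bound
  \<open>w_bound\<close> is too weak. The exponents \<open>2 * k v\<close> are rounded up to natural
  numbers to match \<open>decays_on\<close>.\<close>

lemma w_poly: "\<exists>C M. 0 \<le> C \<and> (\<forall>x. w x \<le> C * (1 + norm x) ^ M)"
proof -
  define C where "C = (\<Prod>v\<in>P. (1 + norm v) powr (2 * k v))"
  define M where "M = (\<Sum>v\<in>P. nat \<lceil>2 * k v\<rceil>)"
  have "w x \<le> C * (1 + norm x) ^ M" for x
  proof -
    have "w x \<le> (\<Prod>v\<in>P. (1 + norm v) powr (2 * k v) * (1 + norm x) ^ nat \<lceil>2 * k v\<rceil>)"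
      unfolding dunkl_weight_def
    proof (rule prod_mono, intro conjI)
      fix v assume v: "v \<in> P"
      have kv: "0 \<le> k v" by (rule k_nonneg[OF v])
      show "0 \<le> (if k v = 0 then 1 else \<bar>x \<bullet> v\<bar> powr (2 * k v))" by simp
      have 1: "1 \<le> (1 + norm x) ^ nat \<lceil>2 * k v\<rceil>" "1 \<le> (1 + norm v) powr (2 * k v)"
        using kv by (auto intro!: one_le_power ge_one_powr_ge_zero)
      show "(if k v = 0 then 1 else \<bar>x \<bullet> v\<bar> powr (2 * k v)) \<le> (1 + norm v) powr (2 * k v) * (1 + norm x) ^ nat \<lceil>2 * k v\<rceil>"
      proof (cases "k v = 0")
        case False
        have "\<bar>x \<bullet> v\<bar> \<le> norm x * norm v" by (rule Cauchy_Schwarz_ineq2)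
        also have "\<dots> \<le> (1 + norm v) * (1 + norm x)" by (simp add: algebra_simps)
        finally have "\<bar>x \<bullet> v\<bar> powr (2 * k v) \<le> ((1 + norm v) * (1 + norm x)) powr (2 * k v)"
          using kv by (intro powr_mono2) auto
        also have "\<dots> = (1 + norm v) powr (2 * k v) * (1 + norm x) powr (2 * k v)"
          by (rule powr_mult)
        also have "(1 + norm x) powr (2 * k v) \<le> (1 + norm x) powr (real (nat \<lceil>2 * k v\<rceil>))"
          by (intro powr_mono) (auto simp: real_nat_ceiling_ge)
        also have "\<dots> = (1 + norm x) ^ nat \<lceil>2 * k v\<rceil>"
          by (rule powr_realpow) (simp add: add_pos_nonneg)
        finally show ?thesis using False by (simp add: mult_left_mono)
      next
        case True
        then show ?thesis using mult_mono[OF 1(2) 1(1)] by simp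
      qed
    qed
    also have "\<dots> = C * (1 + norm x) ^ M"
      by (simp add: C_def M_def prod.distrib power_sum)
    finally show ?thesis .
  qed
  moreover have "0 \<le> C" unfolding C_def by (intro prod_nonneg) auto
  ultimately show ?thesis by blast
qed

lemma integrable_w_decays:
  fixes h :: "real ^ 'n \<Rightarrow> 'b::{banach, second_countable_topology}"
  assumes f: "decays_on UNIV f" and h: "h \<in> borel_measurable borel"
    and le: "\<And>x. norm (h x) \<le> B * (1 + norm x) ^ m * norm (f x)"
  shows "integrable lborel (\<lambda>x. w x *\<^sub>R h x)"
proof -
  obtain C M where C: "0 \<le> C" "\<And>x. w x \<le> C * (1 + norm x) ^ M" using w_poly by blast
  \<comment> \<open>The order of decay pays for the weight, for the factor
    \<open>(1 + norm x) ^ m\<close>, and for integrability at infinity.\<close>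
  obtain D where D: "D \<ge> 0" "\<And>x. norm (f x) * (1 + norm x) ^ (M + m + 2 * CARD('n)) \<le> D"
    using decays_onD[OF f] by blast
  show ?thesis
  proof (rule Bochner_Integration.integrable_bound)
    show "integrable lborel (\<lambda>x :: real ^ 'n. C * (\<bar>B\<bar> * D) * (1 / (1 + norm x) ^ (2 * CARD('n))))"
      by (intro integrable_mult_right integrable_poly_decay)
    show "(\<lambda>x. w x *\<^sub>R h x) \<in> borel_measurable lborel" using h by measurable
    show "AE x in lborel. norm (w x *\<^sub>R h x) \<le> norm (C * (\<bar>B\<bar> * D) * (1 / (1 + norm x) ^ (2 * CARD('n))))"
    proof (rule AE_I2)
      fix x :: "real ^ 'n"
      define r where "r = 1 + norm x"
      have r: "r > 0" by (simp add: r_def add_pos_nonneg)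
      have "norm (h x) \<le> \<bar>B\<bar> * r ^ m * norm (f x)"
        using le[of x] r by (intro order_trans[OF le] mult_right_mono) (auto simp: r_def)
      then have "w x * norm (h x) \<le> (C * r ^ M) * (\<bar>B\<bar> * r ^ m * norm (f x))"
        using C r by (intro mult_mono) (auto simp: r_def)
      also have "\<dots> = C * \<bar>B\<bar> * (norm (f x) * r ^ (M + m + 2 * CARD('n))) / r ^ (2 * CARD('n))"
        using r by (simp add: power_add)
      also have "\<dots> \<le> C * \<bar>B\<bar> * D / r ^ (2 * CARD('n))"
        using D(2)[of x] C r by (intro divide_right_mono mult_left_mono) (auto simp: r_def)
      finally show "norm (w x *\<^sub>R h x) \<le> norm (C * (\<bar>B\<bar> * D) * (1 / (1 + norm x) ^ (2 * CARD('n))))"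
        using C D by (simp add: r_def abs_mult)
    qed
  qed
qed

section \<open>Decay and continuity of the transform\<close>

definition \<kappa> where "\<kappa> = sqrt (real (card G))"

lemma kappa_nonneg: "0 \<le> \<kappa>" by (simp add: \<kappa>_def)

lemma norm_E_i: "norm (E \<i> x y) \<le> \<kappa>" "norm (E (- \<i>) x y) \<le> \<kappa>"
  using norm_E_imaginary by (auto simp: \<kappa>_def)

text \<open>The Dunkl transform without its factor \<open>1 / dunkl_const P k\<close>; the
  normalisation is restored in \<open>dunkl_translation_eq\<close>.\<close>

definition dtr :: "(real ^ 'n \<Rightarrow> complex) \<Rightarrow> real ^ 'n \<Rightarrow> complex" where
  "dtr f \<xi> = (LINT x|lborel. w x *\<^sub>R (f x * E (- \<i>) \<xi> x))"

lemma schwartz_measurable: "schwartz f \<Longrightarrow> f \<in> borel_measurable borel"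
  by (rule borel_measurable_continuous_onI[OF schwartz_continuous])

lemma integrable_dtr: assumes "schwartz f" shows "integrable lborel (\<lambda>x. w x *\<^sub>R (f x * E (- \<i>) \<xi> x))"
proof (rule integrable_w_decays[OF schwartz_decays[OF assms], of _ \<kappa> 0])
  show "(\<lambda>x. f x * E (- \<i>) \<xi> x) \<in> borel_measurable borel"
    using schwartz_measurable[OF assms] by measurable
  show "norm (f x * E (- \<i>) \<xi> x) \<le> \<kappa> * (1 + norm x) ^ 0 * norm (f x)" for x
    using mult_right_mono[OF norm_E_i(2)[of \<xi> x], of "norm (f x)"] by (simp add: norm_mult mult.commute)
qed

lemma dtr_bounded: assumes f: "schwartz f" shows "\<exists>C. \<forall>\<xi>. norm (dtr f \<xi>) \<le> C"
proof -
  have int: "integrable lborel (\<lambda>x. w x *\<^sub>R (\<kappa> * norm (f x)))"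
    by (rule integrable_w_decays[OF schwartz_decays[OF f], of _ \<kappa> 0])
       (use schwartz_measurable[OF f] kappa_nonneg in auto)
  have "norm (dtr f \<xi>) \<le> (LINT x|lborel. w x *\<^sub>R (\<kappa> * norm (f x)))" for \<xi>
    unfolding dtr_def
  proof (rule order_trans[OF integral_norm_bound integral_mono[OF integrable_norm[OF integrable_dtr[OF f]] int]])
    fix x
    show "norm (w x *\<^sub>R (f x * E (- \<i>) \<xi> x)) \<le> w x *\<^sub>R (\<kappa> * norm (f x))"
      using mult_left_mono[OF mult_right_mono[OF norm_E_i(2)[of \<xi> x], of "norm (f x)"], of "w x"]
      by (simp add: norm_mult mult.commute)
  qed
  then show ?thesis by blast
qed

lemma gauss_tendsto: "(\<lambda>i. gauss (1 / real (Suc i)) x) \<longlonglongrightarrow> 1"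
proof -
  have "(\<lambda>i. 1 / real (Suc i)) \<longlonglongrightarrow> 0"
    using LIMSEQ_inverse_real_of_nat by (simp only: inverse_eq_divide)
  then have "(\<lambda>i. exp (- (1 / real (Suc i) * ((norm x)\<^sup>2 / 2)))) \<longlonglongrightarrow> exp (- (0 * ((norm x)\<^sup>2 / 2)))"
    by (intro tendsto_exp tendsto_minus tendsto_mult tendsto_const)
  then show ?thesis by (simp add: gauss_def)
qed

lemma gauss_le_1: "0 \<le> s \<Longrightarrow> gauss s x \<le> 1"
  by (simp add: gauss_def)

text \<open>\<open>dop_antisymmetric\<close> carries a Gaussian. Letting its parameter tend to 0
  removes it together with the term that has this parameter as a factor; the decay of
  \<open>f\<close> provides the majorant.\<close>

lemma dtr_dunkl_op:
  assumes f: "schwartz f"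
  shows "dtr (dunkl_op P k j f) \<xi> = \<i> * of_real (\<xi> $ j) * dtr f \<xi>"
proof -
  let ?T = "dunkl_op P k j f" and ?e = "E (- \<i>) \<xi>"
  have T: "schwartz ?T" by (rule schwartz_dunkl_op[OF f])
  note [measurable] = schwartz_measurable[OF f] schwartz_measurable[OF T]
  let ?s = "\<lambda>i. 1 / real (Suc i)"
  let ?H = "\<lambda>s x. ?T x * ?e x + f x * (- \<i> * of_real (\<xi> $ j) * ?e x) - (s * (x $ j)) *\<^sub>R (f x * ?e x)"
  have zero: "(LINT x|lborel. gauss (?s i) x *\<^sub>R (w x *\<^sub>R ?H (?s i) x)) = 0" for i
  proof -
    have "(LINT x|lborel. gauss (?s i) x *\<^sub>R (w x *\<^sub>R ?H (?s i) x)) =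
      (LINT x|lborel. (gauss (?s i) x * w x) *\<^sub>R (dop f (grad f) (axis j 1) x * ?e x +
         f x * dop ?e (DE (- \<i>) \<xi>) (axis j 1) x - (?s i * (x \<bullet> axis j 1)) *\<^sub>R (f x * ?e x)))"
    proof (rule integral_cong_AE)
      show "(\<lambda>x. (gauss (?s i) x * w x) *\<^sub>R (dop f (grad f) (axis j 1) x * ?e x +
         f x * dop ?e (DE (- \<i>) \<xi>) (axis j 1) x - (?s i * (x \<bullet> axis j 1)) *\<^sub>R (f x * ?e x))) \<in> borel_measurable lborel"
        unfolding dop_def using c1exp_measurable(2)[OF c1exp_E] c1exp_measurable(2)[OF schwartz_c1exp[OF f]] by measurable
      show "AE x in lborel. gauss (?s i) x *\<^sub>R (w x *\<^sub>R ?H (?s i) x) =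
         (gauss (?s i) x * w x) *\<^sub>R (dop f (grad f) (axis j 1) x * ?e x +
         f x * dop ?e (DE (- \<i>) \<xi>) (axis j 1) x - (?s i * (x \<bullet> axis j 1)) *\<^sub>R (f x * ?e x))"
        using AE_Om
      proof eventually_elim
        fix x assume x: "x \<in> Om"
        show "gauss (?s i) x *\<^sub>R (w x *\<^sub>R ?H (?s i) x) =
         (gauss (?s i) x * w x) *\<^sub>R (dop f (grad f) (axis j 1) x * ?e x +
         f x * dop ?e (DE (- \<i>) \<xi>) (axis j 1) x - (?s i * (x \<bullet> axis j 1)) *\<^sub>R (f x * ?e x))"
          unfolding dop_E[OF x] dunkl_op_Om[OF schwartz_has_derivative[OF f] x, symmetric] inner_axis
          by (simp only: scaleR_scaleR inner_real_def mult_1_right)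
      qed
    qed measurable
    also have "\<dots> = 0"
      by (rule dop_antisymmetric[OF _ schwartz_c1exp[OF f] c1exp_E]) simp
    finally show ?thesis .
  qed
  have lim: "(\<lambda>i. LINT x|lborel. gauss (?s i) x *\<^sub>R (w x *\<^sub>R ?H (?s i) x)) \<longlonglongrightarrow>
     (LINT x|lborel. 1 *\<^sub>R (w x *\<^sub>R ?H 0 x))"
  proof (rule integral_dominated_convergence)
    have "integrable lborel (\<lambda>x. w x *\<^sub>R (\<kappa> * norm (?T x)))"
      by (rule integrable_w_decays[OF schwartz_decays[OF T], of _ \<kappa> 0]) (use kappa_nonneg in auto)
    moreover have "integrable lborel (\<lambda>x. w x *\<^sub>R (\<kappa> * (norm \<xi> + norm x) * norm (f x)))"
    proof (rule integrable_w_decays[OF schwartz_decays[OF f], of _ "\<kappa> * (1 + norm \<xi>)" 1])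
      show "norm (\<kappa> * (norm \<xi> + norm x) * norm (f x)) \<le> \<kappa> * (1 + norm \<xi>) * (1 + norm x) ^ 1 * norm (f x)" for x
      proof -
        have "norm \<xi> + norm x \<le> (1 + norm \<xi>) * (1 + norm x)" by (simp add: algebra_simps)
        then have "\<kappa> * (norm \<xi> + norm x) * norm (f x) \<le> \<kappa> * ((1 + norm \<xi>) * (1 + norm x)) * norm (f x)"
          by (intro mult_right_mono mult_left_mono kappa_nonneg) auto
        then show ?thesis using kappa_nonneg by (simp add: mult.assoc)
      qed
    qed measurable
    ultimately show "integrable lborel (\<lambda>x. w x *\<^sub>R (\<kappa> * norm (?T x)) + w x *\<^sub>R (\<kappa> * (norm \<xi> + norm x) * norm (f x)))"
      by (rule Bochner_Integration.integrable_add)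
    show "AE x in lborel. (\<lambda>i. gauss (?s i) x *\<^sub>R (w x *\<^sub>R ?H (?s i) x)) \<longlonglongrightarrow> 1 *\<^sub>R (w x *\<^sub>R ?H 0 x)"
    proof (rule AE_I2)
      fix x
      have "?s \<longlonglongrightarrow> 0" using LIMSEQ_inverse_real_of_nat by (simp only: inverse_eq_divide)
      then show "(\<lambda>i. gauss (?s i) x *\<^sub>R (w x *\<^sub>R ?H (?s i) x)) \<longlonglongrightarrow> 1 *\<^sub>R (w x *\<^sub>R ?H 0 x)"
        by (intro tendsto_scaleR gauss_tendsto tendsto_diff tendsto_const tendsto_mult)
    qed
    show "AE x in lborel. norm (gauss (?s i) x *\<^sub>R (w x *\<^sub>R ?H (?s i) x)) \<le>
        w x *\<^sub>R (\<kappa> * norm (?T x)) + w x *\<^sub>R (\<kappa> * (norm \<xi> + norm x) * norm (f x))" for i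
    proof (rule AE_I2)
      fix x
      have s: "0 < ?s i" "?s i \<le> 1" by auto
      have "norm (?H (?s i) x) \<le> norm (?T x * ?e x) + norm (f x * (- \<i> * of_real (\<xi> $ j) * ?e x)) + norm ((?s i * (x $ j)) *\<^sub>R (f x * ?e x))"
        using norm_triangle_ineq4 norm_triangle_ineq by (meson add_right_mono order_trans)
      also have "norm (?T x * ?e x) \<le> \<kappa> * norm (?T x)"
        using mult_right_mono[OF norm_E_i(2)[of \<xi> x], of "norm (?T x)"] by (simp add: norm_mult mult.commute)
      also have "norm (f x * (- \<i> * of_real (\<xi> $ j) * ?e x)) \<le> norm \<xi> * (\<kappa> * norm (f x))"
      proof -
        have "norm (f x * (- \<i> * of_real (\<xi> $ j) * ?e x)) = \<bar>\<xi> $ j\<bar> * (norm (?e x) * norm (f x))"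
          by (simp add: norm_mult)
        also have "\<dots> \<le> norm \<xi> * (\<kappa> * norm (f x))"
          by (intro mult_mono component_le_norm_cart norm_E_i mult_nonneg_nonneg kappa_nonneg) auto
        finally show ?thesis .
      qed
      also have "norm ((?s i * (x $ j)) *\<^sub>R (f x * ?e x)) \<le> norm x * (\<kappa> * norm (f x))"
      proof -
        have "norm ((?s i * (x $ j)) *\<^sub>R (f x * ?e x)) = (?s i * \<bar>x $ j\<bar>) * (norm (?e x) * norm (f x))"
          using s by (simp add: norm_mult abs_mult)
        also have "\<dots> \<le> (1 * norm x) * (\<kappa> * norm (f x))"
          using s by (intro mult_mono component_le_norm_cart norm_E_i mult_nonneg_nonneg kappa_nonneg) auto
        finally show ?thesis by simp
      qed
      finally have H: "norm (?H (?s i) x) \<le> \<kappa> * norm (?T x) + \<kappa> * (norm \<xi> + norm x) * norm (f x)"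
        by (simp add: algebra_simps)
      have "norm (gauss (?s i) x *\<^sub>R (w x *\<^sub>R ?H (?s i) x)) \<le> 1 * (w x * norm (?H (?s i) x))"
        unfolding norm_scaleR using gauss_le_1[of "?s i" x] gauss_pos[of "?s i" x] s by (intro mult_mono) auto
      also have "\<dots> \<le> w x * (\<kappa> * norm (?T x) + \<kappa> * (norm \<xi> + norm x) * norm (f x))"
        using mult_left_mono[OF H w_nonneg] by simp
      finally show "norm (gauss (?s i) x *\<^sub>R (w x *\<^sub>R ?H (?s i) x)) \<le>
        w x *\<^sub>R (\<kappa> * norm (?T x)) + w x *\<^sub>R (\<kappa> * (norm \<xi> + norm x) * norm (f x))"
        by (simp add: distrib_left)
    qed
  qed measurable
  have "0 = (LINT x|lborel. w x *\<^sub>R (?T x * ?e x) - \<i> * of_real (\<xi> $ j) * (w x *\<^sub>R (f x * ?e x)))"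
    using lim unfolding zero by (simp add: LIMSEQ_const_iff algebra_simps)
  also have "\<dots> = dtr ?T \<xi> - \<i> * of_real (\<xi> $ j) * dtr f \<xi>"
    unfolding dtr_def
    by (simp only: Bochner_Integration.integral_diff[OF integrable_dtr[OF T] integrable_mult_right[OF integrable_dtr[OF f]]]
      integral_mult_right_zero)
  finally show ?thesis by simp
qed

text \<open>A factor \<open>\<xi> $ j\<close> is traded for a Dunkl operator applied to
  \<open>f\<close>, and these operators preserve the Schwartz class; the induction on the exponent
  therefore runs over all Schwartz functions at once.\<close>

lemma dtr_decays: assumes "schwartz f" shows "decays_on UNIV (dtr f)"
  unfolding decays_on_def
proof
  fix N
  have "\<exists>C. \<forall>\<xi>. norm (dtr f \<xi>) * (1 + norm \<xi>) ^ N \<le> C" if "schwartz f" for f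
    using that
  proof (induction N arbitrary: f)
    case 0
    then show ?case using dtr_bounded by simp
  next
    case (Suc N)
    obtain A where A: "\<And>\<xi>. norm (dtr f \<xi>) * (1 + norm \<xi>) ^ N \<le> A" using Suc.IH[OF Suc.prems] by blast
    have "\<forall>j. \<exists>C. \<forall>\<xi>. norm (dtr (dunkl_op P k j f) \<xi>) * (1 + norm \<xi>) ^ N \<le> C"
      using Suc.IH[OF schwartz_dunkl_op[OF Suc.prems]] by blast
    then obtain B where B: "\<And>j \<xi>. norm (dtr (dunkl_op P k j f) \<xi>) * (1 + norm \<xi>) ^ N \<le> B j" by metis
    have "norm (dtr f \<xi>) * (1 + norm \<xi>) ^ Suc N \<le> A + (\<Sum>j\<in>UNIV. B j)" for \<xi>
    proof -
      have "norm (dtr f \<xi>) * (1 + norm \<xi>) ^ Suc N = (1 + norm \<xi>) * (norm (dtr f \<xi>) * (1 + norm \<xi>) ^ N)"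
        by simp
      also have "\<dots> \<le> (1 + (\<Sum>j\<in>UNIV. \<bar>\<xi> $ j\<bar>)) * (norm (dtr f \<xi>) * (1 + norm \<xi>) ^ N)"
        by (intro mult_right_mono add_left_mono norm_le_l1_cart) auto
      also have "\<dots> = norm (dtr f \<xi>) * (1 + norm \<xi>) ^ N + (\<Sum>j\<in>UNIV. norm (dtr (dunkl_op P k j f) \<xi>) * (1 + norm \<xi>) ^ N)"
        unfolding dtr_dunkl_op[OF Suc.prems]
        by (simp add: norm_mult distrib_right sum_distrib_right mult.assoc)
      also have "\<dots> \<le> A + (\<Sum>j\<in>UNIV. B j)" by (intro add_mono A sum_mono B)
      finally show ?thesis .
    qed
    then show ?case by blast
  qed
  then show "\<exists>C. \<forall>x\<in>UNIV. norm (dtr f x) * (1 + norm x) ^ N \<le> C" using assms by simp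
qed

text \<open>For imaginary \<open>c\<close> the kernel is bounded by \<open>\<kappa>\<close>
  uniformly in \<open>y\<close>, which yields the dominating function. The transform and the
  translation are both integrals of this form.\<close>

lemma continuous_integral_E:
  assumes h: "integrable lborel (\<lambda>z. w z *\<^sub>R (h z :: complex))" and c: "Re c = 0"
    and hm: "h \<in> borel_measurable borel"
  shows "continuous_on UNIV (\<lambda>y. LINT z|lborel. w z *\<^sub>R (h z * E c y z))"
  unfolding continuous_on_sequentially
proof (intro allI ballI impI, elim conjE)
  fix Y and y :: "real ^ 'n" assume Y: "Y \<longlonglongrightarrow> y"
  show "((\<lambda>y. LINT z|lborel. w z *\<^sub>R (h z * E c y z)) \<circ> Y) \<longlonglongrightarrow> (LINT z|lborel. w z *\<^sub>R (h z * E c y z))"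
    unfolding o_def
  proof (rule integral_dominated_convergence)
    show "integrable lborel (\<lambda>z. \<kappa> * norm (w z *\<^sub>R h z))"
      by (intro integrable_mult_right integrable_norm h)
    show "AE z in lborel. (\<lambda>i. w z *\<^sub>R (h z * E c (Y i) z)) \<longlonglongrightarrow> w z *\<^sub>R (h z * E c y z)"
    proof (rule AE_I2)
      fix z
      have "continuous_on UNIV (\<lambda>y. E c y z)" by (intro continuous_on_E continuous_on_id continuous_on_const)
      then have "(\<lambda>i. E c (Y i) z) \<longlonglongrightarrow> E c y z"
        using Y unfolding continuous_on_sequentially o_def by blast
      then show "(\<lambda>i. w z *\<^sub>R (h z * E c (Y i) z)) \<longlonglongrightarrow> w z *\<^sub>R (h z * E c y z)"
        by (intro tendsto_scaleR tendsto_mult tendsto_const)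
    qed
    show "AE z in lborel. norm (w z *\<^sub>R (h z * E c (Y i) z)) \<le> \<kappa> * norm (w z *\<^sub>R h z)" for i
    proof (rule AE_I2)
      fix z
      have "norm (E c (Y i) z) * norm (w z *\<^sub>R h z) \<le> \<kappa> * norm (w z *\<^sub>R h z)"
        using norm_E_imaginary[OF c] by (intro mult_right_mono) (auto simp: \<kappa>_def)
      then show "norm (w z *\<^sub>R (h z * E c (Y i) z)) \<le> \<kappa> * norm (w z *\<^sub>R h z)" by (simp add: norm_mult mult_ac)
    qed
  qed (use hm in measurable)
qed

lemma continuous_dtr: assumes "schwartz f" shows "continuous_on UNIV (dtr f)"
proof -
  have "integrable lborel (\<lambda>x. w x *\<^sub>R f x)"
    by (rule integrable_w_decays[OF schwartz_decays[OF assms], of _ 1 0]) (use schwartz_measurable[OF assms] in auto)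
  then show ?thesis
    unfolding dtr_def[abs_def] by (rule continuous_integral_E) (use schwartz_measurable[OF assms] in auto)
qed

end

section \<open>Heat kernel, inversion and translation\<close>

lemma integral_lborel_scale:
  fixes f :: "real ^ 'n \<Rightarrow> real"
  assumes a: "a \<noteq> 0" and f: "f \<in> borel_measurable borel"
  shows "(LINT x|lborel. f x) = \<bar>a\<bar> ^ CARD('n) * (LINT x|lborel. f (a *\<^sub>R x))"
proof -
  have "(LINT x|lborel. f x) = (LINT x|density (distr lborel borel (\<lambda>x. 0 + a *\<^sub>R x)) (\<lambda>_. ennreal (\<bar>a\<bar> ^ CARD('n))). f x)"
    using lborel_affine[OF a, of "0 :: real ^ 'n"] by simp
  also have "\<dots> = (LINT x|distr lborel borel (\<lambda>x. 0 + a *\<^sub>R x). \<bar>a\<bar> ^ CARD('n) *\<^sub>R f x)"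
    by (rule integral_density) (use f in auto)
  also have "\<dots> = (LINT x|lborel. \<bar>a\<bar> ^ CARD('n) *\<^sub>R f (0 + a *\<^sub>R x))"
    by (rule integral_distr) (use f in auto)
  finally show ?thesis by simp
qed

lemma (in pair_sigma_finite) integrable_times_pair:
  fixes f :: "'a \<Rightarrow> real" and g :: "'b \<Rightarrow> real"
  assumes "integrable M1 f" "integrable M2 g"
  shows "integrable (M1 \<Otimes>\<^sub>M M2) (\<lambda>(x, y). f x * g y)"
proof (rule Fubini_integrable)
  have [measurable]: "f \<in> borel_measurable M1" "g \<in> borel_measurable M2" using assms by auto
  show "(\<lambda>(x, y). f x * g y) \<in> borel_measurable (M1 \<Otimes>\<^sub>M M2)" by measurable
  show "integrable M1 (\<lambda>x. LINT y|M2. norm (case (x, y) of (x, y) \<Rightarrow> f x * g y))"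
    using assms by (simp add: abs_mult)
  show "AE x in M1. integrable M2 (\<lambda>y. case (x, y) of (x, y) \<Rightarrow> f x * g y)"
    using assms by simp
qed

context dunkl_setting
begin

section \<open>Homogeneity of the weight and the Gaussian mass\<close>

lemma w_homogeneous: assumes "0 < a" shows "w (a *\<^sub>R x) = a powr (2 * \<Gamma>) * w x"
proof -
  have "w (a *\<^sub>R x) = (\<Prod>v\<in>P. a powr (2 * k v) * (if k v = 0 then 1 else \<bar>x \<bullet> v\<bar> powr (2 * k v)))"
    unfolding dunkl_weight_def using assms by (intro prod.cong refl) (auto simp: abs_mult powr_mult)
  also have "\<dots> = a powr (2 * \<Gamma>) * w x"
    unfolding dunkl_weight_def gamma_index_def
    using assms by (simp add: prod.distrib powr_sum sum_distrib_left)
  finally show ?thesis .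
qed

lemma w_pos: "x \<in> Om \<Longrightarrow> 0 < w x"
  unfolding dunkl_weight_def Om_def by (intro prod_pos) (auto simp: inner_commute)

lemma w_minus [simp]: "w (- x) = w x"
  unfolding dunkl_weight_def by (intro prod.cong refl) auto

lemma integrable_gauss_w1: "0 < s \<Longrightarrow> integrable lborel (\<lambda>x. gauss s x * w x)"
  using integrable_gauss_w[of s "\<lambda>_. 1 :: real"] by (simp add: exp_type_const)

lemma gmass_pos: assumes "0 < s" shows "0 < gmass s"
proof -
  have nn: "0 \<le> gauss s x * w x" for x using gauss_pos[of s x] by simp
  have "gmass s \<noteq> 0"
  proof
    assume "gmass s = 0"
    then have "AE x in lborel. gauss s x * w x = 0"
      unfolding gmass_def using integral_nonneg_eq_0_iff_AE[OF integrable_gauss_w1[OF assms]] nn by simp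
    with AE_Om have "AE x in (lborel :: (real ^ 'n) measure). False"
    proof eventually_elim
      case (elim x)
      then show ?case using w_pos[of x] gauss_pos[of s x] by simp
    qed
    then show False by (simp add: eventually_False ae_filter_eq_bot_iff)
  qed
  moreover have "0 \<le> gmass s" unfolding gmass_def by (rule Bochner_Integration.integral_nonneg) (rule nn)
  ultimately show ?thesis by simp
qed

lemma gmass_scale: assumes a: "0 < a" shows "gmass 1 = a ^ CARD('n) * a powr (2 * \<Gamma>) * gmass (a\<^sup>2)"
proof -
  have "gmass 1 = \<bar>a\<bar> ^ CARD('n) * (LINT x|lborel. gauss 1 (a *\<^sub>R x) * w (a *\<^sub>R x))"
    unfolding gmass_def by (rule integral_lborel_scale) (use a in auto)
  also have "(\<lambda>x. gauss 1 (a *\<^sub>R x) * w (a *\<^sub>R x)) = (\<lambda>x. a powr (2 * \<Gamma>) * (gauss (a\<^sup>2) x * w x))"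
    by (auto simp: w_homogeneous[OF a] gauss_def power_mult_distrib)
  finally show ?thesis using a by (simp add: gmass_def)
qed

text \<open>By scaling, \<open>gmass s\<close> is a power of \<open>s\<close> times
  \<open>gmass 1\<close>, and the powers for \<open>s\<close> and \<open>1 / s\<close> cancel. This
  makes the total mass of \<open>heat s x\<close> independent of \<open>s\<close>.\<close>

lemma gmass_mult: assumes s: "0 < s" shows "gmass s * gmass (1 / s) = (gmass 1)\<^sup>2"
proof -
  define a where "a = sqrt s"
  have a: "0 < a" "a\<^sup>2 = s" "(1 / a)\<^sup>2 = 1 / s" using s by (auto simp: a_def power_divide)
  have "gmass 1 * gmass 1 = (a ^ CARD('n) * a powr (2 * \<Gamma>) * gmass s) * ((1 / a) ^ CARD('n) * (1 / a) powr (2 * \<Gamma>) * gmass (1 / s))"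
    using gmass_scale[of a] gmass_scale[of "1 / a"] a by simp
  also have "\<dots> = (a ^ CARD('n) * (1 / a) ^ CARD('n)) * (a powr (2 * \<Gamma>) * (1 / a) powr (2 * \<Gamma>)) *
      (gmass s * gmass (1 / s))"
    by (simp only: mult_ac)
  also have "a ^ CARD('n) * (1 / a) ^ CARD('n) = 1" using a by (simp add: power_one_over)
  also have "a powr (2 * \<Gamma>) * (1 / a) powr (2 * \<Gamma>) = 1" using a by (simp add: powr_divide)
  finally show ?thesis by (simp add: power2_eq_square)
qed

lemma dunkl_const_gmass: "dunkl_const P k = gmass 1"
  by (simp add: dunkl_const_def gmass_def gauss_def)

lemma E_pair_measurable [measurable (raw)]:
  assumes "f \<in> borel_measurable M" "g \<in> borel_measurable M"
  shows "(\<lambda>p. E c (f p) (g p)) \<in> borel_measurable M"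
proof -
  have "(\<lambda>p. E c (fst p) (snd p)) \<in> borel_measurable (borel \<Otimes>\<^sub>M borel)"
    using borel_measurable_continuous_onI[OF continuous_on_E_pair] by (simp add: borel_prod)
  from measurable_compose[OF measurable_Pair[OF assms] this] show ?thesis by simp
qed

text \<open>Instances of \<open>gauss_EE\<close> and \<open>gauss_EE_moment\<close> with
  \<open>E 0 0 y = 1\<close> as second kernel. Scalar and Gaussian parameter are both
  \<open>t\<close>, so the first moment is centred at \<open>x\<close>.\<close>

lemma gauss_mass_real:
  assumes t: "0 < t"
  shows "(LINT y|lborel. gauss t y * w y * Re (E (of_real t) x y)) = gmass t * exp (t * (norm x)\<^sup>2 / 2)"
    and gauss_moment_real: "(LINT y|lborel. gauss t y * w y * (y \<bullet> \<eta>) * Re (E (of_real t) x y)) =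
      (x \<bullet> \<eta>) * (LINT y|lborel. gauss t y * w y * Re (E (of_real t) x y))"
proof -
  let ?I = "LINT y|lborel. gauss t y * w y * Re (E (of_real t) x y)"
  have "of_real ?I = (LINT y|lborel. (gauss t y * w y) *\<^sub>R (E (of_real t) x y * E 0 0 y))"
    unfolding integral_complex_of_real[symmetric]
    by (intro Bochner_Integration.integral_cong refl) (simp add: scaleR_conv_of_real E_real[symmetric])
  also have "\<dots> = of_real (gmass t * exp (t * (norm x)\<^sup>2 / 2))"
    unfolding gauss_EE[OF t] using t by (simp add: power2_eq_square exp_of_real[symmetric])
  finally show 1: "?I = gmass t * exp (t * (norm x)\<^sup>2 / 2)" by (simp only: of_real_eq_iff)
  have "of_real (LINT y|lborel. gauss t y * w y * (y \<bullet> \<eta>) * Re (E (of_real t) x y)) =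
     (LINT y|lborel. (gauss t y * w y) *\<^sub>R (of_real (y \<bullet> \<eta>) * (E (of_real t) x y * E 0 0 y)))"
    unfolding integral_complex_of_real[symmetric]
    by (intro Bochner_Integration.integral_cong refl) (simp add: scaleR_conv_of_real E_real[symmetric])
  also have "\<dots> = of_real (x \<bullet> \<eta>) * (LINT y|lborel. (gauss t y * w y) *\<^sub>R (E (of_real t) x y * E 0 0 y))"
    unfolding gauss_EE_moment[OF t] using t by simp
  also have "(LINT y|lborel. (gauss t y * w y) *\<^sub>R (E (of_real t) x y * E 0 0 y)) = of_real ?I"
    unfolding integral_complex_of_real[symmetric]
    by (intro Bochner_Integration.integral_cong refl) (simp add: scaleR_conv_of_real E_real[symmetric])
  finally show "(LINT y|lborel. gauss t y * w y * (y \<bullet> \<eta>) * Re (E (of_real t) x y)) = (x \<bullet> \<eta>) * ?I"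
    by (simp only: of_real_mult[symmetric] of_real_eq_iff)
qed

lemma exp_type_ReE: "exp_type (\<lambda>y. Re (E c x y))"
  by (rule exp_type_mono[OF exp_type_E[of c x]]) (simp add: abs_Re_le_cmod)

lemma integrable_gauss_ReE:
  assumes "0 < t" "exp_type q" "q \<in> borel_measurable borel"
  shows "integrable lborel (\<lambda>y. gauss t y * w y * (q y :: real) * Re (E (of_real t) x y))"
  using integrable_gauss_w[OF assms(1) exp_type_mult[OF assms(2) exp_type_ReE]] assms(3) by (simp add: mult.assoc)

text \<open>Integrating \<open>T\<^sub>j(E(x, \<cdot>) g)\<close> against \<open>y\<^sub>j\<close> gives the second moment of the heat kernel.\<close>

lemma gauss_second_moment:
  assumes t: "0 < t"
  shows "(LINT y|lborel. gauss t y * w y * (norm (x - y))\<^sup>2 * Re (E (of_real t) x y)) =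
    (real CARD('n) + 2 * \<Gamma>) / t * (LINT y|lborel. gauss t y * w y * Re (E (of_real t) x y))"
proof -
  let ?m = "\<lambda>y. Re (E (of_real t) x y)"
  let ?I = "LINT y|lborel. gauss t y * w y * ?m y"
  have coord: "(LINT y|lborel. gauss t y * w y * (y $ j)\<^sup>2 * ?m y) =
     (x $ j)\<^sup>2 * ?I + (1 + (\<Sum>v\<in>P. 2 * k v * (v $ j)\<^sup>2 / (norm v)\<^sup>2)) / t * ?I" for j
  proof -
    define \<eta> :: "real ^ 'n" where "\<eta> = axis j 1"
    define q where "q = 1 + (\<Sum>v\<in>P. 2 * k v * (v $ j)\<^sup>2 / (norm v)\<^sup>2)"
    have ie: "y \<bullet> \<eta> = y $ j" for y by (simp add: \<eta>_def inner_axis)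
    let ?e = "\<lambda>y. of_real (y \<bullet> \<eta>) :: complex" and ?e' = "\<lambda>y h. of_real (h \<bullet> \<eta>) :: complex"
    have e: "c1exp ?e ?e'"
    proof (rule c1expI[where C = "norm \<eta>" and A = 1 and D = "norm \<eta>" and B = 0])
      show "(?e has_derivative ?e' y) (at y)" for y by (auto intro!: derivative_eq_intros)
      show "norm (?e y) \<le> norm \<eta> * exp (1 * norm y)" for y
      proof -
        have "\<bar>y \<bullet> \<eta>\<bar> \<le> norm \<eta> * norm y" using Cauchy_Schwarz_ineq2[of y \<eta>] by (simp add: mult.commute)
        also have "\<dots> \<le> norm \<eta> * exp (1 * norm y)"
          unfolding mult_1_left using exp_ge_add_one_self[of "norm y"]
          by (intro mult_left_mono) (linarith, simp)
        finally show ?thesis by simp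
      qed
      show "norm (?e' y h) \<le> norm \<eta> * exp (0 * norm y) * norm h" for y h
        using Cauchy_Schwarz_ineq2[of h \<eta>] by (simp add: mult.commute)
    qed auto
    \<comment> \<open>The Dunkl operator maps its own coordinate function to a constant. Over all
      coordinates these constants add up to \<open>CARD('n) + 2 * \<Gamma>\<close>, the homogeneous
      dimension of the weighted space.\<close>
    have dope: "dop ?e ?e' \<eta> y = of_real q" if y: "y \<in> Om" for y
    proof -
      have 1: "(v \<bullet> \<eta> / (v \<bullet> y)) * (y \<bullet> \<eta> - reflection v y \<bullet> \<eta>) = 2 * (v $ j)\<^sup>2 / (norm v)\<^sup>2" if "v \<in> P" for v
      proof -
        have "v \<bullet> y \<noteq> 0" using y that by (auto simp: Om_def)
        moreover have "y \<bullet> \<eta> - reflection v y \<bullet> \<eta> = (2 * (v \<bullet> y) / (norm v)\<^sup>2) * (v \<bullet> \<eta>)"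
          by (simp add: reflection_def inner_diff_left inner_diff_right inner_commute)
        ultimately show ?thesis by (simp add: ie power2_eq_square)
      qed
      have "(\<Sum>v\<in>P. k v *\<^sub>R ((v \<bullet> \<eta> / (v \<bullet> y)) *\<^sub>R (?e y - ?e (reflection v y)))) =
          of_real (\<Sum>v\<in>P. 2 * k v * (v $ j)\<^sup>2 / (norm v)\<^sup>2)"
        unfolding of_real_sum
      proof (intro sum.cong refl)
        fix v assume "v \<in> P"
        have "k v *\<^sub>R ((v \<bullet> \<eta> / (v \<bullet> y)) *\<^sub>R (?e y - ?e (reflection v y))) =
           of_real (k v * ((v \<bullet> \<eta> / (v \<bullet> y)) * (y \<bullet> \<eta> - reflection v y \<bullet> \<eta>)))"
          by (simp only: scaleR_conv_of_real of_real_mult of_real_diff)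
        also have "\<dots> = of_real (2 * k v * (v $ j)\<^sup>2 / (norm v)\<^sup>2)"
          unfolding 1[OF \<open>v \<in> P\<close>] by simp
        finally show "k v *\<^sub>R ((v \<bullet> \<eta> / (v \<bullet> y)) *\<^sub>R (?e y - ?e (reflection v y))) = \<dots>" .
      qed
      then show ?thesis by (simp add: dop_def q_def \<eta>_def inner_axis)
    qed
    have ex: "exp_type (\<lambda>y::real ^ 'n. y $ j)"
      using exp_type_inner[OF exp_type_id exp_type_const[of \<eta>]] by (simp add: ie)
    note int = integrable_gauss_ReE[OF t]
    have i1: "integrable lborel (\<lambda>y. t * (x $ j) * (gauss t y * w y * (y $ j) * ?m y))"
      by (intro integrable_mult_right int ex) measurable
    have i2: "integrable lborel (\<lambda>y. q * (gauss t y * w y * ?m y))"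
      using int[of "\<lambda>_. 1"] by (simp add: exp_type_const)
    have i3: "integrable lborel (\<lambda>y. t * (gauss t y * w y * (y $ j)\<^sup>2 * ?m y))"
      unfolding power2_eq_square by (intro integrable_mult_right int exp_type_mult ex) measurable
    have "0 = (LINT y|lborel. (gauss t y * w y) *\<^sub>R (dop (E (of_real t) x) (DE (of_real t) x) \<eta> y * ?e y +
       E (of_real t) x y * dop ?e ?e' \<eta> y - (t * (y \<bullet> \<eta>)) *\<^sub>R (E (of_real t) x y * ?e y)))"
      by (rule dop_antisymmetric[OF t c1exp_E e, symmetric])
    also have "\<dots> = (LINT y|lborel. of_real (t * (x $ j) * (gauss t y * w y * (y $ j) * ?m y) + q * (gauss t y * w y * ?m y)
       - t * (gauss t y * w y * (y $ j)\<^sup>2 * ?m y)))"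
    proof (rule integral_cong_AE)
      show "(\<lambda>y. (gauss t y * w y) *\<^sub>R (dop (E (of_real t) x) (DE (of_real t) x) \<eta> y * ?e y +
       E (of_real t) x y * dop ?e ?e' \<eta> y - (t * (y \<bullet> \<eta>)) *\<^sub>R (E (of_real t) x y * ?e y))) \<in> borel_measurable lborel"
        unfolding dop_def using c1exp_measurable(2)[OF c1exp_E] by measurable
      show "AE y in lborel. (gauss t y * w y) *\<^sub>R (dop (E (of_real t) x) (DE (of_real t) x) \<eta> y * ?e y +
         E (of_real t) x y * dop ?e ?e' \<eta> y - (t * (y \<bullet> \<eta>)) *\<^sub>R (E (of_real t) x y * ?e y)) =
         of_real (t * (x $ j) * (gauss t y * w y * (y $ j) * ?m y) + q * (gauss t y * w y * ?m y)
         - t * (gauss t y * w y * (y $ j)\<^sup>2 * ?m y))"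
        using AE_Om
      proof eventually_elim
        fix y assume y: "y \<in> Om"
        show "(gauss t y * w y) *\<^sub>R (dop (E (of_real t) x) (DE (of_real t) x) \<eta> y * ?e y +
         E (of_real t) x y * dop ?e ?e' \<eta> y - (t * (y \<bullet> \<eta>)) *\<^sub>R (E (of_real t) x y * ?e y)) =
         of_real (t * (x $ j) * (gauss t y * w y * (y $ j) * ?m y) + q * (gauss t y * w y * ?m y)
         - t * (gauss t y * w y * (y $ j)\<^sup>2 * ?m y))"
          unfolding dope[OF y] dop_E[OF y] unfolding ie
          by (subst E_real, subst (2) E_real, subst (3) E_real)
             (simp add: scaleR_conv_of_real algebra_simps power2_eq_square)
      qed
    qed measurable
    also have "\<dots> = of_real (t * (x $ j) * (LINT y|lborel. gauss t y * w y * (y $ j) * ?m y) + q * ?I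
       - t * (LINT y|lborel. gauss t y * w y * (y $ j)\<^sup>2 * ?m y))"
      unfolding integral_complex_of_real
        Bochner_Integration.integral_diff[OF Bochner_Integration.integrable_add[OF i1 i2] i3]
        Bochner_Integration.integral_add[OF i1 i2] integral_mult_right_zero ..
    also have "(LINT y|lborel. gauss t y * w y * (y $ j) * ?m y) = (x $ j) * ?I"
      using gauss_moment_real[OF t, of \<eta> x] by (simp add: ie)
    finally have "of_real (t * (x $ j) * ((x $ j) * ?I) + q * ?I - t * (LINT y|lborel. gauss t y * w y * (y $ j)\<^sup>2 * ?m y)) =
        (0 :: complex)" by (rule sym)
    then have 2: "0 = t * (x $ j) * ((x $ j) * ?I) + q * ?I - t * (LINT y|lborel. gauss t y * w y * (y $ j)\<^sup>2 * ?m y)"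
      by (simp only: of_real_eq_0_iff)
    have "J = (x $ j)\<^sup>2 * I + q / t * I" if "0 = t * (x $ j) * ((x $ j) * I) + q * I - t * J" for I J
      using that t by (simp add: field_simps power2_eq_square)
    from this[OF 2] show ?thesis by (simp only: q_def)
  qed
  have ex: "exp_type (\<lambda>y::real ^ 'n. y $ j)" for j
    using exp_type_inner[OF exp_type_id exp_type_const[of "axis j 1 :: real ^ 'n"]] by (simp add: inner_axis)
  note int = integrable_gauss_ReE[OF t]
  have ij: "integrable lborel (\<lambda>y. gauss t y * w y * (y $ j)\<^sup>2 * ?m y)" for j
    unfolding power2_eq_square by (intro int exp_type_mult ex) measurable
  have i1: "integrable lborel (\<lambda>y. gauss t y * w y * (y \<bullet> x) * ?m y)"
    by (intro int exp_type_inner exp_type_id exp_type_const) measurable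
  have i0: "integrable lborel (\<lambda>y. gauss t y * w y * ?m y)" using int[of "\<lambda>_. 1"] by (simp add: exp_type_const)
  have "gauss t y * w y * (norm (x - y))\<^sup>2 * ?m y =
     (norm x)\<^sup>2 * (gauss t y * w y * ?m y) - 2 * (gauss t y * w y * (y \<bullet> x) * ?m y)
     + (\<Sum>j\<in>UNIV. gauss t y * w y * (y $ j)\<^sup>2 * ?m y)" for y
  proof -
    have "(norm (x - y))\<^sup>2 = (norm x)\<^sup>2 - 2 * (y \<bullet> x) + (\<Sum>j\<in>UNIV. (y $ j)\<^sup>2)"
      unfolding power2_norm_eq_inner by (simp add: inner_diff_left inner_diff_right inner_commute)
        (simp add: inner_vec_def power2_eq_square)
    moreover have "(\<Sum>j\<in>UNIV. gauss t y * w y * (y $ j)\<^sup>2 * ?m y) = gauss t y * w y * (\<Sum>j\<in>UNIV. (y $ j)\<^sup>2) * ?m y"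
      by (simp add: sum_distrib_left sum_distrib_right)
    ultimately show ?thesis by (simp only:) (simp add: algebra_simps)
  qed
  then have "(LINT y|lborel. gauss t y * w y * (norm (x - y))\<^sup>2 * ?m y) =
     (norm x)\<^sup>2 * ?I - 2 * (LINT y|lborel. gauss t y * w y * (y \<bullet> x) * ?m y)
     + (\<Sum>j\<in>UNIV. LINT y|lborel. gauss t y * w y * (y $ j)\<^sup>2 * ?m y)"
    using i0 i1 ij by (simp add: Bochner_Integration.integral_add Bochner_Integration.integral_diff
        Bochner_Integration.integral_sum Bochner_Integration.integrable_sum)
  also have "\<dots> = (\<Sum>j\<in>UNIV. (1 + (\<Sum>v\<in>P. 2 * k v * (v $ j)\<^sup>2 / (norm v)\<^sup>2)) / t * ?I)"
  proof -
    have "(\<Sum>j\<in>UNIV. (x $ j)\<^sup>2 * ?I) = (norm x)\<^sup>2 * ?I"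
      unfolding power2_norm_eq_inner inner_vec_def by (simp add: sum_distrib_right power2_eq_square)
    then show ?thesis
      unfolding gauss_moment_real[OF t] coord sum.distrib by (simp add: power2_norm_eq_inner)
  qed
  also have "\<dots> = (\<Sum>j\<in>UNIV. 1 + (\<Sum>v\<in>P. 2 * k v * (v $ j)\<^sup>2 / (norm v)\<^sup>2)) / t * ?I"
    by (simp add: sum_distrib_right sum_divide_distrib)
  also have "(\<Sum>j\<in>UNIV. 1 + (\<Sum>v\<in>P. 2 * k v * (v $ j)\<^sup>2 / (norm v)\<^sup>2)) = real CARD('n) + 2 * \<Gamma>"
  proof -
    have "(\<Sum>j\<in>UNIV. \<Sum>v\<in>P. 2 * k v * (v $ j)\<^sup>2 / (norm v)\<^sup>2) = (\<Sum>v\<in>P. 2 * k v * (\<Sum>j\<in>UNIV. (v $ j)\<^sup>2) / (norm v)\<^sup>2)"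
      by (subst sum.swap) (simp add: sum_distrib_left sum_divide_distrib)
    also have "\<dots> = (\<Sum>v\<in>P. 2 * k v)"
    proof (intro sum.cong refl)
      fix v assume "v \<in> P"
      moreover have "(\<Sum>j\<in>UNIV. (v $ j)\<^sup>2) = (norm v)\<^sup>2"
        unfolding power2_norm_eq_inner inner_vec_def by (simp add: power2_eq_square)
      ultimately show "2 * k v * (\<Sum>j\<in>UNIV. (v $ j)\<^sup>2) / (norm v)\<^sup>2 = 2 * k v"
        using P_nonzero by simp
    qed
    finally show ?thesis by (simp add: sum.distrib gamma_index_def sum_distrib_left)
  qed
  finally show ?thesis .
qed

end

context dunkl_setting
begin

lemma K_scale: "K n (t *\<^sub>R \<xi>) x = t ^ n * K n \<xi> x"
  by (induction n arbitrary: x) (auto simp: sum_distrib_left mult_ac intro!: sum.cong)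

lemma E_scale: "E c (t *\<^sub>R \<xi>) x = E (c * of_real t) \<xi> x"
  unfolding E_def by (simp add: K_scale power_mult_distrib mult.assoc)

lemma E_minus: "E c (- \<xi>) x = E (- c) \<xi> x"
  using E_scale[of c "- 1" \<xi> x] by simp

section \<open>The heat kernel and inversion\<close>

text \<open>Closed form of the oscillating integral in \<open>heat_eq\<close>. The kernel enters at
  real arguments only, so positivity can be read off from \<open>E_real_nonneg\<close>.\<close>

definition heat :: "real \<Rightarrow> real ^ 'n \<Rightarrow> real ^ 'n \<Rightarrow> real" where
  "heat s x y = gmass s * exp (- (norm x)\<^sup>2 / (2 * s)) * (gauss (1 / s) y * Re (E (of_real (1 / s)) x y))"

lemma heat_nonneg: "0 < s \<Longrightarrow> 0 \<le> heat s x y"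
  unfolding heat_def using gmass_pos[of s] gauss_pos[of "1 / s" y] E_real_nonneg[of "1 / s" x y]
  by (simp add: less_imp_le)

lemma heat_eq:
  assumes s: "0 < s"
  shows "(LINT z|lborel. (gauss s z * w z) *\<^sub>R (E \<i> x z * E (- \<i>) y z)) = of_real (heat s x y)"
proof -
  have "\<i> * - \<i> / complex_of_real s = of_real (1 / s)" by simp
  then have e: "E (\<i> * - \<i> / complex_of_real s) y x = of_real (Re (E (of_real (1 / s)) x y))"
    using E_real[of "1 / s" x y] E_commute[of "of_real (1 / s)" x y] by (simp only:)
  have "\<i>\<^sup>2 * of_real ((norm x)\<^sup>2) + (- \<i>)\<^sup>2 * of_real ((norm y)\<^sup>2) = - (of_real ((norm x)\<^sup>2 + (norm y)\<^sup>2) :: complex)"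
    by simp
  then have "exp ((\<i>\<^sup>2 * of_real ((norm x)\<^sup>2) + (- \<i>)\<^sup>2 * of_real ((norm y)\<^sup>2)) / (2 * of_real s)) =
     (of_real (exp (- ((norm x)\<^sup>2 + (norm y)\<^sup>2) / (2 * s))) :: complex)"
    unfolding exp_of_real[symmetric] by (simp only: of_real_divide of_real_minus of_real_mult of_real_numeral)
  also have "exp (- ((norm x)\<^sup>2 + (norm y)\<^sup>2) / (2 * s)) = exp (- (norm x)\<^sup>2 / (2 * s)) * gauss (1 / s) y"
    by (simp add: gauss_def exp_add[symmetric] diff_divide_distrib mult.commute)
  finally show ?thesis
    unfolding gauss_EE[OF s] e heat_def by simp
qed

lemma heat_moments:
  assumes s: "0 < s"
  shows "(LINT y|lborel. w y * heat s x y) = (gmass 1)\<^sup>2"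
    and "(LINT y|lborel. w y * heat s x y * (norm (x - y))\<^sup>2) = (real CARD('n) + 2 * \<Gamma>) * s * (gmass 1)\<^sup>2"
    and "integrable lborel (\<lambda>y. w y * heat s x y)"
    and "integrable lborel (\<lambda>y. w y * heat s x y * (norm (x - y))\<^sup>2)"
proof -
  have t: "0 < 1 / s" using s by simp
  define C where "C = gmass s * exp (- (norm x)\<^sup>2 / (2 * s))"
  let ?m = "\<lambda>y. Re (E (of_real (1 / s)) x y)"
  have 1: "w y * heat s x y = C * (gauss (1 / s) y * w y * ?m y)" for y
    by (simp add: heat_def C_def)
  have 2: "w y * heat s x y * (norm (x - y))\<^sup>2 = C * (gauss (1 / s) y * w y * (norm (x - y))\<^sup>2 * ?m y)" for y
    by (simp add: heat_def C_def)
  have m: "C * (LINT y|lborel. gauss (1 / s) y * w y * ?m y) = (gmass 1)\<^sup>2"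
  proof -
    have "exp (- (norm x)\<^sup>2 / (2 * s)) * exp (1 / s * (norm x)\<^sup>2 / 2) = 1"
      by (simp flip: exp_add)
    then show ?thesis
      unfolding gauss_mass_real[OF t] C_def using gmass_mult[OF s] by (simp add: mult_ac)
  qed
  show "(LINT y|lborel. w y * heat s x y) = (gmass 1)\<^sup>2"
    unfolding 1 using m by (simp only: integral_mult_right_zero)
  show "(LINT y|lborel. w y * heat s x y * (norm (x - y))\<^sup>2) = (real CARD('n) + 2 * \<Gamma>) * s * (gmass 1)\<^sup>2"
    unfolding 2 integral_mult_right_zero gauss_second_moment[OF t] m[symmetric] by simp
  show "integrable lborel (\<lambda>y. w y * heat s x y)"
    unfolding 1 using integrable_gauss_ReE[OF t, of "\<lambda>_. 1"] by (intro integrable_mult_right) (simp add: exp_type_const)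
  have "exp_type (\<lambda>y. (norm (x - y))\<^sup>2)"
    unfolding power2_norm_eq_inner by (intro exp_type_inner exp_type_diff exp_type_id exp_type_const)
  then show "integrable lborel (\<lambda>y. w y * heat s x y * (norm (x - y))\<^sup>2)"
    unfolding 2 by (intro integrable_mult_right integrable_gauss_ReE[OF t]) measurable
qed

text \<open>\<open>u\<close> is Lipschitz, so the error is controlled by the first absolute moment
  about \<open>x\<close>, which in turn is controlled by the mass and the second moment.\<close>

lemma heat_approximation:
  assumes u: "schwartz u"
  shows "\<exists>L. \<forall>s>0. norm ((LINT y|lborel. (w y * heat s x y) *\<^sub>R u y) - of_real ((gmass 1)\<^sup>2) * u x) \<le> L * sqrt s"
proof -
  obtain L where L: "L \<ge> 0" "\<And>y x. norm (u y - u x) \<le> L * norm (y - x)"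
    using schwartz_lipschitz[OF u] by blast
  obtain B where B: "\<And>y. norm (u y) \<le> B" using schwartz_bounded[OF u] by blast
  note [measurable] = schwartz_measurable[OF u]
  define Q where "Q = L / 2 * (1 + (real CARD('n) + 2 * \<Gamma>)) * (gmass 1)\<^sup>2"
  have "norm ((LINT y|lborel. (w y * heat s x y) *\<^sub>R u y) - of_real ((gmass 1)\<^sup>2) * u x) \<le> Q * sqrt s" if s: "0 < s" for s
  proof -
    note mom = heat_moments[OF s, of x]
    have nn: "0 \<le> w y * heat s x y" for y using heat_nonneg[OF s] by simp
    have iu: "integrable lborel (\<lambda>y. (w y * heat s x y) *\<^sub>R u y)"
    proof (rule Bochner_Integration.integrable_bound)
      show "integrable lborel (\<lambda>y. B * (w y * heat s x y))" by (intro integrable_mult_right mom)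
      show "AE y in lborel. norm ((w y * heat s x y) *\<^sub>R u y) \<le> norm (B * (w y * heat s x y))"
      proof (rule AE_I2)
        fix y
        have "norm ((w y * heat s x y) *\<^sub>R u y) = (w y * heat s x y) * norm (u y)" using nn[of y] by simp
        also have "\<dots> \<le> (w y * heat s x y) * B" by (rule mult_left_mono[OF B nn])
        also have "\<dots> \<le> norm (B * (w y * heat s x y))" by (simp add: mult.commute)
        finally show "norm ((w y * heat s x y) *\<^sub>R u y) \<le> norm (B * (w y * heat s x y))" .
      qed
    qed (use borel_measurable_integrable[OF mom(3)] in measurable)
    have ix: "integrable lborel (\<lambda>y. (w y * heat s x y) *\<^sub>R u x)" by (intro integrable_scaleR_left mom)
    have "of_real ((gmass 1)\<^sup>2) * u x = (LINT y|lborel. (w y * heat s x y) *\<^sub>R u x)"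
      by (subst integral_scaleR_left) (use mom in \<open>auto simp: scaleR_conv_of_real\<close>)
    then have "norm ((LINT y|lborel. (w y * heat s x y) *\<^sub>R u y) - of_real ((gmass 1)\<^sup>2) * u x) =
       norm (LINT y|lborel. (w y * heat s x y) *\<^sub>R u y - (w y * heat s x y) *\<^sub>R u x)"
      by (simp only: Bochner_Integration.integral_diff[OF iu ix])
    also have "\<dots> \<le> (LINT y|lborel. norm ((w y * heat s x y) *\<^sub>R u y - (w y * heat s x y) *\<^sub>R u x))"
      by (rule integral_norm_bound)
    also have "\<dots> \<le> (LINT y|lborel. (L / 2 * sqrt s) * (w y * heat s x y) + (L / 2 / sqrt s) * (w y * heat s x y * (norm (x - y))\<^sup>2))"
    proof (rule integral_mono)
      show "integrable lborel (\<lambda>y. norm ((w y * heat s x y) *\<^sub>R u y - (w y * heat s x y) *\<^sub>R u x))"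
        by (intro integrable_norm Bochner_Integration.integrable_diff iu ix)
      show "integrable lborel (\<lambda>y. (L / 2 * sqrt s) * (w y * heat s x y) + (L / 2 / sqrt s) * (w y * heat s x y * (norm (x - y))\<^sup>2))"
        by (intro Bochner_Integration.integrable_add integrable_mult_right mom)
      fix y
      define r where "r = norm (x - y)"
      \<comment> \<open>Young's inequality balanced at the scale \<open>sqrt s\<close>, at which
        both terms integrate to multiples of \<open>sqrt s\<close>.\<close>
      have "r \<le> sqrt s / 2 + r\<^sup>2 / (2 * sqrt s)"
      proof -
        have "0 \<le> (sqrt s - r)\<^sup>2 / (2 * sqrt s)" using s by simp
        also have "(sqrt s - r)\<^sup>2 / (2 * sqrt s) = sqrt s / 2 + r\<^sup>2 / (2 * sqrt s) - r"
          using s by (simp add: power2_diff field_simps power2_eq_square)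
        finally show ?thesis by simp
      qed
      then have "L * r \<le> L * (sqrt s / 2 + r\<^sup>2 / (2 * sqrt s))" by (rule mult_left_mono[OF _ L(1)])
      with L(2)[of y x] have "norm (u y - u x) \<le> L * (sqrt s / 2 + r\<^sup>2 / (2 * sqrt s))"
        by (simp add: r_def norm_minus_commute)
      from mult_left_mono[OF this nn[of y]]
      have "norm ((w y * heat s x y) *\<^sub>R u y - (w y * heat s x y) *\<^sub>R u x) \<le>
         (w y * heat s x y) * (L * (sqrt s / 2 + r\<^sup>2 / (2 * sqrt s)))"
        using nn[of y] by (simp flip: scaleR_diff_right)
      also have "\<dots> = (L / 2 * sqrt s) * (w y * heat s x y) + (L / 2 / sqrt s) * (w y * heat s x y * r\<^sup>2)"
        using s by (simp add: field_simps)
      finally show "norm ((w y * heat s x y) *\<^sub>R u y - (w y * heat s x y) *\<^sub>R u x) \<le>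
         (L / 2 * sqrt s) * (w y * heat s x y) + (L / 2 / sqrt s) * (w y * heat s x y * (norm (x - y))\<^sup>2)"
        by (simp add: r_def)
    qed
    also have "\<dots> = (L / 2 * sqrt s) * (gmass 1)\<^sup>2 + (L / 2 / sqrt s) * ((real CARD('n) + 2 * \<Gamma>) * s * (gmass 1)\<^sup>2)"
      by (subst Bochner_Integration.integral_add) (use mom in auto)
    also have "\<dots> = Q * sqrt s"
    proof -
      have "X * s / sqrt s = X * sqrt s" for X using s real_div_sqrt[of s] by (simp flip: times_divide_eq_right)
      from this[of "L / 2 * (real CARD('n) + 2 * \<Gamma>) * (gmass 1)\<^sup>2"] have "(L / 2 / sqrt s) * ((real CARD('n) + 2 * \<Gamma>) * s * (gmass 1)\<^sup>2) = L / 2 * ((real CARD('n) + 2 * \<Gamma>) * sqrt s * (gmass 1)\<^sup>2)"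
        by (simp add: mult_ac)
      then show ?thesis by (simp add: Q_def algebra_simps)
    qed
    finally show ?thesis .
  qed
  then show ?thesis by blast
qed

lemma dtr_measurable: "schwartz u \<Longrightarrow> dtr u \<in> borel_measurable borel"
  by (rule borel_measurable_continuous_onI[OF continuous_dtr])

lemma integrable_dtr_E:
  assumes u: "schwartz u" and q: "q \<in> borel_measurable borel" "\<And>\<xi>. norm (q \<xi>) \<le> B"
  shows "integrable lborel (\<lambda>\<xi>. w \<xi> *\<^sub>R (dtr u \<xi> * q \<xi>))"
proof (rule integrable_w_decays[OF dtr_decays[OF u], of _ B 0])
  show "(\<lambda>\<xi>. dtr u \<xi> * q \<xi>) \<in> borel_measurable borel" using dtr_measurable[OF u] q(1) by measurable
  show "norm (dtr u \<xi> * q \<xi>) \<le> B * (1 + norm \<xi>) ^ 0 * norm (dtr u \<xi>)" for \<xi>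
    using mult_right_mono[OF q(2)[of \<xi>], of "norm (dtr u \<xi>)"] by (simp add: norm_mult mult.commute)
qed

text \<open>Exchanging the integrals isolates the Gaussian integral of two kernels evaluated in
  \<open>heat_eq\<close>. The Gaussian makes the double integral converge absolutely, the kernels
  being merely bounded.\<close>

lemma smoothed_inversion:
  assumes u: "schwartz u" and s: "0 < s"
  shows "(LINT \<xi>|lborel. (gauss s \<xi> * w \<xi>) *\<^sub>R (dtr u \<xi> * E \<i> x \<xi>)) =
     (LINT y|lborel. (w y * heat s x y) *\<^sub>R u y)"
proof -
  note [measurable] = schwartz_measurable[OF u]
  let ?F = "\<lambda>\<xi> y. ((gauss s \<xi> * w \<xi>) *\<^sub>R E \<i> x \<xi>) * (w y *\<^sub>R (u y * E (- \<i>) \<xi> y))"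
  have iu: "integrable lborel (\<lambda>y. w y *\<^sub>R norm (u y))"
    by (rule integrable_w_decays[OF schwartz_decays[OF u], of _ 1 0]) auto
  have "integrable (lborel \<Otimes>\<^sub>M lborel) (case_prod ?F)"
  proof (rule Bochner_Integration.integrable_bound)
    show "integrable (lborel \<Otimes>\<^sub>M lborel) (\<lambda>(\<xi>, y). (\<kappa> * \<kappa> * (gauss s \<xi> * w \<xi>)) * (w y *\<^sub>R norm (u y)))"
      by (intro lborel_pair.integrable_times_pair integrable_mult_right integrable_gauss_w1 s iu)
    show "case_prod ?F \<in> borel_measurable (lborel \<Otimes>\<^sub>M lborel)" by measurable
    show "AE p in lborel \<Otimes>\<^sub>M lborel. norm (case p of (\<xi>, y) \<Rightarrow> ?F \<xi> y) \<le>
        norm (case p of (\<xi>, y) \<Rightarrow> (\<kappa> * \<kappa> * (gauss s \<xi> * w \<xi>)) * (w y *\<^sub>R norm (u y)))"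
    proof (rule AE_I2, clarify)
      fix \<xi> y
      have g: "0 \<le> gauss s \<xi> * w \<xi>" using gauss_pos[of s \<xi>] by simp
      have "norm (?F \<xi> y) = (gauss s \<xi> * w \<xi>) * norm (E \<i> x \<xi>) * (w y * (norm (u y) * norm (E (- \<i>) \<xi> y)))"
        using gauss_pos[of s \<xi>] by (simp add: norm_mult abs_mult)
      also have "\<dots> \<le> (gauss s \<xi> * w \<xi>) * \<kappa> * (w y * (norm (u y) * \<kappa>))"
        by (intro mult_mono mult_nonneg_nonneg norm_E_i order_refl g) (auto simp: kappa_nonneg)
      also have "\<dots> = (\<kappa> * \<kappa> * (gauss s \<xi> * w \<xi>)) * (w y *\<^sub>R norm (u y))" by simp
      finally show "norm (?F \<xi> y) \<le> norm ((\<kappa> * \<kappa> * (gauss s \<xi> * w \<xi>)) * (w y *\<^sub>R norm (u y)))"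
        by (smt (verit) real_norm_def)
    qed
  qed
  from lborel_pair.Fubini_integral[OF this]
  have "(LINT \<xi>|lborel. LINT y|lborel. ?F \<xi> y) = (LINT y|lborel. LINT \<xi>|lborel. ?F \<xi> y)" by simp
  moreover have "(LINT y|lborel. ?F \<xi> y) = (gauss s \<xi> * w \<xi>) *\<^sub>R (dtr u \<xi> * E \<i> x \<xi>)" for \<xi>
    unfolding integral_mult_right_zero dtr_def[symmetric] by (simp add: mult.commute)
  moreover have "(LINT \<xi>|lborel. ?F \<xi> y) = (w y * heat s x y) *\<^sub>R u y" for y
  proof -
    have "?F \<xi> y = (w y *\<^sub>R u y) * ((gauss s \<xi> * w \<xi>) *\<^sub>R (E \<i> x \<xi> * E (- \<i>) y \<xi>))" for \<xi>
      using E_commute[of "- \<i>" \<xi> y] by (simp add: mult_ac)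
    then show ?thesis
      by (simp only: integral_mult_right_zero heat_eq[OF s]) (simp add: scaleR_conv_of_real mult_ac)
  qed
  ultimately show ?thesis by simp
qed

theorem dunkl_inversion:
  assumes u: "schwartz u"
  shows "(LINT \<xi>|lborel. w \<xi> *\<^sub>R (dtr u \<xi> * E \<i> x \<xi>)) = of_real ((gmass 1)\<^sup>2) * u x"
proof -
  let ?s = "\<lambda>i. 1 / real (Suc i)"
  let ?I = "\<lambda>i. LINT \<xi>|lborel. gauss (?s i) \<xi> *\<^sub>R (w \<xi> *\<^sub>R (dtr u \<xi> * E \<i> x \<xi>))"
  have int: "integrable lborel (\<lambda>\<xi>. w \<xi> *\<^sub>R (dtr u \<xi> * E \<i> x \<xi>))"
    by (rule integrable_dtr_E[OF u _ norm_E_i(1)]) measurable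
  have "?I \<longlonglongrightarrow> (LINT \<xi>|lborel. 1 *\<^sub>R (w \<xi> *\<^sub>R (dtr u \<xi> * E \<i> x \<xi>)))"
  proof (rule integral_dominated_convergence[OF _ _ integrable_norm[OF int]])
    show "AE \<xi> in lborel. (\<lambda>i. gauss (?s i) \<xi> *\<^sub>R (w \<xi> *\<^sub>R (dtr u \<xi> * E \<i> x \<xi>))) \<longlonglongrightarrow> 1 *\<^sub>R (w \<xi> *\<^sub>R (dtr u \<xi> * E \<i> x \<xi>))"
      by (intro AE_I2 tendsto_scaleR gauss_tendsto tendsto_const)
    show "AE \<xi> in lborel. norm (gauss (?s i) \<xi> *\<^sub>R (w \<xi> *\<^sub>R (dtr u \<xi> * E \<i> x \<xi>))) \<le> norm (w \<xi> *\<^sub>R (dtr u \<xi> * E \<i> x \<xi>))" for i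
    proof (rule AE_I2)
      fix \<xi>
      have "\<bar>gauss (?s i) \<xi>\<bar> * norm (w \<xi> *\<^sub>R (dtr u \<xi> * E \<i> x \<xi>)) \<le> 1 * norm (w \<xi> *\<^sub>R (dtr u \<xi> * E \<i> x \<xi>))"
        using gauss_le_1[of "?s i" \<xi>] gauss_pos[of "?s i" \<xi>] by (intro mult_right_mono) auto
      then show "norm (gauss (?s i) \<xi> *\<^sub>R (w \<xi> *\<^sub>R (dtr u \<xi> * E \<i> x \<xi>))) \<le> norm (w \<xi> *\<^sub>R (dtr u \<xi> * E \<i> x \<xi>))"
        by (simp add: abs_mult)
    qed
  qed (use dtr_measurable[OF u] in measurable)
  moreover have "?I \<longlonglongrightarrow> of_real ((gmass 1)\<^sup>2) * u x"
  proof -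
    obtain L where L: "\<And>s. 0 < s \<Longrightarrow> norm ((LINT y|lborel. (w y * heat s x y) *\<^sub>R u y) - of_real ((gmass 1)\<^sup>2) * u x) \<le> L * sqrt s"
      using heat_approximation[OF u] by blast
    have I: "?I i = (LINT y|lborel. (w y * heat (?s i) x y) *\<^sub>R u y)" for i
      using smoothed_inversion[OF u eps_bounds(1), of i x] by simp
    have "(\<lambda>i. L * sqrt (?s i)) \<longlonglongrightarrow> L * sqrt 0"
      using LIMSEQ_inverse_real_of_nat by (intro tendsto_mult tendsto_const tendsto_real_sqrt) (simp only: inverse_eq_divide)
    then have "(\<lambda>i. L * sqrt (?s i)) \<longlonglongrightarrow> 0" by simp
    then have "(\<lambda>i. ?I i - of_real ((gmass 1)\<^sup>2) * u x) \<longlonglongrightarrow> 0"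
      by (rule Lim_null_comparison[rotated]) (unfold I, intro always_eventually allI L eps_bounds)
    then show ?thesis by (rule LIM_zero_cancel)
  qed
  ultimately show ?thesis using LIMSEQ_unique by force
qed

section \<open>Dunkl translation and its second difference\<close>

text \<open>The square of \<open>gmass 1\<close> collects the normalisations of the transform and of
  its inverse.\<close>

definition trans :: "(real ^ 'n \<Rightarrow> complex) \<Rightarrow> real ^ 'n \<Rightarrow> real ^ 'n \<Rightarrow> complex" where
  "trans u x y = (LINT \<xi>|lborel. w \<xi> *\<^sub>R (dtr u \<xi> * E \<i> x \<xi> * E \<i> y \<xi>)) / of_real ((gmass 1)\<^sup>2)"

lemma dunkl_translation_eq: "dunkl_translation P k x u y = trans u x y"
proof -
  have k: "dunkl_kernel P k (cvec \<i> x) = E \<i> x" "dunkl_kernel P k (cvec (- \<i>) x) = E (- \<i>) x" for x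
    by (rule dunkl_kernel_eq)+
  have t: "dunkl_transform P k u \<xi> = dtr u \<xi> / of_real (gmass 1)" for \<xi>
    unfolding dunkl_transform_def k dtr_def dunkl_const_gmass
    by (simp add: scaleR_conv_of_real mult_ac)
  have "E \<i> x \<xi> * (dtr u \<xi> / of_real (gmass 1)) * E \<i> y \<xi> * of_real (w \<xi>) =
     (1 / of_real (gmass 1)) * (w \<xi> *\<^sub>R (dtr u \<xi> * E \<i> x \<xi> * E \<i> y \<xi>))" for \<xi>
    by (simp add: scaleR_conv_of_real mult_ac)
  then show ?thesis
    unfolding dunkl_translation_def inv_dunkl_transform_def k t dunkl_const_gmass trans_def
    by (simp only: integral_mult_right_zero) (simp add: power2_eq_square)
qed

lemma trans_continuous: assumes u: "schwartz u" shows "continuous_on UNIV (trans u x)"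
proof -
  note [measurable] = dtr_measurable[OF u]
  have "continuous_on UNIV (\<lambda>y. LINT z|lborel. w z *\<^sub>R (dtr u z * E \<i> x z * E \<i> y z))"
    by (rule continuous_integral_E) (auto intro!: integrable_dtr_E[OF u _ norm_E_i(1)])
  then show ?thesis
    unfolding trans_def[abs_def] using gmass_pos[of 1]
    by (intro continuous_on_divide continuous_on_const) auto
qed

text \<open>The two kernels are complex conjugates, so only real parts survive and the term of
  degree 1, which is imaginary, drops out. For \<open>r \<le> 1\<close> the series from degree 2 on
  is at most \<open>exp r - 1 - r \<le> r\<^sup>2\<close>; for larger \<open>r\<close> the bound by
  \<open>\<kappa>\<close> suffices.\<close>

lemma E_even_bound: "norm (E \<i> y \<xi> + E \<i> (- y) \<xi> - 2) \<le> (2 * \<kappa> + 2) * (norm y * norm \<xi>)\<^sup>2"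
proof -
  define r where "r = norm y * norm \<xi>"
  have r: "0 \<le> r" by (simp add: r_def)
  have k0: "0 \<le> \<kappa>" by (rule kappa_nonneg)
  have conj: "E \<i> (- y) \<xi> = cnj (E \<i> y \<xi>)" by (simp add: E_minus E_cnj)
  show ?thesis
  proof (cases "r \<le> 1")
    case True
    let ?a = "\<lambda>n. \<i> ^ n * of_real (K n y \<xi>)"
    have "(\<lambda>n. ?a (n + 2)) sums (E \<i> y \<xi> - (\<Sum>n<2. ?a n))"
      using sums_iff_shift[of ?a 2] E_sums[of \<i> y \<xi>] by (simp add: sums_split_initial_segment)
    note s1 = this
    have s2: "(\<lambda>n. r ^ (n + 2) /\<^sub>R fact (n + 2)) sums (exp r - (\<Sum>n<2. r ^ n /\<^sub>R fact n))"
      using exp_converges[of r] by (rule sums_split_initial_segment)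
    have s3: "norm (?a n) \<le> r ^ n /\<^sub>R fact n" for n
      using E_term_bound[of \<i> n y \<xi>] by (simp add: r_def)
    have "norm (E \<i> y \<xi> - (\<Sum>n<2. ?a n)) \<le> exp r - (\<Sum>n<2. r ^ n /\<^sub>R fact n)"
      using s1 s2 s3 by (rule norm_sums_le)
    also have "\<dots> = exp r - 1 - r" by (simp add: numeral_2_eq_2)
    also have "\<dots> \<le> r\<^sup>2" using exp_bound[OF r True] by simp
    finally have b: "norm (E \<i> y \<xi> - (\<Sum>n<2. ?a n)) \<le> r\<^sup>2" .
    have "(\<Sum>n<2. ?a n) = 1 + \<i> * of_real (K 1 y \<xi>)" by (simp add: numeral_2_eq_2)
    then have "E \<i> y \<xi> + E \<i> (- y) \<xi> - 2 = of_real (2 * Re (E \<i> y \<xi> - (\<Sum>n<2. ?a n)))"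
      unfolding conj by (simp add: complex_eq_iff)
    then have "norm (E \<i> y \<xi> + E \<i> (- y) \<xi> - 2) = 2 * \<bar>Re (E \<i> y \<xi> - (\<Sum>n<2. ?a n))\<bar>"
      by (simp only: norm_of_real abs_mult abs_numeral)
    also have "\<dots> \<le> 2 * r\<^sup>2"
      using b abs_Re_le_cmod[of "E \<i> y \<xi> - (\<Sum>n<2. ?a n)"] by linarith
    also have "\<dots> \<le> (2 * \<kappa> + 2) * r\<^sup>2" using k0 by (intro mult_right_mono) auto
    finally show ?thesis by (simp add: r_def)
  next
    case False
    have "norm (E \<i> y \<xi> + E \<i> (- y) \<xi> - 2) \<le> norm (E \<i> y \<xi>) + norm (E \<i> (- y) \<xi>) + norm (2 :: complex)"
      by (rule order_trans[OF norm_triangle_ineq4 add_right_mono[OF norm_triangle_ineq]])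
    also have "\<dots> \<le> (2 * \<kappa> + 2) * 1" using norm_E_i(1)[of y \<xi>] norm_E_i(1)[of "- y" \<xi>] by simp
    also have "\<dots> \<le> (2 * \<kappa> + 2) * r\<^sup>2"
      using k0 False by (intro mult_left_mono) (auto intro: one_le_power)
    finally show ?thesis by (simp add: r_def)
  qed
qed

text \<open>By inversion \<open>2 * u x\<close> is the same integral with the constant 2 in place of
  the kernels in \<open>y\<close>, so the whole expression is a single integral with the factor
  \<open>D y\<close>. The uniform bound on \<open>D y\<close> gives the constant,
  \<open>E_even_bound\<close> the factor \<open>(norm y)\<^sup>2\<close>; decay of
  \<open>dtr u\<close> absorbs the weight and \<open>(norm \<xi>)\<^sup>2\<close>.\<close>

lemma trans_bounds:
  assumes u: "schwartz u"
  shows "\<exists>C\<ge>0. \<forall>y. norm (2 * u x - trans u x y - trans u x (- y)) \<le> C * min 1 ((norm y)\<^sup>2)"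
proof -
  note [measurable] = dtr_measurable[OF u]
  define c2 where "c2 = (gmass 1)\<^sup>2"
  have c2: "0 < c2" using gmass_pos[of 1] by (simp add: c2_def)
  have int: "integrable lborel (\<lambda>\<xi>. w \<xi> *\<^sub>R (dtr u \<xi> * (E \<i> x \<xi> * q \<xi>)))" if "q \<in> borel_measurable borel" "\<And>\<xi>. norm (q \<xi>) \<le> B" for q B
  proof (rule integrable_dtr_E[OF u, of _ "\<kappa> * B"])
    show "(\<lambda>\<xi>. E \<i> x \<xi> * q \<xi>) \<in> borel_measurable borel" using that(1) by measurable
    show "norm (E \<i> x \<xi> * q \<xi>) \<le> \<kappa> * B" for \<xi>
      unfolding norm_mult using that(2) norm_E_i(1) by (intro mult_mono kappa_nonneg) auto
  qed
  define D where "D y \<xi> = E \<i> y \<xi> + E \<i> (- y) \<xi> - 2" for y \<xi>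
  have D1: "norm (D y \<xi>) \<le> 2 * \<kappa> + 2" for y \<xi>
  proof -
    have "norm (D y \<xi>) \<le> norm (E \<i> y \<xi>) + norm (E \<i> (- y) \<xi>) + norm (2 :: complex)"
      unfolding D_def by (rule order_trans[OF norm_triangle_ineq4 add_right_mono[OF norm_triangle_ineq]])
    then show ?thesis using norm_E_i(1)[of y \<xi>] norm_E_i(1)[of "- y" \<xi>] by simp
  qed
  have D2: "norm (D y \<xi>) \<le> (2 * \<kappa> + 2) * ((norm y)\<^sup>2 * (norm \<xi>)\<^sup>2)" for y \<xi>
    using E_even_bound[of y \<xi>] by (simp add: D_def power_mult_distrib)
  have [measurable]: "D y \<in> borel_measurable borel" for y unfolding D_def[abs_def] by measurable
  have eq: "2 * u x - trans u x y - trans u x (- y) = - (LINT \<xi>|lborel. w \<xi> *\<^sub>R (dtr u \<xi> * (E \<i> x \<xi> * D y \<xi>))) / of_real c2" for y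
  proof -
    let ?J = "\<lambda>q. LINT \<xi>|lborel. w \<xi> *\<^sub>R (dtr u \<xi> * (E \<i> x \<xi> * q \<xi>))"
    have i1: "integrable lborel (\<lambda>\<xi>. w \<xi> *\<^sub>R (dtr u \<xi> * (E \<i> x \<xi> * E \<i> y \<xi>)))" for y by (rule int[OF _ norm_E_i(1)]) measurable
    have i2: "integrable lborel (\<lambda>\<xi>. w \<xi> *\<^sub>R (dtr u \<xi> * (E \<i> x \<xi> * 2)))" by (rule int[of _ 2]) auto
    have "?J (D y) = (LINT \<xi>|lborel. w \<xi> *\<^sub>R (dtr u \<xi> * (E \<i> x \<xi> * E \<i> y \<xi>)) + w \<xi> *\<^sub>R (dtr u \<xi> * (E \<i> x \<xi> * E \<i> (- y) \<xi>))
        - w \<xi> *\<^sub>R (dtr u \<xi> * (E \<i> x \<xi> * 2)))"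
      by (intro Bochner_Integration.integral_cong refl) (simp add: D_def algebra_simps)
    also have "\<dots> = ?J (E \<i> y) + ?J (E \<i> (- y)) - ?J (\<lambda>_. 2)"
      by (simp only: Bochner_Integration.integral_diff[OF Bochner_Integration.integrable_add[OF i1 i1] i2]
          Bochner_Integration.integral_add[OF i1 i1])
    also have "\<dots> = of_real c2 * trans u x y + of_real c2 * trans u x (- y) - ?J (\<lambda>_. 2)"
      unfolding trans_def c2_def[symmetric] using c2 by (simp add: mult.assoc)
    also have "?J (\<lambda>_. 2) = of_real c2 * (2 * u x)"
    proof -
      have "?J (\<lambda>_. 2) = 2 * (LINT \<xi>|lborel. w \<xi> *\<^sub>R (dtr u \<xi> * E \<i> x \<xi>))"
        unfolding integral_mult_right_zero[symmetric] by (intro Bochner_Integration.integral_cong refl) simp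
      then show ?thesis unfolding dunkl_inversion[OF u] c2_def by simp
    qed
    finally show ?thesis using c2 by (simp add: field_simps)
  qed
  have nb: "norm (2 * u x - trans u x y - trans u x (- y)) \<le> (LINT \<xi>|lborel. norm (w \<xi> *\<^sub>R (dtr u \<xi> * (E \<i> x \<xi> * D y \<xi>)))) / c2" for y
    unfolding eq norm_divide norm_minus_cancel norm_of_real using c2
    by (intro order_trans[OF divide_right_mono[OF integral_norm_bound]]) auto
  have iD: "integrable lborel (\<lambda>\<xi>. w \<xi> *\<^sub>R (dtr u \<xi> * (E \<i> x \<xi> * D y \<xi>)))" for y by (rule int[OF _ D1]) measurable
  define A where "A = \<kappa> * (2 * \<kappa> + 2)"
  have A0: "0 \<le> A" using kappa_nonneg by (simp add: A_def)
  have ib: "integrable lborel (\<lambda>\<xi>. w \<xi> *\<^sub>R (A * (norm \<xi>) ^ m * norm (dtr u \<xi>)))" for m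
  proof (rule integrable_w_decays[OF dtr_decays[OF u], of _ A m])
    show "norm (A * (norm \<xi>) ^ m * norm (dtr u \<xi>)) \<le> A * (1 + norm \<xi>) ^ m * norm (dtr u \<xi>)" for \<xi>
      using A0 by (auto simp: abs_mult intro!: mult_right_mono mult_left_mono power_mono)
  qed measurable
  define B where "B m = (LINT \<xi>|lborel. w \<xi> *\<^sub>R (A * (norm \<xi>) ^ m * norm (dtr u \<xi>)))" for m
  have B0: "0 \<le> B m" for m unfolding B_def using A0 by (intro Bochner_Integration.integral_nonneg) simp
  have b1: "norm (2 * u x - trans u x y - trans u x (- y)) \<le> B 0 / c2" for y
  proof (rule order_trans[OF nb divide_right_mono])
    show "(LINT \<xi>|lborel. norm (w \<xi> *\<^sub>R (dtr u \<xi> * (E \<i> x \<xi> * D y \<xi>)))) \<le> B 0"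
      unfolding B_def
    proof (rule integral_mono[OF integrable_norm[OF iD] ib])
      fix \<xi>
      have "norm (E \<i> x \<xi>) * norm (D y \<xi>) \<le> A"
        unfolding A_def by (intro mult_mono norm_E_i D1 kappa_nonneg) auto
      then have "w \<xi> * (norm (dtr u \<xi>) * (norm (E \<i> x \<xi>) * norm (D y \<xi>))) \<le> w \<xi> * (norm (dtr u \<xi>) * A)"
        by (intro mult_left_mono) auto
      then show "norm (w \<xi> *\<^sub>R (dtr u \<xi> * (E \<i> x \<xi> * D y \<xi>))) \<le> w \<xi> *\<^sub>R (A * norm \<xi> ^ 0 * norm (dtr u \<xi>))"
        by (simp add: norm_mult mult.commute)
    qed
  qed (use c2 in simp)
  have b2: "norm (2 * u x - trans u x y - trans u x (- y)) \<le> (norm y)\<^sup>2 * B 2 / c2" for y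
  proof (rule order_trans[OF nb divide_right_mono])
    show "(LINT \<xi>|lborel. norm (w \<xi> *\<^sub>R (dtr u \<xi> * (E \<i> x \<xi> * D y \<xi>)))) \<le> (norm y)\<^sup>2 * B 2"
      unfolding B_def integral_mult_right_zero[symmetric]
    proof (rule integral_mono[OF integrable_norm[OF iD] integrable_mult_right[OF ib]])
      fix \<xi>
      have "norm (E \<i> x \<xi>) * norm (D y \<xi>) \<le> \<kappa> * ((2 * \<kappa> + 2) * ((norm y)\<^sup>2 * (norm \<xi>)\<^sup>2))"
        by (intro mult_mono norm_E_i D2 kappa_nonneg) auto
      then have "w \<xi> * (norm (dtr u \<xi>) * (norm (E \<i> x \<xi>) * norm (D y \<xi>))) \<le>
          w \<xi> * (norm (dtr u \<xi>) * (\<kappa> * ((2 * \<kappa> + 2) * ((norm y)\<^sup>2 * (norm \<xi>)\<^sup>2))))"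
        by (intro mult_left_mono) auto
      then show "norm (w \<xi> *\<^sub>R (dtr u \<xi> * (E \<i> x \<xi> * D y \<xi>))) \<le> (norm y)\<^sup>2 * w \<xi> *\<^sub>R (A * norm \<xi> ^ 2 * norm (dtr u \<xi>))"
        by (simp add: norm_mult A_def mult_ac)
    qed
  qed (use c2 in simp)
  define C where "C = max (B 0) (B 2) / c2"
  have "norm (2 * u x - trans u x y - trans u x (- y)) \<le> C * min 1 ((norm y)\<^sup>2)" for y
  proof (cases "(norm y)\<^sup>2 \<le> 1")
    case True
    have "(norm y)\<^sup>2 * B 2 / c2 \<le> (norm y)\<^sup>2 * max (B 0) (B 2) / c2"
      using c2 by (intro divide_right_mono mult_left_mono) auto
    then show ?thesis using b2[of y] True by (simp add: C_def min_def mult.commute)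
  next
    case False
    have "B 0 / c2 \<le> max (B 0) (B 2) / c2" using c2 by (intro divide_right_mono) auto
    then show ?thesis using b1[of y] False by (simp add: C_def min_def)
  qed
  moreover have "0 \<le> C" using B0[of 0] c2 by (simp add: C_def)
  ultimately show ?thesis by blast
qed

end

section \<open>Polar coordinates\<close>

definition radial_measure :: "nat \<Rightarrow> real measure" where
  "radial_measure d = density lborel (\<lambda>r. ennreal (indicator {0<..} r * r ^ (d - 1)))"

lemma sets_radial_measure [measurable_cong, simp]: "sets (radial_measure d) = sets borel"
  by (simp add: radial_measure_def)

lemma space_radial_measure [simp]: "space (radial_measure d) = UNIV"
  by (simp add: radial_measure_def)

lemma emeasure_radial_measure_atMost:
  assumes d: "0 < d"
  shows "emeasure (radial_measure d) {..b} = ennreal (if 0 < b then b ^ d / real d else 0)"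
proof (cases "0 < b")
  case True
  have "emeasure (radial_measure d) {..b} = (\<integral>\<^sup>+r. ennreal (indicator {0<..} r * r ^ (d - 1)) * indicator {..b} r \<partial>lborel)"
    unfolding radial_measure_def by (rule emeasure_density) auto
  also have "\<dots> = (\<integral>\<^sup>+r. ennreal (r ^ (d - 1)) * indicator {0..b} r \<partial>lborel)"
  proof (rule nn_integral_cong_AE)
    show "AE r in lborel. ennreal (indicator {0<..} r * r ^ (d - 1)) * indicator {..b} r =
        ennreal (r ^ (d - 1)) * indicator {0..b} r"
      using AE_lborel_singleton[of 0] by eventually_elim (auto split: split_indicator)
  qed
  also have "\<dots> = ennreal (b ^ d / real d - 0 ^ d / real d)"
    using d True by (intro nn_integral_FTC_Icc) (auto intro!: derivative_eq_intros)
  finally show ?thesis using True d by (simp add: zero_power)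
next
  case False
  have "emeasure (radial_measure d) {..b} = (\<integral>\<^sup>+r. ennreal (indicator {0<..} r * r ^ (d - 1)) * indicator {..b} r \<partial>lborel)"
    unfolding radial_measure_def by (rule emeasure_density) auto
  also have "\<dots> = (\<integral>\<^sup>+r. 0 \<partial>(lborel :: real measure))"
    using False by (intro nn_integral_cong) (auto split: split_indicator)
  finally show ?thesis using False by simp
qed

lemma sigma_finite_radial_measure: "sigma_finite_measure (radial_measure d)"
  unfolding radial_measure_def
  by (subst sigma_finite_measure.sigma_finite_iff_density_finite[OF lborel.sigma_finite_measure_axioms]) auto

lemma sets_sphere_measure [measurable_cong]:
  "sets (sphere_measure :: (real ^ 'n) measure) = sets (restrict_space borel (sphere 0 1))"
  by (simp add: sphere_measure_def)

lemma sets_sphere_measure_iff: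
  "A \<in> sets (sphere_measure :: (real ^ 'n) measure) \<longleftrightarrow> A \<in> sets borel \<and> A \<subseteq> sphere 0 1"
  unfolding sets_sphere_measure by (subst sets_restrict_space_iff) auto

definition cone_part :: "(real ^ 'n) set \<Rightarrow> real set \<Rightarrow> (real ^ 'n) set" where
  "cone_part B A = {x. x \<noteq> 0 \<and> sgn x \<in> B \<and> norm x \<in> A}"

lemma cone_part_measurable [measurable]:
  assumes [measurable]: "B \<in> sets borel" "A \<in> sets borel"
  shows "cone_part B A \<in> sets borel"
  unfolding cone_part_def by measurable

lemma emeasure_sphere_measure_cone_part:
  fixes B :: "(real ^ 'n) set"
  assumes "B \<in> sets borel" "B \<subseteq> sphere 0 1"
  shows "emeasure sphere_measure B = of_nat CARD('n) * emeasure lborel (cone_part B {..1})"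
proof -
  have "{t *\<^sub>R w | t w. 0 < t \<and> t \<le> 1 \<and> w \<in> B} = cone_part B {..1}"
  proof (intro set_eqI iffI)
    fix x assume "x \<in> {t *\<^sub>R w | t w. 0 < t \<and> t \<le> 1 \<and> w \<in> B}"
    then obtain t w where x: "x = t *\<^sub>R w" "0 < t" "t \<le> 1" "w \<in> B" by blast
    moreover from this assms have "norm w = 1" by auto
    ultimately show "x \<in> cone_part B {..1}" by (auto simp: cone_part_def sgn_div_norm)
  next
    fix x assume "x \<in> cone_part B {..1}"
    then have "x = norm x *\<^sub>R sgn x \<and> 0 < norm x \<and> norm x \<le> 1 \<and> sgn x \<in> B"
      by (auto simp: cone_part_def sgn_div_norm)
    then show "x \<in> {t *\<^sub>R w | t w. 0 < t \<and> t \<le> 1 \<and> w \<in> B}" by blast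
  qed
  then show ?thesis using emeasure_sphere_measure[OF assms] by simp
qed

lemma emeasure_cone_part_atMost:
  fixes B :: "(real ^ 'n) set"
  assumes [measurable]: "B \<in> sets borel" and b: "0 < b"
  shows "emeasure lborel (cone_part B {..b}) = ennreal (b ^ CARD('n)) * emeasure lborel (cone_part B {..1})"
proof -
  have "emeasure lborel (cone_part B {..b}) =
      emeasure (density (distr lborel borel (\<lambda>x. 0 + b *\<^sub>R x)) (\<lambda>_. ennreal (\<bar>b\<bar> ^ CARD('n)))) (cone_part B {..b})"
    using lborel_affine[of b "0 :: real ^ 'n"] b by simp
  also have "\<dots> = ennreal (b ^ CARD('n)) * emeasure (distr lborel borel (\<lambda>x. 0 + b *\<^sub>R x)) (cone_part B {..b})"
    using b by (simp add: emeasure_density_const)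
  also have "emeasure (distr lborel borel (\<lambda>x. 0 + b *\<^sub>R x)) (cone_part B {..b}) =
      emeasure lborel ((\<lambda>x. 0 + b *\<^sub>R x) -` cone_part B {..b} \<inter> space lborel)"
    by (rule emeasure_distr) auto
  also have "(\<lambda>x. 0 + b *\<^sub>R x) -` cone_part B {..b} \<inter> space lborel = cone_part B {..1}"
    using b by (auto simp: cone_part_def sgn_scaleR)
  finally show ?thesis .
qed

lemma emeasure_cone_part_finite:
  fixes B :: "(real ^ 'n) set"
  shows "emeasure lborel (cone_part B {..1}) < \<infinity>"
proof -
  have "emeasure lborel (cone_part B {..1}) \<le> emeasure lborel (cball 0 1 :: (real ^ 'n) set)"
    by (rule emeasure_mono) (auto simp: cone_part_def)
  also have "\<dots> < \<infinity>" by (rule emeasure_lborel_cball_finite)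
  finally show ?thesis .
qed

lemma finite_sphere_measure: "finite_measure (sphere_measure :: (real ^ 'n) measure)"
proof
  have "emeasure sphere_measure (sphere 0 1 :: (real ^ 'n) set) =
      of_nat CARD('n) * emeasure lborel (cone_part (sphere 0 1 :: (real ^ 'n) set) {..1})"
    by (rule emeasure_sphere_measure_cone_part) auto
  then show "emeasure sphere_measure (space (sphere_measure :: (real ^ 'n) measure)) \<noteq> \<infinity>"
    unfolding space_sphere_measure
    using emeasure_cone_part_finite[of "sphere 0 1 :: (real ^ 'n) set"] by (simp add: ennreal_mult_eq_top_iff)
qed

text \<open>For fixed \<open>B\<close> both sides are measures in \<open>A\<close> on the line, so
  they need comparison on half-lines only, where homogeneity reduces everything to the cone of
  radius 1. The factor \<open>CARD('n)\<close> in \<open>sphere_measure\<close> cancels the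
  denominator from integrating the radial density.\<close>

lemma emeasure_cone_part:
  fixes B :: "(real ^ 'n) set"
  assumes B: "B \<in> sets borel" "B \<subseteq> sphere 0 1" and A: "A \<in> sets borel"
  shows "emeasure (radial_measure CARD('n)) A * emeasure sphere_measure B = emeasure lborel (cone_part B A)"
proof -
  let ?L = "scale_measure (emeasure sphere_measure B) (radial_measure CARD('n))"
  let ?C = "density lborel (indicator {x. x \<noteq> 0 \<and> sgn x \<in> B}) :: (real ^ 'n) measure"
  let ?R = "distr ?C borel norm"
  note [measurable] = B(1)
  have eR: "emeasure ?R X = emeasure lborel (cone_part B X)" if [measurable]: "X \<in> sets borel" for X
  proof -
    have "emeasure ?R X = emeasure ?C (norm -` X \<inter> space lborel)"
      by (subst emeasure_distr) auto
    also have "\<dots> = (\<integral>\<^sup>+x. indicator {x. x \<noteq> 0 \<and> sgn x \<in> B} x * indicator (norm -` X \<inter> space lborel) x \<partial>lborel)"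
      by (rule emeasure_density) measurable
    also have "\<dots> = (\<integral>\<^sup>+x. indicator (cone_part B X) x \<partial>lborel)"
      by (intro nn_integral_cong) (auto simp: cone_part_def split: split_indicator)
    finally show ?thesis by simp
  qed
  have "?L = ?R"
  proof (rule measure_eqI_generator_eq[where E = "range (\<lambda>a::real. {..a})" and \<Omega> = UNIV and A = "\<lambda>i. {..real i}"])
    show "Int_stable (range (\<lambda>a::real. {..a}))" by (auto simp: Int_stable_def)
    show "sets ?L = sigma_sets UNIV (range (\<lambda>a::real. {..a}))" "sets ?R = sigma_sets UNIV (range (\<lambda>a::real. {..a}))"
      by (simp_all add: borel_eq_atMost)
    show "(\<Union>i. {..real i}) = UNIV" using real_arch_simple by auto
    show "emeasure ?L {..real i} \<noteq> \<infinity>" for i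
      using finite_measure.emeasure_finite[OF finite_sphere_measure, of B]
      by (simp add: emeasure_radial_measure_atMost ennreal_mult_eq_top_iff)
    fix X assume "X \<in> range (\<lambda>a::real. {..a})"
    then obtain b where X: "X = {..b}" by blast
    show "emeasure ?L X = emeasure ?R X"
    proof (cases "0 < b")
      case True
      have "emeasure sphere_measure B * ennreal (b ^ CARD('n) / real CARD('n)) =
          emeasure lborel (cone_part B {..1}) * (ennreal (real CARD('n)) * ennreal (b ^ CARD('n) / real CARD('n)))"
        unfolding emeasure_sphere_measure_cone_part[OF B] by (simp add: mult_ac ennreal_of_nat_eq_real_of_nat)
      also have "ennreal (real CARD('n)) * ennreal (b ^ CARD('n) / real CARD('n)) = ennreal (b ^ CARD('n))"
        using True by (subst ennreal_mult[symmetric]) auto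
      also have "emeasure lborel (cone_part B {..1}) * \<dots> = emeasure ?R {..b}"
        unfolding eR[OF atMost_borel] emeasure_cone_part_atMost[OF B(1) True] by (rule mult.commute)
      also have "emeasure sphere_measure B * ennreal (b ^ CARD('n) / real CARD('n)) = emeasure ?L {..b}"
        using True by (simp add: emeasure_radial_measure_atMost)
      finally show ?thesis unfolding X .
    next
      case False
      then have "x = 0" if "norm x \<le> b" for x :: "real ^ 'n" using that norm_le_zero_iff[of x] by linarith
      then have "cone_part B {..b} = {}" by (auto simp: cone_part_def)
      then show ?thesis unfolding X using False by (simp add: eR emeasure_radial_measure_atMost)
    qed
  qed auto
  from arg_cong[OF this, of "\<lambda>M. emeasure M A"] show ?thesis
    using A by (simp add: eR mult.commute)
qed

lemma measurable_polar:
  "(\<lambda>x. (norm x, sgn x)) \<in>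
    measurable (restrict_space lborel (- {0 :: real ^ 'n})) (borel \<Otimes>\<^sub>M restrict_space borel (sphere 0 1))"
  by (intro measurable_Pair measurable_restrict_space1 measurable_restrict_space2)
     (auto simp: space_restrict_space norm_sgn)

lemma measurable_scaleR_sphere:
  fixes h :: "real ^ 'n \<Rightarrow> 'b::{banach, second_countable_topology}"
  assumes [measurable]: "h \<in> borel_measurable borel"
  shows "(\<lambda>(r, \<omega>). h (r *\<^sub>R \<omega>)) \<in> borel_measurable (borel \<Otimes>\<^sub>M restrict_space borel (sphere 0 1))"
proof -
  have [measurable]: "snd \<in> measurable (borel \<Otimes>\<^sub>M restrict_space borel (sphere 0 1)) (borel :: (real ^ 'n) measure)"
    by (rule measurable_compose[OF measurable_snd measurable_restrict_space1]) simp
  show ?thesis by measurable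
qed

text \<open>Uniqueness of the product measure: the two sides agree on rectangles, whose preimages
  are the sets \<open>cone_part B A\<close>. The origin is removed because \<open>sgn 0 = 0\<close>
  does not lie on the sphere.\<close>

lemma radial_sphere_measure:
  "radial_measure CARD('n) \<Otimes>\<^sub>M (sphere_measure :: (real ^ 'n) measure) =
    distr (restrict_space lborel (- {0})) (borel \<Otimes>\<^sub>M restrict_space borel (sphere 0 1)) (\<lambda>x. (norm x, sgn x))"
proof (rule pair_measure_eqI)
  show "sigma_finite_measure (radial_measure CARD('n))" by (rule sigma_finite_radial_measure)
  show "sigma_finite_measure (sphere_measure :: (real ^ 'n) measure)"
    using finite_sphere_measure by (rule finite_measure.axioms(1))
  let ?M = "distr (restrict_space lborel (- {0 :: real ^ 'n})) (borel \<Otimes>\<^sub>M restrict_space borel (sphere 0 1)) (\<lambda>x. (norm x, sgn x))"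
  show "sets (radial_measure CARD('n) \<Otimes>\<^sub>M (sphere_measure :: (real ^ 'n) measure)) = sets ?M"
    unfolding sets_distr by (intro sets_pair_measure_cong sets_sphere_measure sets_radial_measure)
  fix A B assume A: "A \<in> sets (radial_measure CARD('n))" and B: "B \<in> sets (sphere_measure :: (real ^ 'n) measure)"
  have "emeasure ?M (A \<times> B) = emeasure (restrict_space lborel (- {0})) ((\<lambda>x. (norm x, sgn x)) -` (A \<times> B) \<inter> space (restrict_space lborel (- {0})))"
    by (rule emeasure_distr[OF measurable_polar]) (use A B in \<open>simp add: sets_sphere_measure\<close>)
  also have "\<dots> = emeasure lborel ((\<lambda>x. (norm x, sgn x)) -` (A \<times> B) \<inter> space (restrict_space lborel (- {0})))"
    by (rule emeasure_restrict_space) (auto simp: space_restrict_space)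
  also have "(\<lambda>x. (norm x, sgn x)) -` (A \<times> B) \<inter> space (restrict_space lborel (- {0})) = cone_part B A"
    by (auto simp: space_restrict_space cone_part_def)
  finally show "emeasure (radial_measure CARD('n)) A * emeasure sphere_measure B = emeasure ?M (A \<times> B)"
    using A B by (simp add: emeasure_cone_part sets_sphere_measure_iff)
qed

lemma integrable_polar:
  fixes h :: "real ^ 'n \<Rightarrow> 'b::{banach, second_countable_topology}"
  assumes [measurable]: "h \<in> borel_measurable borel" and h: "integrable lborel h"
  shows "integrable (radial_measure CARD('n) \<Otimes>\<^sub>M (sphere_measure :: (real ^ 'n) measure)) (\<lambda>(r, \<omega>). h (r *\<^sub>R \<omega>))"
proof -
  have "integrable (restrict_space lborel (- {0})) h"
    using h by (simp add: integrable_restrict_space integrable_mult_indicator)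
  then have "integrable (restrict_space lborel (- {0})) (\<lambda>x. (\<lambda>(r, \<omega>). h (r *\<^sub>R \<omega>)) (norm x, sgn x))"
    by (rule iffD1[OF Bochner_Integration.integrable_cong[OF refl], rotated]) (auto simp: space_restrict_space sgn_div_norm)
  then show ?thesis
    unfolding radial_sphere_measure by (rule integrable_distr_eq[OF measurable_polar measurable_scaleR_sphere[OF assms(1)], THEN iffD2])
qed

lemma integral_polar:
  fixes h :: "real ^ 'n \<Rightarrow> 'b::{banach, second_countable_topology}"
  assumes [measurable]: "h \<in> borel_measurable borel"
    and int: "integrable (radial_measure CARD('n) \<Otimes>\<^sub>M (sphere_measure :: (real ^ 'n) measure)) (\<lambda>(r, \<omega>). h (r *\<^sub>R \<omega>))"
  shows "integrable lborel (\<lambda>r. (indicator {0<..} r * r ^ (CARD('n) - 1)) *\<^sub>R (LINT \<omega>|sphere_measure. h (r *\<^sub>R \<omega>)))"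
    and "(LINT x|lborel. h x) = (LINT r|lborel. (indicator {0<..} r * r ^ (CARD('n) - 1)) *\<^sub>R (LINT \<omega>|sphere_measure. h (r *\<^sub>R \<omega>)))"
proof -
  let ?S = "sphere_measure :: (real ^ 'n) measure"
  interpret S: finite_measure ?S by (rule finite_sphere_measure)
  interpret R: sigma_finite_measure "radial_measure CARD('n)" by (rule sigma_finite_radial_measure)
  interpret pair_sigma_finite "radial_measure CARD('n)" ?S ..
  have J: "(\<lambda>r. LINT \<omega>|?S. h (r *\<^sub>R \<omega>)) \<in> borel_measurable borel"
    using borel_measurable_integrable[OF integrable_fst'[OF int]] by (simp add: measurable_cong_sets[OF sets_radial_measure refl])
  have nn: "AE r::real in lborel. 0 \<le> indicator {0<..} r * r ^ (CARD('n) - 1)" by (intro AE_I2) (simp add: indicator_def)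
  show "integrable lborel (\<lambda>r. (indicator {0<..} r * r ^ (CARD('n) - 1)) *\<^sub>R (LINT \<omega>|?S. h (r *\<^sub>R \<omega>)))"
    by (rule integrable_density[THEN iffD1, OF _ _ nn])
       (use integrable_fst'[OF int] J in \<open>auto simp: radial_measure_def\<close>)
  have "(LINT x|lborel. h x) = (LINT x|lborel. indicator (- {0}) x *\<^sub>R h x)"
  proof (rule integral_cong_AE)
    show "AE x in lborel. h x = indicator (- {0}) x *\<^sub>R h x"
      using AE_lborel_singleton[of 0] by eventually_elim simp
  qed auto
  also have "\<dots> = (LINT x|restrict_space lborel (- {0}). h x)"
    by (rule integral_restrict_space[symmetric]) simp
  also have "\<dots> = (LINT x|restrict_space lborel (- {0}). (\<lambda>(r, \<omega>). h (r *\<^sub>R \<omega>)) (norm x, sgn x))"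
    by (intro Bochner_Integration.integral_cong refl) (auto simp: space_restrict_space sgn_div_norm)
  also have "\<dots> = integral\<^sup>L (radial_measure CARD('n) \<Otimes>\<^sub>M ?S) (\<lambda>(r, \<omega>). h (r *\<^sub>R \<omega>))"
    unfolding radial_sphere_measure by (rule integral_distr[OF measurable_polar measurable_scaleR_sphere[OF assms(1)], symmetric])
  also have "\<dots> = (LINT r|radial_measure CARD('n). LINT \<omega>|?S. h (r *\<^sub>R \<omega>))"
    using integral_fst'[OF int] by simp
  also have "\<dots> = (LINT r|lborel. (indicator {0<..} r * r ^ (CARD('n) - 1)) *\<^sub>R (LINT \<omega>|?S. h (r *\<^sub>R \<omega>)))"
    unfolding radial_measure_def by (rule integral_density) (use J nn in auto)
  finally show "(LINT x|lborel. h x) = (LINT r|lborel. (indicator {0<..} r * r ^ (CARD('n) - 1)) *\<^sub>R (LINT \<omega>|?S. h (r *\<^sub>R \<omega>)))" .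
qed

text \<open>\<open>sphere_measure\<close> is given by volumes of truncated cones; the antipodal map
  takes cones to opposite cones and preserves Lebesgue measure.\<close>

lemma integral_sphere_measure_minus:
  fixes f :: "real ^ 'n \<Rightarrow> 'b::{banach, second_countable_topology}"
  assumes f: "f \<in> borel_measurable borel"
  shows "(LINT \<omega>|sphere_measure. f (- \<omega>)) = (LINT \<omega>|sphere_measure. f \<omega>)"
proof -
  let ?S = "sphere_measure :: (real ^ 'n) measure"
  have m: "uminus \<in> measurable ?S ?S"
    unfolding measurable_cong_sets[OF sets_sphere_measure sets_sphere_measure]
    by (intro measurable_restrict_space2 measurable_restrict_space1) (auto simp: space_restrict_space)
  have "distr ?S ?S uminus = ?S"
  proof (rule measure_eqI)
    fix B assume "B \<in> sets (distr ?S ?S uminus)"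
    then have B: "B \<in> sets borel" "B \<subseteq> sphere 0 1" "B \<in> sets ?S" by (auto simp: sets_sphere_measure_iff)
    have "uminus -` B \<inter> space ?S \<in> sets ?S" by (rule measurable_sets[OF m B(3)])
    then have B': "uminus -` B \<inter> space ?S \<in> sets borel" "uminus -` B \<inter> space ?S \<subseteq> sphere 0 1"
      by (auto simp: sets_sphere_measure_iff)
    have "emeasure (distr ?S ?S uminus) B = emeasure ?S (uminus -` B \<inter> space ?S)"
      by (rule emeasure_distr[OF m B(3)])
    also have "\<dots> = of_nat CARD('n) * emeasure lborel (cone_part (uminus -` B \<inter> space ?S) {..1})"
      by (rule emeasure_sphere_measure_cone_part[OF B'])
    also have "cone_part (uminus -` B \<inter> space ?S) {..1} = uminus -` cone_part B {..1} \<inter> space lborel"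
      by (auto simp: cone_part_def space_sphere_measure sgn_minus norm_sgn)
    also have "emeasure lborel (uminus -` cone_part B {..1} \<inter> space lborel) = emeasure (distr lborel borel uminus) (cone_part B {..1})"
      using B(1) by (subst emeasure_distr) auto
    also have "distr lborel borel uminus = (lborel :: (real ^ 'n) measure)"
      by (rule distr_lborel_isometric_involution) (auto simp: linear_uminus)
    finally show "emeasure (distr ?S ?S uminus) B = emeasure ?S B"
      by (simp add: emeasure_sphere_measure_cone_part[OF B(1,2)])
  qed simp
  moreover have "f \<in> borel_measurable ?S"
    using f by (simp add: measurable_cong_sets[OF sets_sphere_measure refl] measurable_restrict_space1)
  ultimately show ?thesis using integral_distr[OF m, of f] by simp
qed

section \<open>The fractional Dunkl Laplacian\<close>

text \<open>On \<open>{0<..1}\<close> the integrand is \<open>r powr (1 - \<alpha>)\<close>,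
  integrable as \<open>\<alpha> < 2\<close>; beyond 1 it is \<open>r powr (- 1 - \<alpha>)\<close>,
  integrable as \<open>0 < \<alpha>\<close>.\<close>

lemma integrable_min_powr:
  fixes \<alpha> :: real
  assumes \<alpha>: "0 < \<alpha>" "\<alpha> < 2"
  shows "integrable lborel (\<lambda>r::real. indicator {0<..} r * (min 1 (r\<^sup>2) * r powr (- 1 - \<alpha>)))"
proof (rule Bochner_Integration.integrable_bound)
  have "(\<lambda>r. r powr (1 - \<alpha>)) absolutely_integrable_on {0<..1::real}"
    using \<alpha> by (intro nonnegative_absolutely_integrable_1 integrable_on_powr_from_0') auto
  then have 1: "integrable lborel (\<lambda>r. indicator {0<..1} r * r powr (1 - \<alpha>))"
    unfolding set_integrable_def by (subst (asm) integrable_completion) auto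
  have "(\<lambda>r. r powr (- 1 - \<alpha>)) integrable_on {1..}"
    using has_integral_powr_to_inf[of "- 1 - \<alpha>" 1] \<alpha> by (auto intro: has_integral_integrable)
  then have "(\<lambda>r. r powr (- 1 - \<alpha>)) absolutely_integrable_on {1::real..}"
    by (intro nonnegative_absolutely_integrable_1) auto
  then have 2: "integrable lborel (\<lambda>r. indicator {1..} r * r powr (- 1 - \<alpha>))"
    unfolding set_integrable_def by (subst (asm) integrable_completion) auto
  show "integrable lborel (\<lambda>r. indicator {0<..1} r * r powr (1 - \<alpha>) + indicator {1..} r * r powr (- 1 - \<alpha>))"
    by (rule Bochner_Integration.integrable_add[OF 1 2])
  show "AE r in lborel. norm (indicator {0<..} r * (min 1 (r\<^sup>2) * r powr (- 1 - \<alpha>))) \<le>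
      norm (indicator {0<..1} r * r powr (1 - \<alpha>) + indicator {1..} r * r powr (- 1 - \<alpha>))"
  proof (rule AE_I2)
    fix r :: real
    consider "r \<le> 0" | "0 < r" "r \<le> 1" | "1 < r" by linarith
    then show "norm (indicator {0<..} r * (min 1 (r\<^sup>2) * r powr (- 1 - \<alpha>))) \<le>
      norm (indicator {0<..1} r * r powr (1 - \<alpha>) + indicator {1..} r * r powr (- 1 - \<alpha>))"
    proof cases
      case 2
      then have "r\<^sup>2 * r powr (- 1 - \<alpha>) = r powr (1 - \<alpha>)"
        by (simp add: powr_realpow[symmetric] powr_add[symmetric] del: powr_numeral)
      moreover have "min 1 (r\<^sup>2) = r\<^sup>2" using 2 by (simp add: power_le_one min_absorb2)
      ultimately have "indicator {0<..} r * (min 1 (r\<^sup>2) * r powr (- 1 - \<alpha>)) = r powr (1 - \<alpha>)" using 2 by simp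
      moreover have "r powr (1 - \<alpha>) \<le> indicator {0<..1} r * r powr (1 - \<alpha>) + indicator {1..} r * r powr (- 1 - \<alpha>)"
        using 2 by simp
      ultimately show ?thesis by simp
    next
      case 3
      then have "min 1 (r\<^sup>2) = 1" by (simp add: min_def)
      then show ?thesis using 3 by simp
    qed auto
  qed
qed auto

lemma borel_measurable_sphere_measure:
  "f \<in> borel_measurable borel \<Longrightarrow> f \<in> borel_measurable (sphere_measure :: (real ^ 'n) measure)"
  by (simp add: measurable_cong_sets[OF sets_sphere_measure refl] measurable_restrict_space1)

lemma integrable_sphere_measure_bounded:
  fixes f :: "real ^ 'n \<Rightarrow> 'b::{banach, second_countable_topology}"
  assumes "f \<in> borel_measurable borel" "\<And>\<omega>. norm \<omega> = 1 \<Longrightarrow> norm (f \<omega>) \<le> B"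
  shows "integrable sphere_measure f"
proof (rule finite_measure.integrable_const_bound[OF finite_sphere_measure])
  show "AE \<omega> in sphere_measure. norm (f \<omega>) \<le> B"
    using assms(2) by (intro AE_I2) (simp add: space_sphere_measure)
qed (rule borel_measurable_sphere_measure[OF assms(1)])

context dunkl_setting
begin

lemma w_bound_sphere: "norm \<omega> = 1 \<Longrightarrow> w \<omega> \<le> exp growth_const"
  using w_bound[of \<omega>] by simp

lemma integrable_w_sphere: "integrable sphere_measure w"
  by (rule integrable_sphere_measure_bounded[where B = "exp growth_const"]) (auto simp: w_bound_sphere)

lemma pair_sigma_finite_polar:
  "pair_sigma_finite (radial_measure CARD('n)) (sphere_measure :: (real ^ 'n) measure)"
  using sigma_finite_radial_measure finite_sphere_measure finite_measure.axioms(1)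
  by (auto simp: pair_sigma_finite_def)

lemma scaleR_sphere_measurable:
  "(\<lambda>p. fst p *\<^sub>R snd p) \<in> borel_measurable (radial_measure CARD('n) \<Otimes>\<^sub>M (sphere_measure :: (real ^ 'n) measure))"
proof -
  have "fst \<in> borel_measurable (radial_measure CARD('n) \<Otimes>\<^sub>M (sphere_measure :: (real ^ 'n) measure))"
    by (rule measurable_compose[OF measurable_fst]) (simp add: measurable_cong_sets[OF sets_radial_measure refl])
  moreover have "snd \<in> borel_measurable (radial_measure CARD('n) \<Otimes>\<^sub>M (sphere_measure :: (real ^ 'n) measure))"
    by (rule measurable_compose[OF measurable_snd borel_measurable_sphere_measure]) simp
  ultimately show ?thesis by measurable
qed

text \<open>The majorant is a product of integrable functions of \<open>r\<close> and
  \<open>\<omega>\<close>. It has to hold for positive \<open>r\<close> only, since the radial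
  measure does not charge the rest of the line.\<close>

lemma integrable_polar_bound:
  fixes h :: "real ^ 'n \<Rightarrow> complex"
  assumes [measurable]: "h \<in> borel_measurable borel"
    and g: "integrable lborel (\<lambda>r. indicator {0<..} r * r ^ (CARD('n) - 1) * g r)" "g \<in> borel_measurable borel"
    and h: "\<And>r \<omega>. 0 < r \<Longrightarrow> norm \<omega> = 1 \<Longrightarrow> norm (h (r *\<^sub>R \<omega>)) \<le> g r * w \<omega>"
  shows "integrable (radial_measure CARD('n) \<Otimes>\<^sub>M (sphere_measure :: (real ^ 'n) measure)) (\<lambda>(r, \<omega>). h (r *\<^sub>R \<omega>))"
proof -
  let ?R = "radial_measure CARD('n)" and ?S = "sphere_measure :: (real ^ 'n) measure"
  interpret pair_sigma_finite ?R ?S by (rule pair_sigma_finite_polar)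
  have nn: "AE r::real in lborel. 0 \<le> indicator {0<..} r * r ^ (CARD('n) - 1)" by (intro AE_I2) (simp add: indicator_def)
  have "integrable ?R g"
    unfolding radial_measure_def by (rule integrable_density[THEN iffD2, OF _ _ nn]) (use g in auto)
  note gw = integrable_times_pair[OF this integrable_w_sphere]
  have pos: "AE p in ?R \<Otimes>\<^sub>M ?S. 0 < fst p"
  proof (rule AE_pair_measure)
    have [measurable]: "fst \<in> borel_measurable (?R \<Otimes>\<^sub>M ?S)"
      by (rule measurable_compose[OF measurable_fst]) (simp add: measurable_cong_sets[OF sets_radial_measure refl])
    show "{p \<in> space (?R \<Otimes>\<^sub>M ?S). 0 < fst p} \<in> sets (?R \<Otimes>\<^sub>M ?S)" by measurable
    have "AE r in ?R. 0 < r"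
      unfolding radial_measure_def by (subst AE_density) (auto simp: indicator_def)
    then show "AE r in ?R. AE \<omega> in ?S. 0 < fst (r, \<omega>)" by eventually_elim simp
  qed
  show ?thesis
  proof (rule Bochner_Integration.integrable_bound[OF gw])
    show "(\<lambda>(r, \<omega>). h (r *\<^sub>R \<omega>)) \<in> borel_measurable (?R \<Otimes>\<^sub>M ?S)"
      using measurable_compose[OF scaleR_sphere_measurable assms(1)] by (simp add: case_prod_beta')
    show "AE p in ?R \<Otimes>\<^sub>M ?S. norm (case p of (r, \<omega>) \<Rightarrow> h (r *\<^sub>R \<omega>)) \<le> norm (case p of (r, \<omega>) \<Rightarrow> g r * w \<omega>)"
      using pos AE_space
    proof eventually_elim
      case (elim p)
      then have "norm (h (fst p *\<^sub>R snd p)) \<le> g (fst p) * w (snd p)"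
        by (intro h) (auto simp: space_pair_measure space_sphere_measure)
      also have "\<dots> \<le> norm (g (fst p) * w (snd p))" by simp
      finally show ?case by (simp add: case_prod_beta')
    qed
  qed
qed

text \<open>In polar coordinates the Gaussian mass contains the spherical integral of the weight as
  a factor, so its vanishing would contradict \<open>gmass_pos\<close>.\<close>

lemma sphere_const_nonzero: "sphere_const P k \<noteq> 0"
proof
  assume 0: "sphere_const P k = 0"
  let ?h = "\<lambda>x. complex_of_real (gauss 1 x * w x)"
  have g: "gauss 1 (r *\<^sub>R \<omega>) = exp (- r\<^sup>2 / 2)" if "norm \<omega> = 1" for r and \<omega> :: "real ^ 'n"
    using that by (simp add: gauss_def)
  let ?g = "\<lambda>r. r powr (2 * \<Gamma>) * exp (- r\<^sup>2 / 2)"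
  have inner: "(LINT \<omega>|sphere_measure. ?h (r *\<^sub>R \<omega>)) = 0" if "0 < r" for r
  proof -
    have "(LINT \<omega>|sphere_measure. ?h (r *\<^sub>R \<omega>)) = (LINT \<omega>|sphere_measure. complex_of_real (?g r * w \<omega>))"
      using that by (intro Bochner_Integration.integral_cong refl) (simp add: g w_homogeneous space_sphere_measure)
    also have "\<dots> = 0"
      using 0 unfolding integral_complex_of_real by (simp add: sphere_const_def)
    finally show ?thesis .
  qed
  have "integrable (radial_measure CARD('n) \<Otimes>\<^sub>M (sphere_measure :: (real ^ 'n) measure)) (\<lambda>(r, \<omega>). ?h (r *\<^sub>R \<omega>))"
    by (intro integrable_polar integrable_of_real integrable_gauss_w1) auto
  from integral_polar(2)[OF _ this]
  have "(LINT x|lborel. ?h x) = (LINT r|lborel. (indicator {0<..} r * r ^ (CARD('n) - 1)) *\<^sub>R (LINT \<omega>|sphere_measure. ?h (r *\<^sub>R \<omega>)))"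
    by simp
  also have "\<dots> = (LINT r|(lborel :: real measure). 0)"
  proof (rule Bochner_Integration.integral_cong[OF refl])
    fix r :: real
    show "(indicator {0<..} r * r ^ (CARD('n) - 1)) *\<^sub>R (LINT \<omega>|sphere_measure. ?h (r *\<^sub>R \<omega>)) = 0"
      by (cases "0 < r") (simp_all only: inner, simp_all)
  qed
  finally have "(LINT x|lborel. ?h x) = 0" by simp
  then show False
    using gmass_pos[of 1] unfolding integral_complex_of_real by (simp add: gmass_def)
qed

lemma sphere_integral_trans:
  assumes u: "schwartz u" and r: "0 < r"
  shows "(LINT \<omega>|sphere_measure. (2 * u x - trans u x (r *\<^sub>R \<omega>) - trans u x (- (r *\<^sub>R \<omega>))) * of_real (w \<omega>)) =
      2 * of_real (sphere_const P k) * (u x - spherical_mean P k r u x)"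
proof -
  let ?q = "\<lambda>\<omega>. trans u x (r *\<^sub>R \<omega>) * of_real (w \<omega>)"
  have [measurable]: "trans u x \<in> borel_measurable borel"
    by (rule borel_measurable_continuous_onI[OF trans_continuous[OF u]])
  have "compact (trans u x ` cball 0 r)"
    by (intro compact_continuous_image continuous_on_subset[OF trans_continuous[OF u]]) auto
  then obtain B where B: "\<And>y. y \<in> cball 0 r \<Longrightarrow> norm (trans u x y) \<le> B"
    using compact_imp_bounded bounded_iff by (metis imageI)
  have iq: "integrable sphere_measure ?q"
  proof (rule integrable_sphere_measure_bounded)
    show "norm (?q \<omega>) \<le> B * exp growth_const" if "norm \<omega> = 1" for \<omega>
      unfolding norm_mult norm_of_real using that r w_bound_sphere[of \<omega>] B[of "r *\<^sub>R \<omega>"]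
      by (intro mult_mono order_trans[OF norm_ge_zero B[of "r *\<^sub>R \<omega>"]]) auto
  qed measurable
  have iq': "integrable sphere_measure (\<lambda>\<omega>. ?q (- \<omega>))"
  proof (rule integrable_sphere_measure_bounded)
    show "norm (?q (- \<omega>)) \<le> B * exp growth_const" if "norm \<omega> = 1" for \<omega>
      unfolding norm_mult norm_of_real using that r w_bound_sphere[of \<omega>] B[of "r *\<^sub>R - \<omega>"]
      by (intro mult_mono order_trans[OF norm_ge_zero B[of "r *\<^sub>R - \<omega>"]]) auto
  qed measurable
  have ic: "integrable sphere_measure (\<lambda>\<omega>. 2 * u x * of_real (w \<omega>))"
    using integrable_w_sphere by (intro integrable_mult_right integrable_of_real)
  have "(LINT \<omega>|sphere_measure. (2 * u x - trans u x (r *\<^sub>R \<omega>) - trans u x (- (r *\<^sub>R \<omega>))) * of_real (w \<omega>)) =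
      (LINT \<omega>|sphere_measure. 2 * u x * of_real (w \<omega>) - ?q \<omega> - ?q (- \<omega>))"
    by (simp add: algebra_simps)
  also have "\<dots> = (LINT \<omega>|sphere_measure. 2 * u x * of_real (w \<omega>)) - (LINT \<omega>|sphere_measure. ?q \<omega>) - (LINT \<omega>|sphere_measure. ?q (- \<omega>))"
    by (simp only: Bochner_Integration.integral_diff[OF Bochner_Integration.integrable_diff[OF ic iq] iq']
        Bochner_Integration.integral_diff[OF ic iq])
  also have "(LINT \<omega>|sphere_measure. ?q (- \<omega>)) = (LINT \<omega>|sphere_measure. ?q \<omega>)"
    by (rule integral_sphere_measure_minus) measurable
  also have "(LINT \<omega>|sphere_measure. ?q \<omega>) = of_real (sphere_const P k) * spherical_mean P k r u x"
    unfolding spherical_mean_def dunkl_translation_eq using sphere_const_nonzero by simp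
  also have "(LINT \<omega>|sphere_measure. 2 * u x * of_real (w \<omega>)) = 2 * u x * of_real (sphere_const P k)"
    unfolding integral_mult_right_zero integral_complex_of_real sphere_const_def ..
  finally show ?thesis by (simp add: algebra_simps)
qed

lemma spherical_mean_formula:
  assumes u: "schwartz u" and \<alpha>: "0 < \<alpha>" "\<alpha> < 2"
  shows "set_integrable lborel {0<..} (\<lambda>r. (u x - spherical_mean P k r u x) / of_real (r powr (1 + \<alpha>)))" (is ?thesis1)
    and "frac_dunkl_laplacian P k \<alpha> u x =
      1 / of_real (pi_const P k \<alpha>) *
      (LBINT r:{0<..}. (u x - spherical_mean P k r u x) / of_real (r powr (1 + \<alpha>)))" (is ?thesis2)
proof -
  let ?S = "complex_of_real (sphere_const P k)"
  let ?D = "\<lambda>y. 2 * u x - trans u x y - trans u x (- y)"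
  let ?h = "\<lambda>y. ?D y / of_real (norm y powr (\<alpha> + 2 * \<Gamma> + real CARD('n))) * of_real (w y)"
  let ?m = "\<lambda>r. (u x - spherical_mean P k r u x) / of_real (r powr (1 + \<alpha>))"
  have [measurable]: "trans u x \<in> borel_measurable borel"
    by (rule borel_measurable_continuous_onI[OF trans_continuous[OF u]])
  obtain C where C: "0 \<le> C" "\<And>y. norm (?D y) \<le> C * min 1 ((norm y)\<^sup>2)"
    using trans_bounds[OF u, of x] by blast
  have h: "?h (r *\<^sub>R \<omega>) = of_real (r powr (- \<alpha> - real CARD('n))) * (?D (r *\<^sub>R \<omega>) * of_real (w \<omega>))"
    if "0 < r" "norm \<omega> = 1" for r \<omega>
  proof -
    \<comment> \<open>Homogeneity of the weight cancels the \<open>2 * \<Gamma>\<close> in the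
      exponent of the singular kernel.\<close>
    have p: "r powr (2 * \<Gamma>) / r powr (\<alpha> + 2 * \<Gamma> + real CARD('n)) = r powr (- \<alpha> - real CARD('n))"
      by (simp flip: powr_diff)
    have e: "d / of_real b * of_real (a * z) = of_real (a / b) * (d * of_real z)" for d :: complex and a b z :: real
      by simp
    have n: "norm (r *\<^sub>R \<omega>) = r" using that by simp
    show ?thesis unfolding w_homogeneous[OF that(1)] n e p ..
  qed
  \<comment> \<open>The Jacobian brings the exponent to \<open>- 1 - \<alpha>\<close>. The
    subtraction in \<open>CARD('n) - 1\<close> is exact because the dimension is positive.\<close>
  have pw: "r ^ (CARD('n) - 1) * r powr (- \<alpha> - real CARD('n)) = r powr (- 1 - \<alpha>)" if "0 < r" for r :: real
    using that by (simp add: powr_realpow[symmetric] powr_add[symmetric] of_nat_diff)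
  let ?g = "\<lambda>r. C * (min 1 (r\<^sup>2) * r powr (- \<alpha> - real CARD('n)))"
  have int: "integrable (radial_measure CARD('n) \<Otimes>\<^sub>M (sphere_measure :: (real ^ 'n) measure)) (\<lambda>(r, \<omega>). ?h (r *\<^sub>R \<omega>))"
  proof (rule integrable_polar_bound[where g = ?g])
    have "indicator {0<..} r * r ^ (CARD('n) - 1) * ?g r = C * (indicator {0<..} r * (min 1 (r\<^sup>2) * r powr (- 1 - \<alpha>)))" for r
      using pw[of r] by (cases "0 < r") (simp_all add: mult_ac)
    then show "integrable lborel (\<lambda>r. indicator {0<..} r * r ^ (CARD('n) - 1) * ?g r)"
      by (simp only:) (intro integrable_mult_right integrable_min_powr \<alpha>)
    fix r :: real and \<omega> :: "real ^ 'n" assume r: "0 < r" "norm \<omega> = 1"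
    have "norm (?h (r *\<^sub>R \<omega>)) = r powr (- \<alpha> - real CARD('n)) * (norm (?D (r *\<^sub>R \<omega>)) * w \<omega>)"
      unfolding h[OF r] by (simp add: norm_mult)
    also have "\<dots> \<le> r powr (- \<alpha> - real CARD('n)) * (C * min 1 (r\<^sup>2) * w \<omega>)"
      using C(2)[of "r *\<^sub>R \<omega>"] r by (intro mult_left_mono mult_right_mono) auto
    finally show "norm (?h (r *\<^sub>R \<omega>)) \<le> ?g r * w \<omega>" by (simp add: mult_ac)
  qed measurable
  have inner: "(indicator {0<..} r * r ^ (CARD('n) - 1)) *\<^sub>R (LINT \<omega>|sphere_measure. ?h (r *\<^sub>R \<omega>)) =
      2 * ?S * (indicator {0<..} r *\<^sub>R ?m r)" for r
  proof (cases "0 < r")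
    case True
    have "(LINT \<omega>|sphere_measure. ?h (r *\<^sub>R \<omega>)) =
        (LINT \<omega>|sphere_measure. of_real (r powr (- \<alpha> - real CARD('n))) * (?D (r *\<^sub>R \<omega>) * of_real (w \<omega>)))"
      by (rule Bochner_Integration.integral_cong[OF refl], rule h[OF True]) (simp add: space_sphere_measure)
    also have "\<dots> = of_real (r powr (- \<alpha> - real CARD('n))) * (2 * ?S * (u x - spherical_mean P k r u x))"
      unfolding integral_mult_right_zero sphere_integral_trans[OF u True] ..
    finally have "(indicator {0<..} r * r ^ (CARD('n) - 1)) *\<^sub>R (LINT \<omega>|sphere_measure. ?h (r *\<^sub>R \<omega>)) =
        of_real (r ^ (CARD('n) - 1) * r powr (- \<alpha> - real CARD('n))) * (2 * ?S * (u x - spherical_mean P k r u x))"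
      using True by (simp add: scaleR_conv_of_real)
    also have "\<dots> = 2 * ?S * ((u x - spherical_mean P k r u x) * of_real (r powr (- (1 + \<alpha>))))"
      unfolding pw[OF True] by (simp add: mult_ac)
    also have "\<dots> = 2 * ?S * (indicator {0<..} r *\<^sub>R ?m r)"
      using True unfolding powr_minus by (simp add: divide_inverse)
    finally show ?thesis .
  qed simp
  have hm: "?h \<in> borel_measurable borel" by measurable
  have nz: "2 * ?S \<noteq> 0" using sphere_const_nonzero by simp
  have "integrable lborel (\<lambda>r. 2 * ?S * (indicator {0<..} r *\<^sub>R ?m r))"
    using integral_polar(1)[OF hm int] unfolding inner .
  from integrable_mult_right[OF this, of "1 / (2 * ?S)"]
  have "integrable lborel (\<lambda>r. (1 / (2 * ?S) * (2 * ?S)) * (indicator {0<..} r *\<^sub>R ?m r))"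
    unfolding mult.assoc .
  then show ?thesis1 unfolding set_integrable_def using nz by simp
  have "(LINT y|lborel. ?h y) = 2 * ?S * (LBINT r:{0<..}. ?m r)"
    using integral_polar(2)[OF hm int] unfolding inner set_lebesgue_integral_def integral_mult_right_zero .
  \<comment> \<open>\<open>pi_const\<close> is \<open>frac_const\<close> divided by twice
    \<open>sphere_const\<close>, so the factor \<open>2 * ?S\<close> turns one normalisation into
    the other.\<close>
  then show ?thesis2
    unfolding frac_dunkl_laplacian_def dunkl_translation_eq pi_const_def by (simp only:) simp
qed

end

theorem lemma4p2:
  fixes R P :: "(real ^ 'n) set"
    and k :: "real ^ 'n \<Rightarrow> real"
    and \<alpha> :: real
    and u :: "real ^ 'n \<Rightarrow> complex"
  assumes "reduced_root_system R"
    and "positive_subsystem R P"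
    and "multiplicity_function R k"
    and "0 < \<alpha>" and "\<alpha> < 2"
    and "u \<in> schwartz_space"
  shows "\<forall>x. set_integrable lborel {0<..}
               (\<lambda>r. (u x - spherical_mean P k r u x) / of_real (r powr (1 + \<alpha>))) \<and>
             frac_dunkl_laplacian P k \<alpha> u x =
               1 / of_real (pi_const P k \<alpha>) *
               (LBINT r:{0<..}. (u x - spherical_mean P k r u x) / of_real (r powr (1 + \<alpha>)))"
proof -
  interpret dunkl_setting R P k using assms by unfold_locales
  have "schwartz u" using schwartz_imp_schwartz_upto[OF assms(6)] by (simp add: schwartz_def)
  from spherical_mean_formula[OF this assms(4,5)] show ?thesis by blast
qed

end
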